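(* Let $X=\{X(t)\}$ be a supOU process with characteristic quadruple $(a,b,\mu_L,\pi)$, finite variance and zero mean, such that the cumulant function $\kappa_X(\zeta)=\log\mathbb{E}e^{i\zeta X(1)}$ is analytic in a neighborhood of the origin, and let $X^*(t)=\int_0^t X(s)\,ds$, $t\ge 0$. Suppose that $\pi$ has a density $p$ satisfying $p(x)\sim\alpha\,\ell(x^{-1})\,x^{\alpha-1}$ as $x\to0$ for some $\alpha\in(0,1)$ and some function $\ell$ slowly varying at infinity, that $b=0$, and that there exist $\beta$ with $1+\alpha<\beta<2$ and $c^+,c^-\ge0$ with $c^++c^->0$ such that $$\mu_L([x,\infty))\sim c^+x^{-\beta}\quad\text{and}\quad\mu_L((-\infty,-x])\sim c^-x^{-\beta}\quad\text{as }x\to0^+.$$ Then for every $q>0$ the limit $\tau_{X^*}(q)=\lim_{t\to\infty}\frac{\log\mathbb{E}|X^*(t)|^q}{\log t}$ exists and $$\tau_{X^*}(q)=\begin{cases}\left(1-\frac{\alpha}{\beta}\right)q,&0<q\le\beta,\\ q-\alpha,&q\ge\beta.\end{cases}$$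
   Context: SupOU process: let $\pi$ be a probability measure on $\mathbb{R}_+=(0,\infty)$ and let $\kappa_L(\zeta)=\log \mathbb{E}e^{i\zeta L(1)}$ be the cumulant function of an infinitely divisible random variable $L(1)$ with Lévy–Khintchine triplet $(a,b,\mu_L)$: $\kappa_L(\zeta)=i\zeta a-\frac{\zeta^2}{2}b+\int_{\mathbb{R}}(e^{i\zeta x}-1-i\zeta x\mathbf{1}_{[-1,1]}(x))\mu_L(dx)$. Let $\Lambda$ be the homogeneous Lévy basis (independently scattered infinitely divisible random measure) on $\mathbb{R}_+\times\mathbb{R}$ with $\log\mathbb{E}e^{i\zeta\Lambda(A)}=(\pi\times \mathrm{Leb})(A)\,\kappa_L(\zeta)$ for Borel sets $A$ (of finite measure). The supOU process with characteristic quadruple $(a,b,\mu_L,\pi)$ is the strictly stationary process $$X(t)=\int_{\mathbb{R}_+}\int_{\mathbb{R}}e^{-\xi t+s}\mathbf{1}_{[0,\infty)}(\xi t-s)\,\Lambda(d\xi,ds),\quad t\in\mathbb{R},$$ where the stochastic integral is in the sense of Rajput–Rosiński: for $\Lambda$-integrable $f$, $\log\mathbb{E}\exp(i\zeta\int f\,d\Lambda)=\int\int\kappa_L(\zeta f(\xi,s))\,ds\,\pi(d\xi)$. Under zero mean and finite variance of $X$, $\int x^2\mu_L(dx)<\infty$, $\mathbb{E}L(1)=0$ and $\kappa_L(\zeta)=-\frac{\zeta^2}{2}b+\int_{\mathbb{R}}(e^{i\zeta x}-1-i\zeta x)\mu_L(dx)$. A relation $M(x)\sim c\,x^{-\beta}$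 with $c=0$ is read as $x^{\beta}M(x)\to 0$. Analyticity of $\kappa_X$ near the origin is equivalent to exponential decay of the tails of the distribution of $X(1)$; in particular all moments are finite. *)

theory Defs
  imports "HOL-Probability.Probability" "HOL-Library.Landau_Symbols"
begin

section \<open>Infinitely divisible laws and cumulant functions\<close>

definition levy_measure :: "real measure \<Rightarrow> bool" where
  "levy_measure \<mu> \<longleftrightarrow> sets \<mu> = sets borel \<and> emeasure \<mu> {0} = 0 \<and>
     (\<integral>\<^sup>+x. ennreal (min 1 (x\<^sup>2)) \<partial>\<mu>) < \<infinity>"

definition levy_khintchine :: "real \<Rightarrow> real \<Rightarrow> real measure \<Rightarrow> real \<Rightarrow> complex" where
  "levy_khintchine a b \<mu> \<zeta> =
     \<i> * of_real (\<zeta> * a) - of_real (\<zeta>\<^sup>2 / 2 * b) +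
     (CLINT x|\<mu>. exp (\<i> * of_real (\<zeta> * x)) - 1 - \<i> * of_real (\<zeta> * x * indicator {-1..1} x))"

text \<open>The logarithm of a characteristic function is the distinguished one: the unique continuous
  logarithm vanishing at the origin. It exists whenever the characteristic function has no zeros,
  in particular for infinitely divisible laws.\<close>

definition cumulant_function :: "real measure \<Rightarrow> real \<Rightarrow> complex" where
  "cumulant_function \<nu> =
     (THE \<psi>. continuous_on UNIV \<psi> \<and> \<psi> 0 = 0 \<and> (\<forall>\<zeta>. exp (\<psi> \<zeta>) = char \<nu> \<zeta>))"

text \<open>A function of a real variable is analytic near the origin if it extends to a
  function that is holomorphic on a complex neighbourhood of the origin.\<close>

definition analytic_near_0 :: "(real \<Rightarrow> complex) \<Rightarrow> bool" where
  "analytic_near_0 \<psi> \<longleftrightarrow>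
     (\<exists>g. g analytic_on {0} \<and> (\<forall>\<^sub>F \<zeta> in nhds 0. \<psi> \<zeta> = g (complex_of_real \<zeta>)))"


section \<open>Levy bases and integration in the sense of Rajput and Rosinski\<close>

definition finite_sets :: "'a measure \<Rightarrow> 'a set set" where
  "finite_sets m = {A \<in> sets m. emeasure m A < \<infinity>}"

text \<open>Homogeneous Levy basis with control measure \<open>m\<close>. For a Levy-Khintchine exponent
  \<open>\<kappa>\<close>, which is continuous and vanishes at the origin, the last clause says exactly that the
  distinguished logarithm of the characteristic function of \<open>\<Lambda> A\<close> is \<open>m(A) \<kappa>\<close>.\<close>

definition levy_basis ::
  "'w measure \<Rightarrow> 'a measure \<Rightarrow> (real \<Rightarrow> complex) \<Rightarrow> ('a set \<Rightarrow> 'w \<Rightarrow> real) \<Rightarrow> bool" where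
  "levy_basis M m \<kappa> \<Lambda> \<longleftrightarrow>
     (\<forall>A \<in> finite_sets m. \<Lambda> A \<in> borel_measurable M) \<and>
     (\<forall>A :: nat \<Rightarrow> 'a set. range A \<subseteq> finite_sets m \<longrightarrow> disjoint_family A \<longrightarrow>
        prob_space.indep_vars M (\<lambda>_. borel) (\<lambda>i. \<Lambda> (A i)) UNIV \<and>
        ((\<Union>i. A i) \<in> finite_sets m \<longrightarrow> (AE \<omega> in M. (\<lambda>i. \<Lambda> (A i) \<omega>) sums \<Lambda> (\<Union>i. A i) \<omega>))) \<and>
     (\<forall>A \<in> finite_sets m. \<forall>\<zeta>.
        char (distr M borel (\<Lambda> A)) \<zeta> = exp (of_real (measure m A) * \<kappa> \<zeta>))"

definition converges_in_prob :: "'w measure \<Rightarrow> (nat \<Rightarrow> 'w \<Rightarrow> real) \<Rightarrow> ('w \<Rightarrow> real) \<Rightarrow> bool" where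
  "converges_in_prob M Y Z \<longleftrightarrow>
     (\<forall>\<epsilon>>0. (\<lambda>n. measure M {\<omega> \<in> space M. \<bar>Y n \<omega> - Z \<omega>\<bar> > \<epsilon>}) \<longlonglongrightarrow> 0)"

text \<open>The integral over \<open>A\<close> of a simple function \<open>f\<close> whose support has finite measure.\<close>

definition simple_levy_integral ::
  "'a measure \<Rightarrow> ('a set \<Rightarrow> 'w \<Rightarrow> real) \<Rightarrow> 'a set \<Rightarrow> ('a \<Rightarrow> real) \<Rightarrow> 'w \<Rightarrow> real" where
  "simple_levy_integral m \<Lambda> A f \<omega> =
     (\<Sum>y \<in> f ` space m - {0}. y * \<Lambda> (A \<inter> (f -` {y} \<inter> space m)) \<omega>)"

text \<open>\<open>f\<close> is \<open>\<Lambda>\<close>-integrable and \<open>Y\<close> is (a version of) its integral: there are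
  simple functions \<open>F n\<close>, supported on sets of finite measure and tending to \<open>f\<close> almost
  everywhere, whose integrals over every measurable set converge in probability, and \<open>Y\<close> is the
  limit of the integrals over the whole space.\<close>

definition has_levy_integral ::
  "'w measure \<Rightarrow> 'a measure \<Rightarrow> ('a set \<Rightarrow> 'w \<Rightarrow> real) \<Rightarrow> ('a \<Rightarrow> real) \<Rightarrow> ('w \<Rightarrow> real) \<Rightarrow> bool" where
  "has_levy_integral M m \<Lambda> f Y \<longleftrightarrow>
     f \<in> borel_measurable m \<and> Y \<in> borel_measurable M \<and>
     (\<exists>F :: nat \<Rightarrow> 'a \<Rightarrow> real.
        (\<forall>n. simple_function m (F n) \<and> emeasure m {x \<in> space m. F n x \<noteq> 0} < \<infinity>) \<and>
        (AE x in m. (\<lambda>n. F n x) \<longlonglongrightarrow> f x) \<and>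
        (\<forall>A \<in> sets m. \<exists>Z \<in> borel_measurable M.
           converges_in_prob M (\<lambda>n. simple_levy_integral m \<Lambda> A (F n)) Z) \<and>
        converges_in_prob M (\<lambda>n. simple_levy_integral m \<Lambda> (space m) (F n)) Y)"


section \<open>SupOU processes\<close>

definition supou_kernel :: "real \<Rightarrow> real \<times> real \<Rightarrow> real" where
  "supou_kernel t = (\<lambda>(\<xi>, s). exp (- \<xi> * t + s) * indicator {0..} (\<xi> * t - s))"

text \<open>The measure \<open>\<pi>\<close> lives on the space \<open>{0<..}\<close> with its Borel sets.\<close>

definition supou_process ::
  "'w measure \<Rightarrow> real \<Rightarrow> real \<Rightarrow> real measure \<Rightarrow> real measure \<Rightarrow> (real \<Rightarrow> 'w \<Rightarrow> real) \<Rightarrow> bool" where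
  "supou_process M a b \<mu> \<pi> X \<longleftrightarrow>
     prob_space M \<and> b \<ge> 0 \<and> levy_measure \<mu> \<and>
     prob_space \<pi> \<and> sets \<pi> = sets (restrict_space borel {0<..}) \<and>
     (\<exists>\<Lambda>. levy_basis M (\<pi> \<Otimes>\<^sub>M lborel) (levy_khintchine a b \<mu>) \<Lambda> \<and>
          (\<forall>t. has_levy_integral M (\<pi> \<Otimes>\<^sub>M lborel) \<Lambda> (supou_kernel t) (X t)))"

text \<open>The integral of a process over \<open>[0,t]\<close> is taken path by path, which requires a version of
  the process that is measurable in time and chance jointly.\<close>

definition measurable_process :: "'w measure \<Rightarrow> (real \<Rightarrow> 'w \<Rightarrow> real) \<Rightarrow> bool" where
  "measurable_process M X \<longleftrightarrow> (\<lambda>(t, \<omega>). X t \<omega>) \<in> borel_measurable (borel \<Otimes>\<^sub>M M)"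

definition integrated_process :: "(real \<Rightarrow> 'w \<Rightarrow> real) \<Rightarrow> real \<Rightarrow> 'w \<Rightarrow> real" where
  "integrated_process X t \<omega> = (LBINT s:{0..t}. X s \<omega>)"

text \<open>The scaling function of \<open>Y\<close> at \<open>q\<close> exists and equals \<open>\<tau>\<close>. An infinite or vanishing moment at
  time \<open>t\<close> would make the quotient 0 here, so for \<open>\<tau> \<noteq> 0\<close> the limit already entails that the
  moments are finite and positive for all large \<open>t\<close>.\<close>

definition has_scaling_exponent ::
  "'w measure \<Rightarrow> (real \<Rightarrow> 'w \<Rightarrow> real) \<Rightarrow> real \<Rightarrow> real \<Rightarrow> bool" where
  "has_scaling_exponent M Y q \<tau> \<longleftrightarrow>
     ((\<lambda>t. ln (LINT \<omega>|M. \<bar>Y t \<omega>\<bar> powr q) / ln t) \<longlongrightarrow> \<tau>) at_top"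


section \<open>Regular variation\<close>

definition slowly_varying :: "(real \<Rightarrow> real) \<Rightarrow> bool" where
  "slowly_varying l \<longleftrightarrow>
     (\<exists>x0. (\<forall>x\<ge>x0. l x > 0) \<and> set_borel_measurable borel {x0..} l) \<and>
     (\<forall>c>0. ((\<lambda>x. l (c * x) / l x) \<longlongrightarrow> 1) at_top)"

text \<open>The relation \<open>T(x) \<sim> c x\<^sup>-\<^sup>\<beta>\<close> as \<open>x\<close> decreases to 0, which for \<open>c = 0\<close> is read as
  \<open>x\<^sup>\<beta> T(x) \<rightarrow> 0\<close>.\<close>

definition power_tail_at_0 :: "(real \<Rightarrow> real) \<Rightarrow> real \<Rightarrow> real \<Rightarrow> bool" where
  "power_tail_at_0 T c \<beta> \<longleftrightarrow>
     (if c = 0 then ((\<lambda>x. x powr \<beta> * T x) \<longlongrightarrow> 0) (at_right 0)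
      else T \<sim>[at_right 0] (\<lambda>x. c * x powr (- \<beta>)))"

end

theory Submission
  imports Defs "HOL-Complex_Analysis.Complex_Analysis"
begin

text \<open>Integrating the kernel in time gives \<open>F t\<close>, and Riemann sums identify the law of the integrated
  process: its cumulant function is the integral of \<open>iexp (u * F t z * x) - 1 - \<i> * u * F t z * x\<close> over
  \<open>z\<close> and over the jumps \<open>x\<close>. Up to factors \<open>t powr \<epsilon>\<close>, \<open>F t\<close> is of order \<open>t\<close> on a set
  of measure \<open>t powr (- \<alpha>)\<close> (\<open>\<xi> \<le> 1 / t\<close>), and since \<open>\<beta> > 1 + \<alpha>\<close> this set dominates the integral of
  \<open>F t powr g\<close>, which is of order \<open>t powr (g - \<alpha>)\<close> for all \<open>g \<ge> \<beta>\<close>.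

  The small jumps have index \<open>\<beta>\<close>, so minus the logarithm of the modulus of the characteristic function at \<open>u\<close> is of
  order \<open>(u * t) powr \<beta> * t powr (- \<alpha>)\<close> for \<open>u * t \<ge> 1\<close>. It becomes of order 1 at
  \<open>u = t powr (\<alpha> / \<beta> - 1)\<close>, which gives the moments of order \<open>q \<le> \<beta>\<close>. At \<open>u = 1 / t\<close> it is of order
  \<open>t powr (- \<alpha>)\<close>: with this probability the process reaches the size \<open>t\<close>, and this event carries the
  moments of order \<open>q \<ge> \<beta>\<close>. The even moments are bounded by the cumulants, which are finite because
  analyticity bounds the central differences of the cumulant function of \<open>X 1\<close>.\<close>

section \<open>Compensated exponentials\<close>

text \<open>The obstacle is that \<open>has_levy_integral\<close> offers only convergence in
  probability along simple functions converging almost everywhere. Nothing dominates them, so the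
  cumulant formula for X t does not follow by a direct passage to the limit. The modulus of a
  characteristic function, however, sees only an integral of 1 - cos (\<open>cos_energy\<close>),
  which is nonnegative, admits Fatou's lemma and obeys a triangle inequality up to a factor 2. At
  small frequencies this gives two-sided bounds, with some loss of constants, between the second
  moment of a centred integral and the squared norm of its integrand. They permit a change to simple
  functions dominated by the integrand, for which the formula does pass to the limit. The jumps near
  0 have no finite absolute moment of order \<beta> itself. Upper bounds therefore use orders g
  above \<beta> and exponents \<eta> < \<alpha>, lower bounds use \<theta> > \<alpha>; the losses
  are powers of t with arbitrarily small exponent. Lower bounds by 1 - cos reach only moments of
  order at most 2, and beyond that the bounds are transferred by
  \<open>powr_interpolation\<close>.\<close>

definition comp_exp :: "real \<Rightarrow> complex" where
  "comp_exp y = iexp y - 1 - \<i> * of_real y"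

lemma comp_exp_0 [simp]: "comp_exp 0 = 0"
  by (simp add: comp_exp_def)

lemma continuous_comp_exp [continuous_intros]:
  "continuous_on A f \<Longrightarrow> continuous_on A (\<lambda>x. comp_exp (f x))"
  unfolding comp_exp_def by (intro continuous_intros)

lemma measurable_comp_exp [measurable]: "comp_exp \<in> borel_measurable borel"
  by (intro borel_measurable_continuous_onI continuous_intros)

lemma Re_comp_exp: "Re (comp_exp y) = cos y - 1"
  by (simp add: comp_exp_def Re_exp)

lemma norm_comp_exp_le_square: "norm (comp_exp y) \<le> y\<^sup>2 / 2"
  using iexp_approx1[of y 1] by (simp add: comp_exp_def diff_diff_eq power2_eq_square)

lemma norm_comp_exp_le_linear: "norm (comp_exp y) \<le> 2 * \<bar>y\<bar>"
  using iexp_approx2[of y 1] by (simp add: comp_exp_def diff_diff_eq)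

text \<open>An interpolation between the linear and the quadratic bound. The exponent is kept free
  because jumps of index \<beta> near 0 have finite absolute moments only of order above
  \<beta>.\<close>

lemma norm_comp_exp_le_powr:
  assumes "1 \<le> g" "g \<le> 2"
  shows "norm (comp_exp y) \<le> 2 * \<bar>y\<bar> powr g"
proof (cases "\<bar>y\<bar> \<le> 1")
  case True
  have "y\<^sup>2 = \<bar>y\<bar> powr 2"
    by (cases "y = 0") (auto simp: powr_numeral)
  also have "\<dots> \<le> \<bar>y\<bar> powr g"
    using True assms by (intro powr_mono') auto
  finally show ?thesis
    using norm_comp_exp_le_square[of y] powr_ge_zero[of "\<bar>y\<bar>" g] by linarith
next
  case False
  have "\<bar>y\<bar> = \<bar>y\<bar> powr 1"
    by simp
  also have "\<dots> \<le> \<bar>y\<bar> powr g"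
    using False assms by (intro powr_mono) auto
  finally show ?thesis
    using norm_comp_exp_le_linear[of y] by linarith
qed

text \<open>The intensity may be infinite, so a plain Lipschitz bound could fail to be integrable;
  the extra factor makes the right side a product of square-integrable functions. It comes from
  expanding around \<open>y\<close>: the remainder at \<open>x - y\<close> is quadratic, and the
  linear term is multiplied by \<open>iexp y - 1\<close>, which is of order
  \<open>y\<close>.\<close>

lemma norm_comp_exp_diff_le: "norm (comp_exp x - comp_exp y) \<le> 2 * \<bar>x - y\<bar> * (\<bar>x\<bar> + \<bar>y\<bar>)"
proof -
  have "comp_exp x - comp_exp y = iexp y * comp_exp (x - y) + \<i> * of_real (x - y) * (iexp y - 1)"
    by (simp add: comp_exp_def algebra_simps exp_add[symmetric])
  then have "norm (comp_exp x - comp_exp y) \<le>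
      norm (iexp y * comp_exp (x - y)) + norm (\<i> * of_real (x - y) * (iexp y - 1))"
    by (metis norm_triangle_ineq)
  also have "norm (iexp y * comp_exp (x - y)) \<le> (x - y)\<^sup>2 / 2"
    using norm_comp_exp_le_square[of "x - y"] by (simp add: norm_mult)
  also have "(x - y)\<^sup>2 / 2 \<le> \<bar>x - y\<bar> * (\<bar>x\<bar> + \<bar>y\<bar>)"
  proof -
    have "(x - y)\<^sup>2 = \<bar>x - y\<bar> * \<bar>x - y\<bar>"
      by (simp add: power2_eq_square flip: abs_mult)
    also have "\<dots> \<le> \<bar>x - y\<bar> * (\<bar>x\<bar> + \<bar>y\<bar>)"
      by (intro mult_left_mono) auto
    finally show ?thesis
      using zero_le_power2[of "x - y"] by linarith
  qed
  also have "norm (\<i> * of_real (x - y) * (iexp y - 1)) \<le> \<bar>x - y\<bar> * (\<bar>x\<bar> + \<bar>y\<bar>)"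
  proof -
    have "norm (iexp y - 1) \<le> \<bar>y\<bar>"
      using iexp_approx1[of y 0] by simp
    then show ?thesis
      unfolding norm_mult by (intro mult_mono) (auto simp del: of_real_diff)
  qed
  finally show ?thesis
    by (simp add: algebra_simps)
qed

text \<open>\<open>1 - cos u\<close> is half the squared chord from 1 to \<open>iexp u\<close>. The
  triangle inequality for chords, followed by squaring, costs the factor 2. This is the source of
  the triangle inequality for \<open>cos_energy\<close>.\<close>

lemma one_minus_cos_add: "1 - cos (x + y) \<le> 2 * (1 - cos x) + 2 * (1 - cos (y::real))"
proof -
  have *: "1 - cos u = 2 * (sin (u / 2))\<^sup>2" for u :: real
    using cos_double_sin[of "u / 2"] by simp
  have "\<bar>sin ((x + y) / 2)\<bar> \<le> \<bar>sin (x / 2)\<bar> + \<bar>sin (y / 2)\<bar>"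
  proof -
    have "\<bar>sin ((x + y) / 2)\<bar> = \<bar>sin (x / 2) * cos (y / 2) + cos (x / 2) * sin (y / 2)\<bar>"
      by (simp add: add_divide_distrib sin_add)
    also have "\<dots> \<le> \<bar>sin (x / 2)\<bar> * \<bar>cos (y / 2)\<bar> + \<bar>cos (x / 2)\<bar> * \<bar>sin (y / 2)\<bar>"
      by (simp only: abs_mult[symmetric] abs_triangle_ineq)
    also have "\<dots> \<le> \<bar>sin (x / 2)\<bar> * 1 + 1 * \<bar>sin (y / 2)\<bar>"
      by (intro add_mono mult_mono) auto
    finally show ?thesis
      by simp
  qed
  then have "\<bar>sin ((x + y) / 2)\<bar>\<^sup>2 \<le> (\<bar>sin (x / 2)\<bar> + \<bar>sin (y / 2)\<bar>)\<^sup>2"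
    by (intro power_mono) auto
  also have "\<dots> \<le> 2 * (sin (x / 2))\<^sup>2 + 2 * (sin (y / 2))\<^sup>2"
    using sum_squares_bound[of "\<bar>sin (x / 2)\<bar>" "\<bar>sin (y / 2)\<bar>"] by (simp add: power2_sum)
  finally show ?thesis
    unfolding * by simp
qed

lemma one_minus_cos_le_square: "1 - cos x \<le> (x::real)\<^sup>2 / 2"
  using abs_Re_le_cmod[of "comp_exp x"] norm_comp_exp_le_square[of x] unfolding Re_comp_exp by linarith

lemma one_minus_cos_le_powr:
  assumes "0 < q" "q \<le> 2"
  shows "1 - cos x \<le> 2 * \<bar>x::real\<bar> powr q"
proof (cases "\<bar>x\<bar> \<le> 1")
  case True
  have "x\<^sup>2 = \<bar>x\<bar> powr 2"
    by (cases "x = 0") (auto simp: powr_numeral)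
  also have "\<dots> \<le> \<bar>x\<bar> powr q"
    using True assms by (intro powr_mono') auto
  finally show ?thesis
    using one_minus_cos_le_square[of x] powr_ge_zero[of "\<bar>x\<bar>" q] by linarith
next
  case False
  then have "1 \<le> \<bar>x\<bar> powr q"
    using assms by (simp add: ge_one_powr_ge_zero)
  then show ?thesis
    using cos_ge_minus_one[of x] by linarith
qed

text \<open>The window from 1 to 2 is one dyadic shell after rescaling, and cos decreases on it
  because 2 \<le> pi.\<close>

lemma one_minus_cos_ge:
  assumes "1 \<le> \<bar>x\<bar>" "\<bar>x\<bar> \<le> (2::real)"
  shows "1 - cos 1 \<le> 1 - cos x"
  using cos_monotone_0_pi_le[of 1 "\<bar>x\<bar>"] assms pi_ge_two by simp

lemma cos_one_less_one: "cos 1 < (1::real)"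
  using cos_monotone_0_pi[of 0 "1::real"] pi_ge_two by simp

lemma obtain_dyadic_scale:
  fixes y :: real
  assumes "1 \<le> y"
  obtains n :: nat where "2 ^ n \<le> y" "y < 2 ^ Suc n"
proof -
  define n where "n = nat \<lfloor>log 2 y\<rfloor>"
  have "0 \<le> log 2 y"
    using assms by simp
  then have n: "real n \<le> log 2 y" "log 2 y < real n + 1"
    unfolding n_def by linarith+
  have y: "2 powr (log 2 y) = y"
    by (rule powr_log_cancel) (use assms in auto)
  have "2 powr (real n) \<le> 2 powr (log 2 y)"
    using n by (intro powr_mono) auto
  moreover have "2 powr (log 2 y) < 2 powr (real (Suc n))"
    using n by (intro powr_less_mono) auto
  ultimately show ?thesis
    by (intro that[of n]) (simp_all only: y powr_realpow zero_less_numeral)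
qed

lemma ennreal_le_suminf: "f n \<le> (\<Sum>n. f n)" for f :: "nat \<Rightarrow> ennreal"
  using sum_le_suminf[of f "{n}"] by simp

lemma integrable_comp_exp:
  fixes G :: "'a \<Rightarrow> real"
  assumes [measurable]: "G \<in> borel_measurable N" and G2: "integrable N (\<lambda>z. (G z)\<^sup>2)"
  shows "integrable N (\<lambda>z. comp_exp (u * G z))"
proof (rule Bochner_Integration.integrable_bound)
  show "integrable N (\<lambda>z. u\<^sup>2 / 2 * (G z)\<^sup>2)"
    using G2 by simp
  show "AE z in N. norm (comp_exp (u * G z)) \<le> norm (u\<^sup>2 / 2 * (G z)\<^sup>2)"
  proof (rule AE_I2)
    show "norm (comp_exp (u * G z)) \<le> norm (u\<^sup>2 / 2 * (G z)\<^sup>2)" for z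
      using norm_comp_exp_le_square[of "u * G z"] by (simp add: power_mult_distrib)
  qed
qed measurable

subsection \<open>Central differences\<close>

text \<open>By Pascal's rule the alternating sum of order \<open>n + 1\<close> of \<open>p\<close>
  is minus the sum of order \<open>n\<close> of the difference \<open>p (x + 1) - p x\<close>, and
  taking this difference lowers the degree.\<close>

lemma alternating_binomial_sum_poly:
  fixes p :: "'a::field_char_0 poly"
  assumes "degree p < n"
  shows "(\<Sum>j\<le>n. (-1)^j * of_nat (n choose j) * poly p (of_nat j)) = 0"
  using assms
proof (induction n arbitrary: p)
  case (Suc n)
  define r where "r = pcompose p [:1, 1:] - p"
  have r: "poly r x = poly p (x + 1) - poly p x" for x
    by (simp add: r_def poly_pcompose add.commute)
  \<comment> \<open>The second disjunct serves constant \<open>p\<close>: for \<open>n = 0\<close>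
    no degree is below \<open>n\<close>, but the difference is the zero polynomial.\<close>
  have "degree r < n \<or> r = 0"
  proof (cases "degree p = 0")
    case True
    then obtain c where "p = [:c:]"
      by (metis degree_eq_zeroE)
    then show ?thesis
      by (simp add: r_def pcompose_pCons)
  next
    case False
    have d: "degree (pcompose p [:1, 1:]) = degree p"
      by (simp add: degree_pcompose)
    have "lead_coeff (pcompose p [:1, 1:]) = lead_coeff p"
      by (subst lead_coeff_comp) auto
    then have "coeff r (degree p) = 0"
      by (simp add: r_def d)
    moreover have "degree r \<le> degree p"
      using d by (simp add: r_def degree_diff_le)
    ultimately have "degree r < degree p"
      using False by (metis coeff_0_degree_minus_1 degree_0 eq_zero_or_degree_less gr0I le_neq_implies_less leading_coeff_0_iff)
    then show ?thesis
      using Suc.prems by simp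
  qed
  then have 0: "(\<Sum>j\<le>n. (-1)^j * of_nat (n choose j) * poly r (of_nat j)) = 0"
    using Suc.IH by auto
  have "(\<Sum>j\<le>Suc n. (-1)^j * of_nat (Suc n choose j) * poly p (of_nat j)) =
      poly p 0 + (\<Sum>j\<le>n. (-1)^(Suc j) * of_nat (Suc n choose Suc j) * poly p (of_nat (Suc j)))"
    by (subst sum.atMost_Suc_shift) simp
  also have "(\<Sum>j\<le>n. (-1)^(Suc j) * of_nat (Suc n choose Suc j) * poly p (of_nat (Suc j))) =
     - (\<Sum>j\<le>n. (-1)^j * of_nat (n choose j) * poly p (of_nat j + 1))
     + (\<Sum>j\<le>n. (-1)^(Suc j) * of_nat (n choose Suc j) * poly p (of_nat (Suc j)))"
    by (simp add: sum_negf sum.distrib algebra_simps sum_subtractf)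
  also have "(\<Sum>j\<le>n. (-1)^(Suc j) * of_nat (n choose Suc j) * poly p (of_nat (Suc j))) =
     (\<Sum>j\<le>Suc n. (-1)^j * of_nat (n choose j) * poly p (of_nat j)) - poly p 0"
    by (simp only: sum.atMost_Suc_shift[of "\<lambda>j. (-1)^j * of_nat (n choose j) * poly p (of_nat j)" n]) simp
  also have "(\<Sum>j\<le>Suc n. (-1)^j * of_nat (n choose j) * poly p (of_nat j)) =
     (\<Sum>j\<le>n. (-1)^j * of_nat (n choose j) * poly p (of_nat j))"
    by simp
  finally show ?case
    using 0 by (simp add: r sum_subtractf algebra_simps)
qed simp

text \<open>The central difference of order \<open>2 * k\<close> with step \<open>h\<close>, on the
  nodes from \<open>- k * h\<close> to \<open>k * h\<close>. Symmetric nodes and an even order make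
  its value on an exponential real, with a sign that does not depend on the exponent.\<close>

definition central_diff :: "nat \<Rightarrow> (real \<Rightarrow> complex) \<Rightarrow> real \<Rightarrow> complex" where
  "central_diff k g h = (\<Sum>j\<le>2*k. (-1)^j * of_nat (2*k choose j) * g ((real j - real k) * h))"

text \<open>This is the central difference of the monomial of degree \<open>2 * k\<close> for
  \<open>h = 1\<close>, that is \<open>fact (2 * k)\<close>; it is carried along
  unevaluated.\<close>

definition central_const :: "nat \<Rightarrow> complex" where
  "central_const k = (\<Sum>j\<le>2*k. (-1)^j * of_nat (2*k choose j) * of_real ((real j - real k) ^ (2*k)))"

lemma central_diff_add: "central_diff k (\<lambda>u. f u + g u) h = central_diff k f h + central_diff k g h"
  by (simp add: central_diff_def sum.distrib algebra_simps)

lemma central_diff_mult: "central_diff k (\<lambda>u. c * f u) h = c * central_diff k f h"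
  by (simp add: central_diff_def sum_distrib_left algebra_simps)

lemma central_diff_sum: "central_diff k (\<lambda>u. \<Sum>i\<in>A. f i u) h = (\<Sum>i\<in>A. central_diff k (f i) h)"
  by (simp add: central_diff_def sum_distrib_left) (rule sum.swap)

lemma central_diff_power:
  assumes "i < 2 * k"
  shows "central_diff k (\<lambda>u. of_real u ^ i) h = 0"
proof -
  define p :: "complex poly" where "p = [:- of_nat k, 1:] ^ i"
  have "degree p < 2 * k"
    using assms by (simp add: p_def degree_power_eq)
  from alternating_binomial_sum_poly[OF this]
  have "(\<Sum>j\<le>2*k. (-1)^j * of_nat (2*k choose j) * (of_nat j - of_nat k :: complex) ^ i) = 0"
    by (simp add: p_def)
  then have "of_real h ^ i * (\<Sum>j\<le>2*k. (-1)^j * of_nat (2*k choose j) * (of_nat j - of_nat k :: complex) ^ i) = 0"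
    by simp
  then show ?thesis
    by (simp add: central_diff_def sum_distrib_left power_mult_distrib mult_ac)
qed

lemma central_diff_power_eq:
  "central_diff k (\<lambda>u. of_real u ^ (2 * k)) h = central_const k * of_real h ^ (2 * k)"
  by (simp add: central_diff_def central_const_def sum_distrib_left power_mult_distrib mult_ac)

text \<open>The binomial theorem gives the \<open>k\<close>-th power of
  \<open>(1 - w)\<^sup>2 / w\<close> with \<open>w = iexp (h * y)\<close>. Because the sign is the
  same for all \<open>y\<close>, the norm of the central difference of an integral of exponentials
  is the integral of a nonnegative function, without cancellation.\<close>

lemma central_diff_iexp:
  "central_diff k (\<lambda>u. iexp (u * y)) h = (-1)^k * of_real ((2 - 2 * cos (h * y)) ^ k)"
proof -
  define w where "w = iexp (h * y)"
  have w0: "w \<noteq> 0"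
    by (simp add: w_def)
  have winv: "inverse w = iexp (- (h * y))"
    by (simp add: w_def exp_minus)
  have "iexp ((real j - real k) * h * y) = w ^ j * inverse w ^ k" for j
    unfolding winv by (simp add: w_def exp_of_nat_mult[symmetric] exp_add[symmetric] algebra_simps)
  then have "central_diff k (\<lambda>u. iexp (u * y)) h =
      inverse w ^ k * (\<Sum>j\<le>2*k. of_nat (2*k choose j) * (- w) ^ j * 1 ^ (2 * k - j))"
    by (simp add: central_diff_def sum_distrib_left power_minus[of w] algebra_simps)
  also have "\<dots> = inverse w ^ k * (1 - w) ^ (2 * k)"
    by (subst binomial_ring[symmetric]) simp
  also have "\<dots> = (inverse w * (1 - w)\<^sup>2) ^ k"
    by (simp add: power_mult_distrib power_mult)
  also have "inverse w * (1 - w)\<^sup>2 = w + inverse w - 2"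
    using w0 by (simp add: power2_eq_square field_simps)
  also have "\<dots> = - of_real (2 - 2 * cos (h * y))"
    unfolding winv unfolding w_def by (simp add: complex_eq_iff Re_exp Im_exp)
  finally show ?thesis
    by (simp only: power_minus[of "of_real (2 - 2 * cos (h * y)) :: complex"] of_real_power)
qed

text \<open>Approximation by a polynomial to order \<open>2 * k + 1\<close> stands in for
  \<open>2 * k\<close> derivatives at 0: lower monomials are annihilated, and higher ones as well as
  the remainder vanish after division by \<open>h ^ (2 * k)\<close>.\<close>

lemma central_diff_tendsto:
  assumes R: "\<forall>\<^sub>F u in nhds 0. norm (g u - poly p (of_real u)) \<le> C * \<bar>u\<bar> ^ (2 * k + 1)"
  shows "((\<lambda>h. central_diff k g h / of_real h ^ (2 * k)) \<longlongrightarrow> central_const k * coeff p (2 * k)) (at_right 0)"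
proof -
  define R where "R u = g u - poly p (of_real u)" for u
  have poly_part: "((\<lambda>h. coeff p i * central_diff k (\<lambda>u. of_real u ^ i) h / of_real h ^ (2 * k)) \<longlongrightarrow>
      (if i = 2 * k then central_const k * coeff p (2 * k) else 0)) (at_right 0)" for i
  proof -
    consider "i < 2 * k" | "i = 2 * k" | "i > 2 * k"
      by linarith
    then show ?thesis
    proof cases
      case 1
      then show ?thesis
        by (simp add: central_diff_power)
    next
      case 2
      have "\<forall>\<^sub>F h in at_right 0. coeff p i * central_diff k (\<lambda>u. of_real u ^ i) h / of_real h ^ (2 * k) =
          central_const k * coeff p (2 * k)"
        using eventually_at_right_less[of "0::real"]
        by eventually_elim (simp add: 2 central_diff_power_eq)
      then show ?thesis
        using 2 by (simp add: tendsto_eventually)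
    next
      case 3
      define s where "s = (\<Sum>j\<le>2*k. (-1)^j * of_nat (2*k choose j) * (of_real ((real j - real k) ^ i) :: complex))"
      have "\<forall>\<^sub>F h in at_right 0. coeff p i * s * of_real (h ^ (i - 2 * k)) =
         coeff p i * central_diff k (\<lambda>u. of_real u ^ i) h / of_real h ^ (2 * k)"
        using eventually_at_right_less[of "0::real"]
      proof eventually_elim
        case (elim h)
        have "central_diff k (\<lambda>u. of_real u ^ i) h = s * of_real h ^ i"
          by (simp add: central_diff_def s_def sum_distrib_left power_mult_distrib mult_ac)
        then show ?case
          using elim 3 by (simp add: power_diff)
      qed
      moreover have "((\<lambda>h. coeff p i * s * of_real (h ^ (i - 2 * k))) \<longlongrightarrow> coeff p i * s * of_real (0 ^ (i - 2 * k))) (at_right 0)"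
        by (intro tendsto_intros)
      ultimately have "((\<lambda>h. coeff p i * central_diff k (\<lambda>u. of_real u ^ i) h / of_real h ^ (2 * k)) \<longlongrightarrow>
          coeff p i * s * of_real (0 ^ (i - 2 * k))) (at_right 0)"
        by (rule Lim_transform_eventually[rotated])
      then show ?thesis
        using 3 by (simp add: power_0_left)
    qed
  qed
  have rem: "((\<lambda>h. central_diff k R h / of_real h ^ (2 * k)) \<longlongrightarrow> 0) (at_right 0)"
  proof -
    have each: "((\<lambda>h. R (c * h) / of_real h ^ (2 * k)) \<longlongrightarrow> 0) (at_right 0)" for c
    proof -
      have lim: "((\<lambda>h. c * h) \<longlongrightarrow> c * 0) (at_right 0)"
        by (intro tendsto_intros)
      have ev: "\<forall>\<^sub>F h in at_right 0. norm (R (c * h)) \<le> C * \<bar>c * h\<bar> ^ (2 * k + 1)"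
        using filterlim_iff[THEN iffD1, OF lim[unfolded mult_zero_right], rule_format, OF assms] by (simp add: R_def)
      have "\<forall>\<^sub>F h in at_right 0. norm (R (c * h) / of_real h ^ (2 * k)) \<le> C * \<bar>c\<bar> ^ (2 * k + 1) * h"
        using ev eventually_at_right_less[of "0::real"]
      proof eventually_elim
        case (elim h)
        then have "norm (R (c * h) / of_real h ^ (2 * k)) \<le> C * \<bar>c * h\<bar> ^ (2 * k + 1) / h ^ (2 * k)"
          by (simp add: norm_divide norm_power divide_right_mono)
        also have "\<dots> = C * \<bar>c\<bar> ^ (2 * k + 1) * h"
          using elim by (simp add: abs_mult power_mult_distrib)
        finally show ?case .
      qed
      moreover have "((\<lambda>h. C * \<bar>c\<bar> ^ (2 * k + 1) * h) \<longlongrightarrow> C * \<bar>c\<bar> ^ (2 * k + 1) * 0) (at_right 0)"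
        by (intro tendsto_intros)
      ultimately show ?thesis
        unfolding mult_zero_right by (rule Lim_null_comparison)
    qed
    have "((\<lambda>h. \<Sum>j\<le>2*k. (-1)^j * of_nat (2*k choose j) * (R ((real j - real k) * h) / of_real h ^ (2 * k))) \<longlongrightarrow>
        (\<Sum>j\<le>2*k. (-1)^j * of_nat (2*k choose j) * 0)) (at_right 0)"
      by (intro tendsto_intros each)
    then show ?thesis
      by (simp add: central_diff_def sum_divide_distrib)
  qed
  have geq: "g = (\<lambda>u. (\<Sum>i\<le>max (degree p) (2*k). coeff p i * of_real u ^ i) + R u)"
  proof
    fix u
    have "poly p (of_real u) = (\<Sum>i\<le>max (degree p) (2*k). coeff p i * of_real u ^ i)"
      unfolding poly_altdef by (intro sum.mono_neutral_left) (auto simp: coeff_eq_0)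
    then show "g u = (\<Sum>i\<le>max (degree p) (2*k). coeff p i * of_real u ^ i) + R u"
      by (simp add: R_def)
  qed
  have "central_diff k g h / of_real h ^ (2 * k) =
      (\<Sum>i\<le>max (degree p) (2*k). coeff p i * central_diff k (\<lambda>u. of_real u ^ i) h / of_real h ^ (2 * k))
      + central_diff k R h / of_real h ^ (2 * k)" for h
    by (subst geq) (simp add: central_diff_add central_diff_sum central_diff_mult add_divide_distrib sum_divide_distrib)
  moreover have "((\<lambda>h. (\<Sum>i\<le>max (degree p) (2*k). coeff p i * central_diff k (\<lambda>u. of_real u ^ i) h / of_real h ^ (2 * k))
      + central_diff k R h / of_real h ^ (2 * k)) \<longlongrightarrow>
      (\<Sum>i\<le>max (degree p) (2*k). if i = 2 * k then central_const k * coeff p (2 * k) else 0) + 0) (at_right 0)"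
    by (intro tendsto_add tendsto_sum poly_part rem)
  ultimately show ?thesis
    by simp
qed

section \<open>Moments of compensated Poisson integrals\<close>

lemma tendsto_two_minus_two_cos:
  fixes y :: real
  shows "((\<lambda>h. (2 - 2 * cos (h * y)) / h\<^sup>2) \<longlongrightarrow> y\<^sup>2) (at_right 0)"
proof -
  have "((\<lambda>h. sin (h * y / 2)) has_field_derivative y / 2) (at 0)"
    by (auto intro!: derivative_eq_intros)
  then have "((\<lambda>h. sin (h * y / 2) / h) \<longlongrightarrow> y / 2) (at 0)"
    by (simp add: DERIV_def)
  then have "((\<lambda>h. 4 * (sin (h * y / 2) / h)\<^sup>2) \<longlongrightarrow> 4 * (y / 2)\<^sup>2) (at 0)"
    by (intro tendsto_mult tendsto_power tendsto_const)
  moreover have "4 * (sin (h * y / 2) / h)\<^sup>2 = (2 - 2 * cos (h * y)) / h\<^sup>2" for h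
    using cos_double_sin[of "h * y / 2"] by (simp add: power_divide)
  moreover have "4 * (y / 2)\<^sup>2 = y\<^sup>2"
    by (simp add: power_divide)
  ultimately show ?thesis
    by (simp only: filterlim_at_split)
qed

lemma nn_integral_le_Fatou_at_right:
  fixes f :: "real \<Rightarrow> 'a \<Rightarrow> real" and L :: real
  assumes [measurable]: "\<And>h. f h \<in> borel_measurable N"
    and lim: "\<And>z. ((\<lambda>h. f h z) \<longlongrightarrow> g z) (at_right 0)"
    and le: "\<forall>\<^sub>F h in at_right 0. (\<integral>\<^sup>+z. ennreal (f h z) \<partial>N) \<le> ennreal (B h)"
    and B: "(B \<longlongrightarrow> L) (at_right 0)"
  shows "(\<integral>\<^sup>+z. ennreal (g z) \<partial>N) \<le> ennreal L"
proof -
  define h :: "nat \<Rightarrow> real" where "h n = 1 / Suc n" for n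
  have h: "filterlim h (at_right 0) sequentially"
    unfolding h_def using LIMSEQ_Suc[OF lim_1_over_n]
    by (auto simp: filterlim_at)
  have "(\<integral>\<^sup>+z. ennreal (g z) \<partial>N) = (\<integral>\<^sup>+z. liminf (\<lambda>n. ennreal (f (h n) z)) \<partial>N)"
    by (intro nn_integral_cong lim_imp_Liminf[symmetric] tendsto_ennrealI filterlim_compose[OF lim h]) auto
  also have "\<dots> \<le> liminf (\<lambda>n. \<integral>\<^sup>+z. ennreal (f (h n) z) \<partial>N)"
    by (rule nn_integral_liminf) measurable
  also have "\<dots> \<le> liminf (\<lambda>n. ennreal (B (h n)))"
    by (rule Liminf_mono) (rule eventually_compose_filterlim[OF le h])
  also have "\<dots> = ennreal L"
    by (intro lim_imp_Liminf tendsto_ennrealI filterlim_compose[OF B h]) auto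
  finally show ?thesis .
qed

text \<open>Used in two ways: with the probability measure and a characteristic function it bounds
  moments of a random variable; with the intensity and a cumulant function it bounds moments of the
  jumps. Fatou's lemma as \<open>h\<close> tends to 0 takes the place of differentiation under the
  integral, which would presuppose that the moment is finite.\<close>

lemma nn_integral_even_power_le_central_diff:
  fixes Y :: "'a \<Rightarrow> real"
  assumes [measurable]: "Y \<in> borel_measurable N"
    and diff: "\<And>h. (\<integral>\<^sup>+z. ennreal ((2 - 2 * cos (h * Y z)) ^ k) \<partial>N) = ennreal (norm (central_diff k g h))"
    and R: "\<forall>\<^sub>F u in nhds 0. norm (g u - poly p (of_real u)) \<le> C * \<bar>u\<bar> ^ (2 * k + 1)"
  shows "(\<integral>\<^sup>+z. ennreal (Y z ^ (2 * k)) \<partial>N) \<le> ennreal (norm (central_const k * coeff p (2 * k)))"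
proof (rule nn_integral_le_Fatou_at_right[where f = "\<lambda>h z. ((2 - 2 * cos (h * Y z)) / h\<^sup>2) ^ k"
      and B = "\<lambda>h. norm (central_diff k g h / of_real h ^ (2 * k))"])
  show "((\<lambda>h. ((2 - 2 * cos (h * Y z)) / h\<^sup>2) ^ k) \<longlongrightarrow> Y z ^ (2 * k)) (at_right 0)" for z
    using tendsto_power[OF tendsto_two_minus_two_cos[of "Y z"], of k] by (simp add: power_mult)
  show "((\<lambda>h. norm (central_diff k g h / of_real h ^ (2 * k))) \<longlongrightarrow> norm (central_const k * coeff p (2 * k))) (at_right 0)"
    by (intro tendsto_norm central_diff_tendsto[OF R])
  show "\<forall>\<^sub>F h in at_right 0. (\<integral>\<^sup>+z. ennreal (((2 - 2 * cos (h * Y z)) / h\<^sup>2) ^ k) \<partial>N) \<le>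
      ennreal (norm (central_diff k g h / of_real h ^ (2 * k)))"
    using eventually_at_right_less[of "0::real"]
  proof eventually_elim
    case (elim h)
    have "(\<integral>\<^sup>+z. ennreal (((2 - 2 * cos (h * Y z)) / h\<^sup>2) ^ k) \<partial>N) =
        (\<integral>\<^sup>+z. ennreal ((2 - 2 * cos (h * Y z)) ^ k) * ennreal (1 / h ^ (2 * k)) \<partial>N)"
      using elim by (intro nn_integral_cong) (simp add: power_divide power_mult ennreal_mult[symmetric])
    also have "\<dots> = ennreal (norm (central_diff k g h)) * ennreal (1 / h ^ (2 * k))"
      by (simp add: nn_integral_multc diff)
    also have "\<dots> = ennreal (norm (central_diff k g h / of_real h ^ (2 * k)))"
      using elim by (simp add: ennreal_mult[symmetric] norm_divide norm_power)
    finally show ?case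
      by simp
  qed
qed measurable

lemma norm_exp_minus_one_le:
  fixes z :: complex
  assumes "Re z \<le> 0"
  shows "norm (exp z - 1) \<le> norm z"
proof -
  have "norm (exp z - exp 0) \<le> 1 * norm (z - 0)"
  proof (rule field_differentiable_bound[where S = "{w. Re w \<le> 0}" and f = exp and f' = exp])
    show "convex {w. Re w \<le> 0}"
      by (rule convex_halfspace_Re_le)
  qed (use assms in \<open>auto intro!: derivative_eq_intros\<close>)
  then show ?thesis
    by simp
qed

lemma norm_exp_minus_one_le': "norm (exp z - 1) \<le> exp (norm z) * norm (z::complex)"
proof -
  have "norm (exp z - 1) \<le> exp \<bar>Re z\<bar> * norm z"
    using Taylor_exp[of z 0] by simp
  also have "\<dots> \<le> exp (norm z) * norm z"
    by (intro mult_right_mono) (auto simp: abs_Re_le_cmod)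
  finally show ?thesis .
qed

text \<open>The law of \<open>Y\<close> is the one of the compensated Poisson integral of \<open>G\<close> with intensity \<open>Q\<close>.\<close>

locale compensated_poisson_law = prob_space M for M :: "'w measure" +
  fixes Q :: "'a measure" and G :: "'a \<Rightarrow> real" and Y :: "'w \<Rightarrow> real"
  assumes Y [measurable]: "Y \<in> borel_measurable M"
    and G [measurable]: "G \<in> borel_measurable Q"
    and G2: "integrable Q (\<lambda>z. (G z)\<^sup>2)"
    and char_Y: "\<And>u. char (distr M borel Y) u = exp (CLINT z|Q. comp_exp (u * G z))"
begin

lemma integrable_exponent: "integrable Q (\<lambda>z. comp_exp (u * G z))"
  by (rule integrable_comp_exp[OF G G2])

lemma integrable_one_minus_cos: "integrable Q (\<lambda>z. 1 - cos (u * G z))"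
proof -
  have "integrable Q (\<lambda>z. - Re (comp_exp (u * G z)))"
    using integrable_exponent by (intro integrable_minus integrable_Re)
  then show ?thesis
    by (simp add: Re_comp_exp)
qed

lemma Re_exponent: "Re (CLINT z|Q. comp_exp (u * G z)) = - (LINT z|Q. 1 - cos (u * G z))"
proof -
  have "Re (CLINT z|Q. comp_exp (u * G z)) = (LINT z|Q. Re (comp_exp (u * G z)))"
    by (rule integral_Re[symmetric, OF integrable_exponent])
  also have "\<dots> = (LINT z|Q. - (1 - cos (u * G z)))"
    by (simp add: Re_comp_exp)
  finally show ?thesis
    by (simp only: Bochner_Integration.integral_minus)
qed

lemma Re_exponent_nonpos: "Re (CLINT z|Q. comp_exp (u * G z)) \<le> 0"
  unfolding Re_exponent by (simp add: integral_nonneg_AE)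

lemma char_Y_eq: "char (distr M borel Y) u = expectation (\<lambda>w. iexp (u * Y w))"
  unfolding char_def by (simp add: integral_distr)

lemma expectation_one_minus_cos:
  "expectation (\<lambda>w. 1 - cos (u * Y w)) = 1 - Re (char (distr M borel Y) u)"
proof -
  have i: "integrable M (\<lambda>w. iexp (u * Y w))"
    by (intro integrable_iexp) auto
  have "Re (char (distr M borel Y) u) = expectation (\<lambda>w. Re (iexp (u * Y w)))"
    unfolding char_Y_eq by (rule integral_Re[symmetric, OF i])
  also have "\<dots> = expectation (\<lambda>w. cos (u * Y w))"
    by (simp add: Re_exp)
  finally show ?thesis
    by (subst Bochner_Integration.integral_diff)
       (auto simp: prob_space intro!: integrable_const_bound[of _ 1])
qed

lemma nn_integral_one_minus_cos:
  "(\<integral>\<^sup>+w. ennreal (1 - cos (u * Y w)) \<partial>M) = ennreal (1 - Re (char (distr M borel Y) u))"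
  unfolding expectation_one_minus_cos[symmetric]
  by (intro nn_integral_eq_integral Bochner_Integration.integrable_diff)
     (auto intro!: integrable_const_bound[of _ 1])

text \<open>The lower bounds for moments start here: a characteristic function of modulus at most
  \<open>exp (- V)\<close> at frequency \<open>u\<close> forces mass at distance of order
  \<open>1 / u\<close> from 0. The restriction to \<open>q \<le> 2\<close> comes from comparing 1 -
  cos, which is quadratic at 0, with the power of order \<open>q\<close>.\<close>

lemma one_minus_exp_le_moment:
  assumes q: "0 < q" "q \<le> 2" and u: "0 < u"
    and V: "V \<le> (LINT z|Q. 1 - cos (u * G z))"
    and int: "integrable M (\<lambda>w. \<bar>Y w\<bar> powr q)"
  shows "1 - exp (- V) \<le> 2 * u powr q * expectation (\<lambda>w. \<bar>Y w\<bar> powr q)"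
proof -
  have "Re (char (distr M borel Y) u) \<le> norm (char (distr M borel Y) u)"
    by (rule complex_Re_le_cmod)
  also have "\<dots> \<le> exp (- V)"
    using V by (simp add: char_Y Re_exponent)
  finally have "1 - exp (- V) \<le> expectation (\<lambda>w. 1 - cos (u * Y w))"
    by (simp add: expectation_one_minus_cos)
  also have "\<dots> \<le> expectation (\<lambda>w. 2 * u powr q * \<bar>Y w\<bar> powr q)"
  proof (rule integral_mono)
    show "integrable M (\<lambda>w. 1 - cos (u * Y w))"
      by (intro Bochner_Integration.integrable_diff) (auto intro!: integrable_const_bound[of _ 1])
    show "1 - cos (u * Y w) \<le> 2 * u powr q * \<bar>Y w\<bar> powr q" for w
      using one_minus_cos_le_powr[OF q, of "u * Y w"] u by (simp add: abs_mult powr_mult)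
  qed (use int in auto)
  finally show ?thesis
    by simp
qed

text \<open>Values above \<open>L\<close> are split into dyadic shells, and the mass of each shell
  is estimated by the integral of 1 - cos at the matching frequency, hence by the exponent. On the
  \<open>n\<close>-th shell the power of order \<open>q\<close> gains \<open>(2 ^ n) powr q\<close>
  while the estimate of the mass gains \<open>(2 ^ n) powr (- g)\<close>, so \<open>q < g\<close>
  makes the sum geometric.\<close>

lemma low_moment_le:
  assumes q: "0 < q" "q < g" and g: "1 \<le> g" "g \<le> 2"
    and int: "integrable Q (\<lambda>z. \<bar>G z\<bar> powr g)" and T: "(LINT z|Q. \<bar>G z\<bar> powr g) \<le> T" "0 < T"
  shows "(\<integral>\<^sup>+w. ennreal (\<bar>Y w\<bar> powr q) \<partial>M) \<le>
    ennreal ((1 + 2 * 2 powr q / ((1 - cos 1) * (1 - 2 powr (q - g)))) * T powr (q / g))"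
proof -
  \<comment> \<open>The scale at which \<open>u powr g * T\<close>, the bound for the exponent at
    \<open>u = 1 / L\<close>, equals 1. Below it the trivial bound by \<open>L powr q\<close>
    suffices.\<close>
  define L where "L = T powr (1 / g)"
  have L: "0 < L"
    using T by (simp add: L_def)
  define c :: real where "c = 1 - cos 1"
  have c: "0 < c"
    using cos_one_less_one by (simp add: c_def)
  \<comment> \<open>Weights and frequencies of the shells: \<open>u n\<close> moves the shell from
    \<open>2 ^ n * L\<close> to \<open>2 ^ Suc n * L\<close> into the window from 1 to 2, where 1 -
    cos is at least \<open>c\<close>, and \<open>a n * c\<close> is the largest value of the power
    on that shell.\<close>
  define a where "a n = (2 ^ Suc n * L) powr q / c" for n :: nat
  have a: "0 \<le> a n" for n
    using c by (simp add: a_def)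
  define u where "u n = 1 / (2 ^ n * L)" for n :: nat
  have u: "0 < u n" for n
    using L by (simp add: u_def)
  have r: "2 powr (q - g) < (1::real)" "0 < (2::real) powr (q - g)"
    using q by (simp_all add: powr_less_one)
  have pointwise: "ennreal (\<bar>y\<bar> powr q) \<le> ennreal (L powr q) + (\<Sum>n. ennreal (a n * (1 - cos (u n * y))))" for y
  proof (cases "\<bar>y\<bar> \<le> L")
    case True
    then have "ennreal (\<bar>y\<bar> powr q) \<le> ennreal (L powr q)"
      using q by (intro ennreal_leI powr_mono2) auto
    then show ?thesis
      by (simp add: add_increasing2)
  next
    case False
    then have "1 \<le> \<bar>y\<bar> / L"
      using L by (simp add: field_simps)
    then obtain n where "2 ^ n \<le> \<bar>y\<bar> / L" "\<bar>y\<bar> / L < 2 ^ Suc n"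
      by (rule obtain_dyadic_scale)
    then have "2 ^ n * L \<le> \<bar>y\<bar>" "\<bar>y\<bar> \<le> 2 ^ Suc n * L"
      using L by (auto simp: field_simps)
    then have "1 \<le> \<bar>u n * y\<bar>" "\<bar>u n * y\<bar> \<le> 2"
      using L by (auto simp: u_def abs_mult field_simps)
    then have cos: "c \<le> 1 - cos (u n * y)"
      unfolding c_def by (rule one_minus_cos_ge)
    have "\<bar>y\<bar> powr q \<le> (2 ^ Suc n * L) powr q"
      using \<open>\<bar>y\<bar> \<le> 2 ^ Suc n * L\<close> q by (intro powr_mono2) auto
    also have "\<dots> = a n * c"
      using c by (simp add: a_def)
    also have "\<dots> \<le> a n * (1 - cos (u n * y))"
      using a cos by (intro mult_left_mono)
    finally have "ennreal (\<bar>y\<bar> powr q) \<le> ennreal (a n * (1 - cos (u n * y)))"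
      by (rule ennreal_leI)
    also have "\<dots> \<le> (\<Sum>n. ennreal (a n * (1 - cos (u n * y))))"
      by (rule ennreal_le_suminf)
    finally show ?thesis
      by (simp add: add_increasing)
  qed
  have term_le: "(\<integral>\<^sup>+w. ennreal (a n * (1 - cos (u n * Y w))) \<partial>M) \<le>
      ennreal (2 * 2 powr q / c * T powr (q / g) * (2 powr (q - g)) ^ n)" for n
  proof -
    have "1 - Re (char (distr M borel Y) (u n)) \<le> norm (exp (CLINT z|Q. comp_exp (u n * G z)) - 1)"
      unfolding char_Y using abs_Re_le_cmod[of "exp (CLINT z|Q. comp_exp (u n * G z)) - 1"]
      by (simp add: abs_le_iff)
    also have "\<dots> \<le> norm (CLINT z|Q. comp_exp (u n * G z))"
      by (intro norm_exp_minus_one_le Re_exponent_nonpos)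
    also have "\<dots> \<le> (LINT z|Q. norm (comp_exp (u n * G z)))"
      by (rule integral_norm_bound)
    also have "\<dots> \<le> (LINT z|Q. 2 * u n powr g * \<bar>G z\<bar> powr g)"
    proof (intro integral_mono)
      show "norm (comp_exp (u n * G z)) \<le> 2 * u n powr g * \<bar>G z\<bar> powr g" for z
        using norm_comp_exp_le_powr[OF g, of "u n * G z"] u[of n] by (simp add: abs_mult powr_mult)
    qed (use int integrable_exponent in auto)
    also have "\<dots> \<le> 2 * u n powr g * T"
      using T by (simp add: mult_left_mono)
    finally have 1: "1 - Re (char (distr M borel Y) (u n)) \<le> 2 * u n powr g * T" .
    have "(\<integral>\<^sup>+w. ennreal (a n * (1 - cos (u n * Y w))) \<partial>M) =
        ennreal (a n) * (\<integral>\<^sup>+w. ennreal (1 - cos (u n * Y w)) \<partial>M)"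
      using a by (simp add: ennreal_mult' nn_integral_cmult)
    also have "\<dots> \<le> ennreal (a n) * ennreal (2 * u n powr g * T)"
      unfolding nn_integral_one_minus_cos using 1 by (intro mult_left_mono ennreal_leI) auto
    also have "\<dots> = ennreal (a n * (2 * u n powr g * T))"
      using a by (simp add: ennreal_mult')
    also have "a n * (2 * u n powr g * T) = 2 * 2 powr q / c * T powr (q / g) * (2 powr (q - g)) ^ n"
    proof -
      have LT: "T = L powr g" "T powr (q / g) = L powr q"
        using T q g by (simp_all add: L_def powr_powr)
      have p: "(2 powr (q - g)) ^ n = (2 ^ n) powr q / (2 ^ n) powr g" for n
        by (simp add: powr_realpow[symmetric] powr_powr powr_diff[symmetric] algebra_simps)
      have u': "u n powr g = 1 / ((2 ^ n) powr g * L powr g)"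
        using L by (simp add: u_def powr_divide powr_mult)
      have a': "a n = 2 powr q * (2 ^ n) powr q * L powr q / c"
        using L by (simp add: a_def powr_mult)
      show ?thesis
        unfolding LT(2) p u' a' using L by (subst LT(1)) (simp add: field_simps)
    qed
    finally show ?thesis .
  qed
  have "(\<integral>\<^sup>+w. ennreal (\<bar>Y w\<bar> powr q) \<partial>M) \<le>
      (\<integral>\<^sup>+w. ennreal (L powr q) + (\<Sum>n. ennreal (a n * (1 - cos (u n * Y w)))) \<partial>M)"
    by (intro nn_integral_mono pointwise)
  also have "\<dots> = ennreal (L powr q) + (\<Sum>n. \<integral>\<^sup>+w. ennreal (a n * (1 - cos (u n * Y w))) \<partial>M)"
    by (subst nn_integral_add) (auto simp: nn_integral_suminf emeasure_space_1)
  also have "\<dots> \<le> ennreal (L powr q) +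
      (\<Sum>n. ennreal (2 * 2 powr q / c * T powr (q / g) * (2 powr (q - g)) ^ n))"
    by (intro add_left_mono suminf_le term_le) auto
  also have "(\<Sum>n. ennreal (2 * 2 powr q / c * T powr (q / g) * (2 powr (q - g)) ^ n)) =
     ennreal (2 * 2 powr q / c * T powr (q / g) * (1 / (1 - 2 powr (q - g))))"
    using r c T by (intro suminf_ennreal_eq sums_mult geometric_sums) auto
  also have "ennreal (L powr q) + \<dots> =
      ennreal (L powr q + 2 * 2 powr q / c * T powr (q / g) * (1 / (1 - 2 powr (q - g))))"
    using r c by (subst ennreal_plus) auto
  also have "L powr q = T powr (q / g)"
    using T q g by (simp add: L_def powr_powr)
  also have "T powr (q / g) + 2 * 2 powr q / c * T powr (q / g) * (1 / (1 - 2 powr (q - g))) =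
      (1 + 2 * 2 powr q / (c * (1 - 2 powr (q - g)))) * T powr (q / g)"
    using c r by (simp add: field_simps)
  finally show ?thesis
    by (simp add: c_def)
qed

end

text \<open>One factor \<open>d\<close> has to survive in every power \<open>s\<close>, because it
  carries the small probability in the moment bounds. A coefficient of \<open>P ^ s\<close> is a sum
  of products of \<open>s\<close> coefficients, and \<open>d \<le> 1\<close> allows all but one of
  the factors \<open>d\<close> to be dropped. Counting at most \<open>j + 1\<close> summands per
  multiplication is crude but independent of \<open>r\<close> and \<open>d\<close>.\<close>

lemma norm_coeff_power_le:
  fixes P :: "complex poly" and s j :: nat
  assumes P: "\<And>j. norm (coeff P j) \<le> B * r ^ j * d" and d: "0 \<le> d" "d \<le> 1" and B: "0 \<le> B" and r: "0 \<le> r"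
    and s: "0 < s"
  shows "norm (coeff (P ^ s) j) \<le> (B * (j + 1)) ^ s * r ^ j * d"
  using s
proof (induction s arbitrary: j rule: nat_induct_non_zero)
  case 1
  have "norm (coeff P j) \<le> B * r ^ j * d * 1"
    using P by simp
  also have "\<dots> \<le> B * r ^ j * d * (j + 1)"
    using B r d by (intro mult_left_mono) auto
  finally show ?case
    by (simp add: mult_ac)
next
  case (Suc s)
  have "norm (coeff (P ^ Suc s) j) \<le> (\<Sum>i\<le>j. norm (coeff P i) * norm (coeff (P ^ s) (j - i)))"
    unfolding power_Suc coeff_mult by (rule order_trans[OF norm_sum]) (simp add: norm_mult)
  also have "\<dots> \<le> (\<Sum>i\<le>j. B * (B * (j + 1)) ^ s * r ^ j * d)"
  proof (intro sum_mono)
    fix i assume i: "i \<in> {..j}"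
    have "norm (coeff P i) * norm (coeff (P ^ s) (j - i)) \<le>
        (B * r ^ i * d) * ((B * ((j - i) + 1)) ^ s * r ^ (j - i) * d)"
      using B r d by (intro mult_mono P Suc.IH) auto
    also have "\<dots> = (B * d * (B * ((j - i) + 1)) ^ s) * (r ^ i * r ^ (j - i)) * d"
      by (simp add: mult_ac)
    also have "r ^ i * r ^ (j - i) = r ^ j"
      using i by (simp add: power_add[symmetric])
    also have "B * d * (B * ((j - i) + 1)) ^ s * r ^ j * d \<le> B * 1 * (B * (j + 1)) ^ s * r ^ j * d"
      using B r d by (intro mult_right_mono mult_mono power_mono mult_left_mono) auto
    finally show "norm (coeff P i) * norm (coeff (P ^ s) (j - i)) \<le> B * (B * (j + 1)) ^ s * r ^ j * d"
      by simp
  qed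
  finally show ?case
    by (simp add: algebra_simps)
qed

context compensated_poisson_law
begin

text \<open>Moments are polynomials in the cumulants without constant term, and the cumulant of
  order \<open>j\<close> is bounded by \<open>B * r ^ j * d\<close>. A product of cumulants with
  orders adding up to \<open>2 * k\<close> is then at most of order \<open>r ^ (2 * k) * d\<close>:
  a single cumulant dominates, products carry further factors \<open>d\<close>. The expansion of the
  characteristic function is obtained only to the order that
  \<open>nn_integral_even_power_le_central_diff\<close> requires.\<close>

lemma even_moment_le:
  assumes k: "0 < k" and int: "\<And>j. 2 \<le> j \<Longrightarrow> j \<le> 2 * k + 1 \<Longrightarrow> integrable Q (\<lambda>z. \<bar>G z\<bar> ^ j)"
    and le: "\<And>j. 2 \<le> j \<Longrightarrow> j \<le> 2 * k \<Longrightarrow> (LINT z|Q. \<bar>G z\<bar> ^ j) \<le> B * r ^ j * d"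
    and d: "0 \<le> d" "d \<le> 1" and B: "0 \<le> B" and r: "0 \<le> r"
  shows "(\<integral>\<^sup>+w. ennreal (Y w ^ (2 * k)) \<partial>M) \<le>
    ennreal (norm (central_const k) * (\<Sum>s=1..2*k. (B * (2 * k + 1)) ^ s) * r ^ (2 * k) * d)"
proof -
  define K where "K u = (CLINT z|Q. comp_exp (u * G z))" for u
  define \<kappa> where "\<kappa> j = (LINT z|Q. G z ^ j)" for j :: nat
  have intG: "integrable Q (\<lambda>z. G z ^ j)" if "2 \<le> j" "j \<le> 2 * k" for j
    by (rule Bochner_Integration.integrable_bound[OF int[of j]]) (use that in \<open>auto simp: power_abs\<close>)
  \<comment> \<open>The Taylor polynomial of the exponent. It starts in degree 2 since the
    compensator removes the first cumulant.\<close>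
  define P :: "complex poly" where "P = (\<Sum>j=2..2*k. monom (\<i> ^ j / fact j * of_real (\<kappa> j)) j)"
  have coeff_P: "coeff P j = (if 2 \<le> j \<and> j \<le> 2 * k then \<i> ^ j / fact j * of_real (\<kappa> j) else 0)" for j
    unfolding P_def coeff_sum coeff_monom by auto
  have norm_P: "norm (coeff P j) \<le> B * r ^ j * d" for j
  proof (cases "2 \<le> j \<and> j \<le> 2 * k")
    case True
    have "\<bar>\<kappa> j\<bar> \<le> (LINT z|Q. \<bar>G z\<bar> ^ j)"
      unfolding \<kappa>_def using integral_abs_bound[of Q "\<lambda>z. G z ^ j"] by (simp add: power_abs)
    also have "\<dots> \<le> B * r ^ j * d"
      using le True by auto
    finally have "\<bar>\<kappa> j\<bar> \<le> B * r ^ j * d" .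
    moreover have "norm (coeff P j) \<le> 1 * \<bar>\<kappa> j\<bar>"
      using True unfolding coeff_P norm_mult
      by (simp add: norm_mult norm_divide norm_power divide_le_eq) (simp add: mult_le_cancel_left1)
    ultimately show ?thesis
      by simp
  next
    case False
    then show ?thesis
      using B r d by (auto simp: coeff_P)
  qed
  \<comment> \<open>The moment of one order higher enters only the Taylor remainder, so its size
    does not appear in the final bound.\<close>
  define M1 where "M1 = (LINT z|Q. \<bar>G z\<bar> ^ (2 * k + 1))"
  have M1: "0 \<le> M1"
    by (simp add: M1_def)
  have KP: "norm (K u - poly P (of_real u)) \<le> M1 * \<bar>u\<bar> ^ (2 * k + 1)" for u
  proof -
    have "poly P (of_real u) = (CLINT z|Q. (\<Sum>j=2..2*k. (\<i> * of_real (u * G z)) ^ j / fact j))"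
    proof -
      have "(CLINT z|Q. (\<Sum>j=2..2*k. (\<i> * of_real (u * G z)) ^ j / fact j)) =
         (CLINT z|Q. (\<Sum>j=2..2*k. (\<i> ^ j / fact j * of_real u ^ j) * of_real (G z ^ j)))"
        by (simp add: power_mult_distrib mult_ac)
      also have "\<dots> = (\<Sum>j=2..2*k. (\<i> ^ j / fact j * of_real u ^ j) * of_real (\<kappa> j))"
        using intG by (subst Bochner_Integration.integral_sum)
          (auto simp: \<kappa>_def simp del: of_real_power intro!: integrable_of_real)
      finally show ?thesis
        by (simp add: P_def poly_sum poly_monom mult_ac)
    qed
    moreover have i2: "integrable Q (\<lambda>z. (\<Sum>j=2..2*k. (\<i> * of_real (u * G z)) ^ j / fact j :: complex))"
    proof -
      have "integrable Q (\<lambda>z. (\<Sum>j=2..2*k. (\<i> ^ j / fact j * of_real u ^ j) * complex_of_real (G z ^ j)))"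
        using intG by (intro Bochner_Integration.integrable_sum integrable_mult_right integrable_of_real) auto
      then show ?thesis
        by (simp add: power_mult_distrib mult_ac)
    qed
    ultimately have "K u - poly P (of_real u) =
        (CLINT z|Q. comp_exp (u * G z) - (\<Sum>j=2..2*k. (\<i> * of_real (u * G z)) ^ j / fact j))"
      unfolding K_def by (subst Bochner_Integration.integral_diff) (auto intro: integrable_exponent)
    also have "norm \<dots> \<le> (LINT z|Q. norm (comp_exp (u * G z) - (\<Sum>j=2..2*k. (\<i> * of_real (u * G z)) ^ j / fact j)))"
      by (rule integral_norm_bound)
    also have "\<dots> \<le> (LINT z|Q. \<bar>u\<bar> ^ (2 * k + 1) * \<bar>G z\<bar> ^ (2 * k + 1))"
    proof (rule integral_mono)
      show "norm (comp_exp (u * G z) - (\<Sum>j=2..2*k. (\<i> * of_real (u * G z)) ^ j / fact j))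
          \<le> \<bar>u\<bar> ^ (2 * k + 1) * \<bar>G z\<bar> ^ (2 * k + 1)" for z
      proof -
        have set: "{..2*k} = insert 0 (insert 1 {2..2*k})"
          using k by auto
        have "comp_exp (u * G z) - (\<Sum>j=2..2*k. (\<i> * of_real (u * G z)) ^ j / fact j) =
           iexp (u * G z) - (\<Sum>j\<le>2*k. (\<i> * of_real (u * G z)) ^ j / fact j)"
          unfolding set by (simp add: comp_exp_def)
        then have "norm (comp_exp (u * G z) - (\<Sum>j=2..2*k. (\<i> * of_real (u * G z)) ^ j / fact j)) \<le>
            \<bar>u * G z\<bar> ^ Suc (2 * k) / fact (Suc (2 * k))"
          using iexp_approx1[of "u * G z" "2 * k"] by simp
        also have "\<dots> \<le> \<bar>u * G z\<bar> ^ Suc (2 * k) / 1"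
          by (intro divide_left_mono fact_ge_1) auto
        finally show ?thesis
          by (simp add: abs_mult power_mult_distrib del: power_Suc)
      qed
      show "integrable Q (\<lambda>z. \<bar>u\<bar> ^ (2 * k + 1) * \<bar>G z\<bar> ^ (2 * k + 1))"
        using int[of "2 * k + 1"] k by (intro integrable_mult_right) simp
      show "integrable Q (\<lambda>z. norm (comp_exp (u * G z) - (\<Sum>j=2..2*k. (\<i> * of_real (u * G z)) ^ j / fact j)))"
        using i2 integrable_exponent by (intro integrable_norm Bochner_Integration.integrable_diff)
    qed
    finally show ?thesis
      by (simp add: M1_def mult.commute)
  qed
  define S where "S = (\<Sum>j\<le>2*k. norm (coeff P j))"
  have S: "0 \<le> S"
    by (simp add: S_def sum_nonneg)
  have Pu: "norm (poly P (of_real u)) \<le> S * \<bar>u\<bar>" if "\<bar>u\<bar> \<le> 1" for u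
  proof -
    have deg: "degree P \<le> 2 * k"
      by (rule degree_le) (simp add: coeff_P)
    have "poly P (of_real u) = (\<Sum>j\<le>2*k. coeff P j * of_real u ^ j)"
      unfolding poly_altdef using deg by (intro sum.mono_neutral_left) (auto simp: coeff_eq_0)
    also have "norm \<dots> \<le> (\<Sum>j\<le>2*k. norm (coeff P j) * \<bar>u\<bar>)"
    proof (rule order_trans[OF norm_sum sum_mono])
      fix j assume "j \<in> {..2*k}"
      show "norm (coeff P j * of_real u ^ j) \<le> norm (coeff P j) * \<bar>u\<bar>"
      proof (cases "j = 0")
        case False
        then have "\<bar>u\<bar> ^ j \<le> \<bar>u\<bar> ^ 1"
          using that by (intro power_decreasing) auto
        then show ?thesis
          by (simp add: norm_mult norm_power mult_left_mono)
      qed (simp add: coeff_P)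
    qed
    finally show ?thesis
      by (simp add: S_def sum_distrib_right)
  qed
  \<comment> \<open>The exponential series of \<open>P\<close>, cut at \<open>2 * k\<close>. Since
    \<open>P\<close> vanishes at 0, the terms cut off are of order
    \<open>\<bar>u\<bar> ^ (2 * k + 1)\<close> and fit into the remainder.\<close>
  define p where "p = (\<Sum>s\<le>2*k. smult (1 / fact s) (P ^ s))"
  define C where "C = exp S * exp M1 * M1 + exp S * S ^ (2 * k + 1)"
  have rem: "\<forall>\<^sub>F u in nhds 0. norm (char (distr M borel Y) u - poly p (of_real u)) \<le> C * \<bar>u\<bar> ^ (2 * k + 1)"
  proof -
    have "\<forall>\<^sub>F u in nhds (0::real). \<bar>u\<bar> < 1"
      by (auto simp: eventually_nhds_metric dist_real_def intro!: exI[of _ 1])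
    then show ?thesis
    proof eventually_elim
      case (elim u)
      define v where "v = poly P (of_real u)"
      have v: "norm v \<le> S * \<bar>u\<bar>"
        using Pu elim by (simp add: v_def)
      also have "\<dots> \<le> S * 1"
        using elim S by (intro mult_left_mono) auto
      finally have v1: "norm v \<le> S"
        by simp
      have Rv: "exp \<bar>Re v\<bar> \<le> exp S"
        using v1 abs_Re_le_cmod[of v] by simp
      define w where "w = K u - v"
      have w: "norm w \<le> M1 * \<bar>u\<bar> ^ (2 * k + 1)"
        using KP by (simp add: w_def v_def)
      also have "\<dots> \<le> M1 * 1"
        using elim M1 by (intro mult_left_mono power_le_one) auto
      finally have w1: "norm w \<le> M1"
        by simp
      have "norm (exp (K u) - exp v) = norm (exp v * (exp w - 1))"
      proof -
        have "exp (K u) = exp v * exp w"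
          by (simp add: w_def exp_add[symmetric])
        then show ?thesis
          by (simp add: right_diff_distrib)
      qed
      also have "\<dots> \<le> exp S * (exp M1 * (M1 * \<bar>u\<bar> ^ (2 * k + 1)))"
        unfolding norm_mult
      proof (intro mult_mono)
        show "norm (exp v) \<le> exp S"
          using Rv by (simp add: abs_le_iff)
        show "norm (exp w - 1) \<le> exp M1 * (M1 * \<bar>u\<bar> ^ (2 * k + 1))"
          using norm_exp_minus_one_le'[of w] w w1
          by (smt (verit) exp_le_cancel_iff exp_ge_zero mult_mono norm_ge_zero)
      qed auto
      finally have 1: "norm (exp (K u) - exp v) \<le> exp S * exp M1 * M1 * \<bar>u\<bar> ^ (2 * k + 1)"
        by (simp add: mult_ac)
      have "norm (exp v - (\<Sum>s\<le>2*k. v ^ s / fact s)) \<le> exp \<bar>Re v\<bar> * norm v ^ Suc (2 * k) / fact (2 * k)"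
        by (rule Taylor_exp)
      also have "\<dots> \<le> exp \<bar>Re v\<bar> * norm v ^ Suc (2 * k) / 1"
        by (intro divide_left_mono fact_ge_1) auto
      also have "\<dots> \<le> exp S * (S * \<bar>u\<bar>) ^ Suc (2 * k)"
        unfolding div_by_1 using Rv v by (intro mult_mono power_mono) auto
      finally have 2: "norm (exp v - (\<Sum>s\<le>2*k. v ^ s / fact s)) \<le> exp S * S ^ (2 * k + 1) * \<bar>u\<bar> ^ (2 * k + 1)"
        by (simp add: power_mult_distrib mult_ac)
      have "poly p (of_real u) = (\<Sum>s\<le>2*k. v ^ s / fact s)"
        by (simp add: p_def poly_sum v_def)
      then have "norm (exp (K u) - poly p (of_real u)) \<le>
          norm (exp (K u) - exp v) + norm (exp v - (\<Sum>s\<le>2*k. v ^ s / fact s))"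
        using norm_triangle_ineq[of "exp (K u) - exp v" "exp v - (\<Sum>s\<le>2*k. v ^ s / fact s)"] by simp
      also have "\<dots> \<le> C * \<bar>u\<bar> ^ (2 * k + 1)"
        using 1 2 unfolding C_def by (simp only: distrib_right)
      finally show ?case
        by (simp add: char_Y K_def)
    qed
  qed
  have cd: "(\<integral>\<^sup>+w. ennreal ((2 - 2 * cos (h * Y w)) ^ k) \<partial>M) = ennreal (norm (central_diff k (char (distr M borel Y)) h))" for h
  proof -
    have i: "integrable M (\<lambda>w. iexp (u * Y w))" for u
      by (intro integrable_iexp) auto
    have "central_diff k (char (distr M borel Y)) h =
        expectation (\<lambda>w. central_diff k (\<lambda>u. iexp (u * Y w)) h)"
      unfolding central_diff_def char_Y_eq
      by (subst Bochner_Integration.integral_sum) (intro integrable_mult_right i, simp)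
    also have "\<dots> = (-1)^k * of_real (expectation (\<lambda>w. (2 - 2 * cos (h * Y w)) ^ k))"
      unfolding central_diff_iexp by (subst integral_mult_right_zero) (simp only: integral_complex_of_real)
    also have "norm \<dots> = expectation (\<lambda>w. (2 - 2 * cos (h * Y w)) ^ k)"
      by (simp add: norm_mult norm_power integral_nonneg_AE)
    finally show ?thesis
    proof (subst nn_integral_eq_integral)
      have "\<bar>(2 - 2 * cos x) ^ k\<bar> \<le> 4 ^ k" for x :: real
      proof -
        have "\<bar>2 - 2 * cos x\<bar> \<le> 4"
          using cos_ge_minus_one[of x] cos_le_one[of x] by linarith
        then show ?thesis
          unfolding power_abs by (intro power_mono) auto
      qed
      then show "integrable M (\<lambda>w. (2 - 2 * cos (h * Y w)) ^ k)"
        by (intro integrable_const_bound[of _ "4 ^ k"]) auto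
    qed auto
  qed
  have "(\<integral>\<^sup>+w. ennreal (Y w ^ (2 * k)) \<partial>M) \<le> ennreal (norm (central_const k * coeff p (2 * k)))"
    by (rule nn_integral_even_power_le_central_diff[OF _ cd rem]) auto
  also have "\<dots> \<le> ennreal (norm (central_const k) * (\<Sum>s=1..2*k. (B * (2 * k + 1)) ^ s) * r ^ (2 * k) * d)"
  proof (rule ennreal_leI)
    have "norm (coeff p (2 * k)) \<le> (\<Sum>s\<le>2*k. norm (coeff (P ^ s) (2 * k)) / fact s)"
      unfolding p_def coeff_sum by (rule order_trans[OF norm_sum]) (simp add: norm_divide)
    also have "\<dots> = (\<Sum>s=1..2*k. norm (coeff (P ^ s) (2 * k)) / fact s)"
      using k by (intro sum.mono_neutral_right) (auto simp: not_le)
    also have "\<dots> \<le> (\<Sum>s=1..2*k. (B * (2 * k + 1)) ^ s * r ^ (2 * k) * d)"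
    proof (rule sum_mono)
      fix s assume "s \<in> {1..2*k}"
      then have "norm (coeff (P ^ s) (2 * k)) \<le> (B * (2 * k + 1)) ^ s * r ^ (2 * k) * d"
        using norm_coeff_power_le[OF norm_P d B r, of s "2 * k"] by simp
      moreover have "norm (coeff (P ^ s) (2 * k)) / fact s \<le> norm (coeff (P ^ s) (2 * k)) / 1"
        by (intro divide_left_mono fact_ge_1) auto
      ultimately show "norm (coeff (P ^ s) (2 * k)) / fact s \<le> (B * (2 * k + 1)) ^ s * r ^ (2 * k) * d"
        by simp
    qed
    finally have "norm (coeff p (2 * k)) \<le> (\<Sum>s=1..2*k. (B * (2 * k + 1)) ^ s) * r ^ (2 * k) * d"
      by (simp add: sum_distrib_right)
    then show "norm (central_const k * coeff p (2 * k)) \<le>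
        norm (central_const k) * (\<Sum>s=1..2*k. (B * (2 * k + 1)) ^ s) * r ^ (2 * k) * d"
      using mult_left_mono[of _ _ "norm (central_const k)"] by (simp add: norm_mult mult.assoc)
  qed
  finally show ?thesis .
qed

end

section \<open>Convergence of characteristic functions\<close>

context prob_space
begin

text \<open>The threshold \<open>e\<close> stays explicit because the Cauchy argument in
  \<open>norm_char_ge_if_cos_energy_le\<close> needs a bound for a single pair of variables, not
  only convergence.\<close>

lemma norm_char_diff_le:
  assumes [measurable]: "U \<in> borel_measurable M" "Z \<in> borel_measurable M" and e: "0 \<le> e"
  shows "norm (char (distr M borel U) u - char (distr M borel Z) u) \<le>
    \<bar>u\<bar> * e + 2 * prob {w \<in> space M. \<bar>U w - Z w\<bar> > e}"
proof -
  let ?A = "{w \<in> space M. \<bar>U w - Z w\<bar> > e}"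
  have iA: "integrable M (indicat_real ?A)"
    by (intro integrable_real_indicator) (auto simp: less_top[symmetric])
  have i: "integrable M (\<lambda>w. iexp (u * V w))" if [measurable]: "V \<in> borel_measurable M" for V
    by (intro integrable_iexp) auto
  have "char (distr M borel U) u - char (distr M borel Z) u = expectation (\<lambda>w. iexp (u * U w) - iexp (u * Z w))"
    unfolding char_def by (simp add: integral_distr i del: of_real_mult)
  also have "norm \<dots> \<le> expectation (\<lambda>w. norm (iexp (u * U w) - iexp (u * Z w)))"
    by (rule integral_norm_bound)
  also have "\<dots> \<le> expectation (\<lambda>w. \<bar>u\<bar> * e + 2 * indicator ?A w)"
  proof (rule integral_mono)
    show "integrable M (\<lambda>w. norm (iexp (u * U w) - iexp (u * Z w)))"
      by (intro integrable_norm Bochner_Integration.integrable_diff i) auto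
    show "integrable M (\<lambda>w. \<bar>u\<bar> * e + 2 * indicator ?A w)"
      using iA by (intro Bochner_Integration.integrable_add integrable_mult_right) auto
    fix w assume w: "w \<in> space M"
    show "norm (iexp (u * U w) - iexp (u * Z w)) \<le> \<bar>u\<bar> * e + 2 * indicator ?A w"
    proof (cases "\<bar>U w - Z w\<bar> > e")
      case True
      have "norm (iexp (u * U w) - iexp (u * Z w)) \<le> norm (iexp (u * U w)) + norm (iexp (u * Z w))"
        by (rule norm_triangle_ineq4)
      also have "\<dots> = 2"
        by (simp del: of_real_mult)
      finally show ?thesis
        using True w e by (simp add: add_increasing)
    next
      case False
      have "iexp (u * U w) - iexp (u * Z w) = iexp (u * Z w) * (iexp (u * (U w - Z w)) - 1)"
        by (simp add: algebra_simps exp_add[symmetric])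
      then have "norm (iexp (u * U w) - iexp (u * Z w)) = norm (iexp (u * (U w - Z w)) - 1)"
        by (simp add: norm_mult del: of_real_mult)
      also have "\<dots> \<le> \<bar>u * (U w - Z w)\<bar>"
        using iexp_approx1[of "u * (U w - Z w)" 0] by simp
      also have "\<dots> \<le> \<bar>u\<bar> * e"
        using False by (simp add: abs_mult mult_left_mono)
      finally show ?thesis
        using w False by simp
    qed
  qed
  also have "\<dots> = \<bar>u\<bar> * e + 2 * prob ?A"
    using iA by (subst Bochner_Integration.integral_add) (auto simp: prob_space)
  finally show ?thesis .
qed

lemma norm_char_diff_le_expectation:
  assumes [measurable]: "U \<in> borel_measurable M" "Z \<in> borel_measurable M"
    and int: "integrable M (\<lambda>w. U w - Z w)"
  shows "norm (char (distr M borel U) u - char (distr M borel Z) u) \<le> \<bar>u\<bar> * expectation (\<lambda>w. \<bar>U w - Z w\<bar>)"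
proof -
  have i: "integrable M (\<lambda>w. iexp (u * V w))" if [measurable]: "V \<in> borel_measurable M" for V
    by (intro integrable_iexp) auto
  have "char (distr M borel U) u - char (distr M borel Z) u = expectation (\<lambda>w. iexp (u * U w) - iexp (u * Z w))"
    unfolding char_def by (simp add: integral_distr i del: of_real_mult)
  also have "norm \<dots> \<le> expectation (\<lambda>w. norm (iexp (u * U w) - iexp (u * Z w)))"
    by (rule integral_norm_bound)
  also have "\<dots> \<le> expectation (\<lambda>w. \<bar>u\<bar> * \<bar>U w - Z w\<bar>)"
  proof (rule integral_mono)
    show "integrable M (\<lambda>w. norm (iexp (u * U w) - iexp (u * Z w)))"
      by (intro integrable_norm Bochner_Integration.integrable_diff i) auto
    show "integrable M (\<lambda>w. \<bar>u\<bar> * \<bar>U w - Z w\<bar>)"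
      using int by (intro integrable_mult_right integrable_abs)
    fix w
    have "iexp (u * U w) - iexp (u * Z w) = iexp (u * Z w) * (iexp (u * (U w - Z w)) - 1)"
      by (simp add: algebra_simps exp_add[symmetric])
    then have "norm (iexp (u * U w) - iexp (u * Z w)) = norm (iexp (u * (U w - Z w)) - 1)"
      by (simp add: norm_mult del: of_real_mult)
    also have "\<dots> \<le> \<bar>u * (U w - Z w)\<bar>"
      using iexp_approx1[of "u * (U w - Z w)" 0] by simp
    finally show "norm (iexp (u * U w) - iexp (u * Z w)) \<le> \<bar>u\<bar> * \<bar>U w - Z w\<bar>"
      by (simp add: abs_mult)
  qed
  finally show ?thesis
    by simp
qed

lemma converges_in_prob_char:
  assumes [measurable]: "\<And>n. U n \<in> borel_measurable M" "Z \<in> borel_measurable M"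
    and conv: "converges_in_prob M U Z"
  shows "(\<lambda>n. char (distr M borel (U n)) u) \<longlonglongrightarrow> char (distr M borel Z) u"
proof (rule tendstoI)
  fix r :: real assume r: "0 < r"
  define e where "e = r / (2 * (\<bar>u\<bar> + 1))"
  have e: "0 < e" and ue: "\<bar>u\<bar> * e < r / 2"
    using r by (auto simp: e_def field_simps)
  have "(\<lambda>n. prob {w \<in> space M. \<bar>U n w - Z w\<bar> > e}) \<longlonglongrightarrow> 0"
    using conv e by (simp add: converges_in_prob_def)
  then have "\<forall>\<^sub>F n in sequentially. prob {w \<in> space M. \<bar>U n w - Z w\<bar> > e} < r / 4"
    using r by (intro order_tendstoD) auto
  then show "\<forall>\<^sub>F n in sequentially. dist (char (distr M borel (U n)) u) (char (distr M borel Z) u) < r"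
  proof eventually_elim
    case (elim n)
    then show ?case
      using norm_char_diff_le[of "U n" Z e u] e ue by (simp add: dist_norm)
  qed
qed

lemma converges_in_prob_add_scaled:
  assumes [measurable]: "\<And>n. U n \<in> borel_measurable M" "Z \<in> borel_measurable M"
    "\<And>n. U' n \<in> borel_measurable M" "Z' \<in> borel_measurable M"
    and conv: "converges_in_prob M U Z" "converges_in_prob M U' Z'"
  shows "converges_in_prob M (\<lambda>n w. U n w + c * U' n w) (\<lambda>w. Z w + c * Z' w)"
  unfolding converges_in_prob_def
proof (intro allI impI)
  fix e :: real assume e: "0 < e"
  define d where "d = e / (2 * (\<bar>c\<bar> + 1))"
  have d: "0 < d" "\<bar>c\<bar> * d \<le> e / 2"
    using e by (auto simp: d_def field_simps)
  have lim: "(\<lambda>n. prob {w \<in> space M. \<bar>U n w - Z w\<bar> > e / 2} + prob {w \<in> space M. \<bar>U' n w - Z' w\<bar> > d}) \<longlonglongrightarrow> 0"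
    using conv(1)[unfolded converges_in_prob_def, rule_format, of "e / 2"]
      conv(2)[unfolded converges_in_prob_def, rule_format, of d] e d by (intro tendsto_add_zero) simp_all
  show "(\<lambda>n. prob {w \<in> space M. e < \<bar>U n w + c * U' n w - (Z w + c * Z' w)\<bar>}) \<longlonglongrightarrow> 0"
  proof (rule tendsto_sandwich[OF _ _ tendsto_const lim])
    show "\<forall>\<^sub>F n in sequentially. prob {w \<in> space M. e < \<bar>U n w + c * U' n w - (Z w + c * Z' w)\<bar>} \<le>
       prob {w \<in> space M. \<bar>U n w - Z w\<bar> > e / 2} + prob {w \<in> space M. \<bar>U' n w - Z' w\<bar> > d}"
    proof (rule always_eventually, rule allI)
      fix n
      have "{w \<in> space M. e < \<bar>U n w + c * U' n w - (Z w + c * Z' w)\<bar>} \<subseteq>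
         {w \<in> space M. \<bar>U n w - Z w\<bar> > e / 2} \<union> {w \<in> space M. \<bar>U' n w - Z' w\<bar> > d}"
      proof (rule subsetI, rule ccontr)
        fix w assume w: "w \<in> {w \<in> space M. e < \<bar>U n w + c * U' n w - (Z w + c * Z' w)\<bar>}"
          and not: "w \<notin> {w \<in> space M. \<bar>U n w - Z w\<bar> > e / 2} \<union> {w \<in> space M. \<bar>U' n w - Z' w\<bar> > d}"
        have "U n w + c * U' n w - (Z w + c * Z' w) = (U n w - Z w) + c * (U' n w - Z' w)"
          by (simp add: algebra_simps)
        then have "\<bar>U n w + c * U' n w - (Z w + c * Z' w)\<bar> \<le> \<bar>U n w - Z w\<bar> + \<bar>c\<bar> * \<bar>U' n w - Z' w\<bar>"
          by (metis abs_mult abs_triangle_ineq)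
        moreover have "\<bar>c\<bar> * \<bar>U' n w - Z' w\<bar> \<le> \<bar>c\<bar> * d"
          using not w by (intro mult_left_mono) auto
        ultimately show False
          using w not d by auto
      qed
      then have "prob {w \<in> space M. e < \<bar>U n w + c * U' n w - (Z w + c * Z' w)\<bar>} \<le>
        prob ({w \<in> space M. \<bar>U n w - Z w\<bar> > e / 2} \<union> {w \<in> space M. \<bar>U' n w - Z' w\<bar> > d})"
        by (rule finite_measure_mono) measurable
      also have "\<dots> \<le> prob {w \<in> space M. \<bar>U n w - Z w\<bar> > e / 2} + prob {w \<in> space M. \<bar>U' n w - Z' w\<bar> > d}"
        by (rule measure_Un_le) measurable
      finally show "prob {w \<in> space M. e < \<bar>U n w + c * U' n w - (Z w + c * Z' w)\<bar>} \<le>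
        prob {w \<in> space M. \<bar>U n w - Z w\<bar> > e / 2} + prob {w \<in> space M. \<bar>U' n w - Z' w\<bar> > d}" .
    qed
  qed simp
qed

lemma converges_in_prob_cong_AE:
  assumes [measurable]: "\<And>n. U n \<in> borel_measurable M" "\<And>n. U' n \<in> borel_measurable M" "Z \<in> borel_measurable M"
    and eq: "\<And>n. AE w in M. U n w = U' n w" and conv: "converges_in_prob M U Z"
  shows "converges_in_prob M U' Z"
proof -
  have "prob {w \<in> space M. \<bar>U n w - Z w\<bar> > e} = prob {w \<in> space M. \<bar>U' n w - Z w\<bar> > e}" for n e
    using eq[of n] by (intro finite_measure_eq_AE) auto
  then show ?thesis
    using conv by (simp add: converges_in_prob_def)
qed

lemma converges_in_prob_const:
  "converges_in_prob M (\<lambda>n. Z) Z"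
  by (simp add: converges_in_prob_def)

text \<open>The real part bounds the integral of \<open>2 - 2 * cos (u * W)\<close> by a multiple of
  \<open>u\<^sup>2\<close>, and Fatou's lemma gives the second moment. Then the characteristic
  function expands as 1 plus \<open>\<i> * u * expectation W\<close> plus a quadratic error, which
  agrees with the hypothesis only if the linear term vanishes.\<close>

lemma square_integrable_if_char_quadratic:
  assumes [measurable]: "W \<in> borel_measurable M"
    and C: "\<And>u. norm (char (distr M borel W) u - 1) \<le> C * u\<^sup>2"
  shows "integrable M (\<lambda>w. (W w)\<^sup>2)" "expectation W = 0"
proof -
  have i: "integrable M (\<lambda>w. iexp (u * W w))" for u
    by (intro integrable_iexp) auto
  have char: "char (distr M borel W) u = expectation (\<lambda>w. iexp (u * W w))" for u
    unfolding char_def by (simp add: integral_distr)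
  have nn: "(\<integral>\<^sup>+w. ennreal (2 - 2 * cos (u * W w)) \<partial>M) \<le> ennreal (2 * C * u\<^sup>2)" for u
  proof -
    have "Re (char (distr M borel W) u) = expectation (\<lambda>w. Re (iexp (u * W w)))"
      unfolding char by (rule integral_Re[symmetric, OF i])
    then have e: "expectation (\<lambda>w. 2 - 2 * cos (u * W w)) = 2 * (1 - Re (char (distr M borel W) u))"
      by (subst Bochner_Integration.integral_diff)
         (auto simp: prob_space Re_exp intro!: integrable_const_bound[of _ 1] integrable_mult_right)
    have "(\<integral>\<^sup>+w. ennreal (2 - 2 * cos (u * W w)) \<partial>M) = ennreal (expectation (\<lambda>w. 2 - 2 * cos (u * W w)))"
      by (intro nn_integral_eq_integral Bochner_Integration.integrable_diff)
         (auto intro!: integrable_const_bound[of _ 1] integrable_mult_right)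
    also have "\<dots> \<le> ennreal (2 * C * u\<^sup>2)"
      using C[of u] abs_Re_le_cmod[of "char (distr M borel W) u - 1"] unfolding e by (intro ennreal_leI) simp
    finally show ?thesis .
  qed
  have "(\<integral>\<^sup>+w. ennreal ((W w)\<^sup>2) \<partial>M) \<le> ennreal (2 * C)"
  proof (rule nn_integral_le_Fatou_at_right)
    show "((\<lambda>h. (2 - 2 * cos (h * W w)) / h\<^sup>2) \<longlongrightarrow> (W w)\<^sup>2) (at_right 0)" for w
      by (rule tendsto_two_minus_two_cos)
    show "\<forall>\<^sub>F h in at_right 0. (\<integral>\<^sup>+w. ennreal ((2 - 2 * cos (h * W w)) / h\<^sup>2) \<partial>M) \<le> ennreal (2 * C)"
      using eventually_at_right_less[of "0::real"]
    proof eventually_elim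
      case (elim h)
      have "(\<integral>\<^sup>+w. ennreal ((2 - 2 * cos (h * W w)) / h\<^sup>2) \<partial>M) =
          (\<integral>\<^sup>+w. ennreal (1 / h\<^sup>2) * ennreal (2 - 2 * cos (h * W w)) \<partial>M)"
        using elim by (intro nn_integral_cong) (simp add: ennreal_mult'[symmetric])
      also have "\<dots> = ennreal (1 / h\<^sup>2) * (\<integral>\<^sup>+w. ennreal (2 - 2 * cos (h * W w)) \<partial>M)"
        by (rule nn_integral_cmult) measurable
      also have "\<dots> \<le> ennreal (1 / h\<^sup>2) * ennreal (2 * C * h\<^sup>2)"
        by (intro mult_left_mono nn) auto
      also have "\<dots> = ennreal (2 * C)"
        using elim by (simp add: ennreal_mult'[symmetric])
      finally show ?case .
    qed
  qed auto
  then show int: "integrable M (\<lambda>w. (W w)\<^sup>2)"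
    by (intro integrableI_bounded) (auto simp: order_le_less_trans)
  have int1: "integrable M W"
    using int by (rule square_integrable_imp_integrable[rotated]) simp
  show "expectation W = 0"
  proof (rule ccontr)
    define V where "V = expectation (\<lambda>w. (W w)\<^sup>2)"
    assume "expectation W \<noteq> 0"
    define D where "D = \<bar>C\<bar> + \<bar>V\<bar> + 1"
    have bound: "\<bar>u * expectation W\<bar> \<le> D * u\<^sup>2" for u
    proof -
      have "norm (char (distr M borel W) u - 1 - \<i> * of_real (u * expectation W)) = norm (expectation (\<lambda>w. comp_exp (u * W w)))"
        unfolding comp_exp_def char using i int1
        by (simp add: prob_space)
      also have "\<dots> \<le> expectation (\<lambda>w. norm (comp_exp (u * W w)))"
        by (rule integral_norm_bound)
      also have "\<dots> \<le> expectation (\<lambda>w. u\<^sup>2 / 2 * (W w)\<^sup>2)"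
      proof (rule integral_mono)
        show le: "norm (comp_exp (u * W w)) \<le> u\<^sup>2 / 2 * (W w)\<^sup>2" for w
          using norm_comp_exp_le_square[of "u * W w"] by (simp add: power_mult_distrib)
        show i2: "integrable M (\<lambda>w. u\<^sup>2 / 2 * (W w)\<^sup>2)"
          using int by simp
        show "integrable M (\<lambda>w. norm (comp_exp (u * W w)))"
          using le by (intro Bochner_Integration.integrable_bound[OF i2]) (auto intro!: AE_I2)
      qed
      also have "\<dots> = u\<^sup>2 / 2 * V"
        by (simp add: V_def)
      finally have "norm (\<i> * of_real (u * expectation W)) \<le> norm (char (distr M borel W) u - 1) + u\<^sup>2 / 2 * V"
        using norm_triangle_sub[of "\<i> * of_real (u * expectation W)" "char (distr M borel W) u - 1"]
        by (simp add: norm_minus_commute)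
      then have "\<bar>u * expectation W\<bar> \<le> C * u\<^sup>2 + u\<^sup>2 / 2 * V"
        using C[of u] by (simp add: norm_mult abs_mult)
      also have "\<dots> = u\<^sup>2 * (C + V / 2)"
        by (simp add: algebra_simps)
      also have "\<dots> \<le> u\<^sup>2 * D"
        by (intro mult_left_mono) (auto simp: D_def)
      finally show ?thesis
        by (simp add: mult.commute)
    qed
    \<comment> \<open>After division by \<open>u\<close> the bound reads
      \<open>\<bar>expectation W\<bar> \<le> D * u\<close>; for this \<open>u\<close> the right side
      is half of the left.\<close>
    define u where "u = \<bar>expectation W\<bar> / (2 * D)"
    have D: "0 < D"
      by (simp add: D_def add_nonneg_pos)
    have u: "0 < u"
      using \<open>expectation W \<noteq> 0\<close> D by (simp add: u_def)
    have "u * \<bar>expectation W\<bar> \<le> u * (D * u)"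
      using bound[of u] u by (simp add: abs_mult power2_eq_square mult_ac)
    then have "\<bar>expectation W\<bar> \<le> D * u"
      using u by simp
    also have "\<dots> = \<bar>expectation W\<bar> / 2"
      using D by (simp add: u_def)
    finally show False
      using \<open>expectation W \<noteq> 0\<close> by simp
  qed
qed

text \<open>Two expansions at \<open>u = 0\<close> are compared: the modulus is at most
  \<open>1 - u\<^sup>2 * V / 2\<close> up to smaller terms and at least
  \<open>1 - C * u\<^sup>2\<close>. The mean has to be 0 because the modulus does not notice a shift
  of \<open>W\<close>.\<close>

lemma expectation_square_le_if_norm_char_ge:
  assumes [measurable]: "W \<in> borel_measurable M"
    and int: "integrable M (\<lambda>w. (W w)\<^sup>2)" and mean: "expectation W = 0"
    and C: "\<And>u. exp (- C * u\<^sup>2) \<le> norm (char (distr M borel W) u)"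
  shows "expectation (\<lambda>w. (W w)\<^sup>2) \<le> 2 * C"
proof -
  define V where "V = expectation (\<lambda>w. (W w)\<^sup>2)"
  \<comment> \<open>The remainder of the second-order expansion. The minimum is dominated by a
    multiple of \<open>(W w)\<^sup>2\<close>, so \<open>r\<close> tends to 0 without a third
    moment.\<close>
  define r where "r u = expectation (\<lambda>w. min (6 * (W w)\<^sup>2) (\<bar>u\<bar> * \<bar>W w\<bar> ^ 3))" for u :: real
  have int1: "integrable M W"
    using int by (rule square_integrable_imp_integrable[rotated]) simp
  have main: "V / 2 - C \<le> r u / 6 + V\<^sup>2 * u\<^sup>2 / 4" if u: "u \<noteq> 0" "u\<^sup>2 * V \<le> 2" for u
  proof -
    have "norm (char (distr M borel W) u - (1 - u\<^sup>2 * V / 2)) \<le> u\<^sup>2 / 6 * r u"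
      unfolding r_def by (rule char_approx3') (auto simp: int int1 mean V_def variance_eq)
    moreover have "norm (char (distr M borel W) u) \<le> norm (of_real (1 - u\<^sup>2 * V / 2) :: complex) +
        norm (char (distr M borel W) u - of_real (1 - u\<^sup>2 * V / 2))"
      by (rule norm_triangle_sub)
    moreover have "norm (of_real (1 - u\<^sup>2 * V / 2) :: complex) = 1 - u\<^sup>2 * V / 2"
      using u by (simp only: norm_of_real)
    ultimately have "exp (- C * u\<^sup>2) \<le> 1 - u\<^sup>2 * V / 2 + u\<^sup>2 / 6 * r u"
      using C[of u] by simp
    moreover have "1 - C * u\<^sup>2 \<le> exp (- C * u\<^sup>2)"
      using exp_ge_add_one_self[of "- C * u\<^sup>2"] by simp
    ultimately have "u\<^sup>2 * (V / 2 - C) \<le> u\<^sup>2 * (r u / 6)"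
      by (simp add: algebra_simps)
    then have "V / 2 - C \<le> r u / 6"
      using u by simp
    then show ?thesis
      by (simp add: add_increasing2)
  qed
  have r0: "(\<lambda>n. r (1 / Suc n)) \<longlonglongrightarrow> 0"
  proof -
    have "(\<lambda>n. r (1 / Suc n)) \<longlonglongrightarrow> expectation (\<lambda>w. 0)"
      unfolding r_def
    proof (rule integral_dominated_convergence[where w = "\<lambda>w. 6 * (W w)\<^sup>2"])
      show "AE w in M. (\<lambda>n. min (6 * (W w)\<^sup>2) (\<bar>1 / Suc n\<bar> * \<bar>W w\<bar> ^ 3)) \<longlonglongrightarrow> 0"
      proof (rule AE_I2)
        fix w
        have "(\<lambda>n. 1 / Suc n * \<bar>W w\<bar> ^ 3) \<longlonglongrightarrow> 0 * \<bar>W w\<bar> ^ 3"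
          using LIMSEQ_Suc[OF lim_1_over_n] by (intro tendsto_mult tendsto_const) simp
        then have "(\<lambda>n. min (6 * (W w)\<^sup>2) (\<bar>1 / Suc n\<bar> * \<bar>W w\<bar> ^ 3)) \<longlonglongrightarrow> min (6 * (W w)\<^sup>2) 0"
          by (intro tendsto_min tendsto_const) simp
        then show "(\<lambda>n. min (6 * (W w)\<^sup>2) (\<bar>1 / Suc n\<bar> * \<bar>W w\<bar> ^ 3)) \<longlonglongrightarrow> 0"
          by simp
      qed
    qed (use int in auto)
    then show ?thesis
      by simp
  qed
  have "(\<lambda>n. r (1 / Suc n) / 6 + V\<^sup>2 * (1 / Suc n)\<^sup>2 / 4) \<longlonglongrightarrow> 0 / 6 + V\<^sup>2 * 0\<^sup>2 / 4"
    using r0 LIMSEQ_Suc[OF lim_1_over_n] by (intro tendsto_intros) auto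
  moreover have "\<forall>\<^sub>F n in sequentially. V / 2 - C \<le> r (1 / Suc n) / 6 + V\<^sup>2 * (1 / Suc n)\<^sup>2 / 4"
  proof -
    have "(\<lambda>n. (1 / Suc n)\<^sup>2 * V) \<longlonglongrightarrow> 0\<^sup>2 * V"
      using LIMSEQ_Suc[OF lim_1_over_n] by (intro tendsto_intros) auto
    then have "\<forall>\<^sub>F n in sequentially. (1 / Suc n)\<^sup>2 * V < 2"
      by (intro order_tendstoD) auto
    then show ?thesis
      by eventually_elim (intro main, auto)
  qed
  ultimately have "V / 2 - C \<le> 0"
    by (intro tendsto_lowerbound) auto
  then show ?thesis
    by (simp add: V_def)
qed

end

section \<open>Levy measures and the Levy-Khintchine integrand\<close>

lemma
  assumes "levy_measure \<mu>"
  shows sets_levy_measure: "sets \<mu> = sets borel"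
    and space_levy_measure: "space \<mu> = UNIV"
    and integrable_levy_measure: "integrable \<mu> (\<lambda>x. min 1 (x\<^sup>2))"
    and sigma_finite_levy_measure: "sigma_finite_measure \<mu>"
    and emeasure_levy_measure_finite: "0 < r \<Longrightarrow> emeasure \<mu> {x. r \<le> \<bar>x\<bar>} < \<infinity>"
proof -
  show sets: "sets \<mu> = sets borel"
    using assms by (simp add: levy_measure_def)
  note [measurable_cong] = sets
  show space: "space \<mu> = UNIV"
    using sets_eq_imp_space_eq[OF sets] by simp
  have fin: "(\<integral>\<^sup>+x. ennreal (min 1 (x\<^sup>2)) \<partial>\<mu>) < \<infinity>"
    using assms by (simp add: levy_measure_def)
  show "integrable \<mu> (\<lambda>x. min 1 (x\<^sup>2))"
    by (intro integrableI_nonneg) (use fin in auto)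
  have *: "emeasure \<mu> {x. r \<le> \<bar>x\<bar>} < \<infinity>" if "0 < r" for r
  proof -
    have "ennreal (min 1 (r\<^sup>2)) * emeasure \<mu> {x. r \<le> \<bar>x\<bar>} = (\<integral>\<^sup>+x. ennreal (min 1 (r\<^sup>2)) * indicator {x. r \<le> \<bar>x\<bar>} x \<partial>\<mu>)"
      by (subst nn_integral_cmult_indicator) auto
    also have "\<dots> \<le> (\<integral>\<^sup>+x. ennreal (min 1 (x\<^sup>2)) \<partial>\<mu>)"
    proof (intro nn_integral_mono)
      fix x :: real
      show "ennreal (min 1 (r\<^sup>2)) * indicator {x. r \<le> \<bar>x\<bar>} x \<le> ennreal (min 1 (x\<^sup>2))"
      proof (cases "r \<le> \<bar>x\<bar>")
        case True
        then have "r\<^sup>2 \<le> x\<^sup>2"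
          using that by (simp add: abs_le_square_iff[symmetric])
        then have "min 1 (r\<^sup>2) \<le> min 1 (x\<^sup>2)"
          by (intro min.mono) auto
        then show ?thesis
          using True by (simp add: ennreal_leI)
      qed simp
    qed
    also have "\<dots> < \<infinity>"
      by (rule fin)
    finally have "ennreal (min 1 (r\<^sup>2)) * emeasure \<mu> {x. r \<le> \<bar>x\<bar>} < \<infinity>" .
    moreover have "0 < min 1 (r\<^sup>2)"
      using that by simp
    ultimately show ?thesis
      by (auto simp: ennreal_mult_less_top)
  qed
  then show "0 < r \<Longrightarrow> emeasure \<mu> {x. r \<le> \<bar>x\<bar>} < \<infinity>" .
  show "sigma_finite_measure \<mu>"
  proof
    show "\<exists>A. countable A \<and> A \<subseteq> sets \<mu> \<and> \<Union> A = space \<mu> \<and> (\<forall>a\<in>A. emeasure \<mu> a \<noteq> \<infinity>)"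
    proof (intro exI conjI ballI)
      let ?A = "insert {0} (range (\<lambda>n. {x. 1 / real (Suc n) \<le> \<bar>x\<bar>}))"
      show "countable ?A" "?A \<subseteq> sets \<mu>"
        by (auto simp: sets)
      show "\<Union> ?A = space \<mu>"
      proof -
        have "x \<in> \<Union> ?A" for x
        proof (cases "x = 0")
          case False
          then obtain n where "1 / real (Suc n) < \<bar>x\<bar>"
            using nat_approx_posE[of "\<bar>x\<bar>"] by auto
          then show ?thesis
            by (auto intro!: exI[of _ n])
        qed auto
        then show ?thesis
          using space by auto
      qed
      show "emeasure \<mu> a \<noteq> \<infinity>" if "a \<in> ?A" for a
        using that * assms by (auto simp: levy_measure_def less_top simp del: of_nat_Suc)
    qed
  qed
qed

lemma integrable_levy_khintchine:
  assumes "levy_measure \<mu>"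
  shows "complex_integrable \<mu> (\<lambda>x. exp (\<i> * of_real (u * x)) - 1 - \<i> * of_real (u * x * indicator {-1..1} x))"
proof (rule Bochner_Integration.integrable_bound)
  note [measurable_cong] = sets_levy_measure[OF assms]
  show "integrable \<mu> (\<lambda>x. (2 + u\<^sup>2) * min 1 (x\<^sup>2))"
    using integrable_levy_measure[OF assms] by simp
  show "AE x in \<mu>. norm (exp (\<i> * of_real (u * x)) - 1 - \<i> * of_real (u * x * indicator {-1..1} x)) \<le>
      norm ((2 + u\<^sup>2) * min 1 (x\<^sup>2))"
  proof (rule AE_I2)
    fix x :: real
    show "norm (exp (\<i> * of_real (u * x)) - 1 - \<i> * of_real (u * x * indicator {-1..1} x)) \<le>
      norm ((2 + u\<^sup>2) * min 1 (x\<^sup>2))"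
    proof (cases "x \<in> {-1..1}")
      case True
      then have x: "x\<^sup>2 \<le> 1"
        by (simp add: abs_square_le_1 abs_le_iff)
      have "norm (exp (\<i> * of_real (u * x)) - 1 - \<i> * of_real (u * x * indicator {-1..1} x)) = norm (comp_exp (u * x))"
        using True by (simp add: comp_exp_def)
      also have "\<dots> \<le> (u * x)\<^sup>2 / 2"
        by (rule norm_comp_exp_le_square)
      also have "\<dots> \<le> (2 + u\<^sup>2) * x\<^sup>2"
        by (simp add: power_mult_distrib distrib_right)
      finally show ?thesis
        using x by simp
    next
      case False
      then have x: "1 \<le> x\<^sup>2"
        using abs_square_le_1[of x] by auto
      have "norm (exp (\<i> * of_real (u * x)) - 1) \<le> norm (exp (\<i> * of_real (u * x))) + norm (1 :: complex)"
        by (rule norm_triangle_ineq4)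
      also have "\<dots> = 2"
        by (simp del: of_real_mult)
      also have "\<dots> \<le> (2 + u\<^sup>2) * min 1 (x\<^sup>2)"
        using x by simp
      finally show ?thesis
        using False x by simp
    qed
  qed
qed (use sets_levy_measure[OF assms] in \<open>simp add: measurable_cong_sets[OF sets_levy_measure[OF assms] refl]\<close>)

section \<open>Integrals of simple functions\<close>

lemma char_distr_scale:
  assumes [measurable]: "W \<in> borel_measurable M"
  shows "char (distr M borel (\<lambda>w. c * W w)) u = char (distr M borel W) (u * c)"
  unfolding char_def by (simp add: integral_distr mult.assoc)

lemma char_distr_shift:
  assumes [measurable]: "W \<in> borel_measurable M"
  shows "char (distr M borel (\<lambda>w. W w + d)) u = iexp (u * d) * char (distr M borel W) u"
  unfolding char_def by (simp add: integral_distr algebra_simps exp_add)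

definition level_set :: "'a measure \<Rightarrow> ('a \<Rightarrow> 'b) \<Rightarrow> 'b \<Rightarrow> 'a set" where
  "level_set m T y = T -` {y} \<inter> space m"

definition finitely_supported_simple :: "'a measure \<Rightarrow> ('a \<Rightarrow> real) \<Rightarrow> bool" where
  "finitely_supported_simple m F \<longleftrightarrow> simple_function m F \<and> emeasure m {x \<in> space m. F x \<noteq> 0} < \<infinity>"

lemma finitely_supported_simpleD:
  assumes "finitely_supported_simple m F"
  shows "simple_function m F" "F \<in> borel_measurable m" "emeasure m {x \<in> space m. F x \<noteq> 0} < \<infinity>"
  using assms by (auto simp: finitely_supported_simple_def borel_measurable_simple_function)

lemma finitely_supported_simple_lincomb:
  assumes F: "finitely_supported_simple m F" and G: "finitely_supported_simple m G"
  shows "finitely_supported_simple m (\<lambda>x. F x + c * G x)"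
proof -
  note [measurable] = finitely_supported_simpleD(2)[OF F] finitely_supported_simpleD(2)[OF G]
  have "emeasure m {x \<in> space m. F x + c * G x \<noteq> 0} \<le>
      emeasure m ({x \<in> space m. F x \<noteq> 0} \<union> {x \<in> space m. G x \<noteq> 0})"
    by (intro emeasure_mono) auto
  also have "\<dots> \<le> emeasure m {x \<in> space m. F x \<noteq> 0} + emeasure m {x \<in> space m. G x \<noteq> 0}"
    by (intro emeasure_subadditive) measurable
  also have "\<dots> < \<infinity>"
    using finitely_supported_simpleD(3)[OF F] finitely_supported_simpleD(3)[OF G] by simp
  finally show ?thesis
    using F G unfolding finitely_supported_simple_def
    by (auto intro!: simple_function_add simple_function_mult)
qed

lemma level_set_finite:
  assumes T: "simple_function m T" and F: "finitely_supported_simple m (\<lambda>x. \<phi> (T x))" and y: "\<phi> y \<noteq> 0"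
  shows "level_set m T y \<in> finite_sets m"
proof -
  note [measurable] = finitely_supported_simpleD(2)[OF F]
  have "emeasure m (level_set m T y) \<le> emeasure m {x \<in> space m. \<phi> (T x) \<noteq> 0}"
    using y by (intro emeasure_mono) (auto simp: level_set_def)
  then show ?thesis
    using simple_functionD(2)[OF T] finitely_supported_simpleD(3)[OF F]
    by (auto simp: finite_sets_def level_set_def)
qed

lemma simple_eq_sum_level_sets:
  fixes g :: "real \<Rightarrow> 'b::real_vector"
  assumes F: "simple_function m F" and z: "z \<in> space m" and g: "g 0 = 0"
  shows "g (F z) = (\<Sum>y\<in>F ` space m - {0}. indicator (level_set m F y) z *\<^sub>R g y)"
proof -
  have fin: "finite (F ` space m)"
    using F by (rule simple_functionD)
  have "(\<Sum>y\<in>F ` space m - {0}. indicator (level_set m F y) z *\<^sub>R g y) =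
      (\<Sum>y\<in>F ` space m - {0}. if y = F z then g y else 0)"
    using z by (intro sum.cong) (auto simp: level_set_def indicator_def)
  also have "\<dots> = g (F z)"
    using fin z g by (subst sum.delta) auto
  finally show ?thesis
    by simp
qed

lemma integral_simple_level_sets:
  fixes g :: "real \<Rightarrow> 'b::{banach, second_countable_topology}"
  assumes F: "finitely_supported_simple m F" and g: "g 0 = 0"
  shows "integrable m (\<lambda>z. g (F z))"
    and "(LINT z|m. g (F z)) = (\<Sum>y\<in>F ` space m - {0}. measure m (level_set m F y) *\<^sub>R g y)"
proof -
  note sF = finitely_supported_simpleD(1)[OF F]
  have lev: "level_set m F y \<in> sets m" "emeasure m (level_set m F y) < \<infinity>" if "y \<in> F ` space m - {0}" for y
    using level_set_finite[where \<phi> = "\<lambda>x. x", OF sF F, of y] that by (auto simp: finite_sets_def)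
  have i: "integrable m (\<lambda>z. \<Sum>y\<in>F ` space m - {0}. indicator (level_set m F y) z *\<^sub>R g y)"
    using lev by (intro Bochner_Integration.integrable_sum integrable_scaleR_left) auto
  then show "integrable m (\<lambda>z. g (F z))"
    by (rule Bochner_Integration.integrable_cong[THEN iffD1, rotated -1])
       (auto intro!: simple_eq_sum_level_sets[symmetric] sF g)
  have "(LINT z|m. g (F z)) = (LINT z|m. (\<Sum>y\<in>F ` space m - {0}. indicator (level_set m F y) z *\<^sub>R g y))"
    by (intro Bochner_Integration.integral_cong refl simple_eq_sum_level_sets sF g)
  also have "\<dots> = (\<Sum>y\<in>F ` space m - {0}. (LINT z|m. indicator (level_set m F y) z *\<^sub>R g y))"
    using lev by (intro Bochner_Integration.integral_sum integrable_scaleR_left) auto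
  also have "\<dots> = (\<Sum>y\<in>F ` space m - {0}. measure m (level_set m F y) *\<^sub>R g y)"
    using lev by (intro sum.cong refl) (subst integral_scaleR_left, auto simp: level_set_def Int_commute)
  finally show "(LINT z|m. g (F z)) = (\<Sum>y\<in>F ` space m - {0}. measure m (level_set m F y) *\<^sub>R g y)" .
qed

locale levy_basis_law = prob_space M for M :: "'w measure" +
  fixes m :: "'a measure" and \<mu> :: "real measure" and a :: real and \<Lambda> :: "'a set \<Rightarrow> 'w \<Rightarrow> real"
  assumes basis: "levy_basis M m (levy_khintchine a 0 \<mu>) \<Lambda>"
    and levy: "levy_measure \<mu>" and sigma_finite_control: "sigma_finite_measure m"
begin

sublocale mu: sigma_finite_measure \<mu>
  by (rule sigma_finite_levy_measure[OF levy])

sublocale m: sigma_finite_measure m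
  by (rule sigma_finite_control)

sublocale Q: pair_sigma_finite m \<mu> ..

lemma sets_mu [measurable_cong]: "sets \<mu> = sets borel"
  by (rule sets_levy_measure[OF levy])

lemma space_mu [simp]: "space \<mu> = UNIV"
  by (rule space_levy_measure[OF levy])

abbreviation \<kappa> :: "real \<Rightarrow> complex" where "\<kappa> \<equiv> levy_khintchine a 0 \<mu>"

abbreviation I :: "('a \<Rightarrow> real) \<Rightarrow> 'w \<Rightarrow> real" where "I \<equiv> simple_levy_integral m \<Lambda> (space m)"

lemma Lambda_measurable [measurable]: "A \<in> finite_sets m \<Longrightarrow> \<Lambda> A \<in> borel_measurable M"
  using basis by (simp add: levy_basis_def)

lemma char_Lambda: "A \<in> finite_sets m \<Longrightarrow> char (distr M borel (\<Lambda> A)) u = exp (of_real (measure m A) * \<kappa> u)"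
  using basis by (simp add: levy_basis_def)

lemma empty_finite_sets [simp]: "{} \<in> finite_sets m"
  by (simp add: finite_sets_def)

lemma Lambda_sequence:
  fixes A :: "nat \<Rightarrow> 'a set"
  assumes "range A \<subseteq> finite_sets m" "disjoint_family A"
  shows "indep_vars (\<lambda>_. borel) (\<lambda>i. \<Lambda> (A i)) UNIV"
    and "(\<Union>i. A i) \<in> finite_sets m \<Longrightarrow> AE \<omega> in M. (\<lambda>i. \<Lambda> (A i) \<omega>) sums \<Lambda> (\<Union>i. A i) \<omega>"
  using basis assms by (auto simp: levy_basis_def)

text \<open>Countable additivity along the constant sequence of empty sets yields a convergent
  series with equal terms.\<close>

lemma Lambda_empty: "AE \<omega> in M. \<Lambda> {} \<omega> = 0"
proof -
  have "AE \<omega> in M. (\<lambda>i. \<Lambda> {} \<omega>) sums \<Lambda> {} \<omega>"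
    using Lambda_sequence(2)[of "\<lambda>_. {}"] by (auto simp: disjoint_family_on_def)
  then show ?thesis
    proof eventually_elim
    case (elim \<omega>)
    from summable_LIMSEQ_zero[OF sums_summable[OF elim]] show ?case
      by (simp add: LIMSEQ_const_iff)
  qed
qed

lemma
  fixes A :: "'i \<Rightarrow> 'a set"
  assumes J: "finite J" and A: "\<And>j. j \<in> J \<Longrightarrow> A j \<in> finite_sets m" and disj: "disjoint_family_on A J"
  shows Lambda_UN: "AE \<omega> in M. \<Lambda> (\<Union>j\<in>J. A j) \<omega> = (\<Sum>j\<in>J. \<Lambda> (A j) \<omega>)"
    and char_sum_Lambda: "char (distr M borel (\<lambda>\<omega>. \<Sum>j\<in>J. c j * \<Lambda> (A j) \<omega>)) u =
      exp (\<Sum>j\<in>J. of_real (measure m (A j)) * \<kappa> (u * c j))"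
proof -
  obtain h where h: "bij_betw h {0..<card J} J"
    using ex_bij_betw_nat_finite[OF J] by auto
  define n where "n = card J"
  \<comment> \<open>The axioms of the basis concern sequences only, so the finite family is
    enumerated and padded by empty sets, on which \<open>\<Lambda>\<close> vanishes almost
    surely.\<close>
  define B where "B i = (if i < n then A (h i) else {})" for i
  have hJ: "h i \<in> J" if "i < n" for i
    using h that by (auto simp: n_def bij_betw_def)
  have B: "range B \<subseteq> finite_sets m"
    using A hJ by (auto simp: B_def)
  have dB: "disjoint_family B"
    unfolding disjoint_family_on_def
  proof (intro ballI impI)
    fix i j :: nat assume "i \<noteq> j"
    show "B i \<inter> B j = {}"
    proof (cases "i < n \<and> j < n")
      case True
      then have "h i \<noteq> h j"
        using h \<open>i \<noteq> j\<close> by (auto simp: n_def bij_betw_def inj_on_def)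
      then show ?thesis
        using disj hJ True by (auto simp: B_def disjoint_family_on_def)
    qed (auto simp: B_def)
  qed
  have J_eq: "J = h ` {0..<n}"
    using h by (auto simp: n_def bij_betw_def)
  have UB: "(\<Union>i. B i) = (\<Union>j\<in>J. A j)"
    unfolding J_eq B_def by (auto split: if_splits)
  have UN: "(\<Union>j\<in>J. A j) \<in> finite_sets m"
  proof -
    have "emeasure m (\<Union>j\<in>J. A j) \<le> (\<Sum>j\<in>J. emeasure m (A j))"
      using A J by (intro emeasure_subadditive_finite) (auto simp: finite_sets_def)
    also have "\<dots> < \<infinity>"
      using A J by (auto simp: finite_sets_def)
    finally show ?thesis
      using A J by (auto simp: finite_sets_def intro!: sets.finite_UN)
  qed
  have "AE \<omega> in M. (\<lambda>i. \<Lambda> (B i) \<omega>) sums \<Lambda> (\<Union>j\<in>J. A j) \<omega>"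
    using Lambda_sequence(2)[OF B dB] UN by (simp add: UB)
  then show "AE \<omega> in M. \<Lambda> (\<Union>j\<in>J. A j) \<omega> = (\<Sum>j\<in>J. \<Lambda> (A j) \<omega>)"
    using Lambda_empty
  proof eventually_elim
    case (elim \<omega>)
    have "(\<lambda>i. \<Lambda> (B i) \<omega>) sums (\<Sum>i\<in>{0..<n}. \<Lambda> (B i) \<omega>)"
      using elim by (intro sums_finite) (auto simp: B_def)
    then have "\<Lambda> (\<Union>j\<in>J. A j) \<omega> = (\<Sum>i\<in>{0..<n}. \<Lambda> (B i) \<omega>)"
      using elim by (auto intro: sums_unique2)
    also have "\<dots> = (\<Sum>i\<in>{0..<n}. \<Lambda> (A (h i)) \<omega>)"
      by (intro sum.cong) (auto simp: B_def)
    also have "\<dots> = (\<Sum>j\<in>J. \<Lambda> (A j) \<omega>)"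
      using h by (intro sum.reindex_bij_betw) (simp add: n_def)
    finally show ?case .
  qed
  have "indep_vars (\<lambda>_. borel) (\<lambda>i. \<Lambda> (B i)) {0..<n}"
    by (rule indep_vars_subset[OF Lambda_sequence(1)[OF B dB]]) simp
  then have "indep_vars (\<lambda>_. borel) (\<lambda>i \<omega>. c (h i) * \<Lambda> (B i) \<omega>) {0..<n}"
    by (rule indep_vars_compose2) auto
  then have "char (distr M borel (\<lambda>\<omega>. \<Sum>i\<in>{0..<n}. c (h i) * \<Lambda> (B i) \<omega>)) u =
      (\<Prod>i\<in>{0..<n}. char (distr M borel (\<lambda>\<omega>. c (h i) * \<Lambda> (B i) \<omega>)) u)"
    by (rule char_distr_sum)
  also have "\<dots> = (\<Prod>i\<in>{0..<n}. exp (of_real (measure m (A (h i))) * \<kappa> (u * c (h i))))"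
    using A hJ by (intro prod.cong refl) (simp add: B_def char_distr_scale char_Lambda)
  also have "\<dots> = exp (\<Sum>i\<in>{0..<n}. of_real (measure m (A (h i))) * \<kappa> (u * c (h i)))"
    by (simp add: exp_sum)
  also have "(\<Sum>i\<in>{0..<n}. of_real (measure m (A (h i))) * \<kappa> (u * c (h i))) =
      (\<Sum>j\<in>J. of_real (measure m (A j)) * \<kappa> (u * c j))"
    using h by (subst sum.reindex_bij_betw[of h _ J]) (simp_all add: n_def)
  also have "(\<lambda>\<omega>. \<Sum>i\<in>{0..<n}. c (h i) * \<Lambda> (B i) \<omega>) = (\<lambda>\<omega>. \<Sum>j\<in>J. c j * \<Lambda> (A j) \<omega>)"
  proof
    fix \<omega>
    have "(\<Sum>i\<in>{0..<n}. c (h i) * \<Lambda> (B i) \<omega>) = (\<Sum>i\<in>{0..<n}. c (h i) * \<Lambda> (A (h i)) \<omega>)"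
      by (intro sum.cong) (auto simp: B_def)
    also have "\<dots> = (\<Sum>j\<in>J. c j * \<Lambda> (A j) \<omega>)"
      using h by (subst sum.reindex_bij_betw[of h _ J "\<lambda>j. c j * \<Lambda> (A j) \<omega>"]) (simp_all add: n_def)
    finally show "(\<Sum>i\<in>{0..<n}. c (h i) * \<Lambda> (B i) \<omega>) = (\<Sum>j\<in>J. c j * \<Lambda> (A j) \<omega>)" .
  qed
  finally show "char (distr M borel (\<lambda>\<omega>. \<Sum>j\<in>J. c j * \<Lambda> (A j) \<omega>)) u =
      exp (\<Sum>j\<in>J. of_real (measure m (A j)) * \<kappa> (u * c j))" .
qed

lemma I_eq: "I F \<omega> = (\<Sum>y\<in>F ` space m - {0}. y * \<Lambda> (level_set m F y) \<omega>)"
  unfolding simple_levy_integral_def level_set_def by (simp add: Int_absorb1)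

lemma I_measurable [measurable]:
  assumes "finitely_supported_simple m F"
  shows "I F \<in> borel_measurable M"
proof -
  have "level_set m F y \<in> finite_sets m" if "y \<noteq> 0" for y
    using level_set_finite[where \<phi> = "\<lambda>x. x", OF finitely_supported_simpleD(1)[OF assms] assms that] .
  then show ?thesis
    unfolding I_eq by (intro borel_measurable_sum borel_measurable_times) auto
qed

lemma char_I:
  assumes F: "finitely_supported_simple m F"
  shows "char (distr M borel (I F)) u =
    exp (\<Sum>y\<in>F ` space m - {0}. of_real (measure m (level_set m F y)) * \<kappa> (u * y))"
  unfolding I_eq
proof (rule char_sum_Lambda)
  show "finite (F ` space m - {0})"
    using finitely_supported_simpleD(1)[OF F] by (auto dest: simple_functionD)
  show "level_set m F y \<in> finite_sets m" if "y \<in> F ` space m - {0}" for y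
    using level_set_finite[where \<phi> = "\<lambda>x. x", OF finitely_supported_simpleD(1)[OF F] F, of y] that by auto
qed (auto simp: disjoint_family_on_def level_set_def)

text \<open>\<open>I\<close> is computed on the level sets of its own integrand. Linearity needs a
  partition common to two integrands, and this lemma passes to the finer partition by the level sets
  of \<open>T\<close>; later \<open>T\<close> is the pair of both integrands. The equality holds
  almost surely only, as additivity of \<open>\<Lambda>\<close> does.\<close>

lemma I_comp_eq_sum:
  fixes T :: "'a \<Rightarrow> 'b"
  assumes T: "simple_function m T" and F: "finitely_supported_simple m (\<lambda>x. \<phi> (T x))"
  shows "AE \<omega> in M. I (\<lambda>x. \<phi> (T x)) \<omega> = (\<Sum>y\<in>{y \<in> T ` space m. \<phi> y \<noteq> 0}. \<phi> y * \<Lambda> (level_set m T y) \<omega>)"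
proof -
  define R where "R = (\<lambda>x. \<phi> (T x)) ` space m - {0}"
  have finT: "finite (T ` space m)"
    using T by (rule simple_functionD)
  have finR: "finite R"
    unfolding R_def using finitely_supported_simpleD(1)[OF F] by (auto dest: simple_functionD)
  have "AE \<omega> in M. \<Lambda> (level_set m (\<lambda>x. \<phi> (T x)) w) \<omega> = (\<Sum>y\<in>{y \<in> T ` space m. \<phi> y = w}. \<Lambda> (level_set m T y) \<omega>)"
    if w: "w \<in> R" for w
  proof -
    have "level_set m (\<lambda>x. \<phi> (T x)) w = (\<Union>y\<in>{y \<in> T ` space m. \<phi> y = w}. level_set m T y)"
      by (auto simp: level_set_def)
    moreover have "AE \<omega> in M. \<Lambda> (\<Union>y\<in>{y \<in> T ` space m. \<phi> y = w}. level_set m T y) \<omega> =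
        (\<Sum>y\<in>{y \<in> T ` space m. \<phi> y = w}. \<Lambda> (level_set m T y) \<omega>)"
    proof (rule Lambda_UN)
      show "level_set m T y \<in> finite_sets m" if "y \<in> {y \<in> T ` space m. \<phi> y = w}" for y
        using level_set_finite[OF T F, of y] that w by (auto simp: R_def)
    qed (use finT in \<open>auto simp: disjoint_family_on_def level_set_def\<close>)
    ultimately show ?thesis
      by simp
  qed
  then have "AE \<omega> in M. \<forall>w\<in>R. \<Lambda> (level_set m (\<lambda>x. \<phi> (T x)) w) \<omega> = (\<Sum>y\<in>{y \<in> T ` space m. \<phi> y = w}. \<Lambda> (level_set m T y) \<omega>)"
    using finR by (intro AE_finite_allI) auto
  then show ?thesis
  proof eventually_elim
    case (elim \<omega>)
    have "I (\<lambda>x. \<phi> (T x)) \<omega> = (\<Sum>w\<in>R. w * \<Lambda> (level_set m (\<lambda>x. \<phi> (T x)) w) \<omega>)"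
      unfolding I_eq R_def ..
    also have "\<dots> = (\<Sum>w\<in>R. \<Sum>y\<in>{y \<in> {y \<in> T ` space m. \<phi> y \<noteq> 0}. \<phi> y = w}. \<phi> y * \<Lambda> (level_set m T y) \<omega>)"
    proof (rule sum.cong[OF refl])
      fix w assume w: "w \<in> R"
      have eq: "{y \<in> {y \<in> T ` space m. \<phi> y \<noteq> 0}. \<phi> y = w} = {y \<in> T ` space m. \<phi> y = w}"
        using w by (auto simp: R_def)
      show "w * \<Lambda> (level_set m (\<lambda>x. \<phi> (T x)) w) \<omega> =
          (\<Sum>y\<in>{y \<in> {y \<in> T ` space m. \<phi> y \<noteq> 0}. \<phi> y = w}. \<phi> y * \<Lambda> (level_set m T y) \<omega>)"
        unfolding eq using elim w by (simp add: sum_distrib_left)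
    qed
    also have "\<dots> = (\<Sum>y\<in>{y \<in> T ` space m. \<phi> y \<noteq> 0}. \<phi> y * \<Lambda> (level_set m T y) \<omega>)"
      using finT finR by (intro sum.group) (auto simp: R_def)
    finally show ?case .
  qed
qed

lemma I_lincomb:
  assumes F: "finitely_supported_simple m F" and G: "finitely_supported_simple m G"
  shows "AE \<omega> in M. I (\<lambda>x. F x + c * G x) \<omega> = I F \<omega> + c * I G \<omega>"
proof -
  define T where "T x = (F x, G x)" for x
  have T: "simple_function m T"
    unfolding T_def using F G by (intro simple_function_Pair) (auto dest: finitely_supported_simpleD)
  have finT: "finite (T ` space m)"
    using T by (rule simple_functionD)
  define S where "S = {y \<in> T ` space m. y \<noteq> (0, 0)}"
  have S: "finite S"
    using finT by (simp add: S_def)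
  have extend: "(\<Sum>y\<in>{y \<in> T ` space m. \<phi> y \<noteq> 0}. \<phi> y * \<Lambda> (level_set m T y) \<omega>) =
      (\<Sum>y\<in>S. \<phi> y * \<Lambda> (level_set m T y) \<omega>)" if "\<phi> (0, 0) = 0" for \<phi> :: "real \<times> real \<Rightarrow> real" and \<omega>
    using S that by (intro sum.mono_neutral_left) (auto simp: S_def)
  have 1: "AE \<omega> in M. I F \<omega> = (\<Sum>y\<in>S. fst y * \<Lambda> (level_set m T y) \<omega>)"
    using I_comp_eq_sum[OF T, of fst] F extend[of fst] by (simp add: T_def)
  have 2: "AE \<omega> in M. I G \<omega> = (\<Sum>y\<in>S. snd y * \<Lambda> (level_set m T y) \<omega>)"
    using I_comp_eq_sum[OF T, of snd] G extend[of snd] by (simp add: T_def)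
  have 3: "AE \<omega> in M. I (\<lambda>x. F x + c * G x) \<omega> = (\<Sum>y\<in>S. (fst y + c * snd y) * \<Lambda> (level_set m T y) \<omega>)"
    using I_comp_eq_sum[OF T, of "\<lambda>y. fst y + c * snd y"] finitely_supported_simple_lincomb[OF F G, of c]
      extend[of "\<lambda>y. fst y + c * snd y"] by (simp add: T_def)
  from 1 2 3 show ?thesis
    by eventually_elim (simp add: sum.distrib sum_distrib_left algebra_simps)
qed

text \<open>The exponent of the symmetrized integral: for a simple integrand it is minus the
  logarithm of the modulus of the characteristic function at 1. Values in \<open>ennreal\<close>
  make it meaningful for every measurable integrand before integrability is known, and the drift has
  no influence on it.\<close>

definition cos_energy :: "('a \<Rightarrow> real) \<Rightarrow> ennreal" where
  "cos_energy h = (\<integral>\<^sup>+z. \<integral>\<^sup>+x. ennreal (1 - cos (h z * x)) \<partial>\<mu> \<partial>m)"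

lemma integrable_one_minus_cos_levy: "integrable \<mu> (\<lambda>x. 1 - cos (u * x))"
proof -
  have "integrable \<mu> (\<lambda>x. - Re (exp (\<i> * of_real (u * x)) - 1 - \<i> * of_real (u * x * indicator {-1..1} x)))"
    by (intro integrable_minus integrable_Re integrable_levy_khintchine levy)
  then show ?thesis
    by (simp add: Re_exp)
qed

lemma Re_kappa: "Re (\<kappa> u) = - (LINT x|\<mu>. 1 - cos (u * x))"
proof -
  have "Re (\<kappa> u) = (LINT x|\<mu>. Re (exp (\<i> * of_real (u * x)) - 1 - \<i> * of_real (u * x * indicator {-1..1} x)))"
    unfolding levy_khintchine_def by (subst integral_Re[OF integrable_levy_khintchine[OF levy]]) simp
  also have "\<dots> = (LINT x|\<mu>. - (1 - cos (u * x)))"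
    by (simp add: Re_exp)
  finally show ?thesis
    by (simp only: Bochner_Integration.integral_minus)
qed

lemma cos_energy_simple:
  assumes F: "finitely_supported_simple m F"
  shows "cos_energy (\<lambda>z. u * F z) =
    ennreal (\<Sum>y\<in>F ` space m - {0}. measure m (level_set m F y) * (LINT x|\<mu>. 1 - cos (u * y * x)))"
proof -
  define g where "g y = (LINT x|\<mu>. 1 - cos (u * y * x))" for y
  have inner: "(\<integral>\<^sup>+x. ennreal (1 - cos (u * F z * x)) \<partial>\<mu>) = ennreal (g (F z))" for z
    unfolding g_def by (intro nn_integral_eq_integral integrable_one_minus_cos_levy) auto
  have g: "g 0 = 0" "\<And>y. 0 \<le> g y"
    by (simp_all add: g_def integral_nonneg_AE)
  have "cos_energy (\<lambda>z. u * F z) = ennreal (LINT z|m. g (F z))"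
    unfolding cos_energy_def inner
    using integral_simple_level_sets(1)[of m F g] F g by (intro nn_integral_eq_integral) auto
  then show ?thesis
    using integral_simple_level_sets(2)[of m F g] F g by (simp add: g_def)
qed

text \<open>The modulus removes both the drift and the shift \<open>c\<close>, so for simple
  integrands energy and modulus determine each other exactly.\<close>

lemma norm_char_I:
  assumes F: "finitely_supported_simple m F"
  shows "cos_energy (\<lambda>z. u * F z) = ennreal (- ln (norm (char (distr M borel (\<lambda>w. I F w + c)) u)))"
    and "0 < norm (char (distr M borel (\<lambda>w. I F w + c)) u)"
proof -
  have "norm (char (distr M borel (\<lambda>w. I F w + c)) u) = norm (char (distr M borel (I F)) u)"
    using F by (simp add: char_distr_shift norm_mult del: of_real_mult)
  also have "\<dots> = exp (- (\<Sum>y\<in>F ` space m - {0}. measure m (level_set m F y) * (LINT x|\<mu>. 1 - cos (u * y * x))))"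
    unfolding char_I[OF F] norm_exp_eq_Re by (simp add: Re_kappa sum_negf)
  finally have *: "norm (char (distr M borel (\<lambda>w. I F w + c)) u) =
    exp (- (\<Sum>y\<in>F ` space m - {0}. measure m (level_set m F y) * (LINT x|\<mu>. 1 - cos (u * y * x))))" .
  show "cos_energy (\<lambda>z. u * F z) = ennreal (- ln (norm (char (distr M borel (\<lambda>w. I F w + c)) u)))"
    unfolding * cos_energy_simple[OF F] by simp
  show "0 < norm (char (distr M borel (\<lambda>w. I F w + c)) u)"
    unfolding * by simp
qed

lemma cos_energy_add:
  assumes [measurable]: "h \<in> borel_measurable m" "k \<in> borel_measurable m"
  shows "cos_energy (\<lambda>z. h z + k z) \<le> 2 * cos_energy h + 2 * cos_energy k"
proof -
  have "cos_energy (\<lambda>z. h z + k z) \<le>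
      (\<integral>\<^sup>+z. \<integral>\<^sup>+x. 2 * ennreal (1 - cos (h z * x)) + 2 * ennreal (1 - cos (k z * x)) \<partial>\<mu> \<partial>m)"
    unfolding cos_energy_def
  proof (intro nn_integral_mono)
    fix z x
    have "ennreal (1 - cos ((h z + k z) * x)) \<le> ennreal (2 * (1 - cos (h z * x)) + 2 * (1 - cos (k z * x)))"
      using one_minus_cos_add[of "h z * x" "k z * x"] by (intro ennreal_leI) (simp add: distrib_right)
    also have "\<dots> = 2 * ennreal (1 - cos (h z * x)) + 2 * ennreal (1 - cos (k z * x))"
    proof -
      have "ennreal (2 * (1 - cos y)) = 2 * ennreal (1 - cos y)" for y :: real
        by (subst ennreal_mult') simp_all
      then show ?thesis
        by (subst ennreal_plus) simp_all
    qed
    finally show "ennreal (1 - cos ((h z + k z) * x)) \<le> 2 * ennreal (1 - cos (h z * x)) + 2 * ennreal (1 - cos (k z * x))" .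
  qed
  also have "\<dots> = 2 * cos_energy h + 2 * cos_energy k"
    unfolding cos_energy_def by (simp add: nn_integral_add nn_integral_cmult)
  finally show ?thesis .
qed

lemma cos_energy_Fatou:
  assumes [measurable]: "\<And>n. h n \<in> borel_measurable m" "k \<in> borel_measurable m"
    and lim: "AE z in m. (\<lambda>n. h n z) \<longlonglongrightarrow> k z"
  shows "cos_energy k \<le> liminf (\<lambda>n. cos_energy (h n))"
proof -
  have "cos_energy k \<le> (\<integral>\<^sup>+z. liminf (\<lambda>n. \<integral>\<^sup>+x. ennreal (1 - cos (h n z * x)) \<partial>\<mu>) \<partial>m)"
    unfolding cos_energy_def
  proof (rule nn_integral_mono_AE)
    show "AE z in m. (\<integral>\<^sup>+x. ennreal (1 - cos (k z * x)) \<partial>\<mu>) \<le> liminf (\<lambda>n. \<integral>\<^sup>+x. ennreal (1 - cos (h n z * x)) \<partial>\<mu>)"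
      using lim
    proof eventually_elim
      case (elim z)
      have "(\<integral>\<^sup>+x. ennreal (1 - cos (k z * x)) \<partial>\<mu>) = (\<integral>\<^sup>+x. liminf (\<lambda>n. ennreal (1 - cos (h n z * x))) \<partial>\<mu>)"
        using elim by (intro nn_integral_cong lim_imp_Liminf[symmetric] tendsto_ennrealI tendsto_intros) auto
      also have "\<dots> \<le> liminf (\<lambda>n. \<integral>\<^sup>+x. ennreal (1 - cos (h n z * x)) \<partial>\<mu>)"
        by (rule nn_integral_liminf) measurable
      finally show ?case .
    qed
  qed
  also have "\<dots> \<le> liminf (\<lambda>n. cos_energy (h n))"
    unfolding cos_energy_def by (rule nn_integral_liminf) measurable
  finally show ?thesis .
qed

lemma cos_energy_le_square:
  assumes [measurable]: "h \<in> borel_measurable m"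
  shows "cos_energy (\<lambda>z. u * h z) \<le> ennreal (u\<^sup>2 / 2) * (\<integral>\<^sup>+z. \<integral>\<^sup>+x. ennreal ((h z * x)\<^sup>2) \<partial>\<mu> \<partial>m)"
proof -
  have "cos_energy (\<lambda>z. u * h z) \<le> (\<integral>\<^sup>+z. \<integral>\<^sup>+x. ennreal (u\<^sup>2 / 2) * ennreal ((h z * x)\<^sup>2) \<partial>\<mu> \<partial>m)"
    unfolding cos_energy_def
  proof (intro nn_integral_mono)
    fix z x
    show "ennreal (1 - cos (u * h z * x)) \<le> ennreal (u\<^sup>2 / 2) * ennreal ((h z * x)\<^sup>2)"
      using one_minus_cos_le_square[of "u * h z * x"]
      by (subst ennreal_mult[symmetric]) (auto intro!: ennreal_leI simp: power_mult_distrib)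
  qed
  also have "\<dots> = ennreal (u\<^sup>2 / 2) * (\<integral>\<^sup>+z. \<integral>\<^sup>+x. ennreal ((h z * x)\<^sup>2) \<partial>\<mu> \<partial>m)"
    by (simp add: nn_integral_cmult)
  finally show ?thesis .
qed

text \<open>Weaker than \<open>has_levy_integral\<close>: only convergence over the whole space is kept, and the
  approximating integrals may be shifted by constants.\<close>

definition weak_integral :: "('a \<Rightarrow> real) \<Rightarrow> ('w \<Rightarrow> real) \<Rightarrow> bool" where
  "weak_integral f Y \<longleftrightarrow> f \<in> borel_measurable m \<and> Y \<in> borel_measurable M \<and>
     (\<exists>F c. (\<forall>n. finitely_supported_simple m (F n)) \<and> (AE x in m. (\<lambda>n. F n x) \<longlonglongrightarrow> f x) \<and>
        converges_in_prob M (\<lambda>n \<omega>. I (F n) \<omega> + c n) Y)"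

lemma weak_integral_if_has_levy_integral:
  assumes "has_levy_integral M m \<Lambda> f Y"
  shows "weak_integral f Y"
proof -
  obtain F where "\<forall>n. simple_function m (F n) \<and> emeasure m {x \<in> space m. F n x \<noteq> 0} < \<infinity>"
    "AE x in m. (\<lambda>n. F n x) \<longlonglongrightarrow> f x" "converges_in_prob M (\<lambda>n. I (F n)) Y"
    using assms unfolding has_levy_integral_def by auto
  then show ?thesis
    using assms unfolding weak_integral_def has_levy_integral_def finitely_supported_simple_def
    by (intro conjI exI[of _ F] exI[of _ "\<lambda>_. 0"]) auto
qed

lemma weak_integral_simple:
  assumes "finitely_supported_simple m F"
  shows "weak_integral F (\<lambda>\<omega>. I F \<omega> + d)"
  unfolding weak_integral_def using assms
  by (intro conjI exI[of _ "\<lambda>_. F"] exI[of _ "\<lambda>_. d"])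
     (auto simp: finitely_supported_simpleD converges_in_prob_const)

lemma weak_integral_lincomb:
  assumes "weak_integral f Y" "weak_integral g Z"
  shows "weak_integral (\<lambda>x. f x + c * g x) (\<lambda>\<omega>. Y \<omega> + c * Z \<omega>)"
proof -
  obtain F d where F: "\<And>n. finitely_supported_simple m (F n)" "AE x in m. (\<lambda>n. F n x) \<longlonglongrightarrow> f x"
    "converges_in_prob M (\<lambda>n \<omega>. I (F n) \<omega> + d n) Y"
    using assms(1) by (auto simp: weak_integral_def)
  obtain G e where G: "\<And>n. finitely_supported_simple m (G n)" "AE x in m. (\<lambda>n. G n x) \<longlonglongrightarrow> g x"
    "converges_in_prob M (\<lambda>n \<omega>. I (G n) \<omega> + e n) Z"
    using assms(2) by (auto simp: weak_integral_def)
  note [measurable] = F(1) G(1)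
  have [measurable]: "f \<in> borel_measurable m" "g \<in> borel_measurable m" "Y \<in> borel_measurable M" "Z \<in> borel_measurable M"
    using assms by (auto simp: weak_integral_def)
  have H: "finitely_supported_simple m (\<lambda>x. F n x + c * G n x)" for n
    by (intro finitely_supported_simple_lincomb F G)
  note [measurable] = H
  have "converges_in_prob M (\<lambda>n \<omega>. I (\<lambda>x. F n x + c * G n x) \<omega> + (d n + c * e n)) (\<lambda>\<omega>. Y \<omega> + c * Z \<omega>)"
  proof (rule converges_in_prob_cong_AE)
    show "converges_in_prob M (\<lambda>n \<omega>. (I (F n) \<omega> + d n) + c * (I (G n) \<omega> + e n)) (\<lambda>\<omega>. Y \<omega> + c * Z \<omega>)"
      by (rule converges_in_prob_add_scaled[OF _ _ _ _ F(3) G(3)]) measurable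
    show "AE w in M. (I (F n) w + d n) + c * (I (G n) w + e n) = I (\<lambda>x. F n x + c * G n x) w + (d n + c * e n)" for n
      using I_lincomb[OF F(1) G(1), of n c n] by eventually_elim (simp add: algebra_simps)
  qed measurable
  moreover have "AE x in m. (\<lambda>n. F n x + c * G n x) \<longlonglongrightarrow> f x + c * g x"
    using F(2) G(2) by eventually_elim (intro tendsto_intros)
  ultimately show ?thesis
    unfolding weak_integral_def using H by (intro conjI exI[of _ "\<lambda>n x. F n x + c * G n x"] exI[of _ "\<lambda>n. d n + c * e n"]) auto
qed

text \<open>Energy is lower semicontinuous by Fatou's lemma, while moduli converge along the simple
  approximants. Without domination only this inequality survives the limit; the opposite direction
  requires the Cauchy argument of \<open>norm_char_ge_if_cos_energy_le\<close>.\<close>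

lemma cos_energy_le_if_norm_char_ge:
  assumes "weak_integral f Y" and B: "exp (- B) \<le> norm (char (distr M borel Y) u)"
  shows "cos_energy (\<lambda>z. u * f z) \<le> ennreal B"
proof -
  obtain F d where F: "\<And>n. finitely_supported_simple m (F n)" "AE x in m. (\<lambda>n. F n x) \<longlonglongrightarrow> f x"
    "converges_in_prob M (\<lambda>n \<omega>. I (F n) \<omega> + d n) Y"
    using assms(1) by (auto simp: weak_integral_def)
  note [measurable] = F(1) finitely_supported_simpleD(2)[OF F(1)]
  have [measurable]: "f \<in> borel_measurable m" "Y \<in> borel_measurable M"
    using assms by (auto simp: weak_integral_def)
  let ?c = "\<lambda>n. norm (char (distr M borel (\<lambda>w. I (F n) w + d n)) u)"
  have "?c \<longlonglongrightarrow> norm (char (distr M borel Y) u)"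
    by (intro tendsto_norm converges_in_prob_char F) measurable
  moreover have pos: "0 < norm (char (distr M borel Y) u)"
    using B by (rule less_le_trans[rotated]) simp
  ultimately have "(\<lambda>n. ennreal (- ln (?c n))) \<longlonglongrightarrow> ennreal (- ln (norm (char (distr M borel Y) u)))"
    by (intro tendsto_ennrealI tendsto_minus tendsto_ln) simp_all
  then have lim: "liminf (\<lambda>n. cos_energy (\<lambda>z. u * F n z)) = ennreal (- ln (norm (char (distr M borel Y) u)))"
  proof (intro lim_imp_Liminf)
    have "cos_energy (\<lambda>z. u * F n z) = ennreal (- ln (?c n))" for n
      by (rule norm_char_I(1)[OF F(1)])
    then show "(\<lambda>n. cos_energy (\<lambda>z. u * F n z)) \<longlonglongrightarrow> ennreal (- ln (norm (char (distr M borel Y) u)))"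
      using \<open>(\<lambda>n. ennreal (- ln (?c n))) \<longlonglongrightarrow> ennreal (- ln (norm (char (distr M borel Y) u)))\<close> by simp
  qed simp
  have "cos_energy (\<lambda>z. u * f z) \<le> liminf (\<lambda>n. cos_energy (\<lambda>z. u * F n z))"
  proof (rule cos_energy_Fatou)
    show "AE z in m. (\<lambda>n. u * F n z) \<longlonglongrightarrow> u * f z"
      using F(2) by eventually_elim (intro tendsto_intros)
  qed measurable
  also have "\<dots> \<le> ennreal B"
    unfolding lim using B pos by (intro ennreal_leI) (simp add: ln_ge_iff[symmetric] minus_le_iff)
  finally show ?thesis .
qed

text \<open>The differences \<open>F j - F k\<close> have small cosine energy, because their integrals are Cauchy in
  probability. Fatou's lemma in \<open>k\<close> passes this to \<open>F j - f\<close> without uniform integrability.\<close>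

lemma norm_char_ge_if_cos_energy_le:
  assumes "weak_integral f Y" and B: "cos_energy (\<lambda>z. u * f z) \<le> ennreal B" "0 \<le> B"
  shows "exp (- 2 * B) \<le> norm (char (distr M borel Y) u)"
proof -
  obtain F d where F: "\<And>n. finitely_supported_simple m (F n)" "AE x in m. (\<lambda>n. F n x) \<longlonglongrightarrow> f x"
    "converges_in_prob M (\<lambda>n \<omega>. I (F n) \<omega> + d n) Y"
    using assms(1) by (auto simp: weak_integral_def)
  note [measurable] = F(1) finitely_supported_simpleD(2)[OF F(1)]
  have [measurable]: "f \<in> borel_measurable m" "Y \<in> borel_measurable M"
    using assms by (auto simp: weak_integral_def)
  have key: "exp (- 2 * B - 2 * \<eta>) \<le> norm (char (distr M borel Y) u)" if \<eta>: "0 < \<eta>" for \<eta>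
  proof -
    \<comment> \<open>A characteristic function within \<delta> of 1 has modulus at least
      \<open>exp (- \<eta>)\<close>. Half of \<delta> is spent on the threshold \<open>e\<close>,
      the other half on the exceptional probability: \<delta> / 8 for each of the two indices,
      doubled by \<open>norm_char_diff_le\<close>.\<close>
    define \<delta> where "\<delta> = 1 - exp (- \<eta>)"
    have \<delta>: "0 < \<delta>"
      using \<eta> by (simp add: \<delta>_def)
    define e where "e = \<delta> / (2 * (\<bar>u\<bar> + 1))"
    have e: "0 < e" "\<bar>u\<bar> * e \<le> \<delta> / 2"
      using \<delta> by (auto simp: e_def field_simps)
    have "(\<lambda>n. prob {w \<in> space M. \<bar>I (F n) w + d n - Y w\<bar> > e / 2}) \<longlonglongrightarrow> 0"
      using F(3)[unfolded converges_in_prob_def, rule_format, of "e / 2"] e by simp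
    then have "\<forall>\<^sub>F n in sequentially. prob {w \<in> space M. \<bar>I (F n) w + d n - Y w\<bar> > e / 2} < \<delta> / 8"
      using \<delta> by (intro order_tendstoD) auto
    then obtain N where N: "\<And>n. N \<le> n \<Longrightarrow> prob {w \<in> space M. \<bar>I (F n) w + d n - Y w\<bar> > e / 2} < \<delta> / 8"
      by (auto simp: eventually_sequentially)
    have cauchy: "cos_energy (\<lambda>z. u * (F j z + (-1) * F k z)) \<le> ennreal \<eta>" if jk: "N \<le> j" "N \<le> k" for j k
    proof -
      define H where "H z = F j z + (-1) * F k z" for z
      have H: "finitely_supported_simple m H"
        unfolding H_def by (intro finitely_supported_simple_lincomb F)
      note [measurable] = H
      let ?U = "\<lambda>w. I H w + (d j - d k)"
      have U: "AE w in M. ?U w = (I (F j) w + d j) - (I (F k) w + d k)"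
        using I_lincomb[OF F(1) F(1), of j "-1" k] unfolding H_def[symmetric] H_def[abs_def, symmetric]
        by eventually_elim simp
      have "norm (char (distr M borel ?U) u - char (distr M borel (\<lambda>w. 0)) u) \<le>
          \<bar>u\<bar> * e + 2 * prob {w \<in> space M. \<bar>?U w - 0\<bar> > e}"
        using e by (intro norm_char_diff_le) auto
      also have "prob {w \<in> space M. \<bar>?U w - 0\<bar> > e} = prob {w \<in> space M. \<bar>(I (F j) w + d j) - (I (F k) w + d k)\<bar> > e}"
        by (rule finite_measure_eq_AE) (use U in \<open>eventually_elim, auto\<close>)
      also have "\<dots> \<le> prob ({w \<in> space M. \<bar>I (F j) w + d j - Y w\<bar> > e / 2} \<union> {w \<in> space M. \<bar>I (F k) w + d k - Y w\<bar> > e / 2})"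
      proof (rule finite_measure_mono)
        have "e / 2 < \<bar>x - y\<bar> \<or> e / 2 < \<bar>z - y\<bar>" if "e < \<bar>x - z\<bar>" for x y z :: real
        proof (rule ccontr)
          assume "\<not> ?thesis"
          then have "\<bar>x - y\<bar> \<le> e / 2" "\<bar>z - y\<bar> \<le> e / 2"
            by (simp_all only: de_Morgan_disj not_less)
          then show False
            using that by linarith
        qed
        then show "{w \<in> space M. \<bar>(I (F j) w + d j) - (I (F k) w + d k)\<bar> > e} \<subseteq>
          {w \<in> space M. \<bar>I (F j) w + d j - Y w\<bar> > e / 2} \<union> {w \<in> space M. \<bar>I (F k) w + d k - Y w\<bar> > e / 2}"
          by blast
      qed measurable
      also have "\<dots> \<le> prob {w \<in> space M. \<bar>I (F j) w + d j - Y w\<bar> > e / 2} + prob {w \<in> space M. \<bar>I (F k) w + d k - Y w\<bar> > e / 2}"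
        by (rule measure_Un_le) measurable
      also have "\<dots> \<le> \<delta> / 8 + \<delta> / 8"
        using N[OF jk(1)] N[OF jk(2)] by linarith
      finally have "norm (char (distr M borel ?U) u - char (distr M borel (\<lambda>w. 0)) u) \<le> \<bar>u\<bar> * e + \<delta> / 2"
        by simp
      then have "norm (char (distr M borel ?U) u - 1) \<le> \<delta>"
      proof -
        have "char (distr M borel (\<lambda>w. 0)) u = 1"
          by (simp add: char_def integral_distr prob_space del: distr_const)
        then show ?thesis
          using \<open>norm (char (distr M borel ?U) u - char (distr M borel (\<lambda>w. 0)) u) \<le> \<bar>u\<bar> * e + \<delta> / 2\<close> e
          by simp
      qed
      then have "1 - \<delta> \<le> norm (char (distr M borel ?U) u)"
        using norm_triangle_ineq3[of "1" "char (distr M borel ?U) u"] by (simp add: norm_minus_commute)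
      then have "exp (- \<eta>) \<le> norm (char (distr M borel ?U) u)"
        by (simp add: \<delta>_def)
      then have "- ln (norm (char (distr M borel ?U) u)) \<le> \<eta>"
        using norm_char_I(2)[OF H, where c = "d j - d k"] by (simp add: ln_ge_iff[symmetric] minus_le_iff)
      then show ?thesis
        using norm_char_I(1)[OF H, of u, where c = "d j - d k"] by (simp add: H_def ennreal_leI)
    qed
    have cauchy': "cos_energy (\<lambda>z. u * (F j z + (-1) * f z)) \<le> ennreal \<eta>" if j: "N \<le> j" for j
    proof -
      have "cos_energy (\<lambda>z. u * (F j z + (-1) * f z)) \<le> liminf (\<lambda>k. cos_energy (\<lambda>z. u * (F j z + (-1) * F k z)))"
      proof (rule cos_energy_Fatou)
        show "AE z in m. (\<lambda>k. u * (F j z + (-1) * F k z)) \<longlonglongrightarrow> u * (F j z + (-1) * f z)"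
          using F(2) by eventually_elim (intro tendsto_intros)
      qed measurable
      also have "\<dots> \<le> liminf (\<lambda>k. ennreal \<eta>)"
        using cauchy[OF j] by (intro Liminf_mono) (auto simp: eventually_sequentially intro!: exI[of _ N])
      finally show ?thesis
        by (simp add: Liminf_const)
    qed
    have "exp (- 2 * B - 2 * \<eta>) \<le> norm (char (distr M borel (\<lambda>w. I (F j) w + d j)) u)" if j: "N \<le> j" for j
    proof -
      \<comment> \<open>\<open>F j\<close> is written as \<open>(F j - f) + f\<close>. The factor 2
        of \<open>cos_energy_add\<close> is what turns \<open>B\<close> into \<open>2 * B\<close> in
        the conclusion.\<close>
      have "cos_energy (\<lambda>z. u * F j z) = cos_energy (\<lambda>z. u * (F j z + (-1) * f z) + u * f z)"
        by (simp add: algebra_simps)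
      also have "\<dots> \<le> 2 * cos_energy (\<lambda>z. u * (F j z + (-1) * f z)) + 2 * cos_energy (\<lambda>z. u * f z)"
        by (rule cos_energy_add) measurable
      also have "\<dots> \<le> 2 * ennreal \<eta> + 2 * ennreal B"
        by (intro add_mono mult_left_mono cauchy' j B) auto
      also have "\<dots> = ennreal (2 * \<eta> + 2 * B)"
        using \<eta> B by (simp add: ennreal_mult')
      finally have "ennreal (- ln (norm (char (distr M borel (\<lambda>w. I (F j) w + d j)) u))) \<le> ennreal (2 * \<eta> + 2 * B)"
        by (simp add: norm_char_I(1)[OF F(1), where c = "d j"])
      then have "- ln (norm (char (distr M borel (\<lambda>w. I (F j) w + d j)) u)) \<le> 2 * \<eta> + 2 * B"
        using \<eta> B by (simp add: ennreal_le_iff del: ennreal_plus)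
      then have "- 2 * B - 2 * \<eta> \<le> ln (norm (char (distr M borel (\<lambda>w. I (F j) w + d j)) u))"
        by simp
      then show ?thesis
        using norm_char_I(2)[OF F(1), where c = "d j"] by (simp add: ln_ge_iff)
    qed
    moreover have "(\<lambda>n. norm (char (distr M borel (\<lambda>w. I (F n) w + d n)) u)) \<longlonglongrightarrow> norm (char (distr M borel Y) u)"
      by (intro tendsto_norm converges_in_prob_char F) measurable
    ultimately show ?thesis
      by (intro LIMSEQ_le_const) auto
  qed
  have "((\<lambda>\<eta>. exp (- 2 * B - 2 * \<eta>)) \<longlongrightarrow> exp (- 2 * B - 2 * 0)) (at_right 0)"
    by (intro tendsto_intros)
  moreover have "\<forall>\<^sub>F \<eta> in at_right 0. exp (- 2 * B - 2 * \<eta>) \<le> norm (char (distr M borel Y) u)"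
    using eventually_at_right_less[of "0::real"] by eventually_elim (rule key)
  ultimately show ?thesis
    by (intro tendsto_upperbound[of _ "exp (- 2 * B)"]) auto
qed

text \<open>With \<open>V\<close> the second moment of \<open>Y\<close>, the modulus at a small
  frequency \<open>u\<close> is at least \<open>1 - u\<^sup>2 * V / 2\<close>, hence at least
  \<open>exp (- u\<^sup>2 * V)\<close>, so the energy is at most \<open>u\<^sup>2 * V\<close>.
  Dividing by \<open>u\<^sup>2 / 2\<close> and letting \<open>u\<close> tend to 0 turns 1 - cos into
  the square, again by Fatou's lemma. This transfers finite variance of the process to the Levy
  measure.\<close>

lemma nn_integral_square_le_if_weak_integral:
  assumes W: "weak_integral f Y" and int: "integrable M (\<lambda>w. (Y w)\<^sup>2)"
  shows "(\<integral>\<^sup>+z. \<integral>\<^sup>+x. ennreal ((f z * x)\<^sup>2) \<partial>\<mu> \<partial>m) \<le> ennreal (2 * expectation (\<lambda>w. (Y w)\<^sup>2))"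
proof -
  define V where "V = expectation (\<lambda>w. (Y w)\<^sup>2)"
  have [measurable]: "f \<in> borel_measurable m" "Y \<in> borel_measurable M"
    using W by (auto simp: weak_integral_def)
  have V: "0 \<le> V"
    by (simp add: V_def)
  have Re: "1 - u\<^sup>2 * V / 2 \<le> norm (char (distr M borel Y) u)" for u
  proof -
    have i: "integrable M (\<lambda>w. iexp (u * Y w))"
      by (intro integrable_iexp) auto
    have "1 - u\<^sup>2 * V / 2 = expectation (\<lambda>w. 1 - u\<^sup>2 / 2 * (Y w)\<^sup>2)"
      using int by (subst Bochner_Integration.integral_diff) (auto simp: V_def prob_space)
    also have "\<dots> \<le> expectation (\<lambda>w. Re (iexp (u * Y w)))"
    proof (rule integral_mono)
      show "1 - u\<^sup>2 / 2 * (Y w)\<^sup>2 \<le> Re (iexp (u * Y w))" for w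
        using one_minus_cos_le_square[of "u * Y w"] by (simp add: Re_exp power_mult_distrib)
    qed (use int i in \<open>auto intro!: integrable_Re simp del: of_real_mult\<close>)
    also have "\<dots> = Re (char (distr M borel Y) u)"
      unfolding char_def by (simp add: integral_distr integral_Re[OF i] del: of_real_mult)
    finally show ?thesis
      using complex_Re_le_cmod[of "char (distr M borel Y) u"] by linarith
  qed
  have small: "\<forall>\<^sub>F u in at_right 0. u\<^sup>2 * V / 2 < 1 / 2"
  proof -
    have "((\<lambda>u. u\<^sup>2 * V / 2) \<longlongrightarrow> 0\<^sup>2 * V / 2) (at_right 0)"
      by (intro tendsto_intros) simp
    then show ?thesis
      by (intro order_tendstoD) auto
  qed
  have energy: "\<forall>\<^sub>F u in at_right 0. cos_energy (\<lambda>z. u * f z) \<le> ennreal (u\<^sup>2 * V)"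
    using small
  proof eventually_elim
    case (elim u)
    have "exp (- (u\<^sup>2 * V)) \<le> 1 - u\<^sup>2 * V / 2"
    proof -
      define y where "y = u\<^sup>2 * V"
      have y: "0 \<le> y" "y \<le> 1"
        using elim V by (auto simp: y_def)
      have "exp (- y) \<le> 1 / (1 + y)"
        using exp_ge_add_one_self[of y] y by (simp add: exp_minus field_simps)
      also have "\<dots> \<le> 1 - y / 2"
        using y mult_left_mono[of y 1 y] by (simp add: field_simps)
      finally show ?thesis
        by (simp add: y_def)
    qed
    also have "\<dots> \<le> norm (char (distr M borel Y) u)"
      by (rule Re)
    finally show ?case
      by (rule cos_energy_le_if_norm_char_ge[OF W])
  qed
  define h :: "nat \<Rightarrow> real" where "h n = 1 / Suc n" for n
  have h: "filterlim h (at_right 0) sequentially"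
    unfolding h_def using LIMSEQ_Suc[OF lim_1_over_n] by (auto simp: filterlim_at)
  have hpos: "0 < h n" for n
    by (simp add: h_def)
  have lim: "(\<lambda>n. ennreal (2 / (h n)\<^sup>2 * (1 - cos (h n * f z * x)))) \<longlonglongrightarrow> ennreal ((f z * x)\<^sup>2)" for z x
  proof (rule tendsto_ennrealI)
    have "(\<lambda>n. (2 - 2 * cos (h n * (f z * x))) / (h n)\<^sup>2) \<longlonglongrightarrow> (f z * x)\<^sup>2"
      by (rule filterlim_compose[OF tendsto_two_minus_two_cos h])
    then show "(\<lambda>n. 2 / (h n)\<^sup>2 * (1 - cos (h n * f z * x))) \<longlonglongrightarrow> (f z * x)\<^sup>2"
      by (simp add: diff_divide_distrib right_diff_distrib mult.assoc)
  qed
  have "(\<integral>\<^sup>+z. \<integral>\<^sup>+x. ennreal ((f z * x)\<^sup>2) \<partial>\<mu> \<partial>m) =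
      (\<integral>\<^sup>+z. \<integral>\<^sup>+x. liminf (\<lambda>n. ennreal (2 / (h n)\<^sup>2 * (1 - cos (h n * f z * x)))) \<partial>\<mu> \<partial>m)"
    by (intro nn_integral_cong lim_imp_Liminf[symmetric] lim) auto
  also have "\<dots> \<le> (\<integral>\<^sup>+z. liminf (\<lambda>n. \<integral>\<^sup>+x. ennreal (2 / (h n)\<^sup>2 * (1 - cos (h n * f z * x))) \<partial>\<mu>) \<partial>m)"
    by (intro nn_integral_mono nn_integral_liminf) measurable
  also have "\<dots> \<le> liminf (\<lambda>n. \<integral>\<^sup>+z. \<integral>\<^sup>+x. ennreal (2 / (h n)\<^sup>2 * (1 - cos (h n * f z * x))) \<partial>\<mu> \<partial>m)"
    by (rule nn_integral_liminf) measurable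
  also have "\<dots> = liminf (\<lambda>n. ennreal (2 / (h n)\<^sup>2) * cos_energy (\<lambda>z. h n * f z))"
    unfolding cos_energy_def by (subst ennreal_mult') (auto simp: nn_integral_cmult)
  also have "\<dots> \<le> liminf (\<lambda>n. ennreal (2 * V))"
  proof (rule Liminf_mono)
    show "\<forall>\<^sub>F n in sequentially. ennreal (2 / (h n)\<^sup>2) * cos_energy (\<lambda>z. h n * f z) \<le> ennreal (2 * V)"
      using eventually_compose_filterlim[OF energy h]
    proof eventually_elim
      case (elim n)
      then have "ennreal (2 / (h n)\<^sup>2) * cos_energy (\<lambda>z. h n * f z) \<le> ennreal (2 / (h n)\<^sup>2) * ennreal ((h n)\<^sup>2 * V)"
        by (intro mult_left_mono) auto
      also have "\<dots> = ennreal (2 * V)"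
        using hpos[of n] V by (subst ennreal_mult[symmetric]) auto
      finally show ?case .
    qed
  qed
  finally show ?thesis
    by (simp add: Liminf_const V_def)
qed

text \<open>A counterpart of the isometry of the integral, for which the constant would be 1. The
  loss of the factor 2 in \<open>norm_char_ge_if_cos_energy_le\<close> is harmless, since the bound
  serves to show that errors vanish in the limit.\<close>

lemma expectation_square_le_if_weak_integral:
  assumes W: "weak_integral f Y" and int: "integrable M (\<lambda>w. (Y w)\<^sup>2)" and mean: "expectation Y = 0"
    and D: "(\<integral>\<^sup>+z. \<integral>\<^sup>+x. ennreal ((f z * x)\<^sup>2) \<partial>\<mu> \<partial>m) \<le> ennreal D" "0 \<le> D"
  shows "expectation (\<lambda>w. (Y w)\<^sup>2) \<le> 2 * D"
proof (rule expectation_square_le_if_norm_char_ge[OF _ int mean])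
  have [measurable]: "f \<in> borel_measurable m"
    using W by (auto simp: weak_integral_def)
  show "Y \<in> borel_measurable M"
    using W by (auto simp: weak_integral_def)
  fix u
  have "cos_energy (\<lambda>z. u * f z) \<le> ennreal (u\<^sup>2 / 2) * ennreal D"
    by (rule order_trans[OF cos_energy_le_square mult_left_mono[OF D(1)]]) auto
  also have "\<dots> = ennreal (u\<^sup>2 / 2 * D)"
    using D by (subst ennreal_mult[symmetric]) auto
  finally show "exp (- D * u\<^sup>2) \<le> norm (char (distr M borel Y) u)"
    using norm_char_ge_if_cos_energy_le[OF W, of u "u\<^sup>2 / 2 * D"] D by (simp add: mult.commute)
qed

end

section \<open>Limits of compensated Poisson laws\<close>

lemma integrable_mult_if_square_integrable:
  fixes f g :: "'a \<Rightarrow> real"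
  assumes [measurable]: "f \<in> borel_measurable N" "g \<in> borel_measurable N"
    and f: "integrable N (\<lambda>x. (f x)\<^sup>2)" and g: "integrable N (\<lambda>x. (g x)\<^sup>2)"
  shows "integrable N (\<lambda>x. f x * g x)"
proof (rule Bochner_Integration.integrable_bound)
  show "integrable N (\<lambda>x. (f x)\<^sup>2 + (g x)\<^sup>2)"
    using f g by simp
  show "AE x in N. norm (f x * g x) \<le> norm ((f x)\<^sup>2 + (g x)\<^sup>2)"
  proof (rule AE_I2)
    fix x
    have "2 * (\<bar>f x\<bar> * \<bar>g x\<bar>) \<le> (f x)\<^sup>2 + (g x)\<^sup>2"
      using sum_squares_bound[of "\<bar>f x\<bar>" "\<bar>g x\<bar>"] by simp
    then have "\<bar>f x\<bar> * \<bar>g x\<bar> \<le> (f x)\<^sup>2 + (g x)\<^sup>2"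
      using mult_nonneg_nonneg[of "\<bar>f x\<bar>" "\<bar>g x\<bar>"] by linarith
    then show "norm (f x * g x) \<le> norm ((f x)\<^sup>2 + (g x)\<^sup>2)"
      by (simp add: abs_mult)
  qed
qed measurable

lemma integrable_diff_square:
  fixes f g :: "'a \<Rightarrow> real"
  assumes "f \<in> borel_measurable N" "g \<in> borel_measurable N"
    and "integrable N (\<lambda>x. (f x)\<^sup>2)" "integrable N (\<lambda>x. (g x)\<^sup>2)"
  shows "integrable N (\<lambda>x. (f x - g x)\<^sup>2)"
proof -
  have "integrable N (\<lambda>x. (f x)\<^sup>2 + (g x)\<^sup>2 - 2 * (f x * g x))"
    using assms integrable_mult_if_square_integrable[OF assms] by simp
  then show ?thesis
    by (simp add: power2_diff mult.assoc)
qed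

lemma Cauchy_Schwarz_integral:
  fixes f g :: "'a \<Rightarrow> real"
  assumes [measurable]: "f \<in> borel_measurable N" "g \<in> borel_measurable N"
    and f: "integrable N (\<lambda>x. (f x)\<^sup>2)" and g: "integrable N (\<lambda>x. (g x)\<^sup>2)"
  shows "(LINT x|N. \<bar>f x * g x\<bar>) \<le> sqrt (LINT x|N. (f x)\<^sup>2) * sqrt (LINT x|N. (g x)\<^sup>2)"
proof -
  have i: "integrable N (\<lambda>x. \<bar>f x * g x\<bar>)"
    by (intro integrable_abs integrable_mult_if_square_integrable f g) measurable
  have "(ennreal (LINT x|N. \<bar>f x * g x\<bar>))\<^sup>2 = (\<integral>\<^sup>+x. ennreal \<bar>f x\<bar> * ennreal \<bar>g x\<bar> \<partial>N)\<^sup>2"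
    using i by (subst nn_integral_eq_integral[symmetric]) (auto simp: abs_mult ennreal_mult)
  also have "\<dots> \<le> (\<integral>\<^sup>+x. (ennreal \<bar>f x\<bar>)\<^sup>2 \<partial>N) * (\<integral>\<^sup>+x. (ennreal \<bar>g x\<bar>)\<^sup>2 \<partial>N)"
    by (rule Cauchy_Schwarz_nn_integral) measurable
  also have "\<dots> = ennreal ((LINT x|N. (f x)\<^sup>2) * (LINT x|N. (g x)\<^sup>2))"
    using f g by (simp add: ennreal_power nn_integral_eq_integral ennreal_mult)
  finally have "(LINT x|N. \<bar>f x * g x\<bar>)\<^sup>2 \<le> (LINT x|N. (f x)\<^sup>2) * (LINT x|N. (g x)\<^sup>2)"
    by (simp add: ennreal_power ennreal_le_iff)
  then show ?thesis
    using real_le_rsqrt by (simp add: real_sqrt_mult[symmetric])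
qed

lemma (in prob_space) expectation_abs_le_sqrt:
  assumes [measurable]: "W \<in> borel_measurable M" and int: "integrable M (\<lambda>w. (W w)\<^sup>2)"
  shows "expectation (\<lambda>w. \<bar>W w\<bar>) \<le> sqrt (expectation (\<lambda>w. (W w)\<^sup>2))"
  using Cauchy_Schwarz_integral[of W M "\<lambda>_. 1"] int by (simp add: prob_space)

context pair_sigma_finite
begin

lemma integrable_product:
  fixes f g :: "_ \<Rightarrow> real"
  assumes f: "integrable M1 f" and g: "integrable M2 g"
  shows "integrable (M1 \<Otimes>\<^sub>M M2) (\<lambda>z. f (fst z) * g (snd z))"
    and "(LINT z|(M1 \<Otimes>\<^sub>M M2). f (fst z) * g (snd z)) = (LINT x|M1. f x) * (LINT y|M2. g y)"
proof -
  have [measurable]: "f \<in> borel_measurable M1" "g \<in> borel_measurable M2"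
    using f g by auto
  show i: "integrable (M1 \<Otimes>\<^sub>M M2) (\<lambda>z. f (fst z) * g (snd z))"
  proof (rule Fubini_integrable)
    show "integrable M1 (\<lambda>x. LINT y|M2. norm (f (fst (x, y)) * g (snd (x, y))))"
      using f g by (simp add: abs_mult)
    show "AE x in M1. integrable M2 (\<lambda>y. f (fst (x, y)) * g (snd (x, y)))"
      using g by simp
  qed measurable
  have "(LINT z|(M1 \<Otimes>\<^sub>M M2). f (fst z) * g (snd z)) = (LINT x|M1. LINT y|M2. f (fst (x, y)) * g (snd (x, y)))"
    by (rule integral_fst'[symmetric, OF i])
  then show "(LINT z|(M1 \<Otimes>\<^sub>M M2). f (fst z) * g (snd z)) = (LINT x|M1. f x) * (LINT y|M2. g y)"
    by simp
qed

end

context compensated_poisson_law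
begin

lemma norm_exponent_le: "norm (CLINT z|Q. comp_exp (u * G z)) \<le> (LINT z|Q. (G z)\<^sup>2) / 2 * u\<^sup>2"
proof -
  have "norm (CLINT z|Q. comp_exp (u * G z)) \<le> (LINT z|Q. norm (comp_exp (u * G z)))"
    by (rule integral_norm_bound)
  also have "\<dots> \<le> (LINT z|Q. u\<^sup>2 / 2 * (G z)\<^sup>2)"
  proof (rule integral_mono)
    show "norm (comp_exp (u * G z)) \<le> u\<^sup>2 / 2 * (G z)\<^sup>2" for z
      using norm_comp_exp_le_square[of "u * G z"] by (simp add: power_mult_distrib)
  qed (use integrable_exponent G2 in auto)
  finally show ?thesis
    by (simp add: mult.commute)
qed

lemma square_integrable_Y: "integrable M (\<lambda>w. (Y w)\<^sup>2)"
  and expectation_Y: "expectation Y = 0"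
proof -
  have "norm (char (distr M borel Y) u - 1) \<le> (LINT z|Q. (G z)\<^sup>2) / 2 * u\<^sup>2" for u
    unfolding char_Y by (rule order_trans[OF norm_exp_minus_one_le[OF Re_exponent_nonpos] norm_exponent_le])
  from square_integrable_if_char_quadratic[OF Y this]
  show "integrable M (\<lambda>w. (Y w)\<^sup>2)" "expectation Y = 0"
    by auto
qed

lemma continuous_exponent: "continuous_on UNIV (\<lambda>u. CLINT z|Q. comp_exp (u * G z))"
proof -
  have "isCont (\<lambda>u. CLINT z|Q. comp_exp (u * G z)) x" for x
    unfolding continuous_at_sequentially o_def
  proof (intro allI impI)
    fix v :: "nat \<Rightarrow> real" assume v: "v \<longlonglongrightarrow> x"
    then obtain B where B: "\<And>n. \<bar>v n\<bar> \<le> B"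
      using convergent_imp_Bseq[OF convergentI[OF v]] by (auto simp: Bseq_def)
    show "(\<lambda>n. CLINT z|Q. comp_exp (v n * G z)) \<longlonglongrightarrow> (CLINT z|Q. comp_exp (x * G z))"
    proof (rule integral_dominated_convergence[where w = "\<lambda>z. B\<^sup>2 / 2 * (G z)\<^sup>2"])
      show "AE z in Q. (\<lambda>n. comp_exp (v n * G z)) \<longlonglongrightarrow> comp_exp (x * G z)"
      proof (rule AE_I2)
        fix z
        have "isCont comp_exp (x * G z)"
          using continuous_comp_exp[OF continuous_on_id, of UNIV] by (simp add: continuous_on_eq_continuous_at)
        then show "(\<lambda>n. comp_exp (v n * G z)) \<longlonglongrightarrow> comp_exp (x * G z)"
          using v by (intro isCont_tendsto_compose[of _ comp_exp] tendsto_intros)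
      qed
      show "AE z in Q. norm (comp_exp (v n * G z)) \<le> B\<^sup>2 / 2 * (G z)\<^sup>2" for n
      proof (rule AE_I2)
        fix z
        have "norm (comp_exp (v n * G z)) \<le> (v n)\<^sup>2 / 2 * (G z)\<^sup>2"
          using norm_comp_exp_le_square[of "v n * G z"] by (simp add: power_mult_distrib)
        also have "(v n)\<^sup>2 \<le> B\<^sup>2"
          using power_mono[OF B[of n], of 2] by simp
        then have "(v n)\<^sup>2 / 2 * (G z)\<^sup>2 \<le> B\<^sup>2 / 2 * (G z)\<^sup>2"
          by (intro mult_right_mono) auto
        finally show "norm (comp_exp (v n * G z)) \<le> B\<^sup>2 / 2 * (G z)\<^sup>2" .
      qed
    qed (use G2 in auto)
  qed
  then show ?thesis
    by (simp add: continuous_on_eq_continuous_at)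
qed

text \<open>Two continuous logarithms of the same function differ by an integer multiple of
  \<open>2 * pi * \<i>\<close>; on a connected set this multiple is constant, and at 0 it is
  zero.\<close>

lemma cumulant_function_Y: "cumulant_function (distr M borel Y) = (\<lambda>u. CLINT z|Q. comp_exp (u * G z))"
  unfolding cumulant_function_def
proof (rule the_equality)
  let ?K = "\<lambda>u. CLINT z|Q. comp_exp (u * G z)"
  show "continuous_on UNIV ?K \<and> ?K 0 = 0 \<and> (\<forall>u. exp (?K u) = char (distr M borel Y) u)"
    using continuous_exponent char_Y by simp
  fix \<psi> :: "real \<Rightarrow> complex"
  assume \<psi>: "continuous_on UNIV \<psi> \<and> \<psi> 0 = 0 \<and> (\<forall>u. exp (\<psi> u) = char (distr M borel Y) u)"
  define D where "D u = (\<psi> u - ?K u) / (2 * pi * \<i>)" for u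
  have exps: "exp (\<psi> u) = exp (?K u)" for u
    using \<psi> char_Y by simp
  have int: "\<exists>n::int. D u = of_int n" for u
  proof -
    obtain n :: int where "\<psi> u = ?K u + (of_int (2 * n) * of_real pi) * \<i>"
      using exps[of u] unfolding exp_eq by auto
    then have "D u = of_int n"
      by (simp add: D_def)
    then show ?thesis ..
  qed
  have cont: "continuous_on UNIV D"
    unfolding D_def using \<psi> continuous_exponent by (intro continuous_intros) auto
  have "D constant_on UNIV"
  proof (rule continuous_discrete_range_constant[OF connected_UNIV cont])
    fix x :: real
    show "\<exists>e>0. \<forall>y. y \<in> UNIV \<and> D y \<noteq> D x \<longrightarrow> e \<le> norm (D y - D x)"
    proof (intro exI[of _ 1] conjI allI impI)
      fix y assume y: "y \<in> UNIV \<and> D y \<noteq> D x"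
      obtain i j :: int where ij: "D y = of_int i" "D x = of_int j"
        using int by metis
      then have "norm (D y - D x) = \<bar>real_of_int (i - j)\<bar>"
        by (metis norm_of_int of_int_diff)
      moreover have "i \<noteq> j"
        using y ij by auto
      ultimately show "1 \<le> norm (D y - D x)"
        by linarith
    qed simp
  qed
  then have "D u = D 0" for u
    by (auto simp: constant_on_def)
  moreover have "D 0 = 0"
    using \<psi> by (simp add: D_def)
  ultimately have "D u = 0" for u
    by simp
  then show "\<psi> = ?K"
    by (auto simp: D_def)
qed

end

text \<open>The common limit step of both identifications of a law, first from simple integrands to
  weak integrals and then from Riemann sums to time integrals. Convergence of the integrands in
  square mean gives convergence of the exponents by \<open>norm_comp_exp_diff_le\<close> and
  Cauchy-Schwarz; convergence of the variables in mean gives it for the characteristic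
  functions.\<close>

lemma (in prob_space) compensated_poisson_law_limit:
  fixes G :: "'b \<Rightarrow> real"
  assumes law: "\<And>n. compensated_poisson_law M Q (F n) (Y n)"
    and [measurable]: "G \<in> borel_measurable Q" "Z \<in> borel_measurable M"
    and G2: "integrable Q (\<lambda>z. (G z)\<^sup>2)"
    and L2: "(\<lambda>n. LINT z|Q. (F n z - G z)\<^sup>2) \<longlonglongrightarrow> 0"
    and int: "\<And>n. integrable M (\<lambda>w. Y n w - Z w)"
    and L1: "(\<lambda>n. expectation (\<lambda>w. \<bar>Y n w - Z w\<bar>)) \<longlonglongrightarrow> 0"
  shows "compensated_poisson_law M Q G Z"
proof
  show "Z \<in> borel_measurable M" "G \<in> borel_measurable Q" "integrable Q (\<lambda>z. (G z)\<^sup>2)"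
    by (fact assms)+
  fix u
  have [measurable]: "F n \<in> borel_measurable Q" "Y n \<in> borel_measurable M" for n
    using compensated_poisson_law.G[OF law] compensated_poisson_law.Y[OF law] by auto
  have F2: "integrable Q (\<lambda>z. (F n z)\<^sup>2)" for n
    by (rule compensated_poisson_law.G2[OF law])
  have "(\<lambda>n. char (distr M borel (Y n)) u) \<longlonglongrightarrow> char (distr M borel Z) u"
  proof (rule Lim_transform2[where f = "\<lambda>_. char (distr M borel Z) u"])
    show "(\<lambda>n. char (distr M borel Z) u - char (distr M borel (Y n)) u) \<longlonglongrightarrow> 0"
    proof (rule Lim_null_comparison)
      show "\<forall>\<^sub>F n in sequentially. norm (char (distr M borel Z) u - char (distr M borel (Y n)) u) \<le>
          \<bar>u\<bar> * expectation (\<lambda>w. \<bar>Y n w - Z w\<bar>)"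
        using norm_char_diff_le_expectation[of "Y _" Z u] int by (simp add: norm_minus_commute)
      show "(\<lambda>n. \<bar>u\<bar> * expectation (\<lambda>w. \<bar>Y n w - Z w\<bar>)) \<longlonglongrightarrow> 0"
        by (rule tendsto_mult_right_zero[OF L1])
    qed
  qed simp
  moreover have "(\<lambda>n. char (distr M borel (Y n)) u) \<longlonglongrightarrow> exp (CLINT z|Q. comp_exp (u * G z))"
  proof -
    define s where "s n = sqrt (LINT z|Q. (F n z - G z)\<^sup>2)" for n
    define g where "g = sqrt (LINT z|Q. (G z)\<^sup>2)"
    have s: "s \<longlonglongrightarrow> 0"
      unfolding s_def using tendsto_real_sqrt[OF L2] by simp
    have iFG: "integrable Q (\<lambda>z. (F n z - G z)\<^sup>2)" for n
      by (intro integrable_diff_square F2 G2) measurable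
    have iF: "integrable Q (\<lambda>z. comp_exp (u * F n z))" for n
      using compensated_poisson_law.integrable_exponent[OF law] .
    have iG: "integrable Q (\<lambda>z. comp_exp (u * G z))"
      by (rule integrable_comp_exp[OF _ G2]) measurable
    have diff: "norm ((CLINT z|Q. comp_exp (u * F n z)) - (CLINT z|Q. comp_exp (u * G z))) \<le>
        2 * u\<^sup>2 * ((s n)\<^sup>2 + 2 * (s n * g))" for n
    proof -
      have i1: "integrable Q (\<lambda>z. \<bar>(F n z - G z) * G z\<bar>)"
        by (intro integrable_abs integrable_mult_if_square_integrable iFG G2) measurable
      have "norm ((CLINT z|Q. comp_exp (u * F n z)) - (CLINT z|Q. comp_exp (u * G z))) =
          norm (CLINT z|Q. comp_exp (u * F n z) - comp_exp (u * G z))"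
        by (subst Bochner_Integration.integral_diff[OF iF iG]) simp
      also have "\<dots> \<le> (LINT z|Q. norm (comp_exp (u * F n z) - comp_exp (u * G z)))"
        by (rule integral_norm_bound)
      also have "\<dots> \<le> (LINT z|Q. 2 * u\<^sup>2 * ((F n z - G z)\<^sup>2 + 2 * \<bar>(F n z - G z) * G z\<bar>))"
      proof (rule integral_mono)
        fix z
        have "norm (comp_exp (u * F n z) - comp_exp (u * G z)) \<le>
            2 * \<bar>u * F n z - u * G z\<bar> * (\<bar>u * F n z\<bar> + \<bar>u * G z\<bar>)"
          by (rule norm_comp_exp_diff_le)
        also have "\<dots> = 2 * u\<^sup>2 * (\<bar>F n z - G z\<bar> * (\<bar>F n z\<bar> + \<bar>G z\<bar>))"
        proof -
          have eq: "2 * (c * d) * (c * x + c * y) = 2 * (c * c) * (d * (x + y))" for c d x y :: real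
            by (simp add: algebra_simps)
          have "\<bar>u * F n z - u * G z\<bar> = \<bar>u\<bar> * \<bar>F n z - G z\<bar>"
            by (simp add: abs_mult[symmetric] right_diff_distrib)
          then show ?thesis
            using eq[of "\<bar>u\<bar>" "\<bar>F n z - G z\<bar>" "\<bar>F n z\<bar>" "\<bar>G z\<bar>"]
            by (simp only: abs_mult abs_mult_self_eq power2_eq_square)
        qed
        also have "\<dots> \<le> 2 * u\<^sup>2 * (\<bar>F n z - G z\<bar> * (\<bar>F n z - G z\<bar> + 2 * \<bar>G z\<bar>))"
          by (intro mult_left_mono) auto
        also have "\<bar>F n z - G z\<bar> * (\<bar>F n z - G z\<bar> + 2 * \<bar>G z\<bar>) = (F n z - G z)\<^sup>2 + 2 * \<bar>(F n z - G z) * G z\<bar>"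
          by (simp add: distrib_left abs_mult power2_eq_square)
        finally show "norm (comp_exp (u * F n z) - comp_exp (u * G z)) \<le>
            2 * u\<^sup>2 * ((F n z - G z)\<^sup>2 + 2 * \<bar>(F n z - G z) * G z\<bar>)" .
      qed (use iFG i1 iF iG in auto)
      also have "\<dots> = 2 * u\<^sup>2 * ((LINT z|Q. (F n z - G z)\<^sup>2) + 2 * (LINT z|Q. \<bar>(F n z - G z) * G z\<bar>))"
        using iFG i1 by simp
      also have "\<dots> \<le> 2 * u\<^sup>2 * ((s n)\<^sup>2 + 2 * (s n * g))"
      proof (intro mult_left_mono add_mono)
        show "(LINT z|Q. (F n z - G z)\<^sup>2) \<le> (s n)\<^sup>2"
          by (simp add: s_def integral_nonneg_AE)
        show "(LINT z|Q. \<bar>(F n z - G z) * G z\<bar>) \<le> s n * g"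
          unfolding s_def g_def by (intro Cauchy_Schwarz_integral iFG G2) measurable
      qed auto
      finally show ?thesis .
    qed
    have "(\<lambda>n. (CLINT z|Q. comp_exp (u * F n z)) - (CLINT z|Q. comp_exp (u * G z))) \<longlonglongrightarrow> 0"
    proof (rule Lim_null_comparison)
      have "(\<lambda>n. 2 * u\<^sup>2 * ((s n)\<^sup>2 + 2 * (s n * g))) \<longlonglongrightarrow> 2 * u\<^sup>2 * (0\<^sup>2 + 2 * (0 * g))"
        by (intro tendsto_intros s)
      then show "(\<lambda>n. 2 * u\<^sup>2 * ((s n)\<^sup>2 + 2 * (s n * g))) \<longlonglongrightarrow> 0"
        by simp
    qed (use diff in auto)
    then have "(\<lambda>n. CLINT z|Q. comp_exp (u * F n z)) \<longlonglongrightarrow> (CLINT z|Q. comp_exp (u * G z))"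
      by (rule LIM_zero_cancel)
    then show ?thesis
      unfolding compensated_poisson_law.char_Y[OF law] by (rule tendsto_exp)
  qed
  ultimately show "char (distr M borel Z) u = exp (CLINT z|Q. comp_exp (u * G z))"
    by (rule LIMSEQ_unique)
qed

section \<open>Cumulant formula for integrals with respect to a square-integrable Levy basis\<close>

locale square_integrable_levy_basis = levy_basis_law +
  assumes S2: "integrable \<mu> (\<lambda>x. x\<^sup>2)"
begin

text \<open>The mean of \<open>\<Lambda>\<close> per unit of control measure: \<open>a\<close> plus
  the mean of the jumps that the Levy-Khintchine formula leaves uncompensated. It is removed by
  centring the simple integrals.\<close>

definition drift :: real where
  "drift = a + (LINT x|\<mu>. x * (1 - indicator {-1..1} x))"

lemma integrable_comp_exp_levy: "integrable \<mu> (\<lambda>x. comp_exp (u * x))"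
  by (rule integrable_comp_exp[OF measurable_ident_sets[OF sets_mu] S2])

lemma kappa_eq: "\<kappa> u = \<i> * of_real (u * drift) + (CLINT x|\<mu>. comp_exp (u * x))"
proof -
  have i: "integrable \<mu> (\<lambda>x. x * (1 - indicator {-1..1} x))"
  proof (rule Bochner_Integration.integrable_bound[OF S2])
    show "AE x in \<mu>. norm (x * (1 - indicator {-1..1} x)) \<le> norm (x\<^sup>2)"
    proof (rule AE_I2)
      fix x :: real
      show "norm (x * (1 - indicator {-1..1} x)) \<le> norm (x\<^sup>2)"
      proof (cases "x \<in> {-1..1}")
        case False
        then have "1 \<le> \<bar>x\<bar>"
          by auto
        then have "1 * \<bar>x\<bar> \<le> \<bar>x\<bar> * \<bar>x\<bar>"
          by (intro mult_right_mono) auto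
        then show ?thesis
          using False by (simp add: power2_eq_square)
      qed simp
    qed
  qed measurable
  have "(CLINT x|\<mu>. exp (\<i> * of_real (u * x)) - 1 - \<i> * of_real (u * x * indicator {-1..1} x)) =
      (CLINT x|\<mu>. comp_exp (u * x) + \<i> * of_real u * of_real (x * (1 - indicator {-1..1} x)))"
    by (simp add: comp_exp_def algebra_simps)
  also have "\<dots> = (CLINT x|\<mu>. comp_exp (u * x)) + \<i> * of_real u * of_real (LINT x|\<mu>. x * (1 - indicator {-1..1} x))"
    using integrable_comp_exp_levy i
    by (subst Bochner_Integration.integral_add) (auto intro!: integrable_mult_right integrable_of_real simp del: of_real_mult)
  finally show ?thesis
    by (simp add: levy_khintchine_def drift_def algebra_simps)
qed

abbreviation Q where "Q \<equiv> m \<Otimes>\<^sub>M \<mu>"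

lemma product_square_integrable:
  assumes f: "integrable m (\<lambda>z. (f z)\<^sup>2)"
  shows "integrable Q (\<lambda>z. (f (fst z) * snd z)\<^sup>2)"
    and "(LINT z|Q. (f (fst z) * snd z)\<^sup>2) = (LINT z|m. (f z)\<^sup>2) * (LINT x|\<mu>. x\<^sup>2)"
  using Q.integrable_product[OF f S2] by (simp_all add: power_mult_distrib)

lemma nn_integral_product_square:
  assumes f: "integrable m (\<lambda>z. (f z)\<^sup>2)"
  shows "(\<integral>\<^sup>+z. \<integral>\<^sup>+x. ennreal ((f z * x)\<^sup>2) \<partial>\<mu> \<partial>m) = ennreal ((LINT z|m. (f z)\<^sup>2) * (LINT x|\<mu>. x\<^sup>2))"
proof -
  have "(\<integral>\<^sup>+x. ennreal ((f z * x)\<^sup>2) \<partial>\<mu>) = ennreal ((f z)\<^sup>2 * (LINT x|\<mu>. x\<^sup>2))" for z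
    using S2 by (subst nn_integral_eq_integral) (auto simp: power_mult_distrib)
  then have "(\<integral>\<^sup>+z. \<integral>\<^sup>+x. ennreal ((f z * x)\<^sup>2) \<partial>\<mu> \<partial>m) = (\<integral>\<^sup>+z. ennreal ((f z)\<^sup>2 * (LINT x|\<mu>. x\<^sup>2)) \<partial>m)"
    by simp
  also have "\<dots> = ennreal (LINT z|m. (f z)\<^sup>2 * (LINT x|\<mu>. x\<^sup>2))"
    using f by (intro nn_integral_eq_integral) auto
  finally show ?thesis
    by simp
qed

text \<open>Both terms of \<open>kappa_eq\<close> are summed over level sets: the linear one becomes
  the drift times the integral of \<open>F\<close>, which the centring cancels, and the compensated
  one becomes the integral over \<open>Q\<close>.\<close>

lemma simple_integral_law:
  assumes F: "finitely_supported_simple m F"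
  shows "compensated_poisson_law M Q (\<lambda>z. F (fst z) * snd z) (\<lambda>w. I F w + - (drift * (LINT z|m. F z)))"
proof
  note [measurable] = F finitely_supported_simpleD(2)[OF F]
  show "(\<lambda>w. I F w + - (drift * (LINT z|m. F z))) \<in> borel_measurable M" "(\<lambda>z. F (fst z) * snd z) \<in> borel_measurable Q"
    by measurable
  have F2: "integrable m (\<lambda>z. (F z)\<^sup>2)"
    by (rule integral_simple_level_sets(1)[OF F]) simp
  show i: "integrable Q (\<lambda>z. (F (fst z) * snd z)\<^sup>2)"
    by (rule product_square_integrable(1)[OF F2])
  fix u
  have iQ: "integrable Q (\<lambda>z. comp_exp (u * (F (fst z) * snd z)))"
    by (rule integrable_comp_exp[OF _ i]) measurable
  let ?R = "F ` space m - {0}"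
  have "(\<Sum>y\<in>?R. of_real (measure m (level_set m F y)) * \<kappa> (u * y)) =
      (\<Sum>y\<in>?R. of_real (measure m (level_set m F y)) * (\<i> * of_real (u * y * drift))) +
      (\<Sum>y\<in>?R. measure m (level_set m F y) *\<^sub>R (CLINT x|\<mu>. comp_exp (u * y * x)))"
    by (simp add: kappa_eq sum.distrib algebra_simps scaleR_conv_of_real)
  also have "(\<Sum>y\<in>?R. of_real (measure m (level_set m F y)) * (\<i> * of_real (u * y * drift))) =
      \<i> * of_real (u * drift * (LINT z|m. F z))"
    by (subst integral_simple_level_sets(2)[OF F, of "\<lambda>y. y"])
       (simp_all add: sum_distrib_left mult_ac)
  also have "(\<Sum>y\<in>?R. measure m (level_set m F y) *\<^sub>R (CLINT x|\<mu>. comp_exp (u * y * x))) =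
      (CLINT z|m. CLINT x|\<mu>. comp_exp (u * F z * x))"
    by (rule integral_simple_level_sets(2)[OF F, of "\<lambda>y. CLINT x|\<mu>. comp_exp (u * y * x)", symmetric]) simp
  also have "\<dots> = (CLINT z|Q. comp_exp (u * (F (fst z) * snd z)))"
    using Q.integral_fst'[OF iQ] by (simp add: mult.assoc)
  finally have sum: "(\<Sum>y\<in>?R. of_real (measure m (level_set m F y)) * \<kappa> (u * y)) =
      \<i> * of_real (u * drift * (LINT z|m. F z)) + (CLINT z|Q. comp_exp (u * (F (fst z) * snd z)))" .
  have "char (distr M borel (\<lambda>w. I F w + - (drift * (LINT z|m. F z)))) u =
      iexp (u * - (drift * (LINT z|m. F z))) * exp (\<Sum>y\<in>?R. of_real (measure m (level_set m F y)) * \<kappa> (u * y))"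
    unfolding char_I[OF F, symmetric] by (rule char_distr_shift) measurable
  also have "\<dots> = exp (CLINT z|Q. comp_exp (u * (F (fst z) * snd z)))"
    unfolding sum exp_add[symmetric] by (simp add: mult.assoc)
  finally show "char (distr M borel (\<lambda>w. I F w + - (drift * (LINT z|m. F z)))) u =
      exp (CLINT z|Q. comp_exp (u * (F (fst z) * snd z)))" .
qed

text \<open>The approximants hidden in \<open>weak_integral\<close> are discarded in favour of
  simple functions with \<open>\<bar>G n z\<bar> \<le> 2 * \<bar>f z\<bar>\<close>, which converge
  to \<open>f\<close> in square mean. The difference of \<open>Y\<close> and the centred integral of
  \<open>G n\<close> is itself a centred weak integral, of \<open>f - G n\<close>, so its second
  moment is controlled and the laws converge. The shifts allowed in \<open>weak_integral\<close>
  absorb the drift.\<close>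

lemma weak_integral_law:
  assumes W: "weak_integral f Y" and int: "integrable M (\<lambda>w. (Y w)\<^sup>2)" and mean: "expectation Y = 0"
    and f2: "integrable m (\<lambda>z. (f z)\<^sup>2)"
  shows "compensated_poisson_law M Q (\<lambda>z. f (fst z) * snd z) Y"
proof -
  have [measurable]: "f \<in> borel_measurable m" "Y \<in> borel_measurable M"
    using W by (auto simp: weak_integral_def)
  obtain G where "\<forall>n. simple_function m (G n)" "\<forall>z\<in>space m. (\<lambda>n. G n z) \<longlonglongrightarrow> f z"
    "\<forall>n. \<forall>z\<in>space m. dist (G n z) 0 \<le> 2 * dist (f z) 0"
    using borel_measurable_implies_sequence_metric[of f m 0] by auto
  then have G: "\<And>n. simple_function m (G n)" "\<And>z. z \<in> space m \<Longrightarrow> (\<lambda>n. G n z) \<longlonglongrightarrow> f z"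
    "\<And>n z. z \<in> space m \<Longrightarrow> \<bar>G n z\<bar> \<le> 2 * \<bar>f z\<bar>"
    by auto
  have [measurable]: "G n \<in> borel_measurable m" for n
    using G(1) by (rule borel_measurable_simple_function)
  have G2: "integrable m (\<lambda>z. (G n z)\<^sup>2)" for n
  proof (rule Bochner_Integration.integrable_bound)
    show "integrable m (\<lambda>z. 4 * (f z)\<^sup>2)"
      using f2 by simp
    show "AE z in m. norm ((G n z)\<^sup>2) \<le> norm (4 * (f z)\<^sup>2)"
      using power_mono[OF G(3), of _ n 2] by (auto simp: power_mult_distrib)
  qed measurable
  have fG: "finitely_supported_simple m (G n)" for n
    unfolding finitely_supported_simple_def
  proof
    show "simple_function m (G n)"
      by (rule G)
    have fin: "finite (G n ` space m)"
      using G(1) by (rule simple_functionD)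
    show "emeasure m {z \<in> space m. G n z \<noteq> 0} < \<infinity>"
    proof -
      \<comment> \<open>A simple function is bounded away from 0 on its support, so a Markov
        estimate bounds the measure of the support. The inserted 1 keeps the minimum defined for the
        zero function.\<close>
      define e where "e = Min (insert 1 ((\<lambda>y. y\<^sup>2) ` (G n ` space m - {0})))"
      have e: "0 < e" "\<And>z. z \<in> space m \<Longrightarrow> G n z \<noteq> 0 \<Longrightarrow> e \<le> (G n z)\<^sup>2"
        unfolding e_def using fin by auto
      have "ennreal e * emeasure m {z \<in> space m. G n z \<noteq> 0} =
          (\<integral>\<^sup>+z. ennreal e * indicator {z \<in> space m. G n z \<noteq> 0} z \<partial>m)"
        by (subst nn_integral_cmult_indicator) auto
      also have "\<dots> \<le> (\<integral>\<^sup>+z. ennreal ((G n z)\<^sup>2) \<partial>m)"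
        using e by (intro nn_integral_mono) (auto simp: indicator_def ennreal_leI)
      also have "\<dots> < \<infinity>"
        using G2[of n] by (simp add: nn_integral_eq_integral)
      finally show ?thesis
        using e by (auto simp: ennreal_mult_less_top)
    qed
  qed
  define J where "J n w = I (G n) w + - (drift * (LINT z|m. G n z))" for n w
  have law: "compensated_poisson_law M Q (\<lambda>z. G n (fst z) * snd z) (J n)" for n
    unfolding J_def by (rule simple_integral_law[OF fG])
  have [measurable]: "J n \<in> borel_measurable M" for n
    using law by (rule compensated_poisson_law.Y)
  have J2: "integrable M (\<lambda>w. (J n w)\<^sup>2)" and J0: "expectation (J n) = 0" for n
    using compensated_poisson_law.square_integrable_Y[OF law] compensated_poisson_law.expectation_Y[OF law] by auto
  have J1: "integrable M (J n)" and Y1: "integrable M Y" for n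
    using square_integrable_imp_integrable[OF _ J2] square_integrable_imp_integrable[OF _ int] by auto
  define S where "S = (LINT x|\<mu>. x\<^sup>2)"
  have S: "0 \<le> S"
    by (simp add: S_def)
  define e where "e n = (LINT z|m. (f z + (-1) * G n z)\<^sup>2)" for n
  have i2: "integrable m (\<lambda>z. (f z + (-1) * G n z)\<^sup>2)" for n
    using integrable_diff_square[of f m "G n"] f2 G2 by simp
  have e0: "e \<longlonglongrightarrow> 0"
  proof -
    have "e \<longlonglongrightarrow> (LINT z|m. 0)"
      unfolding e_def
    proof (rule integral_dominated_convergence[where w = "\<lambda>z. 9 * (f z)\<^sup>2"])
      show "AE z in m. (\<lambda>n. (f z + (-1) * G n z)\<^sup>2) \<longlonglongrightarrow> 0"
      proof (rule AE_I2)
        fix z assume "z \<in> space m"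
        then have "(\<lambda>n. (f z + (-1) * G n z)\<^sup>2) \<longlonglongrightarrow> (f z + (-1) * f z)\<^sup>2"
          by (intro tendsto_intros G)
        then show "(\<lambda>n. (f z + (-1) * G n z)\<^sup>2) \<longlonglongrightarrow> 0"
          by simp
      qed
      show "AE z in m. norm ((f z + (-1) * G n z)\<^sup>2) \<le> 9 * (f z)\<^sup>2" for n
      proof (rule AE_I2)
        fix z assume "z \<in> space m"
        then have "\<bar>f z + (-1) * G n z\<bar> \<le> 3 * \<bar>f z\<bar>"
          using G(3)[of z n] by linarith
        then have "\<bar>f z + (-1) * G n z\<bar>\<^sup>2 \<le> (3 * \<bar>f z\<bar>)\<^sup>2"
          by (intro power_mono) auto
        then show "norm ((f z + (-1) * G n z)\<^sup>2) \<le> 9 * (f z)\<^sup>2"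
          by (simp add: power_mult_distrib)
      qed
    qed (use f2 in auto)
    then show ?thesis
      by simp
  qed
  have YJ: "expectation (\<lambda>w. \<bar>J n w - Y w\<bar>) \<le> sqrt (2 * (e n * S))" for n
  proof -
    let ?D = "\<lambda>w. Y w + (-1) * J n w"
    have D2: "integrable M (\<lambda>w. (?D w)\<^sup>2)"
      using integrable_diff_square[of Y M "J n"] int J2 by simp
    have "weak_integral (\<lambda>z. f z + (-1) * G n z) ?D"
      unfolding J_def by (intro weak_integral_lincomb W weak_integral_simple fG)
    moreover have "expectation ?D = 0"
      using Y1 J1 mean J0 by simp
    ultimately have "expectation (\<lambda>w. (?D w)\<^sup>2) \<le> 2 * (e n * S)"
      using D2 nn_integral_product_square[OF i2[of n]] S
      by (intro expectation_square_le_if_weak_integral) (auto simp: e_def S_def)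
    then have "sqrt (expectation (\<lambda>w. (?D w)\<^sup>2)) \<le> sqrt (2 * (e n * S))"
      by (rule real_sqrt_le_mono)
    with expectation_abs_le_sqrt[OF _ D2] have "expectation (\<lambda>w. \<bar>?D w\<bar>) \<le> sqrt (2 * (e n * S))"
      by (rule order_trans) measurable
    then show ?thesis
      by (simp add: abs_minus_commute)
  qed
  show ?thesis
  proof (rule compensated_poisson_law_limit[OF law])
    show "integrable Q (\<lambda>z. (f (fst z) * snd z)\<^sup>2)"
      by (rule product_square_integrable(1)[OF f2])
    have "(LINT z|Q. (G n (fst z) * snd z - f (fst z) * snd z)\<^sup>2) = e n * S" for n
    proof -
      have "(G n z * x - f z * x)\<^sup>2 = ((f z + (-1) * G n z) * x)\<^sup>2" for z x
        by (simp add: power2_eq_square algebra_simps)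
      then show ?thesis
        using product_square_integrable(2)[OF i2[of n]] by (simp only: e_def S_def)
    qed
    then show "(\<lambda>n. LINT z|Q. (G n (fst z) * snd z - f (fst z) * snd z)\<^sup>2) \<longlonglongrightarrow> 0"
      using tendsto_mult_left_zero[OF e0, of S] by simp
    show "integrable M (\<lambda>w. J n w - Y w)" for n
      using J1 Y1 by simp
    show "(\<lambda>n. expectation (\<lambda>w. \<bar>J n w - Y w\<bar>)) \<longlonglongrightarrow> 0"
    proof (rule tendsto_sandwich[OF _ _ tendsto_const])
      have "(\<lambda>n. sqrt (2 * (e n * S))) \<longlonglongrightarrow> sqrt (2 * (0 * S))"
        by (intro tendsto_intros e0)
      then show "(\<lambda>n. sqrt (2 * (e n * S))) \<longlonglongrightarrow> 0"
        by simp
      show "\<forall>\<^sub>F n in sequentially. expectation (\<lambda>w. \<bar>J n w - Y w\<bar>) \<le> sqrt (2 * (e n * S))"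
        by (intro always_eventually allI YJ)
      show "\<forall>\<^sub>F n in sequentially. 0 \<le> expectation (\<lambda>w. \<bar>J n w - Y w\<bar>)"
        by simp
    qed
    show "(\<lambda>z. f (fst z) * snd z) \<in> borel_measurable Q" "Y \<in> borel_measurable M"
      by measurable
  qed
qed

end

section \<open>Time averages and the supOU kernel\<close>

text \<open>Cauchy-Schwarz in time, then an exchange of the integrals. One factor \<open>t\<close>
  comes from the length of the interval, the other from integrating the uniform bound.\<close>

lemma nn_integral_time_average_square_le:
  fixes D :: "real \<Rightarrow> 'a \<Rightarrow> real"
  assumes N: "sigma_finite_measure N"
    and [measurable]: "(\<lambda>(s, z). D s z) \<in> borel_measurable (borel \<Otimes>\<^sub>M N)"
    and t: "0 \<le> t"
    and le: "\<And>s. 0 \<le> s \<Longrightarrow> s < t \<Longrightarrow> (\<integral>\<^sup>+z. ennreal ((D s z)\<^sup>2) \<partial>N) \<le> ennreal w" and w: "0 \<le> w"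
  shows "(\<integral>\<^sup>+z. (\<integral>\<^sup>+s. ennreal \<bar>D s z\<bar> * indicator {0..<t} s \<partial>lborel)\<^sup>2 \<partial>N) \<le> ennreal (t\<^sup>2 * w)"
proof -
  interpret N: sigma_finite_measure N
    by (rule N)
  interpret P: pair_sigma_finite lborel N ..
  have CS: "(\<integral>\<^sup>+s. ennreal \<bar>D s z\<bar> * indicator {0..<t} s \<partial>lborel)\<^sup>2 \<le>
      ennreal t * (\<integral>\<^sup>+s. ennreal ((D s z)\<^sup>2) * indicator {0..<t} s \<partial>lborel)" if [measurable]: "z \<in> space N" for z
  proof -
    have "(\<integral>\<^sup>+s. ennreal \<bar>D s z\<bar> * indicator {0..<t} s \<partial>lborel)\<^sup>2 =
        (\<integral>\<^sup>+s. (ennreal \<bar>D s z\<bar> * indicator {0..<t} s) * indicator {0..<t} s \<partial>lborel)\<^sup>2"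
      by (intro arg_cong[of _ _ "\<lambda>x. x\<^sup>2"] nn_integral_cong) (auto simp: indicator_def)
    also have "\<dots> \<le> (\<integral>\<^sup>+s. (ennreal \<bar>D s z\<bar> * indicator {0..<t} s)\<^sup>2 \<partial>lborel) * (\<integral>\<^sup>+s. (indicator {0..<t} s)\<^sup>2 \<partial>lborel)"
      by (rule Cauchy_Schwarz_nn_integral) measurable
    also have "(\<integral>\<^sup>+s. (indicator {0..<t} s :: ennreal)\<^sup>2 \<partial>lborel) = (\<integral>\<^sup>+s. indicator {0..<t} s \<partial>lborel)"
      by (intro nn_integral_cong) (auto simp: indicator_def)
    also have "\<dots> = ennreal t"
      using t by simp
    also have "(\<integral>\<^sup>+s. (ennreal \<bar>D s z\<bar> * indicator {0..<t} s)\<^sup>2 \<partial>lborel) =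
        (\<integral>\<^sup>+s. ennreal ((D s z)\<^sup>2) * indicator {0..<t} s \<partial>lborel)"
      by (intro nn_integral_cong) (auto simp: indicator_def ennreal_power)
    finally show ?thesis
      by (simp add: mult.commute)
  qed
  have "(\<integral>\<^sup>+z. (\<integral>\<^sup>+s. ennreal \<bar>D s z\<bar> * indicator {0..<t} s \<partial>lborel)\<^sup>2 \<partial>N) \<le>
      (\<integral>\<^sup>+z. ennreal t * (\<integral>\<^sup>+s. ennreal ((D s z)\<^sup>2) * indicator {0..<t} s \<partial>lborel) \<partial>N)"
    by (intro nn_integral_mono CS)
  also have "\<dots> = ennreal t * (\<integral>\<^sup>+z. \<integral>\<^sup>+s. ennreal ((D s z)\<^sup>2) * indicator {0..<t} s \<partial>lborel \<partial>N)"
    by (rule nn_integral_cmult) measurable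
  also have "(\<integral>\<^sup>+z. \<integral>\<^sup>+s. ennreal ((D s z)\<^sup>2) * indicator {0..<t} s \<partial>lborel \<partial>N) =
      (\<integral>\<^sup>+s. \<integral>\<^sup>+z. ennreal ((D s z)\<^sup>2) * indicator {0..<t} s \<partial>N \<partial>lborel)"
    by (rule P.Fubini') measurable
  also have "\<dots> = (\<integral>\<^sup>+s. (\<integral>\<^sup>+z. ennreal ((D s z)\<^sup>2) \<partial>N) * indicator {0..<t} s \<partial>lborel)"
    by (intro nn_integral_cong nn_integral_multc) measurable
  also have "\<dots> \<le> (\<integral>\<^sup>+s. ennreal w * indicator {0..<t} s \<partial>lborel)"
    using le by (intro nn_integral_mono) (auto simp: indicator_def)
  also have "\<dots> = ennreal w * ennreal t"
    using t by (subst nn_integral_cmult_indicator) auto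
  also have "ennreal t * (ennreal w * ennreal t) = ennreal (t\<^sup>2 * w)"
    using t w by (simp add: ennreal_mult[symmetric] power2_eq_square mult_ac)
  finally show ?thesis
    by (simp add: mult_left_mono)
qed

text \<open>Stated for an arbitrary measure so that it applies both to the process under the
  probability measure and to the kernel under the control measure, with the same nodes. The Riemann
  sum is the time integral of a step function, and its error is a time average of increments over
  lags of at most one mesh.\<close>

lemma riemann_sum_square_error_le:
  fixes \<phi> :: "real \<Rightarrow> 'a \<Rightarrow> real"
  assumes N: "sigma_finite_measure N"
    and \<phi> [measurable]: "(\<lambda>(s, z). \<phi> s z) \<in> borel_measurable (borel \<Otimes>\<^sub>M N)"
    and t: "0 < t"
    and C: "\<And>s. (\<integral>\<^sup>+z. ennreal ((\<phi> s z)\<^sup>2) \<partial>N) \<le> ennreal C" "0 \<le> C"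
    and n: "0 < n" and w: "0 \<le> w"
    and le: "\<And>s r. \<bar>s - r\<bar> \<le> t / real n \<Longrightarrow> (\<integral>\<^sup>+z. ennreal ((\<phi> s z - \<phi> r z)\<^sup>2) \<partial>N) \<le> ennreal w"
  shows "(\<integral>\<^sup>+z. ennreal (((\<Sum>i<n. t / real n * \<phi> (t / real n * real i) z) - (LBINT s:{0..t}. \<phi> s z))\<^sup>2) \<partial>N) \<le> ennreal (t\<^sup>2 * w)"
proof -
  \<comment> \<open>The cells of the Riemann sum partition the half-open interval, the integral runs
    over the closed one; they differ by the null set \<open>{t}\<close>.\<close>
  have set: "indicator {0..t} s = (indicator {0..<t} s :: real)" if "s \<noteq> t" for s
    using that by (auto simp: indicator_def)
  have neq: "AE s in lborel. s \<noteq> t"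
    by (rule AE_lborel_singleton)
  have \<phi>z [measurable]: "(\<lambda>s. \<phi> s z) \<in> borel_measurable borel" if "z \<in> space N" for z
    using that by measurable
  have "(\<integral>\<^sup>+z. (\<integral>\<^sup>+s. ennreal \<bar>\<phi> s z\<bar> * indicator {0..<t} s \<partial>lborel)\<^sup>2 \<partial>N) \<le> ennreal (t\<^sup>2 * C)"
    using N t C by (intro nn_integral_time_average_square_le) auto
  then have "(\<integral>\<^sup>+z. (\<integral>\<^sup>+s. ennreal \<bar>\<phi> s z\<bar> * indicator {0..<t} s \<partial>lborel)\<^sup>2 \<partial>N) \<noteq> \<infinity>"
    by (auto simp: top_unique)
  then have "AE z in N. (\<integral>\<^sup>+s. ennreal \<bar>\<phi> s z\<bar> * indicator {0..<t} s \<partial>lborel)\<^sup>2 \<noteq> \<infinity>"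
    by (intro nn_integral_PInf_AE) measurable
  \<comment> \<open>Integrability in time holds for almost every \<open>z\<close> only. Elsewhere
    the set integral has the default value 0, so the comparison below can only be an almost sure
    one.\<close>
  then have int: "AE z in N. integrable lborel (\<lambda>s. \<phi> s z * indicator {0..<t} s)"
  proof (rule AE_mp, intro AE_I2 impI)
    fix z assume z: "z \<in> space N" and fin: "(\<integral>\<^sup>+s. ennreal \<bar>\<phi> s z\<bar> * indicator {0..<t} s \<partial>lborel)\<^sup>2 \<noteq> \<infinity>"
    have "(\<integral>\<^sup>+s. ennreal \<bar>\<phi> s z\<bar> * indicator {0..<t} s \<partial>lborel) < \<infinity>"
      using fin by (auto simp: power2_eq_square ennreal_mult_eq_top_iff less_top)
    moreover have "(\<integral>\<^sup>+s. ennreal (norm (\<phi> s z * indicator {0..<t} s)) \<partial>lborel) =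
        (\<integral>\<^sup>+s. ennreal \<bar>\<phi> s z\<bar> * indicator {0..<t} s \<partial>lborel)"
      by (intro nn_integral_cong) (auto simp: indicator_def)
    ultimately show "integrable lborel (\<lambda>s. \<phi> s z * indicator {0..<t} s)"
      using \<phi>z[OF z] by (intro integrableI_bounded) auto
  qed
  define h where "h = t / real n"
  have h: "0 < h" "h * real n = t"
    using n t by (auto simp: h_def)
  define A where "A i = {h * real i..<h * (real i + 1)}" for i :: nat
  \<comment> \<open>The step function with the values at left endpoints, minus the function itself.
    At each time just one summand is nonzero.\<close>
  define D where "D s z = (\<Sum>i<n. indicator (A i) s * \<phi> (h * real i) z) - \<phi> s z" for s z
  have [measurable]: "\<phi> s \<in> borel_measurable N" for s
    by measurable
  have D [measurable]: "(\<lambda>(s, z). D s z) \<in> borel_measurable (borel \<Otimes>\<^sub>M N)"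
    unfolding D_def A_def by measurable
  have D_eq: "\<exists>r. \<bar>r - s\<bar> \<le> h \<and> (\<forall>z. D s z = \<phi> r z - \<phi> s z)" if s: "0 \<le> s" "s < t" for s
  proof -
    define i where "i = nat \<lfloor>s / h\<rfloor>"
    have i: "real i \<le> s / h" "s / h < real i + 1"
      using s h by (auto simp: i_def)
    have "s / h < real n"
      using s h by (simp add: field_simps)
    then have "i < n"
      using i by linarith
    have in_iff: "s \<in> A j \<longleftrightarrow> j = i" for j
    proof -
      have "s \<in> A j \<longleftrightarrow> real j \<le> s / h \<and> s / h < real j + 1"
        using h by (auto simp: A_def field_simps)
      also have "\<dots> \<longleftrightarrow> j = i"
        using i by (auto simp flip: of_nat_Suc)
      finally show ?thesis .
    qed
    have "(\<Sum>j<n. indicator (A j) s * \<phi> (h * real j) z) = (\<Sum>j<n. if j = i then \<phi> (h * real j) z else 0)" for z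
      by (intro sum.cong) (auto simp: indicator_def in_iff)
    then have "D s z = \<phi> (h * real i) z - \<phi> s z" for z
      using \<open>i < n\<close> by (simp add: D_def)
    moreover have "\<bar>h * real i - s\<bar> \<le> h"
      using i h by (simp add: field_simps abs_le_iff)
    ultimately show ?thesis
      by blast
  qed
  have "(\<integral>\<^sup>+z. ennreal ((D s z)\<^sup>2) \<partial>N) \<le> ennreal w" if s: "0 \<le> s" "s < t" for s
    using D_eq[OF s] le[of _ s] by (auto simp: h_def)
  then have main: "(\<integral>\<^sup>+z. (\<integral>\<^sup>+s. ennreal \<bar>D s z\<bar> * indicator {0..<t} s \<partial>lborel)\<^sup>2 \<partial>N) \<le> ennreal (t\<^sup>2 * w)"
    using N t w by (intro nn_integral_time_average_square_le) auto
  have "(\<integral>\<^sup>+z. ennreal (((\<Sum>i<n. h * \<phi> (h * real i) z) - (LBINT s:{0..t}. \<phi> s z))\<^sup>2) \<partial>N) \<le>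
      (\<integral>\<^sup>+z. (\<integral>\<^sup>+s. ennreal \<bar>D s z\<bar> * indicator {0..<t} s \<partial>lborel)\<^sup>2 \<partial>N)"
  proof (rule nn_integral_mono_AE)
    show "AE z in N. ennreal (((\<Sum>i<n. h * \<phi> (h * real i) z) - (LBINT s:{0..t}. \<phi> s z))\<^sup>2) \<le>
        (\<integral>\<^sup>+s. ennreal \<bar>D s z\<bar> * indicator {0..<t} s \<partial>lborel)\<^sup>2"
      using int
    proof (rule AE_mp, intro AE_I2 impI)
      fix z assume z: "z \<in> space N" and i: "integrable lborel (\<lambda>s. \<phi> s z * indicator {0..<t} s)"
      note [measurable] = \<phi>z[OF z]
      have A: "A i \<subseteq> {0..<t}" if "i < n" for i
      proof -
        have "real i + 1 \<le> real n"
          using that by linarith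
        then have "h * (real i + 1) \<le> t"
          using h by (metis mult_le_cancel_left_pos)
        moreover have "0 \<le> h * real i"
          using h by simp
        ultimately show ?thesis
          by (auto simp: A_def)
      qed
      have iA: "integrable lborel (\<lambda>s. indicator (A i) s * \<phi> (h * real i) z)" for i
        using h by (intro integrable_mult_left integrable_real_indicator) (auto simp: A_def)
      have "measure lborel (A i) = h" for i
        using h by (simp add: A_def algebra_simps)
      then have sum: "(LINT s|lborel. (\<Sum>i<n. indicator (A i) s * \<phi> (h * real i) z)) = (\<Sum>i<n. h * \<phi> (h * real i) z)"
        using iA by (subst Bochner_Integration.integral_sum) (auto simp: integral_mult_left_zero)
      have lb: "(LBINT s:{0..t}. \<phi> s z) = (LINT s|lborel. \<phi> s z * indicator {0..<t} s)"
        unfolding set_lebesgue_integral_def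
        by (rule integral_cong_AE) (use neq set in \<open>auto elim!: eventually_mono\<close>)
      have D': "(\<Sum>i<n. indicator (A i) s * \<phi> (h * real i) z) - \<phi> s z * indicator {0..<t} s = D s z * indicator {0..<t} s" for s
      proof (cases "s \<in> {0..<t}")
        case False
        then have "s \<notin> A i" if "i < n" for i
          using A[OF that] by blast
        then have "(\<Sum>i<n. indicator (A i) s * \<phi> (h * real i) z) = 0"
          by (intro sum.neutral) auto
        then show ?thesis
          using False by simp
      qed (simp add: D_def)
      have iD: "integrable lborel (\<lambda>s. D s z * indicator {0..<t} s)"
        unfolding D'[symmetric] using iA i by (intro Bochner_Integration.integrable_diff Bochner_Integration.integrable_sum) auto
      have "(\<Sum>i<n. h * \<phi> (h * real i) z) - (LBINT s:{0..t}. \<phi> s z) = (LINT s|lborel. D s z * indicator {0..<t} s)"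
        unfolding lb sum[symmetric] D'[symmetric] using iA i
        by (intro Bochner_Integration.integral_diff[symmetric] Bochner_Integration.integrable_sum) auto
      moreover have "ennreal (norm (LINT s|lborel. D s z * indicator {0..<t} s)) \<le>
          (\<integral>\<^sup>+s. ennreal (norm (D s z * indicator {0..<t} s)) \<partial>lborel)"
        by (rule integral_norm_bound_ennreal[OF iD])
      moreover have "(\<integral>\<^sup>+s. ennreal (norm (D s z * indicator {0..<t} s)) \<partial>lborel) =
          (\<integral>\<^sup>+s. ennreal \<bar>D s z\<bar> * indicator {0..<t} s \<partial>lborel)"
        by (intro nn_integral_cong) (auto simp: indicator_def)
      ultimately have "ennreal \<bar>(\<Sum>i<n. h * \<phi> (h * real i) z) - (LBINT s:{0..t}. \<phi> s z)\<bar> \<le>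
          (\<integral>\<^sup>+s. ennreal \<bar>D s z\<bar> * indicator {0..<t} s \<partial>lborel)"
        by simp
      then have "(ennreal \<bar>(\<Sum>i<n. h * \<phi> (h * real i) z) - (LBINT s:{0..t}. \<phi> s z)\<bar>)\<^sup>2 \<le>
          (\<integral>\<^sup>+s. ennreal \<bar>D s z\<bar> * indicator {0..<t} s \<partial>lborel)\<^sup>2"
        by (intro power_mono) auto
      then show "ennreal (((\<Sum>i<n. h * \<phi> (h * real i) z) - (LBINT s:{0..t}. \<phi> s z))\<^sup>2) \<le>
          (\<integral>\<^sup>+s. ennreal \<bar>D s z\<bar> * indicator {0..<t} s \<partial>lborel)\<^sup>2"
        by (simp add: ennreal_power)
    qed
  qed
  also note main
  finally show "(\<integral>\<^sup>+z. ennreal (((\<Sum>i<n. t / real n * \<phi> (t / real n * real i) z) - (LBINT s:{0..t}. \<phi> s z))\<^sup>2) \<partial>N) \<le> ennreal (t\<^sup>2 * w)"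
    by (simp add: h_def)
qed

text \<open>Reflection turns the left half-line into a right one, to which the fundamental theorem
  for improper integrals applies.\<close>

lemma nn_integral_exp_atMost:
  fixes g c :: real
  assumes g: "0 < g"
  shows "(\<integral>\<^sup>+u. ennreal (exp (g * u)) * indicator {..c} u \<partial>lborel) = ennreal (exp (g * c) / g)"
proof -
  have "(\<integral>\<^sup>+u. ennreal (exp (g * u)) * indicator {..c} u \<partial>lborel) =
      (\<integral>\<^sup>+u. ennreal (exp (g * (0 + - 1 * u))) * indicator {..c} (0 + - 1 * u) \<partial>lborel)"
    by (subst nn_integral_real_affine[where c = "- 1" and t = 0]) auto
  also have "\<dots> = (\<integral>\<^sup>+u. ennreal (exp (- g * u)) * indicator {- c..} u \<partial>lborel)"
    by (intro nn_integral_cong) (auto simp: indicator_def)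
  also have "\<dots> = 0 - (- exp (- g * - c) / g)"
  proof (rule nn_integral_FTC_atLeast)
    show "((\<lambda>u. - exp (- g * u) / g) has_real_derivative exp (- g * u)) (at u)" for u
      using g by (auto intro!: derivative_eq_intros)
    have "LIM u at_top. - g * u :> at_bot"
      using g by (intro filterlim_tendsto_neg_mult_at_bot[OF tendsto_const] filterlim_ident) auto
    then have "((\<lambda>u. exp (- g * u)) \<longlongrightarrow> 0) at_top"
      by (rule filterlim_compose[OF exp_at_bot])
    then have "((\<lambda>u. - exp (- g * u) / g) \<longlongrightarrow> - 0 / g) at_top"
      by (intro tendsto_intros) (use g in auto)
    then show "((\<lambda>u. - exp (- g * u) / g) \<longlongrightarrow> 0) at_top"
      by simp
  qed auto
  finally show ?thesis
    by simp
qed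

section \<open>The supOU kernel in square mean\<close>

lemma supou_kernel_eq: "supou_kernel t (\<xi>, u) = exp (u - \<xi> * t) * indicator {..\<xi> * t} u"
  by (auto simp: supou_kernel_def indicator_def)

lemma supou_kernel_nonneg: "0 \<le> supou_kernel t z"
  by (cases z) (simp add: supou_kernel_eq)

lemma supou_kernel_le_1: "supou_kernel t z \<le> 1"
  by (cases z) (auto simp: supou_kernel_eq indicator_def)

locale supou_control =
  fixes \<pi> :: "real measure"
  assumes prob_pi: "prob_space \<pi>" and sets_pi: "sets \<pi> = sets (restrict_space borel {0<..})"
begin

sublocale pi: prob_space \<pi>
  by (rule prob_pi)

sublocale pl: pair_sigma_finite \<pi> lborel ..

abbreviation m where "m \<equiv> \<pi> \<Otimes>\<^sub>M lborel"

lemma space_pi: "space \<pi> = {0<..}"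
  using sets_eq_imp_space_eq[OF sets_pi] by (simp add: space_restrict_space)

lemma measurable_ident_pi [measurable]: "(\<lambda>\<xi>. \<xi>) \<in> borel_measurable \<pi>"
  unfolding measurable_cong_sets[OF sets_pi refl] by (intro measurable_restrict_space1) simp

lemma measurable_fst_pi [measurable]: "fst \<in> borel_measurable m"
  using measurable_compose[OF measurable_fst measurable_ident_pi, of lborel] by simp

lemma supou_kernel_measurable2 [measurable]: "(\<lambda>(r, z). supou_kernel r z) \<in> borel_measurable (borel \<Otimes>\<^sub>M m)"
proof -
  have "(\<lambda>(r, z). supou_kernel r z) = (\<lambda>w. exp (- fst (snd w) * fst w + snd (snd w)) *
      indicator {0..} (fst (snd w) * fst w - snd (snd w)))"
    by (auto simp: supou_kernel_def fun_eq_iff split: prod.splits)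
  also have "\<dots> \<in> borel_measurable (borel \<Otimes>\<^sub>M m)"
    by measurable
  finally show ?thesis .
qed

lemma supou_kernel_measurable [measurable]: "supou_kernel r \<in> borel_measurable m"
  using measurable_compose[OF _ supou_kernel_measurable2, of "\<lambda>z. (r, z)" m] by simp

text \<open>Up to the second moment of the Levy measure this is the covariance of the process at lag
  \<open>s - r\<close>. For \<open>r \<le> s\<close> and positive \<xi> the support of the earlier
  kernel lies inside that of the later one, so the product is a single exponential on
  \<open>{..\<xi> * r}\<close>.\<close>

lemma nn_integral_supou_kernel_mult:
  assumes "r \<le> s"
  shows "(\<integral>\<^sup>+z. ennreal (supou_kernel s z * supou_kernel r z) \<partial>m) = (\<integral>\<^sup>+\<xi>. ennreal (exp (- \<xi> * (s - r)) / 2) \<partial>\<pi>)"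
proof -
  have "(\<integral>\<^sup>+z. ennreal (supou_kernel s z * supou_kernel r z) \<partial>m) =
      (\<integral>\<^sup>+\<xi>. \<integral>\<^sup>+u. ennreal (supou_kernel s (\<xi>, u) * supou_kernel r (\<xi>, u)) \<partial>lborel \<partial>\<pi>)"
    by (subst lborel.nn_integral_fst[symmetric]) auto
  also have "\<dots> = (\<integral>\<^sup>+\<xi>. ennreal (exp (- \<xi> * (s - r)) / 2) \<partial>\<pi>)"
  proof (rule nn_integral_cong)
    fix \<xi> assume "\<xi> \<in> space \<pi>"
    then have \<xi>: "0 < \<xi>"
      by (simp add: space_pi)
    have "(\<integral>\<^sup>+u. ennreal (supou_kernel s (\<xi>, u) * supou_kernel r (\<xi>, u)) \<partial>lborel) =
        (\<integral>\<^sup>+u. ennreal (exp (- \<xi> * (s + r))) * (ennreal (exp (2 * u)) * indicator {..\<xi> * r} u) \<partial>lborel)"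
    proof (rule nn_integral_cong)
      fix u
      have "u \<le> \<xi> * r \<Longrightarrow> u \<le> \<xi> * s"
        using assms \<xi> by (meson mult_left_mono order.trans less_imp_le)
      then show "ennreal (supou_kernel s (\<xi>, u) * supou_kernel r (\<xi>, u)) =
          ennreal (exp (- \<xi> * (s + r))) * (ennreal (exp (2 * u)) * indicator {..\<xi> * r} u)"
        by (auto simp: supou_kernel_eq indicator_def ennreal_mult[symmetric] exp_add[symmetric] algebra_simps)
    qed
    also have "\<dots> = ennreal (exp (- \<xi> * (s + r))) * ennreal (exp (2 * (\<xi> * r)) / 2)"
      by (subst nn_integral_cmult) (auto simp: nn_integral_exp_atMost)
    also have "\<dots> = ennreal (exp (- \<xi> * (s - r)) / 2)"
      by (simp add: ennreal_mult[symmetric] exp_add[symmetric] algebra_simps)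
    finally show "(\<integral>\<^sup>+u. ennreal (supou_kernel s (\<xi>, u) * supou_kernel r (\<xi>, u)) \<partial>lborel) =
        ennreal (exp (- \<xi> * (s - r)) / 2)" .
  qed
  finally show ?thesis .
qed

lemma integrable_exp_pi: "0 \<le> d \<Longrightarrow> integrable \<pi> (\<lambda>\<xi>. exp (- \<xi> * d))"
  by (rule pi.integrable_const_bound[of _ 1]) (auto simp: space_pi intro!: AE_I2)

lemma
  assumes "r \<le> s"
  shows integrable_supou_kernel_mult: "integrable m (\<lambda>z. supou_kernel s z * supou_kernel r z)"
    and integral_supou_kernel_mult: "(LINT z|m. supou_kernel s z * supou_kernel r z) = (LINT \<xi>|\<pi>. exp (- \<xi> * (s - r))) / 2"
proof -
  have "(\<integral>\<^sup>+\<xi>. ennreal (exp (- \<xi> * (s - r)) / 2) \<partial>\<pi>) = ennreal (LINT \<xi>|\<pi>. exp (- \<xi> * (s - r)) / 2)"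
    using assms integrable_exp_pi[of "s - r"] by (intro nn_integral_eq_integral) auto
  then have nn: "(\<integral>\<^sup>+z. ennreal (supou_kernel s z * supou_kernel r z) \<partial>m) = ennreal ((LINT \<xi>|\<pi>. exp (- \<xi> * (s - r))) / 2)"
    using nn_integral_supou_kernel_mult[OF assms] by simp
  show i: "integrable m (\<lambda>z. supou_kernel s z * supou_kernel r z)"
    by (rule integrableI_nonneg) (auto simp: nn supou_kernel_nonneg)
  show "(LINT z|m. supou_kernel s z * supou_kernel r z) = (LINT \<xi>|\<pi>. exp (- \<xi> * (s - r))) / 2"
    using nn_integral_eq_integral[OF i] nn
    by (simp add: supou_kernel_nonneg integral_nonneg_AE)
qed

lemma integrable_supou_kernel_square: "integrable m (\<lambda>z. (supou_kernel s z)\<^sup>2)"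
  using integrable_supou_kernel_mult[of s s] by (simp add: power2_eq_square)

text \<open>The squared distance in square mean between two kernels at time lag \<open>d\<close>. It
  tends to 0 with \<open>d\<close> by dominated convergence for every mixing probability measure, so
  Riemann sums converge without moments of \<pi>.\<close>

definition kernel_modulus :: "real \<Rightarrow> real" where
  "kernel_modulus d = (LINT \<xi>|\<pi>. 1 - exp (- \<xi> * d))"

lemma kernel_modulus_nonneg: "0 \<le> d \<Longrightarrow> 0 \<le> kernel_modulus d"
  unfolding kernel_modulus_def by (intro integral_nonneg_AE AE_I2) (auto simp: space_pi)

lemma kernel_modulus_mono:
  assumes "0 \<le> d" "d \<le> e"
  shows "kernel_modulus d \<le> kernel_modulus e"
  unfolding kernel_modulus_def
  using assms by (intro integral_mono Bochner_Integration.integrable_diff integrable_exp_pi)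
    (auto simp: space_pi mult_left_mono)

lemma kernel_modulus_tendsto: "0 \<le> t \<Longrightarrow> (\<lambda>n. kernel_modulus (t / real (Suc n))) \<longlonglongrightarrow> 0"
proof -
  assume True: "0 \<le> t"
  have "(\<lambda>n. kernel_modulus (t / real (Suc n))) \<longlonglongrightarrow> (LINT \<xi>|\<pi>. 0)"
    unfolding kernel_modulus_def
  proof (rule integral_dominated_convergence[where w = "\<lambda>_. 1"])
    show "AE \<xi> in \<pi>. (\<lambda>n. 1 - exp (- \<xi> * (t / real (Suc n)))) \<longlonglongrightarrow> 0"
    proof (rule AE_I2)
      fix \<xi>
      have "(\<lambda>n. 1 - exp (- \<xi> * (t * (1 / real (Suc n))))) \<longlonglongrightarrow> 1 - exp (- \<xi> * (t * 0))"
        using LIMSEQ_Suc[OF lim_1_over_n] by (intro tendsto_intros)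
      then show "(\<lambda>n. 1 - exp (- \<xi> * (t / real (Suc n)))) \<longlonglongrightarrow> 0"
        by simp
    qed
    show "AE \<xi> in \<pi>. norm (1 - exp (- \<xi> * (t / real (Suc n)))) \<le> 1" for n
      using True by (intro AE_I2) (auto simp: space_pi abs_le_iff intro!: divide_nonneg_nonneg mult_nonneg_nonneg order_trans[OF _ exp_ge_zero])
  qed auto
  then show ?thesis
    by simp
qed

lemma
  shows integrable_supou_kernel_diff_square: "integrable m (\<lambda>z. (supou_kernel s z - supou_kernel r z)\<^sup>2)"
    and integral_supou_kernel_diff_square: "(LINT z|m. (supou_kernel s z - supou_kernel r z)\<^sup>2) = kernel_modulus \<bar>s - r\<bar>"
proof -
  have *: "integrable m (\<lambda>z. (supou_kernel s z - supou_kernel r z)\<^sup>2) \<and>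
      (LINT z|m. (supou_kernel s z - supou_kernel r z)\<^sup>2) = kernel_modulus (s - r)" if "r \<le> s" for r s
  proof -
    have eq: "(supou_kernel s z - supou_kernel r z)\<^sup>2 = supou_kernel s z * supou_kernel s z + supou_kernel r z * supou_kernel r z
        - 2 * (supou_kernel s z * supou_kernel r z)" for z
      by (simp add: power2_eq_square algebra_simps)
    have "kernel_modulus (s - r) = 1 - (LINT \<xi>|\<pi>. exp (- \<xi> * (s - r)))"
      unfolding kernel_modulus_def using integrable_exp_pi[of "s - r"] that
      by (subst Bochner_Integration.integral_diff) (auto simp: pi.prob_space)
    then show ?thesis
      unfolding eq using that
      by (simp add: integrable_supou_kernel_mult integral_supou_kernel_mult pi.prob_space)
  qed
  have "integrable m (\<lambda>z. (supou_kernel s z - supou_kernel r z)\<^sup>2) \<and>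
      (LINT z|m. (supou_kernel s z - supou_kernel r z)\<^sup>2) = kernel_modulus \<bar>s - r\<bar>"
  proof (cases "r \<le> s")
    case True
    then show ?thesis
      using *[OF True] by simp
  next
    case False
    then show ?thesis
      using *[of s r] by (simp add: power2_commute[of "supou_kernel s _"])
  qed
  then show "integrable m (\<lambda>z. (supou_kernel s z - supou_kernel r z)\<^sup>2)"
    "(LINT z|m. (supou_kernel s z - supou_kernel r z)\<^sup>2) = kernel_modulus \<bar>s - r\<bar>"
    by auto
qed

end

section \<open>The law of the integrated process\<close>

context levy_basis_law
begin

lemma weak_integral_sum:
  assumes "\<And>i. weak_integral (f i) (Y i)"
  shows "weak_integral (\<lambda>z. \<Sum>i<n. c * f i z) (\<lambda>w. \<Sum>i<(n::nat). c * Y i w)"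
proof (induction n)
  case 0
  have "finitely_supported_simple m (\<lambda>_. 0)"
    by (simp add: finitely_supported_simple_def)
  moreover have "I (\<lambda>_. 0) w = 0" for w
    by (auto simp: I_eq intro!: sum.neutral)
  ultimately show ?case
    using weak_integral_simple[of "\<lambda>_. 0" 0] by simp
next
  case (Suc n)
  show ?case
    using weak_integral_lincomb[OF Suc assms[of n], of c] by simp
qed

end

definition integrated_kernel :: "real \<Rightarrow> real \<times> real \<Rightarrow> real" where
  "integrated_kernel t z = (LBINT s:{0..t}. supou_kernel s z)"

lemma (in supou_control) integrated_kernel_measurable [measurable]: "integrated_kernel t \<in> borel_measurable m"
proof -
  have "(\<lambda>(z, s). indicator {0..t} s *\<^sub>R supou_kernel s z) \<in> borel_measurable (m \<Otimes>\<^sub>M lborel)"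
    by measurable
  then show ?thesis
    unfolding integrated_kernel_def set_lebesgue_integral_def
    by (intro lborel.borel_measurable_lebesgue_integral)
qed

locale supou = supou_control \<pi> + levy_basis_law M "\<pi> \<Otimes>\<^sub>M lborel" \<mu> a \<Lambda>
  for \<pi> :: "real measure" and M :: "'w measure" and \<mu> :: "real measure" and a :: real
    and \<Lambda> :: "(real \<times> real) set \<Rightarrow> 'w \<Rightarrow> real" +
  fixes X :: "real \<Rightarrow> 'w \<Rightarrow> real"
  assumes X_integral: "\<And>t. has_levy_integral M (\<pi> \<Otimes>\<^sub>M lborel) \<Lambda> (supou_kernel t) (X t)"
    and X_version: "measurable_process M X"
    and X_square_integrable: "\<And>t. integrable M (\<lambda>w. (X t w)\<^sup>2)"
    and X_mean: "\<And>t. expectation (X t) = 0"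
begin

lemma X_weak_integral: "weak_integral (supou_kernel t) (X t)"
  by (rule weak_integral_if_has_levy_integral[OF X_integral])

lemma X_measurable [measurable]: "X t \<in> borel_measurable M"
  using X_weak_integral by (simp add: weak_integral_def)

lemma X_jointly_measurable [measurable]: "(\<lambda>(t, w). X t w) \<in> borel_measurable (borel \<Otimes>\<^sub>M M)"
  using X_version by (simp add: measurable_process_def)

text \<open>The square integral of the product of kernel and jump factorizes. The kernel contributes
  1 / 2, which is positive and finite, so finite variance of \<open>X 1\<close> passes to the
  jumps.\<close>

lemma integrable_square_levy: "integrable \<mu> (\<lambda>x. x\<^sup>2)"
proof (rule integrableI_nonneg)
  let ?A = "\<integral>\<^sup>+x. ennreal (x\<^sup>2) \<partial>\<mu>"
  have meas: "(\<lambda>x. ennreal (x\<^sup>2)) \<in> borel_measurable \<mu>"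
    by (intro measurable_compose[OF _ measurable_ennreal] borel_measurable_power measurable_ident_sets[OF sets_mu])
  have "(\<integral>\<^sup>+z. \<integral>\<^sup>+x. ennreal ((supou_kernel 1 z * x)\<^sup>2) \<partial>\<mu> \<partial>m) = (\<integral>\<^sup>+z. ennreal ((supou_kernel 1 z)\<^sup>2) * ?A \<partial>m)"
    by (intro nn_integral_cong) (simp add: power_mult_distrib ennreal_mult nn_integral_cmult[OF meas])
  also have "\<dots> = (\<integral>\<^sup>+z. ennreal ((supou_kernel 1 z)\<^sup>2) \<partial>m) * ?A"
    by (rule nn_integral_multc) measurable
  also have "(\<integral>\<^sup>+z. ennreal ((supou_kernel 1 z)\<^sup>2) \<partial>m) = ennreal (1 / 2)"
    using nn_integral_supou_kernel_mult[of 1 1] pi.emeasure_space_1 by (simp add: power2_eq_square)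
  finally have "ennreal (1 / 2) * ?A \<le> ennreal (2 * expectation (\<lambda>w. (X 1 w)\<^sup>2))"
    using nn_integral_square_le_if_weak_integral[OF X_weak_integral X_square_integrable, of 1] by simp
  then have "ennreal (1 / 2) * ?A < \<infinity>"
    by (rule le_less_trans) simp
  then show "?A < \<infinity>"
    by (auto simp: ennreal_mult_less_top)
  show "(\<lambda>x. x\<^sup>2) \<in> borel_measurable \<mu>"
    by (intro borel_measurable_power measurable_ident_sets[OF sets_mu])
qed simp

sublocale square_integrable_levy_basis M "\<pi> \<Otimes>\<^sub>M lborel" \<mu> a \<Lambda>
  by unfold_locales (rule integrable_square_levy)

definition levy_variance :: real where
  "levy_variance = (LINT x|\<mu>. x\<^sup>2)"

lemma levy_variance_nonneg: "0 \<le> levy_variance"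
  by (simp add: levy_variance_def)

lemma X_law: "compensated_poisson_law M Q (\<lambda>z. supou_kernel t (fst z) * snd z) (X t)"
  by (rule weak_integral_law[OF X_weak_integral X_square_integrable X_mean integrable_supou_kernel_square])

lemma X_integrable: "integrable M (X t)"
  by (rule square_integrable_imp_integrable[OF _ X_square_integrable]) simp

lemma weak_integral_second_moment:
  assumes W: "weak_integral f Y" and f: "integrable m (\<lambda>z. (f z)\<^sup>2)"
    and Y: "integrable M (\<lambda>w. (Y w)\<^sup>2)" "expectation Y = 0"
  shows "(\<integral>\<^sup>+w. ennreal ((Y w)\<^sup>2) \<partial>M) \<le> ennreal (2 * ((LINT z|m. (f z)\<^sup>2) * levy_variance))"
proof -
  have "expectation (\<lambda>w. (Y w)\<^sup>2) \<le> 2 * ((LINT z|m. (f z)\<^sup>2) * levy_variance)"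
    unfolding levy_variance_def
    by (rule expectation_square_le_if_weak_integral[OF W Y]) (auto simp: nn_integral_product_square[OF f])
  then show ?thesis
    using Y by (simp add: nn_integral_eq_integral ennreal_leI)
qed

lemma nn_integral_X_square_le: "(\<integral>\<^sup>+w. ennreal ((X s w)\<^sup>2) \<partial>M) \<le> ennreal levy_variance"
proof -
  have "(LINT z|m. (supou_kernel s z)\<^sup>2) = 1 / 2"
    using integral_supou_kernel_mult[of s s] by (simp add: power2_eq_square pi.prob_space)
  then have "2 * ((LINT z|m. (supou_kernel s z)\<^sup>2) * levy_variance) = levy_variance"
    by simp
  then show ?thesis
    using weak_integral_second_moment[OF X_weak_integral integrable_supou_kernel_square X_square_integrable X_mean, of s]
    by (simp only:)
qed

lemma nn_integral_X_diff_square_le: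
  "(\<integral>\<^sup>+w. ennreal ((X s w - X r w)\<^sup>2) \<partial>M) \<le> ennreal (2 * (kernel_modulus \<bar>s - r\<bar> * levy_variance))"
proof -
  have "weak_integral (\<lambda>z. supou_kernel s z + (-1) * supou_kernel r z) (\<lambda>w. X s w + (-1) * X r w)"
    by (intro weak_integral_lincomb X_weak_integral)
  then have W: "weak_integral (\<lambda>z. supou_kernel s z - supou_kernel r z) (\<lambda>w. X s w - X r w)"
    by simp
  have i: "integrable M (\<lambda>w. (X s w - X r w)\<^sup>2)"
    by (intro integrable_diff_square X_square_integrable) measurable
  have "expectation (\<lambda>w. X s w - X r w) = 0"
    using X_integrable by (simp add: X_mean)
  from weak_integral_second_moment[OF W integrable_supou_kernel_diff_square i this] show ?thesis
    by (simp only: integral_supou_kernel_diff_square)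
qed

lemma integrated_process_measurable [measurable]: "integrated_process X t \<in> borel_measurable M"
proof -
  have "(\<lambda>(w, s). indicator {0..t} s *\<^sub>R X s w) \<in> borel_measurable (M \<Otimes>\<^sub>M lborel)"
    by measurable
  then show ?thesis
    unfolding integrated_process_def[abs_def] set_lebesgue_integral_def
    by (intro lborel.borel_measurable_lebesgue_integral)
qed

text \<open>A Fubini theorem for the stochastic integral is avoided. The Riemann sum
  \<open>R n\<close> of the process is the weak integral of the Riemann sum \<open>f n\<close> of
  the kernel with the same nodes, hence has a known law, and both sums converge with an error
  governed by \<open>kernel_modulus\<close>.\<close>

lemma integrated_process_law:
  assumes t: "0 < t"
  shows "compensated_poisson_law M Q (\<lambda>z. integrated_kernel t (fst z) * snd z) (integrated_process X t)"
proof -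
  define h where "h n = t / real (Suc n)" for n
  define R where "R n w = (\<Sum>i<Suc n. h n * X (h n * real i) w)" for n w
  define f where "f n z = (\<Sum>i<Suc n. h n * supou_kernel (h n * real i) z)" for n z
  define w where "w n = kernel_modulus (t / real (Suc n))" for n
  have w0: "w \<longlonglongrightarrow> 0"
    unfolding w_def using t by (intro kernel_modulus_tendsto) simp
  have w: "0 \<le> w n" for n
    unfolding w_def using t by (intro kernel_modulus_nonneg) simp
  have mono: "kernel_modulus \<bar>s - r\<bar> \<le> w n" if "\<bar>s - r\<bar> \<le> t / real (Suc n)" for s r n
    unfolding w_def using that by (intro kernel_modulus_mono) auto
  have [measurable]: "R n \<in> borel_measurable M" "f n \<in> borel_measurable m" for n
    unfolding R_def[abs_def] f_def[abs_def] by measurable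
  have sM: "sigma_finite_measure M" and sm: "sigma_finite_measure m"
    by (unfold_locales)
  have nnR: "(\<integral>\<^sup>+\<omega>. ennreal ((R n \<omega> - integrated_process X t \<omega>)\<^sup>2) \<partial>M) \<le> ennreal (t\<^sup>2 * (2 * (w n * levy_variance)))" for n
    unfolding R_def h_def integrated_process_def
  proof (rule riemann_sum_square_error_le[OF sM X_jointly_measurable t nn_integral_X_square_le levy_variance_nonneg])
    show "0 \<le> 2 * (w n * levy_variance)"
      using w levy_variance_nonneg by simp
    show "(\<integral>\<^sup>+\<omega>. ennreal ((X s \<omega> - X r \<omega>)\<^sup>2) \<partial>M) \<le> ennreal (2 * (w n * levy_variance))"
      if "\<bar>s - r\<bar> \<le> t / real (Suc n)" for s r
      by (rule order_trans[OF nn_integral_X_diff_square_le ennreal_leI])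
         (intro mult_left_mono mult_right_mono mono that levy_variance_nonneg, simp)
  qed simp
  have half: "(\<integral>\<^sup>+z. ennreal ((supou_kernel s z)\<^sup>2) \<partial>m) \<le> ennreal (1 / 2)" for s
    using nn_integral_supou_kernel_mult[of s s] pi.emeasure_space_1 by (simp add: power2_eq_square)
  have nnf: "(\<integral>\<^sup>+z. ennreal ((f n z - integrated_kernel t z)\<^sup>2) \<partial>m) \<le> ennreal (t\<^sup>2 * w n)" for n
    unfolding f_def h_def integrated_kernel_def
  proof (rule riemann_sum_square_error_le[OF sm supou_kernel_measurable2 t half])
    show "(\<integral>\<^sup>+z. ennreal ((supou_kernel s z - supou_kernel r z)\<^sup>2) \<partial>m) \<le> ennreal (w n)"
      if "\<bar>s - r\<bar> \<le> t / real (Suc n)" for s r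
      using mono[OF that] integrable_supou_kernel_diff_square
      by (simp add: nn_integral_eq_integral integral_supou_kernel_diff_square ennreal_leI)
  qed (use w in auto)
  have iR: "integrable M (\<lambda>\<omega>. (R n \<omega> - integrated_process X t \<omega>)\<^sup>2)" for n
    by (rule integrableI_nonneg) (use nnR[of n] in \<open>auto intro: le_less_trans\<close>)
  have if': "integrable m (\<lambda>z. (f n z - integrated_kernel t z)\<^sup>2)" for n
    by (rule integrableI_nonneg) (use nnf[of n] in \<open>auto intro: le_less_trans\<close>)
  have f2: "integrable m (\<lambda>z. (f n z)\<^sup>2)" for n
  proof -
    have "integrable m (\<lambda>z. \<Sum>i<Suc n. \<Sum>j<Suc n. (h n * h n) * (supou_kernel (h n * real i) z * supou_kernel (h n * real j) z))"
      by (intro Bochner_Integration.integrable_sum integrable_mult_right integrable_mult_if_square_integrable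
          integrable_supou_kernel_square) measurable
    then show ?thesis
      unfolding f_def power2_eq_square sum_product by (simp add: mult_ac)
  qed
  have R2: "integrable M (\<lambda>\<omega>. (R n \<omega>)\<^sup>2)" for n
  proof -
    have "integrable M (\<lambda>\<omega>. \<Sum>i<Suc n. \<Sum>j<Suc n. (h n * h n) * (X (h n * real i) \<omega> * X (h n * real j) \<omega>))"
      by (intro Bochner_Integration.integrable_sum integrable_mult_right integrable_mult_if_square_integrable
          X_square_integrable) measurable
    then show ?thesis
      unfolding R_def power2_eq_square sum_product by (simp add: mult_ac)
  qed
  have R0: "expectation (R n) = 0" for n
    unfolding R_def using X_integrable
    by (subst Bochner_Integration.integral_sum) (auto simp: X_mean)
  have law: "compensated_poisson_law M Q (\<lambda>z. f n (fst z) * snd z) (R n)" for n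
  proof (rule weak_integral_law[OF _ R2 R0 f2])
    show "weak_integral (f n) (R n)"
      unfolding f_def[abs_def] R_def[abs_def] by (rule weak_integral_sum) (rule X_weak_integral)
  qed
  have F2: "integrable m (\<lambda>z. (integrated_kernel t z)\<^sup>2)"
    using integrable_diff_square[of "f 0" m "\<lambda>z. f 0 z - integrated_kernel t z"] f2[of 0] if'[of 0] by simp
  show "compensated_poisson_law M Q (\<lambda>z. integrated_kernel t (fst z) * snd z) (integrated_process X t)"
  proof (rule compensated_poisson_law_limit[OF law])
    show "integrable Q (\<lambda>z. (integrated_kernel t (fst z) * snd z)\<^sup>2)"
      by (rule product_square_integrable(1)[OF F2])
    have "(LINT z|Q. (f n (fst z) * snd z - integrated_kernel t (fst z) * snd z)\<^sup>2) \<le> t\<^sup>2 * w n * levy_variance" for n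
    proof -
      have "(LINT z|Q. (f n (fst z) * snd z - integrated_kernel t (fst z) * snd z)\<^sup>2) =
          (LINT z|m. (f n z - integrated_kernel t z)\<^sup>2) * levy_variance"
        using product_square_integrable(2)[OF if'[of n]] by (simp add: levy_variance_def left_diff_distrib)
      also have "\<dots> \<le> t\<^sup>2 * w n * levy_variance"
        using nnf[of n] if'[of n] w[of n]
        by (intro mult_right_mono levy_variance_nonneg) (simp add: nn_integral_eq_integral ennreal_le_iff)
      finally show ?thesis .
    qed
    note le = this
    show "(\<lambda>n. LINT z|Q. (f n (fst z) * snd z - integrated_kernel t (fst z) * snd z)\<^sup>2) \<longlonglongrightarrow> 0"
    proof (rule tendsto_sandwich[OF _ _ tendsto_const])
      have "(\<lambda>n. t\<^sup>2 * w n * levy_variance) \<longlonglongrightarrow> t\<^sup>2 * 0 * levy_variance"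
        by (intro tendsto_intros w0)
      then show "(\<lambda>n. t\<^sup>2 * w n * levy_variance) \<longlonglongrightarrow> 0"
        by simp
      show "\<forall>\<^sub>F n in sequentially. (LINT z|Q. (f n (fst z) * snd z - integrated_kernel t (fst z) * snd z)\<^sup>2) \<le> t\<^sup>2 * w n * levy_variance"
        by (intro always_eventually allI le)
      show "\<forall>\<^sub>F n in sequentially. 0 \<le> (LINT z|Q. (f n (fst z) * snd z - integrated_kernel t (fst z) * snd z)\<^sup>2)"
        by simp
    qed
    show "integrable M (\<lambda>\<omega>. R n \<omega> - integrated_process X t \<omega>)" for n
      by (rule square_integrable_imp_integrable[OF _ iR]) measurable
    have le2: "expectation (\<lambda>\<omega>. \<bar>R n \<omega> - integrated_process X t \<omega>\<bar>) \<le> sqrt (t\<^sup>2 * (2 * (w n * levy_variance)))" for n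
    proof -
      have "expectation (\<lambda>\<omega>. \<bar>R n \<omega> - integrated_process X t \<omega>\<bar>) \<le> sqrt (expectation (\<lambda>\<omega>. (R n \<omega> - integrated_process X t \<omega>)\<^sup>2))"
        by (rule expectation_abs_le_sqrt[OF _ iR]) measurable
      also have "\<dots> \<le> sqrt (t\<^sup>2 * (2 * (w n * levy_variance)))"
        using nnR[of n] iR[of n] w[of n] levy_variance_nonneg
        by (intro real_sqrt_le_mono) (simp add: nn_integral_eq_integral ennreal_le_iff)
      finally show ?thesis .
    qed
    show "(\<lambda>n. expectation (\<lambda>\<omega>. \<bar>R n \<omega> - integrated_process X t \<omega>\<bar>)) \<longlonglongrightarrow> 0"
    proof (rule tendsto_sandwich[OF _ _ tendsto_const])
      have "(\<lambda>n. sqrt (t\<^sup>2 * (2 * (w n * levy_variance)))) \<longlonglongrightarrow> sqrt (t\<^sup>2 * (2 * (0 * levy_variance)))"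
        by (intro tendsto_intros w0)
      then show "(\<lambda>n. sqrt (t\<^sup>2 * (2 * (w n * levy_variance)))) \<longlonglongrightarrow> 0"
        by simp
      show "\<forall>\<^sub>F n in sequentially. expectation (\<lambda>\<omega>. \<bar>R n \<omega> - integrated_process X t \<omega>\<bar>) \<le> sqrt (t\<^sup>2 * (2 * (w n * levy_variance)))"
        by (intro always_eventually allI le2)
      show "\<forall>\<^sub>F n in sequentially. 0 \<le> expectation (\<lambda>\<omega>. \<bar>R n \<omega> - integrated_process X t \<omega>\<bar>)"
        by simp
    qed
    show "(\<lambda>z. integrated_kernel t (fst z) * snd z) \<in> borel_measurable Q" "integrated_process X t \<in> borel_measurable M"
      by measurable
  qed
qed

end

section \<open>Moments of the Levy measure\<close>

text \<open>The difference quotient at 0 is again analytic, as its singularity is removable; each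
  such division raises the order of approximation by one.\<close>

lemma analytic_at_0_polynomial_approx:
  fixes g :: "complex \<Rightarrow> complex"
  assumes "g analytic_on {0}"
  shows "\<exists>p C. \<forall>\<^sub>F z in nhds 0. norm (g z - poly p z) \<le> C * norm z ^ n"
  using assms
proof (induction n arbitrary: g)
  case 0
  have "isCont g 0"
    using 0 by (meson analytic_at_imp_isCont)
  then have "(g \<longlongrightarrow> g 0) (nhds 0)"
    by (simp add: continuous_within tendsto_at_within_iff_tendsto_nhds)
  then have "((\<lambda>z. norm (g z)) \<longlongrightarrow> norm (g 0)) (nhds 0)"
    by (rule tendsto_norm)
  then have "\<forall>\<^sub>F z in nhds 0. norm (g z) < norm (g 0) + 1"
    by (rule order_tendstoD) simp
  then have "\<forall>\<^sub>F z in nhds 0. norm (g z - poly 0 z) \<le> (norm (g 0) + 1) * norm z ^ 0"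
    by eventually_elim simp
  then show ?case
    by blast
next
  case (Suc n)
  define g1 where "g1 z = (if z = 0 then deriv g 0 else (g z - g 0) / z)" for z
  have "g1 analytic_on {0}"
  proof (rule pole_theorem_analytic_0[where g = "\<lambda>z. g z - g 0" and a = 0])
    show "(\<lambda>z. g z - g 0) analytic_on {0}"
      using Suc.prems by (intro analytic_intros)
    have "g field_differentiable at 0"
      using Suc.prems by (rule analytic_on_imp_differentiable_at) simp
    then show "g1 0 = deriv (\<lambda>z. g z - g 0) 0"
      by (simp add: g1_def)
  qed (auto simp: g1_def intro!: exI[of _ 1])
  from Suc.IH[OF this] obtain p C where pC: "\<forall>\<^sub>F z in nhds 0. norm (g1 z - poly p z) \<le> C * norm z ^ n"
    by blast
  have "\<forall>\<^sub>F z in nhds 0. norm (g z - poly (pCons (g 0) p) z) \<le> C * norm z ^ Suc n"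
    using pC
  proof eventually_elim
    case (elim z)
    have "g z - poly (pCons (g 0) p) z = z * (g1 z - poly p z)"
    proof -
      have "z * g1 z = g z - g 0"
        by (simp add: g1_def)
      then show ?thesis
        by (simp add: right_diff_distrib)
    qed
    then have "norm (g z - poly (pCons (g 0) p) z) = norm z * norm (g1 z - poly p z)"
      by (simp only: norm_mult)
    also have "\<dots> \<le> norm z * (C * norm z ^ n)"
      using elim by (intro mult_left_mono) auto
    finally show ?case
      by (simp add: mult_ac)
  qed
  then show ?case
    by blast
qed

text \<open>The compensator is a polynomial of degree at most 1 in \<open>u\<close>, which
  differences of order at least 2 annihilate. Compensated and plain exponentials therefore have the
  same central differences.\<close>

lemma central_diff_comp_exp:
  assumes "0 < k"
  shows "central_diff k (\<lambda>u. comp_exp (u * y)) h = (-1)^k * of_real ((2 - 2 * cos (h * y)) ^ k)"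
proof -
  have "comp_exp (u * y) = iexp (u * y) + ((-1) * of_real u ^ 0 + (- \<i> * of_real y) * of_real u ^ 1)" for u
    by (simp add: comp_exp_def algebra_simps)
  then have "central_diff k (\<lambda>u. comp_exp (u * y)) h =
      central_diff k (\<lambda>u. iexp (u * y) + ((-1) * of_real u ^ 0 + (- \<i> * of_real y) * of_real u ^ 1)) h"
    by (simp only:)
  moreover have "central_diff k (\<lambda>u. of_real u ^ 0) h = 0" "central_diff k (\<lambda>u. of_real u ^ 1) h = 0"
    using assms by (intro central_diff_power; simp)+
  ultimately show ?thesis
    by (simp only: central_diff_add central_diff_mult central_diff_iexp mult_zero_right add_0_right)
qed

text \<open>The central differences are taken of the cumulant function rather than of the
  characteristic function. They integrate a nonnegative function against the intensity, so moments
  of the jumps appear directly.\<close>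

lemma (in compensated_poisson_law) nn_integral_even_power_finite:
  assumes k: "0 < k" and analytic: "analytic_near_0 (cumulant_function (distr M borel Y))"
  shows "(\<integral>\<^sup>+z. ennreal (G z ^ (2 * k)) \<partial>Q) < \<infinity>"
proof -
  let ?K = "\<lambda>u. CLINT z|Q. comp_exp (u * G z)"
  obtain g where g: "g analytic_on {0}" "\<forall>\<^sub>F u in nhds 0. ?K u = g (complex_of_real u)"
    using analytic by (auto simp: analytic_near_0_def cumulant_function_Y)
  obtain p C where pC: "\<forall>\<^sub>F z in nhds 0. norm (g z - poly p z) \<le> C * norm z ^ (2 * k + 1)"
    using analytic_at_0_polynomial_approx[OF g(1)] by blast
  have "((\<lambda>u. complex_of_real u) \<longlongrightarrow> of_real 0) (nhds 0)"
    by (intro tendsto_of_real filterlim_ident)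
  then have "\<forall>\<^sub>F u in nhds 0. norm (g (of_real u) - poly p (of_real u)) \<le> C * norm (complex_of_real u) ^ (2 * k + 1)"
    using eventually_compose_filterlim[OF pC, of complex_of_real "nhds 0"] by simp
  then have R: "\<forall>\<^sub>F u in nhds 0. norm (?K u - poly p (of_real u)) \<le> C * \<bar>u\<bar> ^ (2 * k + 1)"
    using g(2) by eventually_elim simp
  have diff: "(\<integral>\<^sup>+z. ennreal ((2 - 2 * cos (h * G z)) ^ k) \<partial>Q) = ennreal (norm (central_diff k ?K h))" for h
  proof -
    have cd: "central_diff k (\<lambda>u. comp_exp (u * G z)) h = (-1)^k * of_real ((2 - 2 * cos (h * G z)) ^ k)" for z
      by (rule central_diff_comp_exp[OF k])
    have i: "integrable Q (\<lambda>z. central_diff k (\<lambda>u. comp_exp (u * G z)) h)"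
      unfolding central_diff_def by (intro Bochner_Integration.integrable_sum integrable_mult_right integrable_exponent)
    have pos: "0 \<le> (2 - 2 * cos (h * G z)) ^ k" for z
      by simp
    have "integrable Q (\<lambda>z. norm (central_diff k (\<lambda>u. comp_exp (u * G z)) h))"
      using i by (rule integrable_norm)
    then have i': "integrable Q (\<lambda>z. (2 - 2 * cos (h * G z)) ^ k)"
      unfolding cd using pos by (simp add: norm_mult norm_power del: of_real_power)
    have "central_diff k ?K h = (CLINT z|Q. central_diff k (\<lambda>u. comp_exp (u * G z)) h)"
      unfolding central_diff_def
      by (subst Bochner_Integration.integral_sum) (intro integrable_mult_right integrable_exponent, simp)
    also have "\<dots> = (-1)^k * of_real (LINT z|Q. (2 - 2 * cos (h * G z)) ^ k)"
      unfolding cd by (subst integral_mult_right_zero) (simp only: integral_complex_of_real)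
    also have "norm \<dots> = (LINT z|Q. (2 - 2 * cos (h * G z)) ^ k)"
      by (simp add: norm_mult norm_power integral_nonneg_AE)
    finally show ?thesis
      using i' by (subst nn_integral_eq_integral) auto
  qed
  show ?thesis
    by (rule le_less_trans[OF nn_integral_even_power_le_central_diff[OF G diff R]]) simp
qed

context supou
begin

lemma nn_integral_supou_kernel_powr:
  assumes "0 < k"
  shows "(\<integral>\<^sup>+z. ennreal (supou_kernel t z ^ k) \<partial>m) = ennreal (1 / real k)"
proof -
  have "(\<integral>\<^sup>+z. ennreal (supou_kernel t z ^ k) \<partial>m) = (\<integral>\<^sup>+\<xi>. \<integral>\<^sup>+u. ennreal (supou_kernel t (\<xi>, u) ^ k) \<partial>lborel \<partial>\<pi>)"
    by (subst lborel.nn_integral_fst[symmetric]) auto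
  also have "\<dots> = (\<integral>\<^sup>+\<xi>. ennreal (1 / real k) \<partial>\<pi>)"
  proof (rule nn_integral_cong)
    fix \<xi>
    have "(\<integral>\<^sup>+u. ennreal (supou_kernel t (\<xi>, u) ^ k) \<partial>lborel) =
        (\<integral>\<^sup>+u. ennreal (exp (- real k * (\<xi> * t))) * (ennreal (exp (real k * u)) * indicator {..\<xi> * t} u) \<partial>lborel)"
      using assms
      by (intro nn_integral_cong)
         (auto simp: supou_kernel_eq indicator_def ennreal_mult[symmetric] exp_add[symmetric] exp_of_nat_mult[symmetric] algebra_simps)
    also have "\<dots> = ennreal (exp (- real k * (\<xi> * t))) * ennreal (exp (real k * (\<xi> * t)) / real k)"
      using assms by (subst nn_integral_cmult) (auto simp: nn_integral_exp_atMost)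
    also have "\<dots> = ennreal (1 / real k)"
      by (simp add: ennreal_mult[symmetric] exp_add[symmetric])
    finally show "(\<integral>\<^sup>+u. ennreal (supou_kernel t (\<xi>, u) ^ k) \<partial>lborel) = ennreal (1 / real k)" .
  qed
  also have "\<dots> = ennreal (1 / real k)"
    by (simp add: pi.emeasure_space_1)
  finally show ?thesis .
qed

lemma ident_measurable_levy: "(\<lambda>x. x) \<in> borel_measurable \<mu>"
  by (rule measurable_ident_sets[OF sets_mu])

lemma integrable_even_power_levy:
  assumes k: "0 < k" and analytic: "analytic_near_0 (cumulant_function (distr M borel (X 1)))"
  shows "integrable \<mu> (\<lambda>x. x ^ (2 * k))"
proof (rule integrableI_nonneg)
  show meas: "(\<lambda>x. x ^ (2 * k)) \<in> borel_measurable \<mu>"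
    by (intro borel_measurable_power ident_measurable_levy)
  then have meas': "(\<lambda>x. ennreal (x ^ (2 * k))) \<in> borel_measurable \<mu>"
    by (intro measurable_compose[OF _ measurable_ennreal])
  let ?A = "\<integral>\<^sup>+x. ennreal (x ^ (2 * k)) \<partial>\<mu>"
  have "(\<integral>\<^sup>+z. ennreal ((supou_kernel 1 (fst z) * snd z) ^ (2 * k)) \<partial>Q) =
      (\<integral>\<^sup>+z. \<integral>\<^sup>+x. ennreal ((supou_kernel 1 z * x) ^ (2 * k)) \<partial>\<mu> \<partial>m)"
    by (subst mu.nn_integral_fst[symmetric]) auto
  also have "\<dots> = (\<integral>\<^sup>+z. ennreal (supou_kernel 1 z ^ (2 * k)) * ?A \<partial>m)"
    by (intro nn_integral_cong) (simp add: power_mult_distrib ennreal_mult nn_integral_cmult[OF meas'])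
  also have "\<dots> = (\<integral>\<^sup>+z. ennreal (supou_kernel 1 z ^ (2 * k)) \<partial>m) * ?A"
    by (rule nn_integral_multc) measurable
  also have "\<dots> = ennreal (1 / real (2 * k)) * ?A"
    using k by (subst nn_integral_supou_kernel_powr) auto
  finally have "ennreal (1 / real (2 * k)) * ?A < \<infinity>"
    using compensated_poisson_law.nn_integral_even_power_finite[OF X_law k analytic] by simp
  then show "?A < \<infinity>"
    using k by (auto simp: ennreal_mult_less_top)
qed simp

lemma integrable_abs_power_levy:
  assumes j: "2 \<le> j" and analytic: "analytic_near_0 (cumulant_function (distr M borel (X 1)))"
  shows "integrable \<mu> (\<lambda>x. \<bar>x\<bar> ^ j)"
proof (rule Bochner_Integration.integrable_bound)
  show "integrable \<mu> (\<lambda>x. x\<^sup>2 + x ^ (2 * j))"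
    using integrable_square_levy integrable_even_power_levy[OF _ analytic, of j] j by auto
  show "AE x in \<mu>. norm (\<bar>x\<bar> ^ j) \<le> norm (x\<^sup>2 + x ^ (2 * j))"
  proof (rule AE_I2)
    fix x :: real
    have e: "x\<^sup>2 = \<bar>x\<bar>\<^sup>2" "x ^ (2 * j) = \<bar>x\<bar> ^ (2 * j)"
      by (simp_all add: power_even_abs)
    have "\<bar>x\<bar> ^ j \<le> \<bar>x\<bar>\<^sup>2 + \<bar>x\<bar> ^ (2 * j)"
    proof (cases "\<bar>x\<bar> \<le> 1")
      case True
      then have "\<bar>x\<bar> ^ j \<le> \<bar>x\<bar>\<^sup>2"
        using j by (intro power_decreasing) auto
      then show ?thesis
        by (simp add: add_increasing2)
    next
      case False
      then have "\<bar>x\<bar> ^ j \<le> \<bar>x\<bar> ^ (2 * j)"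
        by (intro power_increasing) auto
      then show ?thesis
        by (simp add: add_increasing)
    qed
    then show "norm (\<bar>x\<bar> ^ j) \<le> norm (x\<^sup>2 + x ^ (2 * j))"
      unfolding e by simp
  qed
  show "(\<lambda>x. \<bar>x\<bar> ^ j) \<in> borel_measurable \<mu>"
    by (intro borel_measurable_power borel_measurable_abs ident_measurable_levy)
qed

end

subsection \<open>Small jumps\<close>

lemma half_power_eq: "(1/2) ^ k = (2::real) powr (- real k)"
  by (subst powr_minus, subst powr_realpow, simp, simp only: inverse_eq_divide power_one_over)


lemma power_tail_at_0_tendsto:
  assumes "power_tail_at_0 T c \<beta>"
  shows "((\<lambda>r. r powr \<beta> * T r) \<longlongrightarrow> c) (at_right 0)"
proof (cases "c = 0")
  case False
  then have "T \<sim>[at_right 0] (\<lambda>x. c * x powr (- \<beta>))"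
    using assms by (simp add: power_tail_at_0_def)
  then have "((\<lambda>x. if T x = 0 \<and> c * x powr (- \<beta>) = 0 then 1 else T x / (c * x powr (- \<beta>))) \<longlongrightarrow> 1) (at_right 0)"
    by (simp add: asymp_equiv_def)
  then have "((\<lambda>x. c * (if T x = 0 \<and> c * x powr (- \<beta>) = 0 then 1 else T x / (c * x powr (- \<beta>)))) \<longlongrightarrow> c * 1) (at_right 0)"
    by (intro tendsto_intros)
  moreover have "\<forall>\<^sub>F x in at_right 0. c * (if T x = 0 \<and> c * x powr (- \<beta>) = 0 then 1 else T x / (c * x powr (- \<beta>))) = x powr \<beta> * T x"
    using eventually_at_right_less[of "0::real"]
    by eventually_elim (use False in \<open>auto simp: powr_minus field_simps\<close>)
  ultimately show ?thesis
    by (simp add: Lim_transform_eventually)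
qed (use assms in \<open>simp add: power_tail_at_0_def\<close>)

lemma eventually_at_right_0_obtain:
  fixes P :: "real \<Rightarrow> bool"
  assumes "\<forall>\<^sub>F r in at_right 0. P r"
  obtains r0 where "0 < r0" "\<And>r. 0 < r \<Longrightarrow> r \<le> r0 \<Longrightarrow> P r"
proof -
  from assms obtain b where b: "0 < b" "\<And>r. 0 < r \<Longrightarrow> r < b \<Longrightarrow> P r"
    by (auto simp: eventually_at_right_field)
  show ?thesis
    by (rule that[of "b / 2"]) (use b in auto)
qed

locale levy_power_tail =
  fixes \<mu> :: "real measure" and \<beta> cp cm :: real
  assumes levy: "levy_measure \<mu>" and \<beta>: "0 < \<beta>"
    and c: "0 \<le> cp" "0 \<le> cm" "0 < cp + cm"
    and right_tail: "power_tail_at_0 (\<lambda>x. measure \<mu> {x..}) cp \<beta>"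
    and left_tail: "power_tail_at_0 (\<lambda>x. measure \<mu> {..-x}) cm \<beta>"
begin

lemma sets_levy [simp]: "sets \<mu> = sets borel"
  by (rule sets_levy_measure[OF levy])

lemma emeasure_tail_finite:
  assumes "0 < r"
  shows "emeasure \<mu> {x. r \<le> \<bar>x\<bar>} < \<infinity>" "emeasure \<mu> {r..} < \<infinity>" "emeasure \<mu> {..-r} < \<infinity>"
proof -
  show *: "emeasure \<mu> {x. r \<le> \<bar>x\<bar>} < \<infinity>"
    by (rule emeasure_levy_measure_finite[OF levy assms])
  have "emeasure \<mu> {r..} \<le> emeasure \<mu> {x. r \<le> \<bar>x\<bar>}" "emeasure \<mu> {..-r} \<le> emeasure \<mu> {x. r \<le> \<bar>x\<bar>}"
    by (intro emeasure_mono; auto)+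
  with * show "emeasure \<mu> {r..} < \<infinity>" "emeasure \<mu> {..-r} < \<infinity>"
    by auto
qed

lemma two_sided_tail_bound:
  obtains C where "0 < C" "\<And>r. 0 < r \<Longrightarrow> r \<le> 1 \<Longrightarrow> emeasure \<mu> {x. r \<le> \<bar>x\<bar>} \<le> ennreal (C * r powr (- \<beta>))"
proof -
  define T where "T r = measure \<mu> {r..} + measure \<mu> {..-r}" for r
  have "((\<lambda>r. r powr \<beta> * measure \<mu> {r..} + r powr \<beta> * measure \<mu> {..-r}) \<longlongrightarrow> cp + cm) (at_right 0)"
    by (intro tendsto_add power_tail_at_0_tendsto right_tail left_tail)
  then have "\<forall>\<^sub>F r in at_right 0. r powr \<beta> * measure \<mu> {r..} + r powr \<beta> * measure \<mu> {..-r} < cp + cm + 1"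
    by (rule order_tendstoD) simp
  then obtain r0 where r0: "0 < r0" "\<And>r. 0 < r \<Longrightarrow> r \<le> r0 \<Longrightarrow> r powr \<beta> * T r < cp + cm + 1"
    by (rule eventually_at_right_0_obtain) (auto simp: T_def distrib_left)
  have eT: "emeasure \<mu> {x. r \<le> \<bar>x\<bar>} \<le> ennreal (T r)" if "0 < r" for r
  proof -
    have "{x. r \<le> \<bar>x\<bar>} = {r..} \<union> {..-r}"
      by auto
    then have "emeasure \<mu> {x. r \<le> \<bar>x\<bar>} \<le> emeasure \<mu> {r..} + emeasure \<mu> {..-r}"
      by (simp add: emeasure_subadditive)
    also have "\<dots> = ennreal (T r)"
      using emeasure_tail_finite[OF that] by (simp add: T_def emeasure_eq_ennreal_measure)
    finally show ?thesis .
  qed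
  \<comment> \<open>The asymptotics cover radii up to \<open>r0\<close> only. The summand
    \<open>T r0\<close> covers the remaining radii up to 1, where \<open>r powr (- \<beta>)\<close>
    is at least 1.\<close>
  define C where "C = cp + cm + 1 + T r0"
  have T0: "0 \<le> T r0"
    by (simp add: T_def)
  show ?thesis
  proof (rule that[of C])
    show "0 < C"
      using c T0 by (simp add: C_def)
    fix r :: real assume r: "0 < r" "r \<le> 1"
    show "emeasure \<mu> {x. r \<le> \<bar>x\<bar>} \<le> ennreal (C * r powr (- \<beta>))"
    proof (cases "r \<le> r0")
      case True
      have "T r \<le> (cp + cm + 1) * r powr (- \<beta>)"
        using r0(2)[OF r(1) True] r by (simp add: powr_minus field_simps)
      also have "\<dots> \<le> C * r powr (- \<beta>)"
        using T0 by (intro mult_right_mono) (auto simp: C_def)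
      finally show ?thesis
        using eT[OF r(1)] by (meson ennreal_leI order_trans)
    next
      case False
      have "emeasure \<mu> {x. r \<le> \<bar>x\<bar>} \<le> emeasure \<mu> {x. r0 \<le> \<bar>x\<bar>}"
        using False by (intro emeasure_mono) auto
      also have "\<dots> \<le> ennreal (T r0)"
        by (rule eT[OF r0(1)])
      also have "T r0 \<le> C * 1"
        using c by (simp add: C_def)
      also have "\<dots> \<le> C * r powr (- \<beta>)"
      proof (intro mult_left_mono)
        show "1 \<le> r powr (- \<beta>)"
          using r \<beta> powr_mono'[of "- \<beta>" 0 r] by simp
        show "0 \<le> C"
          using c T0 by (simp add: C_def)
      qed
      finally show ?thesis
        by (simp add: ennreal_leI)
    qed
  qed
qed

text \<open>Large jumps are dominated by the square. A jump of size between
  \<open>(1/2) ^ Suc n\<close> and \<open>(1/2) ^ n\<close> is charged to the whole tail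
  \<open>A n\<close>, whose measure grows at most like \<open>2 powr (n * \<beta>)\<close>; against
  the decay \<open>2 powr (- n * g)\<close> this is summable because
  \<open>\<beta> < g\<close>.\<close>

lemma integrable_abs_powr_levy:
  assumes g: "\<beta> < g" "g \<le> 2" and S2: "integrable \<mu> (\<lambda>x. x\<^sup>2)"
  shows "integrable \<mu> (\<lambda>x. \<bar>x\<bar> powr g)"
proof (rule integrableI_nonneg)
  note [measurable_cong] = sets_levy
  obtain C where C: "0 < C" "\<And>r. 0 < r \<Longrightarrow> r \<le> 1 \<Longrightarrow> emeasure \<mu> {x. r \<le> \<bar>x\<bar>} \<le> ennreal (C * r powr (- \<beta>))"
    by (rule two_sided_tail_bound) blast
  show "(\<lambda>x. \<bar>x\<bar> powr g) \<in> borel_measurable \<mu>"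
    by measurable
  define A where "A n = {x::real. (1/2) ^ Suc n \<le> \<bar>x\<bar>}" for n :: nat
  have [measurable]: "A n \<in> sets \<mu>" for n
    unfolding A_def by measurable
  have pointwise: "ennreal (\<bar>x\<bar> powr g) \<le> ennreal (x\<^sup>2) + (\<Sum>n. ennreal (((1/2) ^ n) powr g) * indicator (A n) x)" for x
  proof -
    consider "x = 0" | "1 < \<bar>x\<bar>" | "0 < \<bar>x\<bar>" "\<bar>x\<bar> \<le> 1"
      by linarith
    then show ?thesis
    proof cases
      case 1
      then show ?thesis
        by simp
    next
      case 2
      then have "\<bar>x\<bar> powr g \<le> \<bar>x\<bar> powr 2"
        using g by (intro powr_mono) auto
      also have "\<dots> = x\<^sup>2"
        using 2 by (simp add: powr_numeral)
      finally show ?thesis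
        by (simp add: add_increasing2 ennreal_leI)
    next
      case 3
      define n where "n = nat \<lfloor>- log 2 \<bar>x\<bar>\<rfloor>"
      have "0 \<le> - log 2 \<bar>x\<bar>"
        using 3 by simp
      then have n: "real n \<le> - log 2 \<bar>x\<bar>" "- log 2 \<bar>x\<bar> < real n + 1"
        unfolding n_def by linarith+
      have x: "2 powr (log 2 \<bar>x\<bar>) = \<bar>x\<bar>"
        by (rule powr_log_cancel) (use 3 in auto)
      have le: "\<bar>x\<bar> \<le> (1/2) ^ n"
      proof -
        have "2 powr (log 2 \<bar>x\<bar>) \<le> (2::real) powr (- real n)"
          using n by (intro powr_mono) auto
        then show ?thesis
          by (simp only: x half_power_eq)
      qed
      have ge: "(1/2) ^ Suc n \<le> \<bar>x\<bar>"
      proof -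
        have "(2::real) powr (- real (Suc n)) \<le> 2 powr (log 2 \<bar>x\<bar>)"
          using n by (intro powr_mono) auto
        then show ?thesis
          by (simp only: x half_power_eq)
      qed
      have "ennreal (\<bar>x\<bar> powr g) \<le> ennreal (((1/2) ^ n) powr g) * indicator (A n) x"
        using le ge g \<beta> by (simp add: A_def ennreal_leI powr_mono2)
      also have "\<dots> \<le> (\<Sum>n. ennreal (((1/2) ^ n) powr g) * indicator (A n) x)"
        by (rule ennreal_le_suminf)
      finally show ?thesis
        by (simp add: add_increasing)
    qed
  qed
  have term_le: "(\<integral>\<^sup>+x. ennreal (((1/2) ^ n) powr g) * indicator (A n) x \<partial>\<mu>) \<le> ennreal (C * 2 powr \<beta> * (2 powr (\<beta> - g)) ^ n)" for n
  proof -
    have "(\<integral>\<^sup>+x. ennreal (((1/2) ^ n) powr g) * indicator (A n) x \<partial>\<mu>) = ennreal (((1/2) ^ n) powr g) * emeasure \<mu> (A n)"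
      by (rule nn_integral_cmult_indicator) measurable
    also have "\<dots> \<le> ennreal (((1/2) ^ n) powr g) * ennreal (C * ((1/2) ^ Suc n) powr (- \<beta>))"
      unfolding A_def by (intro mult_left_mono C(2) power_le_one) auto
    also have "\<dots> = ennreal (((1/2) ^ n) powr g * (C * ((1/2) ^ Suc n) powr (- \<beta>)))"
      by (rule ennreal_mult'[symmetric]) simp
    also have "((1/2) ^ n) powr g * (C * ((1/2) ^ Suc n) powr (- \<beta>)) = C * 2 powr \<beta> * (2 powr (\<beta> - g)) ^ n"
    proof -
      have "(2 powr (\<beta> - g)) ^ n = 2 powr (real n * (\<beta> - g))"
        by (simp add: powr_realpow[symmetric] powr_powr mult.commute)
      then show ?thesis
        unfolding half_power_eq powr_powr by (simp add: powr_add[symmetric] algebra_simps)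
    qed
    finally show ?thesis .
  qed
  have r: "2 powr (\<beta> - g) < (1::real)"
    using g by (simp add: powr_less_one)
  have "(\<integral>\<^sup>+x. ennreal (\<bar>x\<bar> powr g) \<partial>\<mu>) \<le>
      (\<integral>\<^sup>+x. ennreal (x\<^sup>2) + (\<Sum>n. ennreal (((1/2) ^ n) powr g) * indicator (A n) x) \<partial>\<mu>)"
    by (intro nn_integral_mono pointwise)
  also have "\<dots> = (\<integral>\<^sup>+x. ennreal (x\<^sup>2) \<partial>\<mu>) + (\<Sum>n. \<integral>\<^sup>+x. ennreal (((1/2) ^ n) powr g) * indicator (A n) x \<partial>\<mu>)"
    by (subst nn_integral_add) (auto simp: nn_integral_suminf)
  also have "\<dots> \<le> (\<integral>\<^sup>+x. ennreal (x\<^sup>2) \<partial>\<mu>) + (\<Sum>n. ennreal (C * 2 powr \<beta> * (2 powr (\<beta> - g)) ^ n))"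
    by (intro add_left_mono suminf_le term_le) auto
  also have "(\<Sum>n. ennreal (C * 2 powr \<beta> * (2 powr (\<beta> - g)) ^ n)) = ennreal (C * 2 powr \<beta> * (1 / (1 - 2 powr (\<beta> - g))))"
    using r C by (intro suminf_ennreal_eq sums_mult geometric_sums) auto
  also have "(\<integral>\<^sup>+x. ennreal (x\<^sup>2) \<partial>\<mu>) + \<dots> < \<infinity>"
    using S2 by (simp add: nn_integral_eq_integral)
  finally show "(\<integral>\<^sup>+x. ennreal (\<bar>x\<bar> powr g) \<partial>\<mu>) < \<infinity>" .
qed simp

text \<open>Jumps of size between \<open>1 / v\<close> and \<open>2 / v\<close> suffice: there 1 -
  cos is bounded below, and the measure of this shell is the difference of the tails at
  \<open>r\<close> and \<open>2 * r\<close> with \<open>r = 1 / v\<close>, which is of exact order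
  \<open>v powr \<beta>\<close>.\<close>

lemma one_minus_cos_lower_bound:
  assumes int: "\<And>u. integrable \<mu> (\<lambda>x. 1 - cos (u * x))"
  obtains c0 v0 where "0 < c0" "0 < v0" "\<And>v. v0 \<le> v \<Longrightarrow> c0 * v powr \<beta> \<le> (LINT x|\<mu>. 1 - cos (v * x))"
proof -
  note [measurable_cong] = sets_levy
  text \<open>Both tails are treated at once: \<open>A r\<close> is the set of the jumps of size at least \<open>r\<close> on the
    side whose constant is positive.\<close>
  obtain A :: "real \<Rightarrow> real set" and c1 where A: "0 < c1" "((\<lambda>r. r powr \<beta> * measure \<mu> (A r)) \<longlongrightarrow> c1) (at_right 0)"
    "\<And>r. A r \<in> sets \<mu>" "\<And>r. 0 < r \<Longrightarrow> emeasure \<mu> (A r) < \<infinity>" "\<And>r s. r \<le> s \<Longrightarrow> A s \<subseteq> A r"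
    "\<And>r s x. 0 < r \<Longrightarrow> x \<in> A r - A s \<Longrightarrow> r \<le> \<bar>x\<bar> \<and> \<bar>x\<bar> \<le> s"
  proof (cases "0 < cp")
    case True
    show ?thesis
      by (rule that[of cp "\<lambda>r. {r..}"])
         (use True emeasure_tail_finite power_tail_at_0_tendsto[OF right_tail] in auto)
  next
    case False
    then have "0 < cm"
      using c by simp
    then show ?thesis
      by (rule that[of cm "\<lambda>r. {..-r}"])
         (use emeasure_tail_finite power_tail_at_0_tendsto[OF left_tail] in auto)
  qed
  \<comment> \<open>Half of the limit of \<open>r powr \<beta>\<close> times the measure of the
    shell from \<open>r\<close> to \<open>2 * r\<close>, hence a strict lower bound for small
    \<open>r\<close>.\<close>
  define c2 where "c2 = c1 * (1 - 2 powr (- \<beta>)) / 2"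
  have "2 powr (- \<beta>) < (1::real)"
    using \<beta> by (simp add: powr_less_one)
  then have c2: "0 < c2"
    using A(1) by (simp add: c2_def)
  have "((\<lambda>r. (2 * r) powr \<beta> * measure \<mu> (A (2 * r))) \<longlongrightarrow> c1) (at_right 0)"
  proof (rule filterlim_compose[OF A(2)])
    have "((\<lambda>r. 2 * r) \<longlongrightarrow> 2 * 0) (at_right (0::real))"
      by (intro tendsto_intros)
    then show "filterlim (\<lambda>r. 2 * r) (at_right 0) (at_right (0::real))"
      by (auto simp: filterlim_at eventually_at_right_less intro: eventually_mono[OF eventually_at_right_less])
  qed
  then have "((\<lambda>r. r powr \<beta> * measure \<mu> (A r) - 2 powr (- \<beta>) * ((2 * r) powr \<beta> * measure \<mu> (A (2 * r)))) \<longlongrightarrow>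
      c1 - 2 powr (- \<beta>) * c1) (at_right 0)"
    by (intro tendsto_intros A)
  moreover have "c1 - 2 powr (- \<beta>) * c1 = 2 * c2"
    by (simp add: c2_def algebra_simps)
  then have "c2 < c1 - 2 powr (- \<beta>) * c1"
    using c2 by simp
  ultimately have "\<forall>\<^sub>F r in at_right 0. c2 < r powr \<beta> * measure \<mu> (A r) - 2 powr (- \<beta>) * ((2 * r) powr \<beta> * measure \<mu> (A (2 * r)))"
    by (rule order_tendstoD)
  then obtain r0 where r0: "0 < r0" "\<And>r. 0 < r \<Longrightarrow> r \<le> r0 \<Longrightarrow>
      c2 < r powr \<beta> * measure \<mu> (A r) - 2 powr (- \<beta>) * ((2 * r) powr \<beta> * measure \<mu> (A (2 * r)))"
    by (rule eventually_at_right_0_obtain) blast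
  show ?thesis
  proof (rule that[of "c2 * (1 - cos 1)" "1 / r0"])
    show "0 < c2 * (1 - cos 1)" "0 < 1 / r0"
      using c2 r0 cos_one_less_one by simp_all
    fix v assume v: "1 / r0 \<le> v"
    then have vpos: "0 < v"
      using r0 by (meson less_le_trans zero_less_divide_1_iff)
    define r where "r = 1 / v"
    have r: "0 < r" "r \<le> r0"
      using v vpos r0 by (auto simp: r_def field_simps)
    define B where "B = A r - A (2 * r)"
    have B: "B \<in> sets \<mu>" "emeasure \<mu> B < \<infinity>"
    proof -
      show "B \<in> sets \<mu>"
        unfolding B_def by (intro sets.Diff A)
      have "emeasure \<mu> B \<le> emeasure \<mu> (A r)"
        unfolding B_def by (intro emeasure_mono A) auto
      then show "emeasure \<mu> B < \<infinity>"
        using A(4)[OF r(1)] by (rule le_less_trans)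
    qed
    have mB: "measure \<mu> B = measure \<mu> (A r) - measure \<mu> (A (2 * r))"
      unfolding B_def using A(4)[OF r(1)] A(5)[of r "2 * r"] r A(3)
      by (intro measure_Diff) auto
    have "(2 * r) powr \<beta> = 2 powr \<beta> * r powr \<beta>"
      using r by (simp add: powr_mult)
    then have "c2 < r powr \<beta> * measure \<mu> B"
      using r0(2)[OF r] by (simp add: mB powr_minus field_simps)
    then have low: "c2 * v powr \<beta> \<le> measure \<mu> B"
      using vpos by (simp add: r_def powr_divide field_simps)
    have "c2 * (1 - cos 1) * v powr \<beta> \<le> (1 - cos 1) * measure \<mu> B"
      using low cos_one_less_one mult_left_mono[of "c2 * v powr \<beta>" "measure \<mu> B" "1 - cos 1"] by (simp add: mult_ac)
    also have "\<dots> = (LINT x|\<mu>. (1 - cos 1) * indicator B x)"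
      using B by simp
    also have "\<dots> \<le> (LINT x|\<mu>. 1 - cos (v * x))"
    proof (rule integral_mono)
      show "integrable \<mu> (\<lambda>x. (1 - cos (1::real)) * indicator B x)"
        by (rule integrable_mult_right, rule integrable_real_indicator[OF B])
      show "(1 - cos 1) * indicator B x \<le> 1 - cos (v * x)" for x
      proof (cases "x \<in> B")
        case True
        then have "r \<le> \<bar>x\<bar> \<and> \<bar>x\<bar> \<le> 2 * r"
          unfolding B_def by (rule A(6)[OF r(1)])
        then have "1 \<le> \<bar>v * x\<bar>" "\<bar>v * x\<bar> \<le> 2"
          using vpos by (auto simp: r_def abs_mult field_simps)
        then show ?thesis
          using True one_minus_cos_ge by simp
      qed simp
    qed (rule int)
    finally show "c2 * (1 - cos 1) * v powr \<beta> \<le> (LINT x|\<mu>. 1 - cos (v * x))" .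
  qed
qed

end

section \<open>The mixing measure near the origin\<close>

locale regularly_varying_density = prob_space \<pi> for \<pi> :: "real measure" +
  fixes p l :: "real \<Rightarrow> real" and \<alpha> :: real
  assumes p_measurable: "p \<in> borel_measurable (restrict_space borel {0<..})"
    and p_nonneg: "\<And>x. x > 0 \<Longrightarrow> p x \<ge> 0"
    and p_density: "\<pi> = density (restrict_space lborel {0<..}) (\<lambda>x. ennreal (p x))"
    and \<alpha>: "0 < \<alpha>"
    and slow: "slowly_varying l"
    and p_asymp: "p \<sim>[at_right 0] (\<lambda>x. \<alpha> * l (inverse x) * x powr (\<alpha> - 1))"
begin

text \<open>Slow variation is used only for the scale factor 2, where it says that halving the
  argument multiplies the density by \<open>2 powr (1 - \<alpha>)\<close> in the limit. Both claims
  share the comparison function \<open>f\<close>, which is positive near 0.\<close>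

lemma
  shows density_pos: "\<forall>\<^sub>F x in at_right 0. 0 < p x"
    and density_ratio: "((\<lambda>x. p (x / 2) / p x) \<longlongrightarrow> 2 powr (1 - \<alpha>)) (at_right 0)"
proof -
  define f where "f x = \<alpha> * l (inverse x) * x powr (\<alpha> - 1)" for x
  have inv: "filterlim inverse at_top (at_right (0::real))"
    by (rule filterlim_inverse_at_top_right)
  obtain x0 where x0: "\<And>x. x0 \<le> x \<Longrightarrow> 0 < l x"
    using slow by (auto simp: slowly_varying_def)
  have "\<forall>\<^sub>F x in at_right 0. x0 \<le> inverse x"
    using inv by (simp add: filterlim_at_top)
  then have f_pos: "\<forall>\<^sub>F x in at_right 0. 0 < f x"
    using eventually_at_right_less[of "0::real"]
    by eventually_elim (use \<alpha> x0 in \<open>simp add: f_def\<close>)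
  have "((\<lambda>x. if p x = 0 \<and> f x = 0 then 1 else p x / f x) \<longlongrightarrow> 1) (at_right 0)"
    using p_asymp unfolding asymp_equiv_def f_def .
  moreover have "\<forall>\<^sub>F x in at_right 0. (if p x = 0 \<and> f x = 0 then 1 else p x / f x) = p x / f x"
    using f_pos by eventually_elim auto
  ultimately have pf: "((\<lambda>x. p x / f x) \<longlongrightarrow> 1) (at_right 0)"
    by (rule Lim_transform_eventually)
  have half: "filterlim (\<lambda>x. x / 2) (at_right 0) (at_right (0::real))"
  proof -
    have "((\<lambda>x. x / 2) \<longlongrightarrow> 0 / 2) (at_right (0::real))"
      by (intro tendsto_intros) auto
    then show ?thesis
      by (auto simp: filterlim_at intro: eventually_mono[OF eventually_at_right_less])
  qed
  have pf2: "((\<lambda>x. p (x / 2) / f (x / 2)) \<longlongrightarrow> 1) (at_right 0)"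
    by (rule filterlim_compose[OF pf half])
  have f_pos2: "\<forall>\<^sub>F x in at_right 0. 0 < f (x / 2)"
    by (rule eventually_compose_filterlim[OF f_pos half])
  have "\<forall>\<^sub>F x in at_right 0. 0 < p x / f x"
    using pf by (rule order_tendstoD) simp
  then show pos: "\<forall>\<^sub>F x in at_right 0. 0 < p x"
    using f_pos by eventually_elim (simp add: zero_less_divide_iff)
  have "((\<lambda>x. l (2 * x) / l x) \<longlongrightarrow> 1) at_top"
    using slow by (simp add: slowly_varying_def)
  then have lr: "((\<lambda>x. l (2 * inverse x) / l (inverse x)) \<longlongrightarrow> 1) (at_right 0)"
    by (rule filterlim_compose[OF _ inv])
  have "((\<lambda>x. (p (x / 2) / f (x / 2)) * (2 powr (1 - \<alpha>) * (l (2 * inverse x) / l (inverse x))) / (p x / f x)) \<longlongrightarrow>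
      1 * (2 powr (1 - \<alpha>) * 1) / 1) (at_right 0)"
    by (intro tendsto_intros pf pf2 lr) simp
  moreover have "\<forall>\<^sub>F x in at_right 0. (p (x / 2) / f (x / 2)) * (2 powr (1 - \<alpha>) * (l (2 * inverse x) / l (inverse x))) / (p x / f x) =
      p (x / 2) / p x"
    using f_pos f_pos2 pos eventually_at_right_less[of "0::real"]
  proof eventually_elim
    case (elim x)
    have "f (x / 2) / f x = 2 powr (1 - \<alpha>) * (l (2 * inverse x) / l (inverse x))"
    proof -
      have "(x / 2) powr (\<alpha> - 1) = x powr (\<alpha> - 1) * 2 powr (1 - \<alpha>)"
        using elim powr_minus_divide[of 2 "\<alpha> - 1"] by (simp add: powr_divide)
      moreover have "inverse (x / 2) = 2 * inverse x"
        by (simp add: field_simps)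
      ultimately show ?thesis
        using elim \<alpha> by (simp add: f_def)
    qed
    then have "(p (x / 2) / f (x / 2)) * (2 powr (1 - \<alpha>) * (l (2 * inverse x) / l (inverse x))) / (p x / f x) =
        (p (x / 2) / f (x / 2)) * (f (x / 2) / f x) / (p x / f x)"
      by simp
    also have "\<dots> = p (x / 2) / p x"
      using elim by (simp add: field_simps)
    finally show ?case .
  qed
  ultimately have "((\<lambda>x. p (x / 2) / p x) \<longlongrightarrow> 1 * (2 powr (1 - \<alpha>) * 1) / 1) (at_right 0)"
    by (rule Lim_transform_eventually)
  then show "((\<lambda>x. p (x / 2) / p x) \<longlongrightarrow> 2 powr (1 - \<alpha>)) (at_right 0)"
    by simp
qed

text \<open>Extension by zero to the whole line, so that the substitution \<open>y / 2\<close> can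
  be made under \<open>lborel\<close>.\<close>

definition p0 :: "real \<Rightarrow> real" where
  "p0 x = indicator {0<..} x * p x"

lemma p0_measurable [measurable]: "p0 \<in> borel_measurable borel"
  using p_measurable by (simp add: p0_def[abs_def] borel_measurable_restrict_space_iff)

lemma emeasure_cdf: "emeasure \<pi> {0<..x} = (\<integral>\<^sup>+y. ennreal (p0 y) * indicator {0<..x} y \<partial>lborel)"
proof -
  have sets: "{0<..x} \<in> sets (restrict_space lborel {0<..})"
    by (auto simp: sets_restrict_space_iff)
  have [measurable]: "p \<in> borel_measurable (restrict_space lborel {0<..})"
    using p_measurable unfolding measurable_cong_sets[OF sets_restrict_space_cong[OF sets_lborel] refl] .
  have "emeasure \<pi> {0<..x} = (\<integral>\<^sup>+y. ennreal (p y) * indicator {0<..x} y \<partial>restrict_space lborel {0<..})"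
    unfolding p_density by (rule emeasure_density[OF _ sets]) measurable
  also have "\<dots> = (\<integral>\<^sup>+y. ennreal (p y) * indicator {0<..x} y * indicator {0<..} y \<partial>lborel)"
    by (subst nn_integral_restrict_space) auto
  also have "\<dots> = (\<integral>\<^sup>+y. ennreal (p0 y) * indicator {0<..x} y \<partial>lborel)"
    by (intro nn_integral_cong) (auto simp: indicator_def p0_def)
  finally show ?thesis .
qed

definition cdf0 :: "real \<Rightarrow> real" where
  "cdf0 x = measure \<pi> {0<..x}"

lemma sets_cdf [measurable]: "{0<..x} \<in> sets \<pi>"
  by (simp add: p_density sets_restrict_space_iff subset_eq)

lemma cdf0_le_1: "cdf0 x \<le> 1" and cdf0_nonneg: "0 \<le> cdf0 x"
  by (simp_all add: cdf0_def)

lemma cdf0_mono: "x \<le> y \<Longrightarrow> cdf0 x \<le> cdf0 y"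
  unfolding cdf0_def by (intro finite_measure_mono) auto

lemma emeasure_cdf_half:
  "emeasure \<pi> {0<..x / 2} = ennreal (1 / 2) * (\<integral>\<^sup>+y. ennreal (p0 (y / 2)) * indicator {0<..x} y \<partial>lborel)"
proof -
  have "emeasure \<pi> {0<..x / 2} = ennreal \<bar>1 / 2\<bar> * (\<integral>\<^sup>+y. ennreal (p0 (0 + (1 / 2) * y)) * indicator {0<..x / 2} (0 + (1 / 2) * y) \<partial>lborel)"
    unfolding emeasure_cdf by (rule nn_integral_real_affine) auto
  also have "(\<integral>\<^sup>+y. ennreal (p0 (0 + (1 / 2) * y)) * indicator {0<..x / 2} (0 + (1 / 2) * y) \<partial>lborel) =
      (\<integral>\<^sup>+y. ennreal (p0 (y / 2)) * indicator {0<..x} y \<partial>lborel)"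
    by (intro nn_integral_cong) (auto simp: indicator_def)
  finally show ?thesis
    by simp
qed

text \<open>The limit of \<open>p (x / 2) / p x\<close> lies strictly between
  \<open>2 powr (1 - \<theta>)\<close> and \<open>2 powr (1 - \<eta>)\<close>, so both bounds hold
  pointwise near 0. Integration with the Jacobian 1 / 2 of the halving map gives the exponents
  \<open>- \<theta>\<close> and \<open>- \<eta>\<close>.\<close>

lemma cdf0_half_bounds:
  assumes "\<eta> < \<alpha>" "\<alpha> < \<theta>"
  obtains r0 where "0 < r0" "0 < cdf0 r0"
    "\<And>x. 0 < x \<Longrightarrow> x \<le> r0 \<Longrightarrow> cdf0 (x / 2) \<le> 2 powr (- \<eta>) * cdf0 x"
    "\<And>x. 0 < x \<Longrightarrow> x \<le> r0 \<Longrightarrow> 2 powr (- \<theta>) * cdf0 x \<le> cdf0 (x / 2)"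
proof -
  have "\<forall>\<^sub>F x in at_right 0. p (x / 2) / p x < 2 powr (1 - \<eta>)"
    using density_ratio by (rule order_tendstoD) (use assms in simp)
  moreover have "\<forall>\<^sub>F x in at_right 0. 2 powr (1 - \<theta>) < p (x / 2) / p x"
    using density_ratio by (rule order_tendstoD) (use assms in simp)
  ultimately have "\<forall>\<^sub>F x in at_right 0. 0 < p x \<and> p (x / 2) \<le> 2 powr (1 - \<eta>) * p x \<and> 2 powr (1 - \<theta>) * p x \<le> p (x / 2)"
    using density_pos by eventually_elim (auto simp: field_simps)
  then obtain r0 where r0: "0 < r0" "\<And>x. 0 < x \<Longrightarrow> x \<le> r0 \<Longrightarrow>
      0 < p x \<and> p (x / 2) \<le> 2 powr (1 - \<eta>) * p x \<and> 2 powr (1 - \<theta>) * p x \<le> p (x / 2)"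
    by (rule eventually_at_right_0_obtain) blast
  have pos: "0 < cdf0 r0"
  proof (rule ccontr)
    assume "\<not> 0 < cdf0 r0"
    then have "cdf0 r0 = 0"
      using cdf0_nonneg[of r0] by linarith
    then have "emeasure \<pi> {0<..r0} = 0"
      by (simp add: cdf0_def emeasure_eq_measure)
    then have "AE y in lborel. ennreal (p0 y) * indicator {0<..r0} y = 0"
      unfolding emeasure_cdf by (subst (asm) nn_integral_0_iff_AE) auto
    then have "AE y in lborel. y \<notin> {0<..r0}"
    proof eventually_elim
      case (elim y)
      show ?case
      proof
        assume y: "y \<in> {0<..r0}"
        then have "0 < p0 y"
          using r0(2)[of y] by (simp add: p0_def)
        then show False
          using elim y by simp
      qed
    qed
    then have "emeasure lborel {0<..r0} = 0"
      by (subst (asm) AE_iff_measurable[of "{0<..r0}"]) auto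
    then show False
      using r0(1) by simp
  qed
  have le1: "ennreal (1 / 2) * (ennreal (2 powr (1 - x)) * e) = ennreal (2 powr (- x)) * e" for e x
  proof -
    have "1 / 2 * 2 powr (1 - x) = (2::real) powr (- x)"
      by (simp add: powr_diff powr_minus field_simps)
    then have "ennreal (1 / 2) * ennreal (2 powr (1 - x)) = ennreal (2 powr (- x))"
      by (subst ennreal_mult[symmetric]) simp_all
    then show ?thesis
      by (simp only: mult.assoc[symmetric])
  qed
  have scale: "ennreal (1 / 2) * (\<integral>\<^sup>+y. ennreal (2 powr (1 - e)) * (ennreal (p0 y) * indicator {0<..x} y) \<partial>lborel) =
      ennreal (2 powr (- e)) * emeasure \<pi> {0<..x}" for e x
    unfolding emeasure_cdf by (subst nn_integral_cmult, measurable, rule le1)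
  show ?thesis
  proof (rule that[OF r0(1) pos])
    fix x assume x: "0 < x" "x \<le> r0"
    have "emeasure \<pi> {0<..x / 2} \<le> ennreal (1 / 2) * (\<integral>\<^sup>+y. ennreal (2 powr (1 - \<eta>)) * (ennreal (p0 y) * indicator {0<..x} y) \<partial>lborel)"
      unfolding emeasure_cdf_half
    proof (intro mult_left_mono nn_integral_mono)
      fix y
      show "ennreal (p0 (y / 2)) * indicator {0<..x} y \<le> ennreal (2 powr (1 - \<eta>)) * (ennreal (p0 y) * indicator {0<..x} y)"
        using r0(2)[of y] x by (auto simp: indicator_def p0_def ennreal_mult'[symmetric] intro!: ennreal_leI)
    qed simp
    also have "\<dots> = ennreal (2 powr (- \<eta>)) * emeasure \<pi> {0<..x}"
      by (rule scale)
    finally show "cdf0 (x / 2) \<le> 2 powr (- \<eta>) * cdf0 x"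
      by (simp add: emeasure_eq_measure cdf0_def ennreal_mult[symmetric] ennreal_le_iff)
    have "ennreal (2 powr (- \<theta>)) * emeasure \<pi> {0<..x} = ennreal (1 / 2) * (\<integral>\<^sup>+y. ennreal (2 powr (1 - \<theta>)) * (ennreal (p0 y) * indicator {0<..x} y) \<partial>lborel)"
      by (rule scale[symmetric])
    also have "\<dots> \<le> emeasure \<pi> {0<..x / 2}"
      unfolding emeasure_cdf_half
    proof (intro mult_left_mono nn_integral_mono)
      fix y
      show "ennreal (2 powr (1 - \<theta>)) * (ennreal (p0 y) * indicator {0<..x} y) \<le> ennreal (p0 (y / 2)) * indicator {0<..x} y"
        using r0(2)[of y] x by (auto simp: indicator_def p0_def ennreal_mult'[symmetric] intro!: ennreal_leI)
    qed simp
    finally show "2 powr (- \<theta>) * cdf0 x \<le> cdf0 (x / 2)"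
      by (simp add: emeasure_eq_measure cdf0_def ennreal_mult[symmetric] ennreal_le_iff)
  qed
qed

text \<open>Iterating the halving inequalities replaces Potter's bounds, and with them the uniform
  convergence theorem for slowly varying functions.\<close>

lemma cdf0_bounds:
  assumes "0 < \<eta>" "\<eta> < \<alpha>" "\<alpha> < \<theta>"
  obtains C c r0 where "0 < C" "0 < c" "0 < r0"
    "\<And>x. 0 < x \<Longrightarrow> emeasure \<pi> {0<..x} \<le> ennreal (C * x powr \<eta>)"
    "\<And>x. 0 < x \<Longrightarrow> x \<le> r0 \<Longrightarrow> c * x powr \<theta> \<le> measure \<pi> {0<..x}"
proof -
  obtain r0 where r0: "0 < r0" "0 < cdf0 r0"
    and up: "\<And>x. 0 < x \<Longrightarrow> x \<le> r0 \<Longrightarrow> cdf0 (x / 2) \<le> 2 powr (- \<eta>) * cdf0 x"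
    and lo: "\<And>x. 0 < x \<Longrightarrow> x \<le> r0 \<Longrightarrow> 2 powr (- \<theta>) * cdf0 x \<le> cdf0 (x / 2)"
    by (rule cdf0_half_bounds[OF assms(2,3)]) blast
  have le_r0: "r0 / 2 ^ n \<le> r0" "0 < r0 / 2 ^ n" for n
    using r0 by (simp_all add: field_simps)
  have up_n: "cdf0 (r0 / 2 ^ n) \<le> (2 powr (- \<eta>)) ^ n" for n
  proof (induction n)
    case (Suc n)
    have "cdf0 (r0 / 2 ^ Suc n) \<le> 2 powr (- \<eta>) * cdf0 (r0 / 2 ^ n)"
      using up[OF le_r0(2,1), of n] by (simp add: mult.commute)
    also have "\<dots> \<le> 2 powr (- \<eta>) * (2 powr (- \<eta>)) ^ n"
      using Suc by (intro mult_left_mono) auto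
    finally show ?case
      by simp
  qed (simp add: cdf0_le_1)
  have lo_n: "(2 powr (- \<theta>)) ^ n * cdf0 r0 \<le> cdf0 (r0 / 2 ^ n)" for n
  proof (induction n)
    case (Suc n)
    have "(2 powr (- \<theta>)) ^ Suc n * cdf0 r0 = 2 powr (- \<theta>) * ((2 powr (- \<theta>)) ^ n * cdf0 r0)"
      by simp
    also have "\<dots> \<le> 2 powr (- \<theta>) * cdf0 (r0 / 2 ^ n)"
      using Suc by (intro mult_left_mono) auto
    also have "\<dots> \<le> cdf0 (r0 / 2 ^ Suc n)"
      using lo[OF le_r0(2,1), of n] by (simp add: mult.commute)
    finally show ?case .
  qed simp
  have pw: "(2 powr (- e)) ^ n = (2 ^ n) powr (- e)" for e :: real and n
    by (simp add: powr_realpow[symmetric] powr_powr mult.commute)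
  show ?thesis
  \<comment> \<open>Both factors 2 pay for rounding \<open>x\<close> to a dyadic fraction of
    \<open>r0\<close>: upwards to \<open>r0 / 2 ^ n\<close> for the upper bound, downwards to
    \<open>r0 / 2 ^ Suc n\<close> for the lower one. Beyond \<open>r0\<close> the upper bound
    exceeds 1 and is trivial.\<close>
  proof (rule that[of "(2 / r0) powr \<eta>" "cdf0 r0 * (2 * r0) powr (- \<theta>)" r0])
    show "0 < (2 / r0) powr \<eta>" "0 < cdf0 r0 * (2 * r0) powr (- \<theta>)" "0 < r0"
      using r0 by simp_all
  next
    fix x :: real assume x: "0 < x"
    have "cdf0 x \<le> (2 * (x / r0)) powr \<eta>"
    proof (cases "x \<le> r0")
      case True
      then have "1 \<le> r0 / x"
        using x by simp
      then obtain n where n: "2 ^ n \<le> r0 / x" "r0 / x < 2 ^ Suc n"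
        by (rule obtain_dyadic_scale)
      have "cdf0 x \<le> cdf0 (r0 / 2 ^ n)"
        using n x by (intro cdf0_mono) (simp add: field_simps)
      also have "\<dots> \<le> (2 ^ n) powr (- \<eta>)"
        using up_n[of n] by (simp add: pw)
      also have "\<dots> = (1 / 2 ^ n) powr \<eta>"
        by (simp add: powr_minus powr_divide inverse_eq_divide)
      also have "\<dots> \<le> (2 * (x / r0)) powr \<eta>"
        using n x r0 assms by (intro powr_mono2) (auto simp: field_simps)
      finally show ?thesis .
    next
      case False
      then have "1 \<le> 2 * (x / r0)"
        using r0 by (simp add: field_simps)
      then have "1 \<le> (2 * (x / r0)) powr \<eta>"
        using assms by (intro ge_one_powr_ge_zero) auto
      then show ?thesis
        using cdf0_le_1[of x] by linarith
    qed
    also have "(2 * (x / r0)) powr \<eta> = (2 / r0) powr \<eta> * x powr \<eta>"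
      using x r0 by (simp add: powr_mult[symmetric])
    finally show "emeasure \<pi> {0<..x} \<le> ennreal ((2 / r0) powr \<eta> * x powr \<eta>)"
      by (simp add: emeasure_eq_measure cdf0_def ennreal_leI)
    assume "x \<le> r0"
    then have "1 \<le> r0 / x"
      using x by simp
    then obtain n where n: "2 ^ n \<le> r0 / x" "r0 / x < 2 ^ Suc n"
      by (rule obtain_dyadic_scale)
    have "cdf0 r0 * (2 * r0) powr (- \<theta>) * x powr \<theta> = cdf0 r0 * (x / (2 * r0)) powr \<theta>"
    proof -
      have "(x / (2 * r0)) powr \<theta> = x powr \<theta> / (2 * r0) powr \<theta>"
        by (rule powr_divide)
      moreover have "(2 * r0) powr (- \<theta>) = 1 / (2 * r0) powr \<theta>"
        by (rule powr_minus_divide)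
      ultimately show ?thesis
        by simp
    qed
    also have "\<dots> \<le> cdf0 r0 * (1 / 2 ^ Suc n) powr \<theta>"
      using n x r0 assms by (intro mult_left_mono powr_mono2) (auto simp: field_simps cdf0_nonneg)
    also have "\<dots> = (2 powr (- \<theta>)) ^ Suc n * cdf0 r0"
      unfolding pw by (simp add: powr_minus powr_divide inverse_eq_divide del: power_Suc)
    also have "\<dots> \<le> cdf0 (r0 / 2 ^ Suc n)"
      by (rule lo_n)
    also have "\<dots> \<le> cdf0 x"
      using n x by (intro cdf0_mono) (simp add: field_simps)
    finally show "cdf0 r0 * (2 * r0) powr (- \<theta>) * x powr \<theta> \<le> measure \<pi> {0<..x}"
      by (simp add: cdf0_def)
  qed
qed

end

section \<open>Size of the integrated kernel\<close>

lemma integrated_kernel_nonneg: "0 \<le> integrated_kernel t z"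
  unfolding integrated_kernel_def set_lebesgue_integral_def
  by (intro integral_nonneg_AE AE_I2) (simp add: supou_kernel_nonneg)

lemma kernel_time_measurable [measurable]: "(\<lambda>s. supou_kernel s (\<xi>, u)) \<in> borel_measurable borel"
  unfolding supou_kernel_def by measurable

text \<open>A jump occurs at time \<open>u / \<xi>\<close> and decays at rate \<xi>. Its effect over
  the window is limited by the length \<open>t\<close> and by the total decay
  \<open>1 / \<xi>\<close>, both reduced by \<open>exp u\<close> if it occurs before time 0; a jump
  after time \<open>t\<close> has no effect. For \<open>\<xi> \<le> 1 / t\<close> and
  \<open>u\<close> in [-1, 0] the exponent \<open>u - \<xi> * s\<close> stays above -2 throughout,
  which explains the constant \<open>exp (-2)\<close>.\<close>

lemma
  assumes t: "0 < t" and \<xi>: "0 < \<xi>"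
  shows integrated_kernel_le_time: "integrated_kernel t (\<xi>, u) \<le> exp (min u 0) * t"
    and integrated_kernel_le_inverse: "integrated_kernel t (\<xi>, u) \<le> exp (min u 0) * (1 / \<xi>)"
    and integrated_kernel_eq_0: "\<xi> * t < u \<Longrightarrow> integrated_kernel t (\<xi>, u) = 0"
    and integrated_kernel_ge: "\<xi> \<le> 1 / t \<Longrightarrow> -1 \<le> u \<Longrightarrow> u \<le> 0 \<Longrightarrow> exp (-2) * t \<le> integrated_kernel t (\<xi>, u)"
proof -
  have i: "integrable lborel (\<lambda>s. indicator {0..t} s * supou_kernel s (\<xi>, u))"
  proof (rule Bochner_Integration.integrable_bound)
    show "integrable lborel (indicat_real {0..t})"
      using t by (intro integrable_real_indicator) auto
    show "AE s in lborel. norm (indicator {0..t} s * supou_kernel s (\<xi>, u)) \<le> norm (indicat_real {0..t} s)"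
      using supou_kernel_nonneg[of _ "(\<xi>, u)"] supou_kernel_le_1[of _ "(\<xi>, u)"]
      by (intro AE_I2) (auto simp: indicator_def)
  qed measurable
  have F: "integrated_kernel t (\<xi>, u) = (LINT s|lborel. indicator {0..t} s * supou_kernel s (\<xi>, u))"
    by (simp add: integrated_kernel_def set_lebesgue_integral_def)
  have "ennreal (integrated_kernel t (\<xi>, u)) = (\<integral>\<^sup>+s. ennreal (indicator {0..t} s * supou_kernel s (\<xi>, u)) \<partial>lborel)"
    unfolding F by (intro nn_integral_eq_integral[symmetric] i AE_I2) (simp add: supou_kernel_nonneg)
  also have "\<dots> = (\<integral>\<^sup>+s. ennreal (supou_kernel s (\<xi>, u)) * indicator {0..t} s \<partial>lborel)"
    by (intro nn_integral_cong) (auto simp: indicator_def)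
  finally have nn: "ennreal (integrated_kernel t (\<xi>, u)) = (\<integral>\<^sup>+s. ennreal (supou_kernel s (\<xi>, u)) * indicator {0..t} s \<partial>lborel)" .
  have "ennreal (integrated_kernel t (\<xi>, u)) \<le> (\<integral>\<^sup>+s. ennreal (exp (min u 0)) * indicator {0..t} s \<partial>lborel)"
    unfolding nn
  proof (rule nn_integral_mono)
    fix s
    have "supou_kernel s (\<xi>, u) \<le> exp (min u 0)" if "0 \<le> s"
      using that \<xi> by (auto simp: supou_kernel_eq indicator_def)
    then show "ennreal (supou_kernel s (\<xi>, u)) * indicator {0..t} s \<le> ennreal (exp (min u 0)) * indicator {0..t} s"
      by (auto simp: indicator_def intro!: ennreal_leI)
  qed
  also have "\<dots> = ennreal (exp (min u 0) * t)"
    using t by (subst nn_integral_cmult_indicator) (auto simp: ennreal_mult)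
  finally show "integrated_kernel t (\<xi>, u) \<le> exp (min u 0) * t"
    using t by (simp add: ennreal_le_iff)
  \<comment> \<open>The first nonnegative time at which the kernel is active.\<close>
  define b where "b = max 0 (u / \<xi>)"
  have "ennreal (integrated_kernel t (\<xi>, u)) \<le> (\<integral>\<^sup>+s. ennreal (exp (u - \<xi> * s)) * indicator {b..} s \<partial>lborel)"
    unfolding nn
  proof (rule nn_integral_mono)
    fix s
    show "ennreal (supou_kernel s (\<xi>, u)) * indicator {0..t} s \<le> ennreal (exp (u - \<xi> * s)) * indicator {b..} s"
      using \<xi> by (auto simp: supou_kernel_eq indicator_def b_def field_simps)
  qed
  also have "\<dots> = 0 - (- exp (u - \<xi> * b) / \<xi>)"
  proof (rule nn_integral_FTC_atLeast)
    show "((\<lambda>s. - exp (u - \<xi> * s) / \<xi>) has_real_derivative exp (u - \<xi> * s)) (at s)" for s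
      using \<xi> by (auto intro!: derivative_eq_intros)
    have "LIM s at_top. - \<xi> * s :> at_bot"
      using \<xi> by (intro filterlim_tendsto_neg_mult_at_bot[OF tendsto_const] filterlim_ident) auto
    then have "((\<lambda>s. exp (- \<xi> * s)) \<longlongrightarrow> 0) at_top"
      by (rule filterlim_compose[OF exp_at_bot])
    then have "((\<lambda>s. - (exp u * exp (- \<xi> * s)) / \<xi>) \<longlongrightarrow> - (exp u * 0) / \<xi>) at_top"
      by (intro tendsto_intros) (use \<xi> in auto)
    then show "((\<lambda>s. - exp (u - \<xi> * s) / \<xi>) \<longlongrightarrow> 0) at_top"
      by (simp add: exp_add[symmetric])
  qed auto
  also have "u - \<xi> * b = min u 0"
    using \<xi> by (auto simp: b_def max_def min_def field_simps)
  finally show "integrated_kernel t (\<xi>, u) \<le> exp (min u 0) * (1 / \<xi>)"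
    using \<xi> by (simp add: ennreal_le_iff)
  show "integrated_kernel t (\<xi>, u) = 0" if "\<xi> * t < u"
  proof -
    have "indicator {0..t} s * supou_kernel s (\<xi>, u) = 0" for s
    proof (cases "s \<in> {0..t}")
      case True
      then have "\<xi> * s \<le> \<xi> * t"
        using \<xi> by (intro mult_left_mono) auto
      then show ?thesis
        using that by (simp add: supou_kernel_eq)
    qed simp
    then have "(\<lambda>s. indicator {0..t} s * supou_kernel s (\<xi>, u)) = (\<lambda>_. 0)"
      by (rule ext)
    then show ?thesis
      unfolding F by simp
  qed
  show "exp (-2) * t \<le> integrated_kernel t (\<xi>, u)" if "\<xi> \<le> 1 / t" "-1 \<le> u" "u \<le> 0"
  proof -
    have "exp (-2) * t = (LINT s|lborel. exp (-2) * indicator {0..t} s)"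
      using t by simp
    also have "\<dots> \<le> (LINT s|lborel. indicator {0..t} s * supou_kernel s (\<xi>, u))"
    proof (rule integral_mono[OF _ i])
      show "integrable lborel (\<lambda>s. exp (-2) * indicat_real {0..t} s)"
        using t by (intro integrable_mult_right integrable_real_indicator) auto
      fix s
      show "exp (-2) * indicator {0..t} s \<le> indicator {0..t} s * supou_kernel s (\<xi>, u)"
      proof (cases "s \<in> {0..t}")
        case True
        have "\<xi> * s \<le> 1 / t * t"
          using True that t \<xi> by (intro mult_mono) auto
        then have "\<xi> * s \<le> 1"
          using t by simp
        moreover have "0 \<le> \<xi> * s"
          using True \<xi> by simp
        ultimately show ?thesis
          using that True by (simp add: supou_kernel_eq)
      qed simp
    qed
    finally show ?thesis
      unfolding F .
  qed
qed

context supou_control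
begin

text \<open>For fixed \<xi> the jumps before time 0 contribute a constant and those inside the
  window have total length \<open>\<xi> * t\<close>. Summing over dyadic values of
  \<open>\<xi> * t\<close>, the \<open>n\<close>-th shell has height \<open>t powr g\<close> times
  \<open>2 powr (n * (1 - g))\<close> and mass of order \<open>(2 ^ n / t) powr \<eta>\<close>. The
  sum is geometric when \<open>1 + \<eta> < g\<close>, and its first term, from slow decay rates,
  determines the order \<open>t powr (g - \<eta>)\<close>.\<close>

lemma nn_integral_integrated_kernel_powr_le:
  assumes U: "\<And>x. 0 < x \<Longrightarrow> emeasure \<pi> {0<..x} \<le> ennreal (C * x powr \<eta>)" and C: "0 \<le> C"
    and \<eta>: "0 < \<eta>" "1 + \<eta> < g" and t: "0 < t"
  shows "(\<integral>\<^sup>+z. ennreal (integrated_kernel t z powr g) \<partial>m) \<le>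
    ennreal (2 * C * 2 powr \<eta> / (1 - 2 powr (1 - g + \<eta>)) * t powr (g - \<eta>))"
proof -
  have g: "1 < g"
    using \<eta> by simp
  have [measurable]: "{0<..x} \<in> sets \<pi>" for x
    by (simp add: sets_pi sets_restrict_space_iff subset_eq)
  have inner: "(\<integral>\<^sup>+u. ennreal (integrated_kernel t (\<xi>, u) powr g) \<partial>lborel) \<le> ennreal ((min t (1 / \<xi>)) powr g * (1 + \<xi> * t))"
    if \<xi>: "0 < \<xi>" for \<xi>
  proof -
    define b where "b = min t (1 / \<xi>)"
    have b: "0 < b"
      using t \<xi> by (simp add: b_def)
    have "(\<integral>\<^sup>+u. ennreal (integrated_kernel t (\<xi>, u) powr g) \<partial>lborel) \<le>
        (\<integral>\<^sup>+u. ennreal (b powr g) * (ennreal (exp (g * u)) * indicator {..0} u + indicator {0..\<xi> * t} u) \<partial>lborel)"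
    proof (rule nn_integral_mono)
      fix u
      have F: "integrated_kernel t (\<xi>, u) \<le> exp (min u 0) * b"
        using integrated_kernel_le_time[OF t \<xi>, of u] integrated_kernel_le_inverse[OF t \<xi>, of u]
        by (auto simp: b_def min_def)
      have "integrated_kernel t (\<xi>, u) powr g \<le> (exp (min u 0) * b) powr g"
        using F integrated_kernel_nonneg[of t "(\<xi>, u)"] g by (intro powr_mono2) auto
      also have "\<dots> = b powr g * exp (g * min u 0)"
        using b by (simp add: powr_mult exp_powr_real mult.commute)
      finally have P: "integrated_kernel t (\<xi>, u) powr g \<le> b powr g * exp (g * min u 0)" .
      consider "u \<le> 0" | "0 < u" "u \<le> \<xi> * t" | "\<xi> * t < u"
        by linarith
      then show "ennreal (integrated_kernel t (\<xi>, u) powr g) \<le>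
          ennreal (b powr g) * (ennreal (exp (g * u)) * indicator {..0} u + indicator {0..\<xi> * t} u)"
      proof cases
        case 1
        then have "ennreal (integrated_kernel t (\<xi>, u) powr g) \<le> ennreal (b powr g) * ennreal (exp (g * u))"
          using P by (simp add: ennreal_mult[symmetric] ennreal_leI)
        also have "\<dots> \<le> ennreal (b powr g) * (ennreal (exp (g * u)) * indicator {..0} u + indicator {0..\<xi> * t} u)"
          using 1 by (intro mult_left_mono) (auto simp: add_increasing2)
        finally show ?thesis .
      next
        case 2
        then show ?thesis
          using P by (simp add: ennreal_leI)
      next
        case 3
        then show ?thesis
          using integrated_kernel_eq_0[OF t \<xi> 3] by simp
      qed
    qed
    also have "\<dots> = ennreal (b powr g) * (ennreal (1 / g) + ennreal (\<xi> * t))"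
    proof -
      have "(\<integral>\<^sup>+u. ennreal (exp (g * u)) * indicator {..0} u + indicator {0..\<xi> * t} u \<partial>lborel) =
          ennreal (1 / g) + ennreal (\<xi> * t)"
        using g \<xi> t nn_integral_exp_atMost[of g 0] by (subst nn_integral_add) auto
      then show ?thesis
        by (subst nn_integral_cmult) auto
    qed
    also have "\<dots> = ennreal (b powr g * (1 / g + \<xi> * t))"
      using g \<xi> t by (simp add: ennreal_mult)
    also have "\<dots> \<le> ennreal (b powr g * (1 + \<xi> * t))"
      using g by (intro ennreal_leI mult_left_mono) auto
    finally show ?thesis
      by (simp add: b_def)
  qed
  have pointwise: "ennreal ((min t (1 / \<xi>)) powr g * (1 + \<xi> * t)) \<le>
      (\<Sum>n. ennreal (2 * t powr g * (2 ^ n) powr (1 - g)) * indicator {0<..2 ^ Suc n / t} \<xi>)" if \<xi>: "0 < \<xi>" for \<xi>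
  proof -
    \<comment> \<open>One term of the series already dominates: the term of the dyadic shell of
      \<open>\<xi> * t\<close>, or the term 0 if \<open>\<xi> * t < 1\<close>.\<close>
    have "\<exists>n. ennreal ((min t (1 / \<xi>)) powr g * (1 + \<xi> * t)) \<le>
        ennreal (2 * t powr g * (2 ^ n) powr (1 - g)) * indicator {0<..2 ^ Suc n / t} \<xi>"
    proof (cases "1 \<le> \<xi> * t")
      case False
      have "(min t (1 / \<xi>)) powr g * (1 + \<xi> * t) \<le> t powr g * 2"
        using False t \<xi> g by (intro mult_mono powr_mono2) auto
      moreover have "\<xi> \<le> 2 / t"
        using False t \<xi> by (simp add: field_simps)
      ultimately show ?thesis
        using \<xi> by (intro exI[of _ 0]) (simp add: ennreal_leI mult.commute)
    next
      case True
      then obtain n where n: "2 ^ n \<le> \<xi> * t" "\<xi> * t < 2 ^ Suc n"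
        by (rule obtain_dyadic_scale)
      have "(min t (1 / \<xi>)) powr g * (1 + \<xi> * t) \<le> (1 / \<xi>) powr g * (2 * (\<xi> * t))"
        using True t \<xi> g by (intro mult_mono powr_mono2) auto
      also have "\<dots> = 2 * t powr g * (\<xi> * t) powr (1 - g)"
      proof -
        have "(1 / \<xi>) powr g = t powr g * (\<xi> * t) powr (- g)"
          using \<xi> t by (simp add: powr_mult powr_minus powr_divide field_simps)
        moreover have "(\<xi> * t) powr (- g) * (\<xi> * t) = (\<xi> * t) powr (1 - g)"
          using \<xi> t powr_add[of "\<xi> * t" "- g" 1] by simp
        ultimately show ?thesis
          by (simp add: mult_ac)
      qed
      also have "\<dots> \<le> 2 * t powr g * (2 ^ n) powr (1 - g)"
        using n g by (intro mult_left_mono powr_mono2') auto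
      finally have "(min t (1 / \<xi>)) powr g * (1 + \<xi> * t) \<le> 2 * t powr g * (2 ^ n) powr (1 - g)" .
      moreover have "\<xi> \<le> 2 ^ Suc n / t"
        using n t by (simp add: field_simps)
      ultimately show ?thesis
        using \<xi> by (intro exI[of _ n]) (simp add: ennreal_leI)
    qed
    then obtain n where "ennreal ((min t (1 / \<xi>)) powr g * (1 + \<xi> * t)) \<le>
        ennreal (2 * t powr g * (2 ^ n) powr (1 - g)) * indicator {0<..2 ^ Suc n / t} \<xi>" ..
    also have "\<dots> \<le> (\<Sum>n. ennreal (2 * t powr g * (2 ^ n) powr (1 - g)) * indicator {0<..2 ^ Suc n / t} \<xi>)"
      by (rule ennreal_le_suminf)
    finally show ?thesis .
  qed
  have term_le: "(\<integral>\<^sup>+\<xi>. ennreal (2 * t powr g * (2 ^ n) powr (1 - g)) * indicator {0<..2 ^ Suc n / t} \<xi> \<partial>\<pi>) \<le>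
      ennreal (2 * C * 2 powr \<eta> * t powr (g - \<eta>) * (2 powr (1 - g + \<eta>)) ^ n)" for n
  proof -
    have "(\<integral>\<^sup>+\<xi>. ennreal (2 * t powr g * (2 ^ n) powr (1 - g)) * indicator {0<..2 ^ Suc n / t} \<xi> \<partial>\<pi>) =
        ennreal (2 * t powr g * (2 ^ n) powr (1 - g)) * emeasure \<pi> {0<..2 ^ Suc n / t}"
      by (rule nn_integral_cmult_indicator) measurable
    also have "\<dots> \<le> ennreal (2 * t powr g * (2 ^ n) powr (1 - g)) * ennreal (C * (2 ^ Suc n / t) powr \<eta>)"
      using t by (intro mult_left_mono U) auto
    also have "\<dots> = ennreal (2 * t powr g * (2 ^ n) powr (1 - g) * (C * (2 ^ Suc n / t) powr \<eta>))"
      by (rule ennreal_mult'[symmetric]) simp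
    also have "2 * t powr g * (2 ^ n) powr (1 - g) * (C * (2 ^ Suc n / t) powr \<eta>) =
        2 * C * 2 powr \<eta> * t powr (g - \<eta>) * (2 powr (1 - g + \<eta>)) ^ n"
    proof -
      have 1: "(2 ^ Suc n / t) powr \<eta> = 2 powr \<eta> * (2 ^ n) powr \<eta> / t powr \<eta>"
        using t by (simp add: powr_divide powr_mult)
      have 2: "(2 powr (1 - g + \<eta>)) ^ n = (2 ^ n) powr (1 - g) * (2 ^ n) powr \<eta>"
        by (simp add: powr_realpow[symmetric] powr_powr powr_add[symmetric] algebra_simps)
      have 3: "t powr (g - \<eta>) = t powr g / t powr \<eta>"
        by (rule powr_diff)
      show ?thesis
        unfolding 1 2 3 by simp
    qed
    finally show ?thesis .
  qed
  have r: "2 powr (1 - g + \<eta>) < (1::real)"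
    using \<eta> by (simp add: powr_less_one)
  have "(\<integral>\<^sup>+z. ennreal (integrated_kernel t z powr g) \<partial>m) =
      (\<integral>\<^sup>+\<xi>. \<integral>\<^sup>+u. ennreal (integrated_kernel t (\<xi>, u) powr g) \<partial>lborel \<partial>\<pi>)"
    by (subst lborel.nn_integral_fst[symmetric]) auto
  also have "\<dots> \<le> (\<integral>\<^sup>+\<xi>. (\<Sum>n. ennreal (2 * t powr g * (2 ^ n) powr (1 - g)) * indicator {0<..2 ^ Suc n / t} \<xi>) \<partial>\<pi>)"
    by (intro nn_integral_mono order_trans[OF inner pointwise]) (auto simp: space_pi)
  also have "\<dots> = (\<Sum>n. \<integral>\<^sup>+\<xi>. ennreal (2 * t powr g * (2 ^ n) powr (1 - g)) * indicator {0<..2 ^ Suc n / t} \<xi> \<partial>\<pi>)"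
    by (rule nn_integral_suminf) measurable
  also have "\<dots> \<le> (\<Sum>n. ennreal (2 * C * 2 powr \<eta> * t powr (g - \<eta>) * (2 powr (1 - g + \<eta>)) ^ n))"
    by (intro suminf_le term_le) auto
  also have "\<dots> = ennreal (2 * C * 2 powr \<eta> * t powr (g - \<eta>) * (1 / (1 - 2 powr (1 - g + \<eta>))))"
    using r C by (intro suminf_ennreal_eq sums_mult geometric_sums) auto
  finally show ?thesis
    by simp
qed

end

section \<open>Scaling of moments\<close>

text \<open>Constants disappear after division by \<open>ln t\<close>, so bounds with arbitrarily
  small errors in the exponent suffice. The positive lower bound also keeps \<open>ln\<close> away
  from its default values.\<close>

lemma log_ratio_tendsto:
  fixes f :: "real \<Rightarrow> real"
  assumes upper: "\<And>\<epsilon>. 0 < \<epsilon> \<Longrightarrow> \<exists>C. \<forall>\<^sub>F t in at_top. f t \<le> C * t powr (\<tau> + \<epsilon>)"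
    and lower: "\<And>\<epsilon>. 0 < \<epsilon> \<Longrightarrow> \<exists>c>0. \<forall>\<^sub>F t in at_top. c * t powr (\<tau> - \<epsilon>) \<le> f t"
  shows "((\<lambda>t. ln (f t) / ln t) \<longlongrightarrow> \<tau>) at_top"
proof (rule tendstoI)
  fix e :: real assume e: "0 < e"
  define \<epsilon> where "\<epsilon> = e / 4"
  have \<epsilon>: "0 < \<epsilon>"
    using e by (simp add: \<epsilon>_def)
  obtain C where C: "\<forall>\<^sub>F t in at_top. f t \<le> C * t powr (\<tau> + \<epsilon>)"
    using upper[OF \<epsilon>] by blast
  obtain c where c: "0 < c" "\<forall>\<^sub>F t in at_top. c * t powr (\<tau> - \<epsilon>) \<le> f t"
    using lower[OF \<epsilon>] by blast
  define D where "D = \<bar>C\<bar> + 1"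
  have D: "0 < D"
    by (simp add: D_def add_nonneg_pos)
  have "((\<lambda>t::real. ln D / ln t) \<longlongrightarrow> 0) at_top" "((\<lambda>t::real. ln c / ln t) \<longlongrightarrow> 0) at_top"
    by (intro real_tendsto_divide_at_top[OF tendsto_const ln_at_top])+
  then have "\<forall>\<^sub>F t in at_top. ln D / ln t < \<epsilon>" "\<forall>\<^sub>F t in at_top. - \<epsilon> < ln c / ln t"
    using \<epsilon> by (auto intro: order_tendstoD)
  then show "\<forall>\<^sub>F t in at_top. dist (ln (f t) / ln t) \<tau> < e"
    using C c(2) eventually_gt_at_top[of "1::real"]
  proof eventually_elim
    case (elim t)
    then have t: "1 < t" "0 < ln t"
      by auto
    have "0 < c * t powr (\<tau> - \<epsilon>)"
      using c t by simp
    then have f: "0 < f t"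
      using elim by linarith
    have "f t \<le> D * t powr (\<tau> + \<epsilon>)"
    proof -
      have "C * t powr (\<tau> + \<epsilon>) \<le> D * t powr (\<tau> + \<epsilon>)"
        by (intro mult_right_mono) (auto simp: D_def)
      then show ?thesis
        using elim(3) by linarith
    qed
    then have "ln (f t) \<le> ln (D * t powr (\<tau> + \<epsilon>))"
      using f D t by (subst ln_le_cancel_iff) auto
    also have "\<dots> = ln D + (\<tau> + \<epsilon>) * ln t"
      using D t by (simp add: ln_mult ln_powr)
    finally have up: "ln (f t) / ln t \<le> ln D / ln t + (\<tau> + \<epsilon>)"
      using t by (simp add: field_simps)
    have "ln c + (\<tau> - \<epsilon>) * ln t = ln (c * t powr (\<tau> - \<epsilon>))"
      using c t by (simp add: ln_mult ln_powr)
    also have "\<dots> \<le> ln (f t)"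
      using f c t elim by (subst ln_le_cancel_iff) auto
    finally have "(ln c + (\<tau> - \<epsilon>) * ln t) / ln t \<le> ln (f t) / ln t"
      using t by (intro divide_right_mono) auto
    then have lo: "ln c / ln t + (\<tau> - \<epsilon>) \<le> ln (f t) / ln t"
      using t by (simp add: add_divide_distrib)
    have "ln (f t) / ln t - \<tau> < e" "- e < ln (f t) / ln t - \<tau>"
      using up lo elim(1,2) e unfolding \<epsilon>_def by linarith+
    then show ?case
      by (simp add: dist_real_def abs_less_iff)
  qed
qed

text \<open>A split at the level \<open>L\<close> in place of Hoelder's inequality. Its additive
  form serves twice: to bound a moment from above between two known ones, and to bound a high moment
  from below once the low-order term is known to be negligible.\<close>

lemma powr_interpolation:
  fixes y L :: real
  assumes "0 < L" "q1 \<le> q" "q \<le> q2" "0 \<le> y"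
  shows "y powr q \<le> L powr (q - q1) * y powr q1 + L powr (q - q2) * y powr q2"
proof (cases "y = 0")
  case False
  then have y: "0 < y"
    using assms by simp
  show ?thesis
  proof (cases "y \<le> L")
    case True
    have "y powr q = y powr (q - q1) * y powr q1"
      by (simp add: powr_add[symmetric])
    also have "\<dots> \<le> L powr (q - q1) * y powr q1"
      using True y assms by (intro mult_right_mono powr_mono2) auto
    finally show ?thesis
      by (simp add: add_increasing2)
  next
    case False
    have "y powr q = y powr (q - q2) * y powr q2"
      by (simp add: powr_add[symmetric])
    also have "\<dots> \<le> L powr (q - q2) * y powr q2"
      using False y assms by (intro mult_right_mono powr_mono2') auto
    finally show ?thesis
      by (simp add: add_increasing)
  qed
qed simp

locale supou_regular = supou \<pi> M \<mu> a \<Lambda> X + dens: regularly_varying_density \<pi> p l \<alpha> + tail: levy_power_tail \<mu> \<beta> cp cm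
  for \<pi> :: "real measure" and M :: "'w measure" and \<mu> :: "real measure" and a :: real
    and \<Lambda> :: "(real \<times> real) set \<Rightarrow> 'w \<Rightarrow> real" and X :: "real \<Rightarrow> 'w \<Rightarrow> real"
    and p l :: "real \<Rightarrow> real" and \<alpha> \<beta> cp cm :: real +
  assumes \<alpha>\<beta>: "1 + \<alpha> < \<beta>" "\<beta> < 2"
    and analytic: "analytic_near_0 (cumulant_function (distr M borel (X 1)))"
begin

lemma \<alpha>_pos: "0 < \<alpha>"
  by (rule dens.\<alpha>)

lemma \<beta>_bounds: "1 < \<beta>" "0 < \<beta>" "\<alpha> < \<beta>"
  using \<alpha>_pos \<alpha>\<beta> by linarith+

abbreviation Y :: "real \<Rightarrow> 'w \<Rightarrow> real" where "Y \<equiv> integrated_process X"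

abbreviation G :: "real \<Rightarrow> (real \<times> real) \<times> real \<Rightarrow> real" where
  "G t z \<equiv> integrated_kernel t (fst z) * snd z"

section \<open>Upper bounds for the moments of the integrated process\<close>

lemma integrated_kernel_moment:
  assumes \<eta>: "0 < \<eta>" "\<eta> < \<alpha>" and g: "\<beta> < g"
  obtains K where "0 \<le> K" "\<And>t. 0 < t \<Longrightarrow> integrable m (\<lambda>z. integrated_kernel t z powr g)"
    "\<And>t. 0 < t \<Longrightarrow> (LINT z|m. integrated_kernel t z powr g) \<le> K * t powr (g - \<eta>)"
proof -
  obtain C where C: "0 < C" "\<And>x. 0 < x \<Longrightarrow> emeasure \<pi> {0<..x} \<le> ennreal (C * x powr \<eta>)"
    by (rule dens.cdf0_bounds[OF \<eta>, of "\<alpha> + 1"]) auto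
  define K where "K = 2 * C * 2 powr \<eta> / (1 - 2 powr (1 - g + \<eta>))"
  have "2 powr (1 - g + \<eta>) < (1::real)"
    using \<eta> g \<alpha>\<beta> by (simp add: powr_less_one)
  then have K: "0 \<le> K"
    using C by (simp add: K_def)
  have nn: "(\<integral>\<^sup>+z. ennreal (integrated_kernel t z powr g) \<partial>m) \<le> ennreal (K * t powr (g - \<eta>))" if "0 < t" for t
    unfolding K_def by (rule nn_integral_integrated_kernel_powr_le[OF C(2)]) (use C \<eta> g \<alpha>\<beta> that in auto)
  show ?thesis
  proof (rule that[OF K])
    fix t :: real assume t: "0 < t"
    show i: "integrable m (\<lambda>z. integrated_kernel t z powr g)"
      by (rule integrableI_nonneg) (use nn[OF t] in \<open>auto intro: le_less_trans\<close>)
    show "(LINT z|m. integrated_kernel t z powr g) \<le> K * t powr (g - \<eta>)"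
      using nn[OF t] i K by (simp add: nn_integral_eq_integral ennreal_le_iff)
  qed
qed

lemma jump_moment:
  assumes \<eta>: "0 < \<eta>" "\<eta> < \<alpha>" and g: "\<beta> < g" and int: "integrable \<mu> (\<lambda>x. \<bar>x\<bar> powr g)"
  obtains K where "0 \<le> K" "\<And>t. 0 < t \<Longrightarrow> integrable Q (\<lambda>z. \<bar>G t z\<bar> powr g)"
    "\<And>t. 0 < t \<Longrightarrow> (LINT z|Q. \<bar>G t z\<bar> powr g) \<le> K * t powr (g - \<eta>)"
proof -
  obtain K where K: "0 \<le> K" "\<And>t. 0 < t \<Longrightarrow> integrable m (\<lambda>z. integrated_kernel t z powr g)"
    "\<And>t. 0 < t \<Longrightarrow> (LINT z|m. integrated_kernel t z powr g) \<le> K * t powr (g - \<eta>)"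
    by (rule integrated_kernel_moment[OF \<eta> g]) blast
  define J where "J = (LINT x|\<mu>. \<bar>x\<bar> powr g)"
  have J: "0 \<le> J"
    by (simp add: J_def)
  have eq: "\<bar>G t z\<bar> powr g = integrated_kernel t (fst z) powr g * \<bar>snd z\<bar> powr g" for t z
    using integrated_kernel_nonneg[of t "fst z"] by (simp add: abs_mult powr_mult)
  show ?thesis
  proof (rule that[of "K * J"])
    show "0 \<le> K * J"
      using K J by simp
    fix t :: real assume t: "0 < t"
    show "integrable Q (\<lambda>z. \<bar>G t z\<bar> powr g)"
      unfolding eq by (rule Q.integrable_product(1)[OF K(2)[OF t] int])
    have "(LINT z|Q. \<bar>G t z\<bar> powr g) = (LINT z|m. integrated_kernel t z powr g) * J"
      unfolding eq J_def by (rule Q.integrable_product(2)[OF K(2)[OF t] int])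
    also have "\<dots> \<le> K * t powr (g - \<eta>) * J"
      by (intro mult_right_mono K t J)
    finally show "(LINT z|Q. \<bar>G t z\<bar> powr g) \<le> K * J * t powr (g - \<eta>)"
      by (simp add: mult_ac)
  qed
qed

text \<open>The exponent is the one of \<open>T powr (q / g)\<close> in \<open>low_moment_le\<close>
  with \<open>T\<close> of order \<open>t powr (g - \<eta>)\<close>. It approaches
  \<open>scaling q\<close> as \<eta> tends to \<alpha> and \<open>g\<close> to the maximum of
  \<open>q\<close> and \<beta>.\<close>

lemma low_moment_upper:
  assumes \<eta>: "0 < \<eta>" "\<eta> < \<alpha>" and q: "0 < q" "q < g" and g: "\<beta> < g" "g \<le> 2"
  shows "\<exists>C\<ge>0. \<forall>t>0. (\<integral>\<^sup>+w. ennreal (\<bar>Y t w\<bar> powr q) \<partial>M) \<le> ennreal (C * t powr ((1 - \<eta> / g) * q))"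
proof -
  have g1: "1 \<le> g"
    using g \<beta>_bounds by simp
  have int: "integrable \<mu> (\<lambda>x. \<bar>x\<bar> powr g)"
    by (rule tail.integrable_abs_powr_levy[OF g integrable_square_levy])
  obtain K where K: "0 \<le> K" "\<And>t. 0 < t \<Longrightarrow> integrable Q (\<lambda>z. \<bar>G t z\<bar> powr g)"
    "\<And>t. 0 < t \<Longrightarrow> (LINT z|Q. \<bar>G t z\<bar> powr g) \<le> K * t powr (g - \<eta>)"
    by (rule jump_moment[OF \<eta> g(1) int]) blast
  define c where "c = 1 + 2 * 2 powr q / ((1 - cos 1) * (1 - 2 powr (q - g)))"
  have "2 powr (q - g) < (1::real)"
    using q by (simp add: powr_less_one)
  then have c: "0 \<le> c"
    using cos_one_less_one by (simp add: c_def)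
  show ?thesis
  proof (intro exI[of _ "c * (K + 1) powr (q / g)"] conjI allI impI)
    show "0 \<le> c * (K + 1) powr (q / g)"
      using c by simp
    fix t :: real assume t: "0 < t"
    have "(LINT z|Q. \<bar>G t z\<bar> powr g) \<le> (K + 1) * t powr (g - \<eta>)"
      using K(3)[OF t] mult_right_mono[of K "K + 1" "t powr (g - \<eta>)"] by simp
    then have "(\<integral>\<^sup>+w. ennreal (\<bar>Y t w\<bar> powr q) \<partial>M) \<le> ennreal (c * ((K + 1) * t powr (g - \<eta>)) powr (q / g))"
      unfolding c_def using K(1) t
      by (intro compensated_poisson_law.low_moment_le[OF integrated_process_law[OF t] q g1 g(2) K(2)[OF t]]) auto
    also have "c * ((K + 1) * t powr (g - \<eta>)) powr (q / g) = c * (K + 1) powr (q / g) * t powr ((1 - \<eta> / g) * q)"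
    proof -
      have "(g - \<eta>) * (q / g) = (1 - \<eta> / g) * q"
        using g1 by (simp add: field_simps)
      then show ?thesis
        using K(1) t by (simp add: powr_mult powr_powr)
    qed
    finally show "(\<integral>\<^sup>+w. ennreal (\<bar>Y t w\<bar> powr q) \<partial>M) \<le> ennreal (c * (K + 1) powr (q / g) * t powr ((1 - \<eta> / g) * q))" .
  qed
qed

text \<open>\<open>even_moment_le\<close> with \<open>r = t\<close> and
  \<open>d = t powr (- \<eta>)\<close>; the condition \<open>t \<ge> 1\<close> ensures
  \<open>d \<le> 1\<close>. Every cumulant of order \<open>j\<close> has size at most of order
  \<open>t ^ j * d\<close>, with the same \<open>d\<close>, so a single factor
  \<open>t powr (- \<eta>)\<close> remains in the moment.\<close>

lemma even_moment_upper:
  assumes \<eta>: "0 < \<eta>" "\<eta> < \<alpha>" and k: "0 < k"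
  shows "\<exists>C\<ge>0. \<forall>t\<ge>1. (\<integral>\<^sup>+w. ennreal (Y t w ^ (2 * k)) \<partial>M) \<le> ennreal (C * t powr (real (2 * k) - \<eta>))"
proof -
  \<comment> \<open>Positivity of \<open>j\<close> is needed at \<open>y = 0\<close>, since
    \<open>0 powr 0\<close> is 0 while \<open>0 ^ 0\<close> is 1.\<close>
  have pw: "y powr real j = y ^ j" if "0 \<le> y" "0 < j" for y :: real and j
    using that by (cases "y = 0") (auto simp: powr_realpow)
  have "\<exists>K\<ge>0. \<forall>t>0. integrable Q (\<lambda>z. \<bar>G t z\<bar> ^ j) \<and> (LINT z|Q. \<bar>G t z\<bar> ^ j) \<le> K * t powr (real j - \<eta>)" if j: "2 \<le> j" for j
  proof -
    have "integrable \<mu> (\<lambda>x. \<bar>x\<bar> powr real j)"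
      using integrable_abs_power_levy[OF j analytic] j by (simp add: pw)
    moreover have "\<beta> < real j"
      using \<alpha>\<beta> j by linarith
    ultimately obtain K where "0 \<le> K" "\<And>t. 0 < t \<Longrightarrow> integrable Q (\<lambda>z. \<bar>G t z\<bar> powr real j)"
      "\<And>t. 0 < t \<Longrightarrow> (LINT z|Q. \<bar>G t z\<bar> powr real j) \<le> K * t powr (real j - \<eta>)"
      by - (rule jump_moment[OF \<eta>, of "real j"], blast+)
    then show ?thesis
      using j by (intro exI[of _ K]) (simp add: pw)
  qed
  then have "\<forall>j\<in>{2..}. \<exists>K\<ge>0. \<forall>t>0. integrable Q (\<lambda>z. \<bar>G t z\<bar> ^ j) \<and> (LINT z|Q. \<bar>G t z\<bar> ^ j) \<le> K * t powr (real j - \<eta>)"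
    by auto
  from bchoice[OF this] obtain K where K: "\<And>j. 2 \<le> j \<Longrightarrow> 0 \<le> K j"
    "\<And>j t. 2 \<le> j \<Longrightarrow> 0 < t \<Longrightarrow> integrable Q (\<lambda>z. \<bar>G t z\<bar> ^ j)"
    "\<And>j t. 2 \<le> j \<Longrightarrow> 0 < t \<Longrightarrow> (LINT z|Q. \<bar>G t z\<bar> ^ j) \<le> K j * t powr (real j - \<eta>)"
    by auto
  define B where "B = (\<Sum>j=2..2*k. K j)"
  have B: "0 \<le> B"
    unfolding B_def using K(1) by (intro sum_nonneg) auto
  define C where "C = norm (central_const k) * (\<Sum>s=1..2*k. (B * (2 * k + 1)) ^ s)"
  show ?thesis
  proof (intro exI[of _ C] conjI allI impI)
    show "0 \<le> C"
      using B by (auto simp: C_def intro!: mult_nonneg_nonneg sum_nonneg)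
    fix t :: real assume t: "1 \<le> t"
    then have t0: "0 < t"
      by simp
    have "(\<integral>\<^sup>+w. ennreal (Y t w ^ (2 * k)) \<partial>M) \<le> ennreal (C * t ^ (2 * k) * t powr (- \<eta>))"
      unfolding C_def
    proof (rule compensated_poisson_law.even_moment_le[OF integrated_process_law[OF t0] k])
      show "integrable Q (\<lambda>z. \<bar>G t z\<bar> ^ j)" if "2 \<le> j" for j
        by (rule K(2)[OF that t0])
      show "(LINT z|Q. \<bar>G t z\<bar> ^ j) \<le> B * t ^ j * t powr (- \<eta>)" if j: "2 \<le> j" "j \<le> 2 * k" for j
      proof -
        have "(LINT z|Q. \<bar>G t z\<bar> ^ j) \<le> K j * t powr (real j - \<eta>)"
          by (rule K(3)[OF j(1) t0])
        also have "t powr (real j - \<eta>) = t ^ j * t powr (- \<eta>)"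
          using t0 by (simp add: powr_diff powr_minus_divide powr_realpow)
        also have "K j * (t ^ j * t powr (- \<eta>)) \<le> B * (t ^ j * t powr (- \<eta>))"
          unfolding B_def using j t0 K(1) by (intro mult_right_mono member_le_sum) auto
        finally show ?thesis
          by (simp add: mult_ac)
      qed
      show "t powr (- \<eta>) \<le> 1"
        using t \<eta> powr_mono[of "- \<eta>" 0 t] by simp
    qed (use B t in auto)
    also have "C * t ^ (2 * k) * t powr (- \<eta>) = C * t powr (real (2 * k) - \<eta>)"
      using t0 powr_realpow[of t "2 * k"] by (simp add: powr_diff powr_minus_divide)
    finally show "(\<integral>\<^sup>+w. ennreal (Y t w ^ (2 * k)) \<partial>M) \<le> ennreal (C * t powr (real (2 * k) - \<eta>))" .
  qed
qed

definition scaling :: "real \<Rightarrow> real" where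
  "scaling q = (if q \<le> \<beta> then (1 - \<alpha> / \<beta>) * q else q - \<alpha>)"

text \<open>Both branches come from the same formula with the index \<open>max q \<beta>\<close>,
  which lets one continuity argument treat them together.\<close>

lemma scaling_eq: "0 < q \<Longrightarrow> scaling q = (1 - \<alpha> / max q \<beta>) * q"
  using \<beta>_bounds by (auto simp: scaling_def max_def field_simps)

text \<open>The order \<open>g\<close> must exceed both \<open>q\<close> and \<beta> but not 2;
  \<open>q < 2\<close> leaves room for this.\<close>

lemma moment_upper_below_2:
  assumes q: "0 < q" "q < 2" and \<epsilon>: "0 < \<epsilon>"
  shows "\<exists>C\<ge>0. \<forall>t\<ge>1. (\<integral>\<^sup>+w. ennreal (\<bar>Y t w\<bar> powr q) \<partial>M) \<le> ennreal (C * t powr (scaling q + \<epsilon>))"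
proof -
  define g0 where "g0 = max q \<beta>"
  have g0: "0 < g0" "g0 < 2"
    using q \<alpha>\<beta> by (auto simp: g0_def)
  \<comment> \<open>Both parameters are moved by the same \<delta>, with
    \<open>\<eta> = \<alpha> - \<delta>\<close> and \<open>g = g0 + \<delta>\<close>, and continuity
    at 0 keeps the exponent below \<open>scaling q + \<epsilon>\<close>.\<close>
  have "((\<lambda>\<delta>. (1 - (\<alpha> - \<delta>) / (g0 + \<delta>)) * q) \<longlongrightarrow> (1 - (\<alpha> - 0) / (g0 + 0)) * q) (at_right 0)"
    by (intro tendsto_intros) (use g0 in auto)
  then have "\<forall>\<^sub>F \<delta> in at_right 0. (1 - (\<alpha> - \<delta>) / (g0 + \<delta>)) * q < scaling q + \<epsilon>"
    by (rule order_tendstoD) (use q \<epsilon> in \<open>simp add: scaling_eq g0_def\<close>)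
  moreover have "\<forall>\<^sub>F \<delta> in at_right 0. \<delta> < \<alpha>" "\<forall>\<^sub>F \<delta> in at_right 0. \<delta> < 2 - g0"
    using \<alpha>_pos g0 by (intro order_tendstoD(2)[OF tendsto_ident_at]; simp)+
  ultimately have "\<forall>\<^sub>F \<delta> in at_right 0. 0 < \<delta> \<and> \<delta> < \<alpha> \<and> \<delta> < 2 - g0 \<and> (1 - (\<alpha> - \<delta>) / (g0 + \<delta>)) * q < scaling q + \<epsilon>"
    using eventually_at_right_less[of "0::real"] by eventually_elim auto
  then obtain \<delta> where \<delta>: "0 < \<delta>" "\<delta> < \<alpha>" "\<delta> < 2 - g0" "(1 - (\<alpha> - \<delta>) / (g0 + \<delta>)) * q < scaling q + \<epsilon>"
    using eventually_happens'[OF trivial_limit_at_right_real] by blast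
  obtain C where C: "0 \<le> C" "\<And>t. 0 < t \<Longrightarrow> (\<integral>\<^sup>+w. ennreal (\<bar>Y t w\<bar> powr q) \<partial>M) \<le>
      ennreal (C * t powr ((1 - (\<alpha> - \<delta>) / (g0 + \<delta>)) * q))"
  proof -
    have "q \<le> g0" "\<beta> \<le> g0"
      by (simp_all add: g0_def)
    then have "q < g0 + \<delta>" "\<beta> < g0 + \<delta>" "g0 + \<delta> \<le> 2" "0 < \<alpha> - \<delta>" "\<alpha> - \<delta> < \<alpha>"
      using \<delta> by linarith+
    then show ?thesis
      using low_moment_upper[of "\<alpha> - \<delta>" q "g0 + \<delta>"] q that by blast
  qed
  show ?thesis
  proof (intro exI[of _ C] conjI allI impI)
    fix t :: real assume t: "1 \<le> t"
    have "C * t powr ((1 - (\<alpha> - \<delta>) / (g0 + \<delta>)) * q) \<le> C * t powr (scaling q + \<epsilon>)"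
      using t \<delta> by (intro mult_left_mono powr_mono C) auto
    then show "(\<integral>\<^sup>+w. ennreal (\<bar>Y t w\<bar> powr q) \<partial>M) \<le> ennreal (C * t powr (scaling q + \<epsilon>))"
      using C(2)[of t] t by (meson ennreal_leI less_le_trans order_trans zero_less_one)
  qed (rule C)
qed

text \<open>From order 2 on, interpolation at the level \<open>t\<close> between an order
  \<open>q1\<close> in (\<beta>, 2) and an even order loses nothing: on this range
  \<open>scaling\<close> is affine with slope 1, and a change of order by 1 costs exactly one factor
  \<open>t\<close>.\<close>

lemma moment_upper:
  assumes q: "0 < q" and \<epsilon>: "0 < \<epsilon>"
  shows "\<exists>C\<ge>0. \<forall>t\<ge>1. (\<integral>\<^sup>+w. ennreal (\<bar>Y t w\<bar> powr q) \<partial>M) \<le> ennreal (C * t powr (scaling q + \<epsilon>))"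
proof (cases "q < 2")
  case True
  then show ?thesis
    using moment_upper_below_2 assms by blast
next
  case False
  define q1 where "q1 = (\<beta> + 2) / 2"
  have q1: "\<beta> < q1" "q1 < 2" "0 < q1"
    using \<alpha>\<beta> \<beta>_bounds by (auto simp: q1_def)
  obtain k :: nat where k: "q < real k"
    using reals_Archimedean2 by blast
  then have k0: "0 < k" and qk: "q \<le> real (2 * k)"
    using q by (cases k; simp)+
  \<comment> \<open>Within \<epsilon> of \<alpha>, yet still positive.\<close>
  define \<eta> where "\<eta> = \<alpha> - min \<epsilon> (\<alpha> / 2)"
  have \<eta>: "0 < \<eta>" "\<eta> < \<alpha>" "\<alpha> - \<eta> \<le> \<epsilon>"
    using \<epsilon> \<alpha>_pos by (auto simp: \<eta>_def min_def)
  obtain C1 where C1: "0 \<le> C1" "\<And>t. 1 \<le> t \<Longrightarrow> (\<integral>\<^sup>+w. ennreal (\<bar>Y t w\<bar> powr q1) \<partial>M) \<le> ennreal (C1 * t powr (scaling q1 + \<epsilon>))"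
    using moment_upper_below_2[OF q1(3,2) \<epsilon>] by blast
  obtain C2 where C2: "0 \<le> C2" "\<And>t. 1 \<le> t \<Longrightarrow> (\<integral>\<^sup>+w. ennreal (Y t w ^ (2 * k)) \<partial>M) \<le> ennreal (C2 * t powr (real (2 * k) - \<eta>))"
    using even_moment_upper[OF \<eta>(1,2) k0] by blast
  have sc: "scaling q = q - \<alpha>" "scaling q1 = q1 - \<alpha>"
    using False q1 \<alpha>\<beta> by (auto simp: scaling_def)
  show ?thesis
  proof (intro exI[of _ "C1 + C2"] conjI allI impI)
    fix t :: real assume t: "1 \<le> t"
    have ev: "\<bar>y\<bar> powr real (2 * k) = y ^ (2 * k)" for y :: real
      using k0 by (cases "y = 0") (auto simp: powr_realpow power_even_abs simp del: of_nat_mult)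
    have "(\<integral>\<^sup>+w. ennreal (\<bar>Y t w\<bar> powr q) \<partial>M) \<le>
        (\<integral>\<^sup>+w. ennreal (t powr (q - q1)) * ennreal (\<bar>Y t w\<bar> powr q1) + ennreal (t powr (q - real (2 * k))) * ennreal (Y t w ^ (2 * k)) \<partial>M)"
    proof (rule nn_integral_mono)
      fix w
      have "\<bar>Y t w\<bar> powr q \<le> t powr (q - q1) * \<bar>Y t w\<bar> powr q1 + t powr (q - real (2 * k)) * Y t w ^ (2 * k)"
        using powr_interpolation[of t q1 q "real (2 * k)" "\<bar>Y t w\<bar>"] False q1 qk t unfolding ev by simp
      then have "ennreal (\<bar>Y t w\<bar> powr q) \<le> ennreal (t powr (q - q1) * \<bar>Y t w\<bar> powr q1 + t powr (q - real (2 * k)) * Y t w ^ (2 * k))"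
        by (rule ennreal_leI)
      also have "\<dots> = ennreal (t powr (q - q1)) * ennreal (\<bar>Y t w\<bar> powr q1) + ennreal (t powr (q - real (2 * k))) * ennreal (Y t w ^ (2 * k))"
        by (subst ennreal_plus) (auto simp: ennreal_mult)
      finally show "ennreal (\<bar>Y t w\<bar> powr q) \<le>
          ennreal (t powr (q - q1)) * ennreal (\<bar>Y t w\<bar> powr q1) + ennreal (t powr (q - real (2 * k))) * ennreal (Y t w ^ (2 * k))" .
    qed
    also have "\<dots> = ennreal (t powr (q - q1)) * (\<integral>\<^sup>+w. ennreal (\<bar>Y t w\<bar> powr q1) \<partial>M) +
        ennreal (t powr (q - real (2 * k))) * (\<integral>\<^sup>+w. ennreal (Y t w ^ (2 * k)) \<partial>M)"
      by (subst nn_integral_add) (auto simp: nn_integral_cmult)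
    also have "\<dots> \<le> ennreal (t powr (q - q1)) * ennreal (C1 * t powr (scaling q1 + \<epsilon>)) +
        ennreal (t powr (q - real (2 * k))) * ennreal (C2 * t powr (real (2 * k) - \<eta>))"
      by (intro add_mono mult_left_mono C1 C2 t) auto
    also have "\<dots> = ennreal (t powr (q - q1) * (C1 * t powr (scaling q1 + \<epsilon>)) + t powr (q - real (2 * k)) * (C2 * t powr (real (2 * k) - \<eta>)))"
      using C1(1) C2(1) by (simp add: ennreal_mult')
    also have "\<dots> \<le> ennreal ((C1 + C2) * t powr (scaling q + \<epsilon>))"
    proof (rule ennreal_leI)
      have "t powr (q - q1) * (C1 * t powr (scaling q1 + \<epsilon>)) = C1 * t powr (scaling q + \<epsilon>)"
      proof -
        have "t powr (q - q1) * t powr (scaling q1 + \<epsilon>) = t powr (scaling q + \<epsilon>)"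
        proof -
          have "q - q1 + (scaling q1 + \<epsilon>) = scaling q + \<epsilon>"
            by (simp add: sc)
          then show ?thesis
            by (simp only: powr_add[symmetric])
        qed
        then show ?thesis
          by (simp add: mult.left_commute)
      qed
      moreover have "t powr (q - real (2 * k)) * (C2 * t powr (real (2 * k) - \<eta>)) = C2 * t powr (q - \<eta>)"
      proof -
        have "t powr (q - real (2 * k)) * t powr (real (2 * k) - \<eta>) = t powr (q - \<eta>)"
          by (simp add: powr_add[symmetric])
        then show ?thesis
          by (simp add: mult.left_commute)
      qed
      moreover have "C2 * t powr (q - \<eta>) \<le> C2 * t powr (scaling q + \<epsilon>)"
        using t \<eta> by (intro mult_left_mono powr_mono C2) (auto simp: sc)
      ultimately show "t powr (q - q1) * (C1 * t powr (scaling q1 + \<epsilon>)) + t powr (q - real (2 * k)) * (C2 * t powr (real (2 * k) - \<eta>)) \<le>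
          (C1 + C2) * t powr (scaling q + \<epsilon>)"
        unfolding distrib_right by linarith
    qed
    finally show "(\<integral>\<^sup>+w. ennreal (\<bar>Y t w\<bar> powr q) \<partial>M) \<le> ennreal ((C1 + C2) * t powr (scaling q + \<epsilon>))" .
  qed (use C1 C2 in simp)
qed

lemma moment_integrable:
  assumes q: "0 < q" and t: "1 \<le> t"
  shows "integrable M (\<lambda>w. \<bar>Y t w\<bar> powr q)"
proof (rule integrableI_nonneg)
  obtain C where "(\<integral>\<^sup>+w. ennreal (\<bar>Y t w\<bar> powr q) \<partial>M) \<le> ennreal (C * t powr (scaling q + 1))"
    using moment_upper[OF q, of 1] t by auto
  then show "(\<integral>\<^sup>+w. ennreal (\<bar>Y t w\<bar> powr q) \<partial>M) < \<infinity>"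
    by (rule le_less_trans) simp
qed auto

lemma expectation_upper:
  assumes q: "0 < q" and \<epsilon>: "0 < \<epsilon>"
  shows "\<exists>C\<ge>0. \<forall>t\<ge>1. expectation (\<lambda>w. \<bar>Y t w\<bar> powr q) \<le> C * t powr (scaling q + \<epsilon>)"
proof -
  obtain C where C: "0 \<le> C" "\<And>t. 1 \<le> t \<Longrightarrow> (\<integral>\<^sup>+w. ennreal (\<bar>Y t w\<bar> powr q) \<partial>M) \<le> ennreal (C * t powr (scaling q + \<epsilon>))"
    using moment_upper[OF assms] by blast
  have "expectation (\<lambda>w. \<bar>Y t w\<bar> powr q) \<le> C * t powr (scaling q + \<epsilon>)" if t: "1 \<le> t" for t
    using C(2)[OF t] C(1) by (simp add: nn_integral_eq_integral[OF moment_integrable[OF q t]] ennreal_le_iff)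
  then show ?thesis
    using C(1) by blast
qed

section \<open>Lower bounds for the moments of the integrated process\<close>

lemma energy_lower:
  assumes \<theta>: "\<alpha> < \<theta>"
  obtains c0 A t0 where "0 < c0" "0 < A" "1 \<le> t0"
    "\<And>t u. t0 \<le> t \<Longrightarrow> A \<le> u * t \<Longrightarrow> c0 * (u * t) powr \<beta> * t powr (- \<theta>) \<le> (LINT z|Q. 1 - cos (u * G t z))"
proof -
  obtain c r0 where c: "0 < c" "0 < r0" "\<And>x. 0 < x \<Longrightarrow> x \<le> r0 \<Longrightarrow> c * x powr \<theta> \<le> measure \<pi> {0<..x}"
    by (rule dens.cdf0_bounds[of "\<alpha> / 2" \<theta>]) (use \<alpha>_pos \<theta> in auto)
  obtain c1 v0 where v0: "0 < c1" "0 < v0" "\<And>v. v0 \<le> v \<Longrightarrow> c1 * v powr \<beta> \<le> (LINT x|\<mu>. 1 - cos (v * x))"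
    by (rule tail.one_minus_cos_lower_bound[OF integrable_one_minus_cos_levy]) blast
  show ?thesis
  \<comment> \<open>\<open>v0 * exp 2\<close> makes \<open>u * exp (-2) * t\<close> at least
    \<open>v0\<close>, so the lower bound for the jumps applies on all of \<open>E\<close> below;
    the bound on \<open>t\<close> brings \<open>1 / t\<close> into the range where the mass of \<pi>
    is known.\<close>
  proof (rule that[of "c1 * exp (-2) powr \<beta> * c" "v0 * exp 2" "max 1 (1 / r0)"])
    show "0 < c1 * exp (-2) powr \<beta> * c" "0 < v0 * exp 2" "1 \<le> max 1 (1 / r0)"
      using c v0 by auto
    fix t u :: real assume t: "max 1 (1 / r0) \<le> t" and ut: "v0 * exp 2 \<le> u * t"
    have t0: "0 < t" "1 / t \<le> r0"
      using t c by (auto simp: field_simps)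
    have "0 < v0 * exp 2"
      using v0 by simp
    then have "0 < u * t"
      using ut by linarith
    then have u: "0 < u"
      using t0 by (simp add: zero_less_mult_iff)
    define \<psi> where "\<psi> z = (LINT x|\<mu>. 1 - cos (u * (integrated_kernel t z * x)))" for z
    note law = integrated_process_law[OF t0(1)]
    have iQ: "integrable Q (\<lambda>z. 1 - cos (u * G t z))"
      by (rule compensated_poisson_law.integrable_one_minus_cos[OF law])
    have i\<psi>: "integrable m \<psi>"
      using Q.integrable_fst'[OF iQ] by (simp add: \<psi>_def[abs_def])
    have int\<psi>: "(LINT z|Q. 1 - cos (u * G t z)) = (LINT z|m. \<psi> z)"
      using Q.integral_fst'[OF iQ] by (simp add: \<psi>_def[abs_def])
    \<comment> \<open>Slowly decaying jumps shortly before time 0: the integrated kernel is at least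
      \<open>exp (-2) * t\<close> on this set, and the second side has length 1, so the measure of
      the set is the mass of \<pi> alone.\<close>
    define E where "E = {0<..1 / t} \<times> {-1..0::real}"
    have E1: "{0<..1 / t} \<in> sets \<pi>"
      by (rule dens.sets_cdf)
    have E: "E \<in> sets m"
      unfolding E_def using E1 by (intro pair_measureI) auto
    have emE: "emeasure m E = ennreal (measure \<pi> {0<..1 / t})"
      unfolding E_def using E1 by (simp add: lborel.emeasure_pair_measure_Times pi.emeasure_eq_measure)
    define b where "b = c1 * (u * (exp (-2) * t)) powr \<beta>"
    have b: "0 \<le> b"
      using v0 by (simp add: b_def)
    have "c1 * exp (-2) powr \<beta> * c * (u * t) powr \<beta> * t powr (- \<theta>) = b * (c * (1 / t) powr \<theta>)"
    proof -
      have "(u * (exp (-2) * t)) powr \<beta> = exp (-2) powr \<beta> * (u * t) powr \<beta>"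
        using u t0 by (subst powr_mult[symmetric]) (auto simp: mult_ac)
      moreover have "(1 / t) powr \<theta> = t powr (- \<theta>)"
        using t0 by (simp add: powr_divide powr_minus_divide)
      ultimately show ?thesis
        by (simp add: b_def)
    qed
    also have "\<dots> \<le> b * measure \<pi> {0<..1 / t}"
      by (intro mult_left_mono c b) (use t0 in auto)
    also have "\<dots> = (LINT z|m. b * indicator E z)"
      using E emE by (simp add: measure_def)
    also have "\<dots> \<le> (LINT z|m. \<psi> z)"
    proof (rule integral_mono[OF _ i\<psi>])
      show "integrable m (\<lambda>z. b * indicator E z)"
        using E emE by (intro integrable_mult_right integrable_real_indicator) auto
      fix z
      show "b * indicator E z \<le> \<psi> z"
      proof (cases "z \<in> E")
        case True
        then obtain \<xi> s where z: "z = (\<xi>, s)" "0 < \<xi>" "\<xi> \<le> 1 / t" "-1 \<le> s" "s \<le> 0"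
          by (auto simp: E_def)
        have F: "exp (-2) * t \<le> integrated_kernel t z"
          unfolding z(1) by (rule integrated_kernel_ge[OF t0(1) z(2-5)])
        have "v0 = (v0 * exp 2) * exp (-2)"
          by (simp add: mult.assoc exp_add[symmetric])
        also have "\<dots> \<le> u * t * exp (-2)"
          using ut by (intro mult_right_mono) auto
        also have "\<dots> = u * (exp (-2) * t)"
          by (simp add: mult_ac)
        also have "\<dots> \<le> u * integrated_kernel t z"
          using F u by (intro mult_left_mono) auto
        finally have v: "v0 \<le> u * integrated_kernel t z" .
        have "b \<le> c1 * (u * integrated_kernel t z) powr \<beta>"
          unfolding b_def using F u t0 v0 \<beta>_bounds by (intro mult_left_mono powr_mono2) auto
        also have "\<dots> \<le> \<psi> z"
          using v0(3)[OF v] by (simp add: \<psi>_def mult.assoc)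
        finally show ?thesis
          using True by simp
      next
        case False
        then show ?thesis
          by (simp add: \<psi>_def integral_nonneg_AE)
      qed
    qed
    finally show "c1 * exp (-2) powr \<beta> * c * (u * t) powr \<beta> * t powr (- \<theta>) \<le> (LINT z|Q. 1 - cos (u * G t z))"
      unfolding int\<psi> .
  qed
qed

text \<open>The frequency is chosen according to which behaviour carries the moment: up to order
  \<beta> the one where the exponent has order 1, above \<beta> the lowest one that
  \<open>energy_lower\<close> admits, of order \<open>1 / t\<close>.\<close>

lemma moment_lower_upto_2:
  assumes q: "0 < q" "q \<le> 2" and \<epsilon>: "0 < \<epsilon>"
  shows "\<exists>c>0. \<forall>\<^sub>F t in at_top. c * t powr (scaling q - \<epsilon>) \<le> expectation (\<lambda>w. \<bar>Y t w\<bar> powr q)"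
proof -
  \<comment> \<open>The loss in the exponent is \<open>(\<theta> - \<alpha>) * q / \<beta>\<close>
    in the first case below and \<open>\<theta> - \<alpha>\<close> in the second; the minimum keeps
    both within \<epsilon>.\<close>
  define \<theta> where "\<theta> = \<alpha> + min \<epsilon> (\<epsilon> * \<beta> / q)"
  have "0 < \<epsilon> * \<beta> / q"
    using \<epsilon> q \<beta>_bounds by simp
  then have \<theta>: "\<alpha> < \<theta>" "\<theta> \<le> \<alpha> + \<epsilon>" "\<theta> \<le> \<alpha> + \<epsilon> * \<beta> / q" "0 < \<theta>"
    unfolding \<theta>_def using \<epsilon> \<alpha>_pos by linarith+
  obtain c0 A t0 where cA: "0 < c0" "0 < A" "1 \<le> t0"
    "\<And>t u. t0 \<le> t \<Longrightarrow> A \<le> u * t \<Longrightarrow> c0 * (u * t) powr \<beta> * t powr (- \<theta>) \<le> (LINT z|Q. 1 - cos (u * G t z))"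
    by (rule energy_lower[OF \<theta>(1)]) blast
  have key: "1 - exp (- (c0 * (u * t) powr \<beta> * t powr (- \<theta>))) \<le> 2 * u powr q * expectation (\<lambda>w. \<bar>Y t w\<bar> powr q)"
    if t: "t0 \<le> t" and u: "0 < u" "A \<le> u * t" for t u
  proof -
    have t1: "1 \<le> t" "0 < t"
      using t cA by linarith+
    show ?thesis
      by (rule compensated_poisson_law.one_minus_exp_le_moment[OF integrated_process_law[OF t1(2)] q u(1)
            cA(4)[OF t u(2)] moment_integrable[OF q(1) t1(1)]])
  qed
  show ?thesis
  proof (cases "q \<le> \<beta>")
    case True
    define c where "c = (1 - exp (- c0)) / 2"
    have \<theta>\<beta>: "0 < \<theta> / \<beta>"
      using \<theta> \<beta>_bounds by simp
    have "\<forall>\<^sub>F t in at_top. A \<le> t powr (\<theta> / \<beta>)"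
      using eventually_ge_at_top[of "A powr (1 / (\<theta> / \<beta>))"]
    proof eventually_elim
      case (elim t)
      have "A = (A powr (1 / x)) powr x" if "0 < x" for x
        using that cA by (simp add: powr_powr)
      from this[OF \<theta>\<beta>] have "A = (A powr (1 / (\<theta> / \<beta>))) powr (\<theta> / \<beta>)" .
      also have "\<dots> \<le> t powr (\<theta> / \<beta>)"
        using elim \<theta>\<beta> by (intro powr_mono2) auto
      finally show ?case .
    qed
    then have "\<forall>\<^sub>F t in at_top. c * t powr (scaling q - \<epsilon>) \<le> expectation (\<lambda>w. \<bar>Y t w\<bar> powr q)"
      using eventually_ge_at_top[of t0]
    proof eventually_elim
      case (elim t)
      have t: "1 \<le> t"
        using elim cA by linarith
      \<comment> \<open>The solution of
        \<open>(u * t) powr \<beta> * t powr (- \<theta>) = 1\<close>, which makes the bound for the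
        exponent equal to \<open>c0\<close>.\<close>
      define u where "u = t powr (\<theta> / \<beta> - 1)"
      have u: "0 < u"
        using t by (simp add: u_def)
      have ut: "u * t = t powr (\<theta> / \<beta>)"
        using t powr_add[of t "\<theta> / \<beta> - 1" 1] by (simp add: u_def)
      have "(u * t) powr \<beta> * t powr (- \<theta>) = 1"
        unfolding ut powr_powr using t \<beta>_bounds by (simp add: powr_add[symmetric])
      then have "1 - exp (- c0) \<le> 2 * u powr q * expectation (\<lambda>w. \<bar>Y t w\<bar> powr q)"
        using key[OF elim(2) u] elim(1) by (simp add: ut mult.assoc)
      then have "c * u powr (- q) \<le> u powr q * expectation (\<lambda>w. \<bar>Y t w\<bar> powr q) * u powr (- q)"
        by (intro mult_right_mono) (auto simp: c_def)
      also have "\<dots> = expectation (\<lambda>w. \<bar>Y t w\<bar> powr q)"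
        using u by (simp add: powr_minus field_simps)
      finally have "c * u powr (- q) \<le> expectation (\<lambda>w. \<bar>Y t w\<bar> powr q)" .
      moreover have "t powr (scaling q - \<epsilon>) \<le> u powr (- q)"
      proof -
        have "\<theta> * q \<le> \<alpha> * q + \<epsilon> * \<beta>"
          using mult_right_mono[OF \<theta>(3), of q] q by (simp add: distrib_right)
        then have "(\<theta> * q) / \<beta> \<le> (\<alpha> * q + \<epsilon> * \<beta>) / \<beta>"
          using \<beta>_bounds by (intro divide_right_mono) auto
        then have "scaling q - \<epsilon> \<le> (\<theta> / \<beta> - 1) * (- q)"
          using True \<beta>_bounds by (simp add: scaling_def add_divide_distrib algebra_simps)
        then show ?thesis
          unfolding u_def powr_powr using t by (intro powr_mono)
      qed
      moreover have "0 \<le> c"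
        using cA by (simp add: c_def)
      ultimately show ?case
        by (meson mult_left_mono order_trans)
    qed
    moreover have "0 < c"
      using cA by (simp add: c_def)
    ultimately show ?thesis
      by blast
  next
    case False
    define V where "V = c0 * A powr \<beta>"
    have V: "0 < V"
      using cA by (simp add: V_def)
    define c where "c = V / 4 * A powr (- q)"
    have "((\<lambda>t. V * t powr (- \<theta>)) \<longlongrightarrow> V * 0) at_top"
      using \<theta> by (intro tendsto_mult tendsto_const tendsto_neg_powr filterlim_ident) auto
    then have "\<forall>\<^sub>F t in at_top. V * t powr (- \<theta>) < 1"
      by (rule order_tendstoD) simp
    then have "\<forall>\<^sub>F t in at_top. c * t powr (scaling q - \<epsilon>) \<le> expectation (\<lambda>w. \<bar>Y t w\<bar> powr q)"
      using eventually_ge_at_top[of t0]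
    proof eventually_elim
      case (elim t)
      have t: "1 \<le> t"
        using elim cA by linarith
      \<comment> \<open>Here the exponent is small, and the elementary bound
        \<open>y / 2 \<le> 1 - exp (- y)\<close> on [0, 1] preserves its order
        \<open>t powr (- \<theta>)\<close>.\<close>
      define u where "u = A / t"
      have u: "0 < u" "u * t = A"
        using t cA by (auto simp: u_def)
      define y where "y = V * t powr (- \<theta>)"
      have y: "0 \<le> y" "y \<le> 1"
        using elim V by (auto simp: y_def)
      have "exp (- y) \<le> 1 / (1 + y)"
        using exp_ge_add_one_self[of y] y by (simp add: exp_minus field_simps)
      also have "\<dots> \<le> 1 - y / 2"
        using y mult_left_mono[of y 1 y] by (simp add: field_simps)
      finally have "y / 2 \<le> 1 - exp (- y)"
        by simp
      also have "\<dots> \<le> 2 * u powr q * expectation (\<lambda>w. \<bar>Y t w\<bar> powr q)"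
        using key[OF elim(2) u(1)] by (simp add: u(2) y_def V_def)
      finally have "y / 4 * u powr (- q) \<le> u powr q * expectation (\<lambda>w. \<bar>Y t w\<bar> powr q) * u powr (- q)"
        by (intro mult_right_mono) auto
      also have "\<dots> = expectation (\<lambda>w. \<bar>Y t w\<bar> powr q)"
        using u by (simp add: powr_minus field_simps)
      also have "y / 4 * u powr (- q) = c * t powr (q - \<theta>)"
      proof -
        have "u powr (- q) = A powr (- q) * t powr q"
          using t cA by (simp add: u_def powr_divide powr_minus field_simps)
        moreover have "t powr (q - \<theta>) = t powr q * t powr (- \<theta>)"
          by (simp add: powr_add[symmetric])
        ultimately show ?thesis
          by (simp add: y_def c_def)
      qed
      finally have "c * t powr (q - \<theta>) \<le> expectation (\<lambda>w. \<bar>Y t w\<bar> powr q)" .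
      moreover have "t powr (scaling q - \<epsilon>) \<le> t powr (q - \<theta>)"
        using t False \<theta> by (intro powr_mono) (auto simp: scaling_def)
      moreover have "0 \<le> c"
        using V by (simp add: c_def)
      ultimately show ?case
        by (meson mult_left_mono order_trans)
    qed
    moreover have "0 < c"
      using V cA by (simp add: c_def)
    ultimately show ?thesis
      by blast
  qed
qed

text \<open>Above order 2 the second moment is split at \<open>L = t powr (1 - \<delta>)\<close>.
  The part below \<open>L\<close> is estimated through an order \<open>q1\<close> in (\<beta>, 2)
  and is smaller than the second moment by a power of \<open>t\<close>. The rest is at most
  \<open>L powr (2 - q)\<close> times the moment of order \<open>q\<close>, which is thereby bounded
  below.\<close>

lemma moment_lower:
  assumes q: "0 < q" and \<epsilon>: "0 < \<epsilon>"
  shows "\<exists>c>0. \<forall>\<^sub>F t in at_top. c * t powr (scaling q - \<epsilon>) \<le> expectation (\<lambda>w. \<bar>Y t w\<bar> powr q)"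
proof (cases "q \<le> 2")
  case True
  then show ?thesis
    using moment_lower_upto_2 assms by blast
next
  case False
  define q1 where "q1 = (\<beta> + 2) / 2"
  have q1: "\<beta> < q1" "q1 < 2" "0 < q1"
    using \<alpha>\<beta> \<beta>_bounds by (auto simp: q1_def)
  \<comment> \<open>Lowering the level from \<open>t\<close> to \<open>t powr (1 - \<delta>)\<close>
    costs \<open>\<delta> * (q - 2)\<close> in the exponent, half of the allowed \<epsilon>.\<close>
  define \<delta> where "\<delta> = \<epsilon> / (2 * (q - 2))"
  have "\<epsilon> / (2 * d) * d = \<epsilon> / 2" if "d \<noteq> 0" for d
    using that by simp
  from this[of "q - 2"] have \<delta>: "0 < \<delta>" "\<delta> * (q - 2) = \<epsilon> / 2"
    using False \<epsilon> unfolding \<delta>_def by simp_all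
  \<comment> \<open>The split gains \<open>\<delta> * (2 - q1)\<close>. Two \<open>e\<close> are
    consumed by the errors of the upper and the lower moment bound, and two more give the factor
    \<open>t powr (- (2 * e))\<close> that makes the low-order term negligible.\<close>
  define e where "e = min (\<epsilon> / 2) (\<delta> * (2 - q1) / 4)"
  have "0 < \<delta> * (2 - q1)"
    using \<delta> q1 by simp
  then have e: "0 < e" "e \<le> \<epsilon> / 2" "4 * e \<le> \<delta> * (2 - q1)"
    using \<epsilon> by (auto simp: e_def min_def)
  have sc: "scaling q = q - \<alpha>" "scaling q1 = q1 - \<alpha>" "scaling 2 = 2 - \<alpha>"
    using False q1 \<alpha>\<beta> by (auto simp: scaling_def)
  obtain C where C: "0 \<le> C" "\<And>t. 1 \<le> t \<Longrightarrow> expectation (\<lambda>w. \<bar>Y t w\<bar> powr q1) \<le> C * t powr (scaling q1 + e)"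
    using expectation_upper[OF q1(3) e(1)] by blast
  obtain c where c: "0 < c" "\<forall>\<^sub>F t in at_top. c * t powr (scaling 2 - e) \<le> expectation (\<lambda>w. \<bar>Y t w\<bar> powr 2)"
    using moment_lower_upto_2[of 2, OF _ _ e(1)] by auto
  have "((\<lambda>t. C * t powr (- (2 * e))) \<longlongrightarrow> C * 0) at_top"
    using e by (intro tendsto_mult tendsto_const tendsto_neg_powr filterlim_ident) auto
  then have "\<forall>\<^sub>F t in at_top. C * t powr (- (2 * e)) < c / 2"
    by (rule order_tendstoD) (use c in simp)
  then have "\<forall>\<^sub>F t in at_top. c / 2 * t powr (scaling q - \<epsilon>) \<le> expectation (\<lambda>w. \<bar>Y t w\<bar> powr q)"
    using c(2) eventually_ge_at_top[of 1]
  proof eventually_elim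
    case (elim t)
    then have t: "1 \<le> t"
      by simp
    define L where "L = t powr (1 - \<delta>)"
    have L: "0 < L"
      using t by (simp add: L_def)
    have i1: "integrable M (\<lambda>w. \<bar>Y t w\<bar> powr q1)" and iq: "integrable M (\<lambda>w. \<bar>Y t w\<bar> powr q)"
      using moment_integrable q1 q t by auto
    have i2: "integrable M (\<lambda>w. \<bar>Y t w\<bar> powr 2)"
      by (rule moment_integrable[OF _ t]) simp
    have "expectation (\<lambda>w. \<bar>Y t w\<bar> powr 2) \<le>
        expectation (\<lambda>w. L powr (2 - q1) * \<bar>Y t w\<bar> powr q1 + L powr (2 - q) * \<bar>Y t w\<bar> powr q)"
    proof (rule integral_mono[OF i2])
      show "integrable M (\<lambda>w. L powr (2 - q1) * \<bar>Y t w\<bar> powr q1 + L powr (2 - q) * \<bar>Y t w\<bar> powr q)"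
        using i1 iq by (intro Bochner_Integration.integrable_add integrable_mult_right)
      show "\<bar>Y t w\<bar> powr 2 \<le> L powr (2 - q1) * \<bar>Y t w\<bar> powr q1 + L powr (2 - q) * \<bar>Y t w\<bar> powr q" for w
        by (rule powr_interpolation[OF L]) (use q1 False in auto)
    qed
    also have "\<dots> = L powr (2 - q1) * expectation (\<lambda>w. \<bar>Y t w\<bar> powr q1) + L powr (2 - q) * expectation (\<lambda>w. \<bar>Y t w\<bar> powr q)"
      using i1 iq by simp
    also have "L powr (2 - q1) * expectation (\<lambda>w. \<bar>Y t w\<bar> powr q1) \<le> c / 2 * t powr (scaling 2 - e)"
    proof -
      have "L powr (2 - q1) * expectation (\<lambda>w. \<bar>Y t w\<bar> powr q1) \<le> L powr (2 - q1) * (C * t powr (scaling q1 + e))"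
        by (intro mult_left_mono C t) auto
      also have "\<dots> = C * t powr ((1 - \<delta>) * (2 - q1) + (scaling q1 + e))"
        by (simp add: L_def powr_powr powr_add mult_ac)
      also have "\<dots> \<le> C * t powr (- (2 * e) + (scaling 2 - e))"
        using e t by (intro mult_left_mono powr_mono C) (auto simp: sc algebra_simps)
      also have "\<dots> = C * t powr (- (2 * e)) * t powr (scaling 2 - e)"
        by (simp only: powr_add mult.assoc)
      also have "\<dots> \<le> c / 2 * t powr (scaling 2 - e)"
        using elim(1) by (intro mult_right_mono) auto
      finally show ?thesis .
    qed
    finally have "c / 2 * t powr (scaling 2 - e) \<le> L powr (2 - q) * expectation (\<lambda>w. \<bar>Y t w\<bar> powr q)"
      using elim(2) by linarith
    then have "L powr (q - 2) * (c / 2 * t powr (scaling 2 - e)) \<le> L powr (q - 2) * (L powr (2 - q) * expectation (\<lambda>w. \<bar>Y t w\<bar> powr q))"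
      by (intro mult_left_mono) auto
    also have "\<dots> = expectation (\<lambda>w. \<bar>Y t w\<bar> powr q)"
      using L by (simp add: mult.assoc[symmetric] powr_add[symmetric])
    also have "L powr (q - 2) * (c / 2 * t powr (scaling 2 - e)) = c / 2 * t powr ((1 - \<delta>) * (q - 2) + (scaling 2 - e))"
      by (simp add: L_def powr_powr powr_add mult_ac)
    finally have "c / 2 * t powr ((1 - \<delta>) * (q - 2) + (scaling 2 - e)) \<le> expectation (\<lambda>w. \<bar>Y t w\<bar> powr q)" .
    moreover have "scaling q - \<epsilon> \<le> (1 - \<delta>) * (q - 2) + (scaling 2 - e)"
      using \<delta>(2) e(2) by (simp add: sc left_diff_distrib)
    then have "c / 2 * t powr (scaling q - \<epsilon>) \<le> c / 2 * t powr ((1 - \<delta>) * (q - 2) + (scaling 2 - e))"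
      using t c by (intro mult_left_mono powr_mono) auto
    ultimately show ?case
      by linarith
  qed
  then show ?thesis
    using c(1) by (intro exI[of _ "c / 2"]) auto
qed

lemma scaling_exponent:
  assumes q: "0 < q"
  shows "has_scaling_exponent M Y q (scaling q)"
  unfolding has_scaling_exponent_def
proof (rule log_ratio_tendsto)
  fix \<epsilon> :: real assume \<epsilon>: "0 < \<epsilon>"
  obtain C where "\<forall>t\<ge>1. expectation (\<lambda>w. \<bar>Y t w\<bar> powr q) \<le> C * t powr (scaling q + \<epsilon>)"
    using expectation_upper[OF q \<epsilon>] by blast
  then show "\<exists>C. \<forall>\<^sub>F t in at_top. expectation (\<lambda>w. \<bar>Y t w\<bar> powr q) \<le> C * t powr (scaling q + \<epsilon>)"
    by (intro exI[of _ C]) (auto simp: eventually_at_top_linorder)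
  show "\<exists>c>0. \<forall>\<^sub>F t in at_top. c * t powr (scaling q - \<epsilon>) \<le> expectation (\<lambda>w. \<bar>Y t w\<bar> powr q)"
    by (rule moment_lower[OF q \<epsilon>])
qed

end

theorem theorem4p3:
  fixes M :: "'w measure" and X :: "real \<Rightarrow> 'w \<Rightarrow> real"
    and a b \<alpha> \<beta> cp cm :: real and \<mu> \<pi> :: "real measure" and p l :: "real \<Rightarrow> real"
  assumes supou: "supou_process M a b \<mu> \<pi> X"
    and version: "measurable_process M X"
    and finite_variance: "\<And>t. integrable M (\<lambda>\<omega>. (X t \<omega>)\<^sup>2)"
    and zero_mean: "\<And>t. (LINT \<omega>|M. X t \<omega>) = 0"
    and analytic: "analytic_near_0 (cumulant_function (distr M borel (X 1)))"
    and p_measurable: "p \<in> borel_measurable (restrict_space borel {0<..})"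
    and p_nonneg: "\<And>x. x > 0 \<Longrightarrow> p x \<ge> 0"
    and p_density: "\<pi> = density (restrict_space lborel {0<..}) (\<lambda>x. ennreal (p x))"
    and alpha: "0 < \<alpha>" "\<alpha> < 1"
    and slow: "slowly_varying l"
    and p_asymp: "p \<sim>[at_right 0] (\<lambda>x. \<alpha> * l (inverse x) * x powr (\<alpha> - 1))"
    and no_gaussian: "b = 0"
    and beta: "1 + \<alpha> < \<beta>" "\<beta> < 2"
    and c: "cp \<ge> 0" "cm \<ge> 0" "cp + cm > 0"
    and right_tail: "power_tail_at_0 (\<lambda>x. measure \<mu> {x..}) cp \<beta>"
    and left_tail: "power_tail_at_0 (\<lambda>x. measure \<mu> {..-x}) cm \<beta>"
  shows "\<forall>q>0. has_scaling_exponent M (integrated_process X) q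
           (if q \<le> \<beta> then (1 - \<alpha> / \<beta>) * q else q - \<alpha>)"
proof -
  obtain \<Lambda> where M: "prob_space M" and \<mu>: "levy_measure \<mu>" and \<pi>: "prob_space \<pi>"
    and sets: "sets \<pi> = sets (restrict_space borel {0<..})"
    and basis: "levy_basis M (\<pi> \<Otimes>\<^sub>M lborel) (levy_khintchine a 0 \<mu>) \<Lambda>"
    and integral: "\<And>t. has_levy_integral M (\<pi> \<Otimes>\<^sub>M lborel) \<Lambda> (supou_kernel t) (X t)"
    using supou unfolding supou_process_def no_gaussian by blast
  interpret M: prob_space M
    by (rule M)
  interpret control: supou_control \<pi>
    by (rule supou_control.intro[OF \<pi> sets])
  have levy: "levy_basis_law M (\<pi> \<Otimes>\<^sub>M lborel) \<mu> a \<Lambda>"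
    by (intro levy_basis_law.intro levy_basis_law_axioms.intro M basis \<mu>) unfold_locales
  have process: "supou \<pi> M \<mu> a \<Lambda> X"
    by (intro supou.intro supou_axioms.intro control.supou_control_axioms levy integral version finite_variance zero_mean)
  have density: "regularly_varying_density \<pi> p l \<alpha>"
    by (intro regularly_varying_density.intro regularly_varying_density_axioms.intro \<pi> p_measurable p_nonneg
        p_density alpha(1) slow p_asymp)
  have tail: "levy_power_tail \<mu> \<beta> cp cm"
    by (intro levy_power_tail.intro \<mu> c right_tail left_tail) (use alpha beta in linarith)
  interpret supou_regular \<pi> M \<mu> a \<Lambda> X p l \<alpha> \<beta> cp cm
    by (intro supou_regular.intro supou_regular_axioms.intro process density tail beta analytic)
  show ?thesis
    using scaling_exponent unfolding scaling_def by blast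
qed

end
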